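(* Let $\tfrac12<s<1$, let $0<c_0<1<C_0$ be fixed constants, let $b>\frac12$ and $\varepsilon>0$. There is a constant $C>0$, depending only on $s,c_0,C_0,b,\varepsilon$, such that for all $\lambda\ge1$, all dyadic $N\ge1$ and all $\delta\in[c_0,C_0]$ the following holds. Let $u$ solve $iu_t+\Delta_{\mathbb{R}\times\mathbb{T}_\lambda}u=|u|^2u$ on $[0,\delta]\times\mathbb{R}\times\mathbb{T}_\lambda$ with $u(0)=u_0$, such that $Iu\in C([0,\delta],H^1(\mathbb{R}\times\mathbb{T}_\lambda))$ is the solution of $i\partial_t(Iu)+\Delta_{\mathbb{R}\times\mathbb{T}_\lambda}Iu=I(|u|^2u)$, $Iu(0)=Iu_0$, and $\|Iu_0\|_{H^1(\mathbb{R}\times\mathbb{T}_\lambda)}\le C_0$. Then $$\left|\int_0^\delta\int_{\Sigma_4}A(\xi_1,\xi_2,\xi_3,\xi_4)\,\widehat u(t,\xi_1)\widehat{\overline u}(t,\xi_2)\widehat u(t,\xi_3)\widehat{\overline u}(t,\xi_4)\,dt\right|\le C\,N^{-2+\varepsilon}\|Iu\|_{X^{1,b}_\delta}^4,$$ where the inner integral is with respect to the measure on $\Sigma_4$ and $$A(\xi_1,\xi_2,\xi_3,\xi_4)=\big(m(\xi_1)^2|\xi_1|^2-m(\xi_2)^2|\xi_2|^2+m(\xi_3)^2|\xi_3|^2-m(\xi_4)^2|\xi_4|^2\big)\,1_{S^c}(\xi_1,\xi_2,\xi_3,\xi_4).$$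
   Context: For $\lambda\ge1$: $\mathbb{T}_\lambda=\mathbb{R}/2\pi\lambda\mathbb{Z}$, $\mathbb{Z}_{1/\lambda}=\frac1\lambda\mathbb{Z}$, $\int_{\mathbb{R}\times\mathbb{Z}_{1/\lambda}}f(\xi)(d\xi)_\lambda:=\frac1\lambda\sum_{\eta\in\mathbb{Z}_{1/\lambda}}\int_{\mathbb{R}}f(\mu,\eta)d\mu$, and $\widehat f(\xi)=\frac1{2\pi}\int_{\mathbb{R}\times\mathbb{T}_\lambda}f(z)e^{-iz\cdot\xi}dz$. Bourgain norm: $\|u\|_{X^{s,b}}=\|\langle\tau+|\xi|^2\rangle^b\langle\xi\rangle^s\mathcal{F}_{t,z}u(\tau,\xi)\|_{L^2_{\tau,\xi}(\mathbb{R}\times\mathbb{R}\times\mathbb{Z}_{1/\lambda})}$, with $\mathcal{F}_{t,z}$ the space-time Fourier transform (kernel $e^{-it\tau-iz\cdot\xi}$) and $\langle a\rangle=(1+|a|^2)^{1/2}$; $\|u\|_{X^{s,b}_\delta}$ is the infimum of $\|w\|_{X^{s,b}}$ over all $w$ agreeing with $u$ on the time interval $[0,\delta]$. I-operator: $\widehat{Iu}(\xi)=m(\xi)\widehat u(\xi)$, where $m$ is a fixed smooth radial non-increasing (in $|\xi|$) function with $m(\xi)=1$ for $|\xi|\le N$ and $m(\xi)=(N/|\xi|)^{1-s}$ for $|\xi|\ge2N$ (with the usual symbol bounds, $m(\xi)=m_1(\xi/N)$ for a fixed $m_1$). Hyperplane: $\Sigma_4=\{(\xi_1,\dots,\xi_4)\in(\mathbb{R}\times\mathbb{Z}_{1/\lambda})^4:\xi_1+\dots+\xi_4=0\}$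 with the measure obtained by pushing forward $(d\xi_1)_\lambda(d\xi_2)_\lambda(d\xi_3)_\lambda$ under $(\xi_1,\xi_2,\xi_3)\mapsto(\xi_1,\xi_2,\xi_3,-\xi_1-\xi_2-\xi_3)$. Write $\xi_{ij}=\xi_i+\xi_j$. Set $S$: for dyadic $N_1,\dots,N_4\in2^{\mathbb{N}}$, $S(N_1,N_2,N_3,N_4)$ is the set of $(\xi_1,\dots,\xi_4)\in\Sigma_4$ with $|\xi_j|\sim N_j$ (with $|\xi_j|\lesssim1$ when $N_j=1$) such that either $|\cos\angle(\xi_{12},\xi_{14})|\ge\max\{N_1,N_2,N_3,N_4\}^{-1}$ or $\max_j|\xi_j|\ll N$ (i.e. $\le cN$ for a fixed small constant $c>0$); $S$ is the union of these sets over all dyadic $N_1,\dots,N_4$, and $S^c=\Sigma_4\setminus S$. *)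

theory Defs
  imports "HOL-Analysis.Analysis"
begin

section \<open>The waveguide and its frequency space\<close>

text \<open>
  A function on \<open>\<real> \<times> T\<^sub>L\<close>, where \<open>T\<^sub>L = \<real> / 2\<pi>L\<int>\<close>, is given by its values on the fundamental domain
  \<open>\<real> \<times> [0, 2\<pi>L)\<close>; its values elsewhere are never used.
  Throughout, \<open>L\<close> is the scale of the torus (the period in the second variable is \<open>2\<pi>L\<close>).
\<close>

definition waveguide :: "real \<Rightarrow> (real \<times> real) measure" where
  "waveguide L = lborel \<Otimes>\<^sub>M restrict_space lborel {0..<2 * pi * L}"

definition lattice :: "real \<Rightarrow> real set" where
  "lattice L = range (\<lambda>k::int. of_int k / L)"

text \<open>The measure \<open>(d\<xi>)\<^sub>L\<close> on the frequency space \<open>\<real> \<times> (1/L)\<int>\<close>.\<close>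

definition freq :: "real \<Rightarrow> (real \<times> real) measure" where
  "freq L = lborel \<Otimes>\<^sub>M scale_measure (ennreal (1 / L)) (count_space (lattice L))"

definition spacetime :: "real \<Rightarrow> (real \<times> real \<times> real) measure" where
  "spacetime L = lborel \<Otimes>\<^sub>M waveguide L"

definition spacetime_freq :: "real \<Rightarrow> (real \<times> real \<times> real) measure" where
  "spacetime_freq L = lborel \<Otimes>\<^sub>M freq L"


section \<open>Fourier transform\<close>

definition square_integrable :: "'a measure \<Rightarrow> ('a \<Rightarrow> complex) set" where
  "square_integrable M = {f \<in> borel_measurable M. integrable M (\<lambda>x. (cmod (f x))\<^sup>2)}"

text \<open>
  The normalisation is \<open>1 / (2\<pi>)\<close> on the waveguide and \<open>(2\<pi>) powr (-3/2)\<close> on space-time.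
\<close>

definition fourier_integral ::
    "'a::euclidean_space measure \<Rightarrow> ('a \<Rightarrow> complex) \<Rightarrow> 'a \<Rightarrow> complex" where
  "fourier_integral M f \<xi> =
     of_real ((2 * pi) powr (- (real DIM('a) / 2))) * (LINT z|M. f z * cis (- (z \<bullet> \<xi>)))"

text \<open>
  The Fourier transform of a square-integrable function is the \<open>L\<^sup>2\<close>-limit of the Fourier integrals
  of its truncations to balls. Here \<open>M\<close> is the measure on the physical side and \<open>M'\<close> the one on the
  frequency side. The transform is determined up to \<open>M'\<close>-null sets only;
  \<open>fourier\<close> picks a representative.
\<close>

definition is_fourier ::
    "'a::euclidean_space measure \<Rightarrow> 'a measure \<Rightarrow> ('a \<Rightarrow> complex) \<Rightarrow> ('a \<Rightarrow> complex) \<Rightarrow> bool" where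
  "is_fourier M M' f g \<longleftrightarrow>
     f \<in> square_integrable M \<and> g \<in> square_integrable M' \<and>
     ((\<lambda>R. \<integral>\<^sup>+ \<xi>. ennreal ((cmod (fourier_integral M (\<lambda>z. if norm z \<le> R then f z else 0) \<xi>
              - g \<xi>))\<^sup>2) \<partial>M') \<longlongrightarrow> 0) at_top"

definition fourier ::
    "'a::euclidean_space measure \<Rightarrow> 'a measure \<Rightarrow> ('a \<Rightarrow> complex) \<Rightarrow> 'a \<Rightarrow> complex" where
  "fourier M M' f = (SOME g. is_fourier M M' f g)"

abbreviation wg_fourier :: "real \<Rightarrow> (real \<times> real \<Rightarrow> complex) \<Rightarrow> real \<times> real \<Rightarrow> complex" where
  "wg_fourier L \<equiv> fourier (waveguide L) (freq L)"

abbreviation st_fourier ::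
    "real \<Rightarrow> (real \<times> real \<times> real \<Rightarrow> complex) \<Rightarrow> real \<times> real \<times> real \<Rightarrow> complex" where
  "st_fourier L \<equiv> fourier (spacetime L) (spacetime_freq L)"


section \<open>Function spaces\<close>

definition ennreal_sqrt :: "ennreal \<Rightarrow> ennreal" where
  "ennreal_sqrt x = (if x = top then top else ennreal (sqrt (enn2real x)))"

definition japanese :: "real \<Rightarrow> real" where
  "japanese a = sqrt (1 + a\<^sup>2)"

definition H_norm :: "real \<Rightarrow> real \<Rightarrow> (real \<times> real \<Rightarrow> complex) \<Rightarrow> ennreal" where
  "H_norm L \<sigma> f = ennreal_sqrt
     (\<integral>\<^sup>+ \<xi>. ennreal ((japanese (norm \<xi>) powr \<sigma> * cmod (wg_fourier L f \<xi>))\<^sup>2) \<partial>freq L)"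

definition continuous_in_H ::
    "real \<Rightarrow> real \<Rightarrow> real \<Rightarrow> (real \<Rightarrow> real \<times> real \<Rightarrow> complex) \<Rightarrow> bool" where
  "continuous_in_H L \<sigma> \<delta> v \<longleftrightarrow>
     (\<forall>t\<in>{0..\<delta>}. v t \<in> square_integrable (waveguide L) \<and> H_norm L \<sigma> (v t) < top \<and>
        ((\<lambda>r. H_norm L \<sigma> (\<lambda>z. v r z - v t z)) \<longlongrightarrow> 0) (at t within {0..\<delta>}))"

definition X_norm :: "real \<Rightarrow> real \<Rightarrow> real \<Rightarrow> (real \<times> real \<times> real \<Rightarrow> complex) \<Rightarrow> ennreal" where
  "X_norm L s b w = ennreal_sqrt
     (\<integral>\<^sup>+ (\<tau>, \<xi>). ennreal ((japanese (\<tau> + (norm \<xi>)\<^sup>2) powr b * japanese (norm \<xi>) powr s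
          * cmod (st_fourier L w (\<tau>, \<xi>)))\<^sup>2) \<partial>spacetime_freq L)"

text \<open>
  The infimum is taken over square-integrable \<open>w\<close>, which is no restriction for \<open>s, b \<ge> 0\<close>.
  It is \<open>top\<close> if \<open>v\<close> has no extension of finite norm.
\<close>

definition X_norm_on ::
    "real \<Rightarrow> real \<Rightarrow> real \<Rightarrow> real \<Rightarrow> (real \<Rightarrow> real \<times> real \<Rightarrow> complex) \<Rightarrow> ennreal" where
  "X_norm_on L s b \<delta> v =
     (INF w \<in> {w \<in> square_integrable (spacetime L).
                AE t in lborel. t \<in> {0..\<delta>} \<longrightarrow> (AE z in waveguide L. w (t, z) = v t z)}.
        X_norm L s b w)"


section \<open>The I-operator\<close>

text \<open>
  The fixed symbol \<open>m\<^sub>1\<close> is radial and is represented by its profile \<open>p\<close>, that is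
  \<open>m\<^sub>1(\<xi>) = p(|\<xi>|)\<close>. Since \<open>p\<close> is \<open>1\<close> on \<open>[0,1]\<close>, smoothness of \<open>m\<^sub>1\<close> on the plane amounts to
  smoothness of \<open>p\<close> on \<open>(0,\<infinity>)\<close>; the usual symbol bounds then follow from the formulas for
  \<open>r \<le> 1\<close> and \<open>r \<ge> 2\<close>.
\<close>

definition I_profile :: "real \<Rightarrow> (real \<Rightarrow> real) \<Rightarrow> bool" where
  "I_profile s p \<longleftrightarrow>
     (\<forall>n. \<forall>r>0. ((deriv ^^ n) p) differentiable (at r)) \<and>
     antimono_on {0..} p \<and>
     (\<forall>r\<in>{0..1}. p r = 1) \<and>
     (\<forall>r\<ge>2. p r = (1 / r) powr (1 - s))"

definition I_symbol :: "(real \<Rightarrow> real) \<Rightarrow> real \<Rightarrow> real \<times> real \<Rightarrow> real" where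
  "I_symbol p N \<xi> = p (norm \<xi> / N)"

definition I_op ::
    "(real \<Rightarrow> real) \<Rightarrow> real \<Rightarrow> real \<Rightarrow> (real \<times> real \<Rightarrow> complex) \<Rightarrow> real \<times> real \<Rightarrow> complex" where
  "I_op p N L f = (SOME g. is_fourier (waveguide L) (freq L) g
                      (\<lambda>\<xi>. of_real (I_symbol p N \<xi>) * wg_fourier L f \<xi>))"


section \<open>Solutions\<close>

definition cubic :: "(real \<times> real \<Rightarrow> complex) \<Rightarrow> real \<times> real \<Rightarrow> complex" where
  "cubic f = (\<lambda>z. of_real ((cmod (f z))\<^sup>2) * f z)"

text \<open>
  \<open>v\<close> is a (mild) solution on \<open>[0,\<delta>]\<close> of \<open>i v\<^sub>t + \<Delta> v = F\<close>, \<open>v(0) = v\<^sub>0\<close>. This is Duhamel's formula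
  on the Fourier side; \<open>G t\<close> is the spatial Fourier transform of \<open>F(t)\<close>.
\<close>

definition schroedinger_solution ::
    "real \<Rightarrow> real \<Rightarrow> (real \<Rightarrow> real \<times> real \<Rightarrow> complex) \<Rightarrow> (real \<times> real \<Rightarrow> complex)
      \<Rightarrow> (real \<Rightarrow> real \<times> real \<Rightarrow> complex) \<Rightarrow> bool" where
  "schroedinger_solution L \<delta> v v0 G \<longleftrightarrow>
     v0 \<in> square_integrable (waveguide L) \<and>
     (\<forall>t\<in>{0..\<delta>}. v t \<in> square_integrable (waveguide L)) \<and>
     (AE z in waveguide L. v 0 z = v0 z) \<and>
     (\<forall>t\<in>{0..\<delta>}. AE \<xi> in freq L.
        wg_fourier L (v t) \<xi> =
          cis (- t * (norm \<xi>)\<^sup>2) * wg_fourier L v0 \<xi>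
          - \<i> * (LINT r:{0..t}|lborel. cis (- (t - r) * (norm \<xi>)\<^sup>2) * G r \<xi>))"

text \<open>
  For \<open>u(t) \<in> H\<^sup>s\<close> with \<open>s > 1/2\<close> the function \<open>|u|\<^sup>2u\<close> is integrable, but it need not be
  square-integrable. Hence its Fourier transform is the absolutely convergent Fourier integral.
\<close>

definition NLS_solution ::
    "real \<Rightarrow> real \<Rightarrow> (real \<Rightarrow> real \<times> real \<Rightarrow> complex) \<Rightarrow> (real \<times> real \<Rightarrow> complex) \<Rightarrow> bool" where
  "NLS_solution L \<delta> u u0 \<longleftrightarrow>
     schroedinger_solution L \<delta> u u0 (\<lambda>t. fourier_integral (waveguide L) (cubic (u t)))"

definition I_NLS_solution ::
    "(real \<Rightarrow> real) \<Rightarrow> real \<Rightarrow> real \<Rightarrow> real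
      \<Rightarrow> (real \<Rightarrow> real \<times> real \<Rightarrow> complex) \<Rightarrow> (real \<times> real \<Rightarrow> complex) \<Rightarrow> bool" where
  "I_NLS_solution p N L \<delta> u u0 \<longleftrightarrow>
     schroedinger_solution L \<delta> (\<lambda>t. I_op p N L (u t)) (I_op p N L u0)
       (\<lambda>t \<xi>. of_real (I_symbol p N \<xi>) * fourier_integral (waveguide L) (cubic (u t)) \<xi>)"


section \<open>The hyperplane and the multiplier\<close>

type_synonym quad = "(real \<times> real) \<times> (real \<times> real) \<times> (real \<times> real) \<times> (real \<times> real)"

definition Sigma4 :: "real \<Rightarrow> quad set" where
  "Sigma4 L = {(\<xi>1, \<xi>2, \<xi>3, \<xi>4). {\<xi>1, \<xi>2, \<xi>3, \<xi>4} \<subseteq> UNIV \<times> lattice L \<and> \<xi>1 + \<xi>2 + \<xi>3 + \<xi>4 = 0}"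

definition Sigma4_measure :: "real \<Rightarrow> quad measure" where
  "Sigma4_measure L =
     distr (freq L \<Otimes>\<^sub>M freq L \<Otimes>\<^sub>M freq L)
           (freq L \<Otimes>\<^sub>M freq L \<Otimes>\<^sub>M freq L \<Otimes>\<^sub>M freq L)
           (\<lambda>(\<xi>1, \<xi>2, \<xi>3). (\<xi>1, \<xi>2, \<xi>3, - \<xi>1 - \<xi>2 - \<xi>3))"

text \<open>The value for a zero vector (namely \<open>0\<close>) only matters on a null set of the hyperplane.\<close>

definition cos_angle :: "real \<times> real \<Rightarrow> real \<times> real \<Rightarrow> real" where
  "cos_angle x y = (x \<bullet> y) / (norm x * norm y)"

text \<open>
  The relation \<open>|\<xi>| \<sim> 2^n\<close>, read as \<open>|\<xi>| \<lesssim> 1\<close> when \<open>n = 0\<close>, with implicit constant \<open>K\<close>.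
\<close>

definition dyadic_size :: "real \<Rightarrow> nat \<Rightarrow> real \<times> real \<Rightarrow> bool" where
  "dyadic_size K n \<xi> \<longleftrightarrow> (n = 0 \<or> 2 ^ n / K \<le> norm \<xi>) \<and> norm \<xi> \<le> K * 2 ^ n"

text \<open>
  \<open>dyadic_S K c N L n1 n2 n3 n4\<close> is \<open>S(2^n1, 2^n2, 2^n3, 2^n4)\<close>; \<open>c\<close> is the constant in
  \<open>max\<^sub>j |\<xi>\<^sub>j| \<lless> N\<close>.
\<close>

definition dyadic_S ::
    "real \<Rightarrow> real \<Rightarrow> real \<Rightarrow> real \<Rightarrow> nat \<Rightarrow> nat \<Rightarrow> nat \<Rightarrow> nat \<Rightarrow> quad set" where
  "dyadic_S K c N L n1 n2 n3 n4 =
     {(\<xi>1, \<xi>2, \<xi>3, \<xi>4) \<in> Sigma4 L.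
        dyadic_size K n1 \<xi>1 \<and> dyadic_size K n2 \<xi>2 \<and> dyadic_size K n3 \<xi>3 \<and> dyadic_size K n4 \<xi>4 \<and>
        (\<bar>cos_angle (\<xi>1 + \<xi>2) (\<xi>1 + \<xi>4)\<bar> \<ge> 1 / Max {2 ^ n1, 2 ^ n2, 2 ^ n3, 2 ^ n4} \<or>
         Max {norm \<xi>1, norm \<xi>2, norm \<xi>3, norm \<xi>4} \<le> c * N)}"

definition S_set :: "real \<Rightarrow> real \<Rightarrow> real \<Rightarrow> real \<Rightarrow> quad set" where
  "S_set K c N L = (\<Union>n1 n2 n3 n4. dyadic_S K c N L n1 n2 n3 n4)"

definition A_mult ::
    "(real \<Rightarrow> real) \<Rightarrow> real \<Rightarrow> real \<Rightarrow> real \<Rightarrow> real \<Rightarrow> quad \<Rightarrow> real" where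
  "A_mult p K c N L = (\<lambda>(\<xi>1, \<xi>2, \<xi>3, \<xi>4).
     ((I_symbol p N \<xi>1)\<^sup>2 * (norm \<xi>1)\<^sup>2 - (I_symbol p N \<xi>2)\<^sup>2 * (norm \<xi>2)\<^sup>2
      + (I_symbol p N \<xi>3)\<^sup>2 * (norm \<xi>3)\<^sup>2 - (I_symbol p N \<xi>4)\<^sup>2 * (norm \<xi>4)\<^sup>2)
     * indicator (Sigma4 L - S_set K c N L) (\<xi>1, \<xi>2, \<xi>3, \<xi>4))"

end

theory Submission
  imports Defs "HOL-Probability.Probability"
begin

text \<open>
  On the Fourier side and in the variable \<open>\<sigma> = \<tau> + |\<xi>|\<^sup>2\<close> every factor is a superposition of free evolutions,
  whose product has the phase \<open>t (h - \<sigma>\<^sub>1 + \<sigma>\<^sub>2 - \<sigma>\<^sub>3 + \<sigma>\<^sub>4)\<close> with the resonance function \<open>h\<close>. On the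
  hyperplane \<open>h\<close> is twice the inner product of \<open>\<xi>\<^sub>1\<^sub>2\<close> and \<open>\<xi>\<^sub>1\<^sub>4\<close>. Integrating in time therefore leaves a
  quadrilinear form with a kernel of size \<open>1 / max 1 |h - \<theta>|\<close>, and the weight of the Bourgain norm
  with \<open>b > 1/2\<close> makes the superposition integrable.

  Off \<open>S\<close> the two sides are nearly orthogonal, so the four frequencies are close to the vertices
  of a rectangle. Cutting the form into sectors and unit boxes, and counting the frequencies in the thin sets
  that remain, Cauchy-Schwarz bounds each dyadic piece by a power of a logarithm. Near a rectangle
  the multiplier is small compared with the product of the weights of the four factors, which gains
  \<open>N powr (-2)\<close>.
\<close>

text \<open>The obstacle is the weight left by the multiplier. At a near rectangle with smallest
  vertex \<open>d\<close>, neighbours \<open>a\<close>, \<open>c\<close> of \<open>d\<close> and |c|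
  \<le> |a|, it is a negative power of N and of |a| times |c-d| / <d>, which is large when
  \<open>d\<close> is small. Counting frequencies on circles gives a bound without loss, but also
  without decay in |c-d|. The decay comes from rigidity: once \<open>d\<close> is confined to a unit
  box, the direction of one side at \<open>d\<close> is known up to O(1/|c-d|) and determines that
  of the other, so sectors pair off almost one to one and the form gains 1/|c-d|. The remaining
  1/<d> just fails to be square summable over unit boxes; this, the number of scales of |c-d| and
  the kernel 1 / max 1 |h - \<theta>| produce the logarithms.

  Uniformity in L comes from measuring frequency sets by horizontal length times a weighted number
  of rows, at most height + 1 when L \<ge> 1.

  The transforms in the statement are chosen representatives of L2 limits. The Plancherel theorem is
  therefore built up from the circle, and identities between transforms hold almost
  everywhere.\<close>

notation pair_measure (infixr "\<otimes>" 80)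

abbreviation (input) bmeas ("\<B>") where "\<B> M \<equiv> borel_measurable M"

abbreviation "fs x \<equiv> fst (snd x)"
abbreviation "ss x \<equiv> snd (snd x)"
abbreviation "fss x \<equiv> fst (snd (snd x))"
abbreviation "sss x \<equiv> snd (snd (snd x))"

abbreviation mass :: "real \<Rightarrow> (real \<times> real \<Rightarrow> ennreal) \<Rightarrow> ennreal" where
 "mass L g \<equiv> \<integral>\<^sup>+y. (g y)^2 \<partial>freq L"

syntax "_nn_integral_on" :: "pttrn \<Rightarrow> 'a measure \<Rightarrow> ennreal \<Rightarrow> ennreal" ("(3NN _|_./ _)" [0, 0, 10] 10)
translations "NN x|M. f" \<rightharpoonup> "CONST nn_integral M (\<lambda>x. f)"

notation measurable (infixr "->M" 60)

abbreviation (input) "ind \<equiv> indicator"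
abbreviation (input) "L2 \<equiv> square_integrable"
abbreviation (input) "lat L \<equiv> count_space (lattice L)"
abbreviation (input) tends_to (infix "-->>" 60) where "f -->> l \<equiv> f \<longlonglongrightarrow> l"

section \<open>Squares, roots and Cauchy-Schwarz for extended nonnegative integrals\<close>

lemma ennreal_power2_le_imp_le:
 fixes a b :: ennreal
 assumes "a^2 <= b^2"
 shows "a <= b"
proof (rule ccontr)
 assume "\<not> a <= b"
 hence ab: "b < a" by simp
 then obtain r where r: "b = ennreal r" "0 <= r" by (cases b) auto
 show False
 proof (cases a)
  case (real q)
  hence "r < q" using ab r by (simp add: ennreal_less_iff)
  hence "r^2 < q^2" using r by (simp add: power_strict_mono)
  thus False using assms real r by (metis ennreal_le_iff ennreal_power not_less zero_le_power2)
 next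
  case top
  thus False using assms r by (simp add: ennreal_power top_power_ennreal top_unique)
 qed
qed

lemma ennreal_sqrt_power2 [simp]: "(ennreal_sqrt x)^2 = x"
 by (cases x) (auto simp: ennreal_sqrt_def ennreal_power top_power_ennreal)

lemma borel_measurable_ennreal_sqrt [measurable]: "ennreal_sqrt \<in> \<B> borel"
proof -
 have m: "(%x. ennreal (sqrt (enn2real x))) \<in> \<B> borel"
  by (intro measurable_compose[OF _ measurable_ennreal] borel_measurable_sqrt borel_measurable_enn2real) simp
 have "ennreal_sqrt = (%x. if x \<in> {top} then top else ennreal (sqrt (enn2real x)))"
  by (auto simp: fun_eq_iff ennreal_sqrt_def)
 also have "... \<in> \<B> borel" by (rule measurable_If_set[OF _ m]) simp_all
 finally show ?thesis .
qed

text \<open>Stated for squares and with a pointwise hypothesis, so that it can be nested under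
  iterated integrals and no root of an extended real enters an estimate.\<close>

lemma nn_integral_CS:
 fixes x y z :: "'a => ennreal"
 assumes [measurable]: "y \<in> \<B> M" "z \<in> \<B> M"
  and le: "\<And>u. u \<in> space M ==> (x u)^2 <= y u*z u"
 shows "(NN u|M. x u)^2 <= (NN u|M. y u)*(NN u|M. z u)"
proof -
 have "(NN u|M. x u) <= (NN u|M. ennreal_sqrt (y u)*ennreal_sqrt (z u))"
  by (rule nn_integral_mono, rule ennreal_power2_le_imp_le) (simp add: power_mult_distrib le)
 hence "(NN u|M. x u)^2 <= (NN u|M. ennreal_sqrt (y u)*ennreal_sqrt (z u))^2" by (intro power_mono) auto
 also have "... <= (NN u|M. (ennreal_sqrt (y u))^2)*(NN u|M. (ennreal_sqrt (z u))^2)"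
  by (intro Cauchy_Schwarz_nn_integral) measurable
 finally show ?thesis by simp
qed

section \<open>The frequency measure: measurability, invariance, and the size of thin sets\<close>

lemma countable_lattice [simp]: "countable (lattice L)" by (simp add: lattice_def)

lemma lattice_add: "x \<in> lattice L ==> y \<in> lattice L ==> x+y \<in> lattice L"
 unfolding lattice_def by (auto simp: add_divide_distrib[symmetric] simp flip: of_int_add)

lemma lattice_uminus: "x \<in> lattice L ==> - x \<in> lattice L"
 unfolding lattice_def by (auto simp: minus_divide_left simp flip: of_int_minus)

lemma lattice_diff: "x \<in> lattice L ==> y \<in> lattice L ==> x-y \<in> lattice L"
 using lattice_add[OF _ lattice_uminus, of x L y] by simp

abbreviation latmeas :: "real => real measure" where
 "latmeas L \<equiv> scale_measure (ennreal (1/L)) (lat L)"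

lemma space_latmeas [simp]: "space (latmeas L) = lattice L" by (simp add: space_scale_measure)

lemma sets_latmeas [measurable_cong]: "sets (latmeas L) = sets (lat L)" by simp

lemma nn_integral_latmeas:
 "(NN y|latmeas L. f y) = ennreal (1/L)*(NN y|lat L. f y)" by (simp add: nn_integral_scale_measure)

lemma sigma_finite_latmeas: "sigma_finite_measure (latmeas L)"
proof
 show "\<exists>A. countable A \<and> A \<subseteq> sets (latmeas L) \<and> \<Union> A = space (latmeas L) \<and>
  (\<forall>a\<in>A. emeasure (latmeas L) a \<noteq> \<infinity>)" by (rule exI[of _ "(%x. {x}) ` lattice L"])
   (auto simp: emeasure_scale_measure ennreal_mult_eq_top_iff)
qed

lemma space_freq: "space (freq L) = UNIV \<times> lattice L" by (simp add: freq_def space_pair_measure)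

lemma sets_freq [measurable_cong]:
 "sets (freq L) = sets (borel \<otimes> lat L)" unfolding freq_def by (intro sets_pair_measure_cong) auto

lemma sigma_finite_freq: "sigma_finite_measure (freq L)"
proof -
 interpret A: sigma_finite_measure "latmeas L" by (rule sigma_finite_latmeas)
 interpret pair_sigma_finite "lborel :: real measure" "latmeas L" ..
 show ?thesis unfolding freq_def by (rule sigma_finite_measure_axioms)
qed

lemma measurable_lattice_borel [measurable]: "(%x. x) \<in> lat L ->M borel"
 by (rule measurable_count_space_eq1[THEN iffD2]) auto

lemma freq_into_borel:
 assumes "f \<in> M ->M freq L"
 shows "f \<in> M ->M borel"
proof -
 have "(%x. x) \<in> freq L ->M (borel \<otimes> borel :: (real \<times> real) measure)"
 proof -
  have "(%x. (fst x, snd x)) \<in> freq L ->M (borel \<otimes> borel :: (real \<times> real) measure)"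
  proof (rule measurable_Pair)
   show "fst \<in> freq L ->M borel" by measurable
   have "(%x. snd x) \<in> freq L ->M lat L" by measurable
   from measurable_compose[OF this measurable_lattice_borel]
   show "snd \<in> freq L ->M borel" .
  qed
  thus ?thesis by simp
 qed
 from measurable_compose[OF assms this] show ?thesis by (simp add: borel_prod)
qed

lemma freq_measurableI:
 assumes "(%x. fst (f x)) \<in> M ->M borel" "(%x. snd (f x)) \<in> M ->M lat L"
 shows "f \<in> M ->M freq L"
proof -
 have "(%x. (fst (f x), snd (f x))) \<in> M ->M freq L" using assms by measurable
 thus ?thesis by simp
qed

lemma freq_snd:
 assumes "f \<in> M ->M freq L"
 shows "(%x. snd (f x)) \<in> M ->M lat L"
proof -
 have "snd \<in> freq L ->M lat L" by measurable
 from measurable_compose[OF assms this] show ?thesis .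
qed

lemma freq_fst:
 assumes "f \<in> M ->M freq L"
 shows "(%x. fst (f x)) \<in> M ->M borel"
proof -
 have "fst \<in> freq L ->M borel" by measurable
 from measurable_compose[OF assms this] show ?thesis .
qed

text \<open>The domain splits into countably many fibres of \<open>f\<close>; on each of them one
  argument is fixed and the operation is a map between discrete spaces.\<close>

lemma lattice_binop_measurable:
 assumes f: "f \<in> M ->M lat L" and g: "g \<in> M ->M lat L"
  and cl: "\<And>u v. u \<in> lattice L ==> v \<in> lattice L ==> h u v \<in> lattice L"
 shows "(%x. h (f x) (g x)) \<in> M ->M lat L"
proof (rule measurable_compose_countable'[where I = "lattice L" and g = f and f = "%u x. h u (g x)"])
 fix u assume "u \<in> lattice L"
 hence "h u \<in> lat L ->M lat L" using cl by auto
 from measurable_compose[OF g this] show "(%x. h u (g x)) \<in> M ->M lat L" .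
qed (use f in auto)

lemma freq_add [measurable (raw)]:
 assumes f: "f \<in> M ->M freq L" and g: "g \<in> M ->M freq L"
 shows "(%x. f x+g x) \<in> M ->M freq L"
proof (rule freq_measurableI)
 have "(%x. fst (f x)+fst (g x)) \<in> \<B> M" using freq_fst[OF f] freq_fst[OF g] by measurable
 thus "(%x. fst (f x+g x)) \<in> M ->M borel" by simp
 have "(%x. snd (f x)+snd (g x)) \<in> M ->M lat L"
  by (rule lattice_binop_measurable[OF freq_snd[OF f] freq_snd[OF g] lattice_add])
 thus "(%x. snd (f x+g x)) \<in> M ->M lat L" by simp
qed

lemma freq_diff [measurable (raw)]:
 assumes f: "f \<in> M ->M freq L" and g: "g \<in> M ->M freq L"
 shows "(%x. f x-g x) \<in> M ->M freq L"
proof (rule freq_measurableI)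
 have "(%x. fst (f x)-fst (g x)) \<in> \<B> M" using freq_fst[OF f] freq_fst[OF g] by measurable
 thus "(%x. fst (f x-g x)) \<in> M ->M borel" by simp
 have "(%x. snd (f x)-snd (g x)) \<in> M ->M lat L"
  by (rule lattice_binop_measurable[OF freq_snd[OF f] freq_snd[OF g] lattice_diff])
 thus "(%x. snd (f x-g x)) \<in> M ->M lat L" by simp
qed

lemma freq_uminus [measurable (raw)]:
 assumes f: "f \<in> M ->M freq L"
 shows "(%x. - f x) \<in> M ->M freq L"
proof (rule freq_measurableI)
 have "(%x. - fst (f x)) \<in> \<B> M" using freq_fst[OF f] by measurable
 thus "(%x. fst (- f x)) \<in> M ->M borel" by simp
 have "(%x. - snd (f x)) \<in> M ->M lat L"
  using lattice_binop_measurable[where h = "%u v. - u", OF freq_snd[OF f] freq_snd[OF f]]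
  by (simp add: lattice_uminus)
 thus "(%x. snd (- f x)) \<in> M ->M lat L" by simp
qed

lemma nn_integral_freq:
 assumes "f \<in> \<B> (freq L)"
 shows "(NN xi|freq L. f xi) = ennreal (1/L)*(NN y|lat L. (NN x|lborel. f (x, y)))"
proof -
 interpret A: sigma_finite_measure "latmeas L" by (rule sigma_finite_latmeas)
 interpret pair_sigma_finite "lborel :: real measure" "latmeas L" ..
 have "(NN xi|freq L. f xi) = (NN y|latmeas L. (NN x|lborel. f (x, y)))"
  using nn_integral_snd[of f] assms by (simp add: freq_def)
 thus ?thesis by (simp add: nn_integral_latmeas)
qed

lemma freq_section: 
 assumes "y \<in> lattice L"
 shows "(%x. (x, y)) \<in> borel ->M freq L"
proof (rule freq_measurableI)
 show "(%x. snd (x::real, y)) \<in> borel ->M lat L" using assms unfolding snd_conv by (intro measurable_const) simp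
qed simp

text \<open>The frequency measure is a Haar measure of the product of the line with the lattice: a
  translation inside each row and a permutation of the rows.\<close>

lemma nn_integral_freq_translate:
 assumes f: "f \<in> \<B> (freq L)" and v: "v \<in> space (freq L)"
 shows "(NN xi|freq L. f (v+xi)) = (NN xi|freq L. f xi)"
proof -
 obtain p q where v': "v = (p, q)" "q \<in> lattice L" using v by (auto simp: space_freq)
 have fm: "(%xi. f (v+xi)) \<in> \<B> (freq L)" using f v by measurable
 have inner: "(NN x|lborel. f (p+x, q+y)) = (NN x|lborel. f (x, q+y))"
  if y: "y \<in> lattice L" for y
 proof -
  have [measurable]: "(%x. f (x, q+y)) \<in> \<B> borel"
  proof -
   have "(%x. (x, q+y)) \<in> borel ->M freq L" by (intro freq_section lattice_add v' y)
   from measurable_compose[OF this f] show ?thesis .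
  qed
  show ?thesis using nn_integral_real_affine[of "%x. f (x, q+y)" 1 p] by simp
 qed
 have bij: "bij_betw (%y. q+y) (lattice L) (lattice L)"
  by (rule bij_betwI[where g = "%y. y-q"]) (auto intro: lattice_add lattice_diff v')
 have "(NN y|lat L. (NN x|lborel. f (v+(x, y)))) = (NN y|lat L. (NN x|lborel. f (x, q+y)))"
  by (rule nn_integral_cong) (simp add: v' inner)
 also have "... = (NN y|lat L. (NN x|lborel. f (x, y)))"
  using nn_integral_bij_count_space[OF bij, of "%y. (NN x|lborel. f (x, y))"] by simp
 finally show ?thesis by (simp add: nn_integral_freq[OF f] nn_integral_freq[OF fm])
qed

lemma nn_integral_freq_uminus:
 assumes f: "f \<in> \<B> (freq L)"
 shows "(NN xi|freq L. f (- xi)) = (NN xi|freq L. f xi)"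
proof -
 have fm: "(%xi. f (- xi)) \<in> \<B> (freq L)" using f by measurable
 have inner: "(NN x|lborel. f (- x, - y)) = (NN x|lborel. f (x, - y))"
  if y: "y \<in> lattice L" for y
 proof -
  have [measurable]: "(%x. f (x, - y)) \<in> \<B> borel"
  proof -
   have "(%x. (x, - y)) \<in> borel ->M freq L" by (intro freq_section lattice_uminus y)
   from measurable_compose[OF this f] show ?thesis .
  qed
  show ?thesis using nn_integral_real_affine[of "%x. f (x, - y)" "-1" 0] by simp
 qed
 have bij: "bij_betw uminus (lattice L) (lattice L)"
  by (rule bij_betwI[where g = uminus]) (auto intro: lattice_uminus)
 have "(NN y|lat L. (NN x|lborel. f (- (x, y)))) = (NN y|lat L. (NN x|lborel. f (x, - y)))"
  by (rule nn_integral_cong) (simp add: inner)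
 also have "... = (NN y|lat L. (NN x|lborel. f (x, y)))"
  using nn_integral_bij_count_space[OF bij, of "%y. (NN x|lborel. f (x, y))"] by simp
 finally show ?thesis by (simp add: nn_integral_freq[OF f] nn_integral_freq[OF fm])
qed

lemma card_lattice_interval:
 assumes L: "1 <= L" and w: "0 <= w" and S: "S \<subseteq> lattice L"
  and diam: "\<And>x y. x \<in> S ==> y \<in> S ==> \<bar>x-y\<bar> <= w"
 shows "finite S" "real (card S) <= L*w+1"
proof -
 have "finite S \<and> real (card S) <= L*w+1"
 proof (cases "S = {}")
  case False
  then obtain x0 where x0: "x0 \<in> S" by auto
  define K where "K = {k::int. of_int k/L \<in> S}"
  have SK: "S = (%k. of_int k/L) ` K" using S by (auto simp: K_def lattice_def)
  have d: "\<bar>real_of_int k-real_of_int l\<bar> <= L*w" if "k \<in> K" "l \<in> K" for k l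
  proof -
   have "\<bar>of_int k/L-of_int l/L\<bar> <= w" using that diam by (auto simp: K_def)
   thus ?thesis using L by (simp add: diff_divide_distrib[symmetric] abs_divide field_simps)
  qed
  obtain k0 where k0: "k0 \<in> K" using x0 SK by auto
  have bd: "k0-\<lceil>L*w\<rceil> <= k \<and> k <= k0+\<lceil>L*w\<rceil>" if "k \<in> K" for k
   using d[OF that k0] by linarith
  have finK: "finite K" by (rule finite_subset[of _ "{k0-\<lceil>L*w\<rceil>..k0+\<lceil>L*w\<rceil>}"]) (use bd in auto)
  have "K \<subseteq> {Min K..Max K}" using finK by auto
  hence "card K <= card {Min K..Max K}" by (intro card_mono) auto
  also have "... = nat (Max K-Min K+1)" by simp
  finally have "real (card K) <= real (nat (Max K-Min K+1))" by simp
  also have "... = real_of_int (Max K)-real_of_int (Min K)+1"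
   using order_trans[OF Min_le[OF finK k0] Max_ge[OF finK k0]] by simp
  also have "... <= L*w+1" using d[of "Max K" "Min K"] finK k0 Max_in Min_in by fastforce
  finally have "real (card K) <= L*w+1" .
  moreover have "card S <= card K" unfolding SK by (rule card_image_le[OF finK])
  ultimately show ?thesis using finK SK by auto
 qed (use L w in auto)
 thus "finite S" "real (card S) <= L*w+1" by auto
qed

lemma emeasure_lborel_diam:
 fixes A :: "real set"
 assumes "0 <= l" "A \<in> sets borel" and diam: "\<And>x y. x \<in> A ==> y \<in> A ==> \<bar>x-y\<bar> <= l"
 shows "emeasure lborel A <= ennreal l"
proof (cases "A = {}")
 case False
 then obtain a where a: "a \<in> A" by auto
 have bb: "bdd_below A" by (rule bdd_belowI[of _ "a-l"]) (use diam[OF a] in force)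
 have "A \<subseteq> {Inf A..Inf A+l}"
 proof
  fix x assume x: "x \<in> A"
  have "x-l <= Inf A" by (rule cInf_greatest) (use False diam[OF x] in force)+
  thus "x \<in> {Inf A..Inf A+l}" using cInf_lower[OF x bb] by auto
 qed
 hence "emeasure lborel A <= emeasure lborel {Inf A..Inf A+l}" by (intro emeasure_mono) auto
 thus ?thesis using assms by simp
qed simp

lemma freq_section_measurable:
 assumes "S \<in> sets (freq L)"
 shows "{x. (x, y) \<in> S} \<in> sets borel"
proof (cases "y \<in> lattice L")
 case True
 hence "(%x. (x, y)) \<in> borel ->M freq L" by (rule freq_section)
 from measurable_sets[OF this assms] show ?thesis by (simp add: vimage_def)
next
 case False
 have "S \<subseteq> space (freq L)" using assms by (rule sets.sets_into_space)
 hence "{x. (x, y) \<in> S} = {}" using False by (auto simp: space_freq)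
 thus ?thesis by simp
qed

lemma emeasure_freq:
 assumes "S \<in> sets (freq L)"
 shows "emeasure (freq L) S = ennreal (1/L)*(NN y|lat L. emeasure lborel {x. (x, y) \<in> S})"
proof -
 have "emeasure (freq L) S = (NN xi|freq L. ind S xi)" using assms by simp
 also have "... = ennreal (1/L) * (NN y|lat L. (NN x|lborel. ind S (x, y)))"
  using assms by (intro nn_integral_freq) auto
 also have "(%y. (NN x|lborel. ind S (x, y))) = (%y. emeasure lborel {x. (x, y) \<in> S})"
 proof
  fix y
  have "(NN x|lborel. ind S (x, y)) = (NN x|lborel. ind {x. (x, y) \<in> S} x)"
   by (intro nn_integral_cong) (auto simp: indicator_def)
  thus "(NN x|lborel. ind S (x, y)) = emeasure lborel {x. (x, y) \<in> S}"
   using freq_section_measurable[OF assms] by simp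
 qed
 finally show ?thesis .
qed

text \<open>A set of height \<open>w\<close> meets at most L*w + 1 rows, and the factor 1/L turns
  this into w + 1/L \<le> w + 1, uniformly in L. Horizontal distances are only compared within a
  row, so the rows may drift: this is how slanted strips and thin sectors are measured
  below.\<close>

lemma emeasure_freq_diam:
 assumes L: "1 <= L" and S: "S \<in> sets (freq L)" and w: "0 <= w" and l: "0 <= l"
  and dy: "\<And>xi et. xi \<in> S ==> et \<in> S ==> \<bar>snd xi-snd et\<bar> <= w"
  and dx: "\<And>xi et. xi \<in> S ==> et \<in> S ==> snd xi = snd et ==> \<bar>fst xi-fst et\<bar> <= l"
 shows "emeasure (freq L) S <= ennreal ((w+1)*l)"
proof -
 define Y where "Y = snd ` S"
 have Ssp: "S \<subseteq> UNIV \<times> lattice L" using sets.sets_into_space[OF S] by (simp add: space_freq)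
 have Y: "finite Y" "real (card Y) <= L*w+1"
  by (rule card_lattice_interval[OF L w]; use Ssp dy in \<open>force simp: Y_def\<close>)+
 have "(NN y|lat L. emeasure lborel {x. (x, y) \<in> S}) <= (NN y|lat L. ennreal l*ind Y y)"
 proof (intro nn_integral_mono)
  fix y
  show "emeasure lborel {x. (x, y) \<in> S} <= ennreal l*ind Y y"
  proof (cases "y \<in> Y")
   case True
   have "emeasure lborel {x. (x, y) \<in> S} <= ennreal l"
    by (rule emeasure_lborel_diam[OF l freq_section_measurable[OF S]]) (use dx in force)
   thus ?thesis using True by simp
  next
   case False
   hence "{x. (x, y) \<in> S} = {}" by (force simp: Y_def)
   thus ?thesis by simp
  qed
 qed
 also have "... = ennreal l*emeasure (lat L) Y" using Ssp by (subst nn_integral_cmult_indicator) (auto simp: Y_def)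
 also have "... = ennreal (l*real (card Y))" using Y Ssp l by (subst emeasure_count_space_finite)
   (auto simp: Y_def ennreal_mult ennreal_of_nat_eq_real_of_nat)
 also have "... <= ennreal (l*(L*w+1))" using Y l by (intro ennreal_leI mult_left_mono) auto
 finally have "emeasure (freq L) S <= ennreal (1/L)*ennreal (l*(L*w+1))"
  unfolding emeasure_freq[OF S] by (rule mult_left_mono) simp
 also have "... = ennreal (l*(w+1/L))" using L l w by (subst ennreal_mult[symmetric]) (auto simp: field_simps)
 also have "... <= ennreal ((w+1)*l)"
  using L l w by (intro ennreal_leI) (auto simp: mult.commute intro!: mult_left_mono)
 finally show ?thesis .
qed

section \<open>Iterated integrals over three vertices of a parallelogram\<close>

text \<open>The vertices \<open>y\<close> and \<open>x\<close> are opposite to each other,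
  \<open>d\<close> is adjacent to both, and the fourth vertex is x+y-d. The integral is iterated
  rather than taken over a product, because each estimate integrates one chosen vertex with two
  others fixed.\<close>

definition tri :: "real => (real \<times> real => real \<times> real => real \<times> real => ennreal) => ennreal" where
 "tri L f = (NN y|freq L. (NN x|freq L. (NN d|freq L. f y x d)))"

abbreviation freq3 :: "real => ((real \<times> real) \<times> (real \<times> real) \<times> (real \<times> real)) measure" where
 "freq3 L \<equiv> freq L \<otimes> freq L \<otimes> freq L"

lemma nn_integral_freq_swap:
 assumes "(%(x, y). f x y) \<in> \<B> (freq L \<otimes> freq L)"
 shows "(NN x|freq L. (NN y|freq L. f x y)) = (NN y|freq L. (NN x|freq L. f x y))"
proof -
 interpret F: sigma_finite_measure "freq L" by (rule sigma_finite_freq)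
 interpret pair_sigma_finite "freq L" "freq L" ..
 show ?thesis using Fubini'[OF assms] by simp
qed

lemma nn_integral_freq_measurable:
 assumes "(%(x, y). f x y) \<in> \<B> (M \<otimes> freq L)"
 shows "(%x. (NN y|freq L. f x y)) \<in> \<B> M"
proof -
 interpret F: sigma_finite_measure "freq L" by (rule sigma_finite_freq)
 show ?thesis using F.borel_measurable_nn_integral[OF assms] .
qed

lemma freq3_section:
 assumes "(%(y, x, d). f y x d) \<in> \<B> (freq3 L)"
 shows "y \<in> space (freq L) ==> (%(x, d). f y x d) \<in> \<B> (freq L \<otimes> freq L)"
  and "y \<in> space (freq L) ==> x \<in> space (freq L) ==> (%d. f y x d) \<in> \<B> (freq L)"
  and "(%(y, x). (NN d|freq L. f y x d)) \<in> \<B> (freq L \<otimes> freq L)"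
  and "y \<in> space (freq L) ==> (%x. (NN d|freq L. f y x d)) \<in> \<B> (freq L)"
  and "(%y. (NN x|freq L. (NN d|freq L. f y x d))) \<in> \<B> (freq L)"
proof -
 have f [measurable]: "(%z. f (fst z) (fs z) (ss z)) \<in> \<B> (freq3 L)" using assms by (simp add: case_prod_beta')
 have comp: "(%u. f (p u) (q u) (r u)) \<in> \<B> M"
  if "p \<in> M ->M freq L" "q \<in> M ->M freq L" "r \<in> M ->M freq L" for p q r M
 proof -
  have "(%u. (p u, q u, r u)) \<in> M ->M freq3 L" using that by measurable
  from measurable_compose[OF this f] show ?thesis by simp
 qed
 show 1: "y \<in> space (freq L) ==> (%(x, d). f y x d) \<in> \<B> (freq L \<otimes> freq L)"
  unfolding case_prod_beta' by (rule comp) measurable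
 show "y \<in> space (freq L) ==> x \<in> space (freq L) ==> (%d. f y x d) \<in> \<B> (freq L)"
  by (rule comp) measurable
 show 2: "(%(y, x). (NN d|freq L. f y x d)) \<in> \<B> (freq L \<otimes> freq L)" unfolding case_prod_beta'
 proof (rule nn_integral_freq_measurable)
  show "(%(x, y). f (fst x) (snd x) y) \<in> \<B> ((freq L \<otimes> freq L) \<otimes> freq L)"
   unfolding case_prod_beta' by (rule comp) measurable
 qed
 show "y \<in> space (freq L) ==> (%x. (NN d|freq L. f y x d)) \<in> \<B> (freq L)"
  using nn_integral_freq_measurable[OF 1] .
 show "(%y. (NN x|freq L. (NN d|freq L. f y x d))) \<in> \<B> (freq L)" using nn_integral_freq_measurable[OF 2] .
qed

lemma tri_mono:
 assumes "\<And>y x d. y \<in> space (freq L) ==> x \<in> space (freq L) ==> d \<in> space (freq L) ==> f y x d <= g y x d"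
 shows "tri L f <= tri L g" unfolding tri_def by (intro nn_integral_mono assms)

lemma tri_CS:
 assumes f: "(%(y, x, d). f y x d) \<in> \<B> (freq3 L)"
  and g: "(%(y, x, d). g y x d) \<in> \<B> (freq3 L)"
  and le: "\<And>y x d. y \<in> space (freq L) ==> x \<in> space (freq L) ==> d \<in> space (freq L) ==>
   (h y x d)^2 <= f y x d*g y x d"
 shows "(tri L h)^2 <= tri L f*tri L g" unfolding tri_def
 by (rule nn_integral_CS[OF freq3_section(5)[OF f] freq3_section(5)[OF g]],
   rule nn_integral_CS[OF freq3_section(4)[OF f] freq3_section(4)[OF g]], assumption+,
   rule nn_integral_CS[OF freq3_section(2)[OF f] freq3_section(2)[OF g]], assumption+,
   rule le)

lemma tri_swap_xd:
 assumes f: "(%(y, x, d). f y x d) \<in> \<B> (freq3 L)"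
 shows "tri L f = tri L (%y d x. f y x d)" unfolding tri_def
 by (rule nn_integral_cong, rule nn_integral_freq_swap, rule freq3_section(1)[OF f])

lemma tri_swap_yx:
 assumes f: "(%(y, x, d). f y x d) \<in> \<B> (freq3 L)"
 shows "tri L f = tri L (%x y d. f y x d)"
 unfolding tri_def by (rule nn_integral_freq_swap, rule freq3_section(3)[OF f])

lemma freq3_compose:
 assumes f: "(%(y, x, d). f y x d) \<in> \<B> (freq3 L)"
  and "p \<in> M ->M freq L" "q \<in> M ->M freq L" "r \<in> M ->M freq L"
 shows "(%u. f (p u) (q u) (r u)) \<in> \<B> M"
proof -
 have "(%u. (p u, q u, r u)) \<in> M ->M freq3 L" using assms(2-) by measurable
 from measurable_compose[OF this f] show ?thesis by simp
qed

lemma space_freq_add: "x \<in> space (freq L) ==> y \<in> space (freq L) ==> x+y \<in> space (freq L)"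
 by (auto simp: space_freq lattice_add)

lemma space_freq_diff: "x \<in> space (freq L) ==> y \<in> space (freq L) ==> x-y \<in> space (freq L)"
 by (auto simp: space_freq lattice_diff)

text \<open>For fixed \<open>x\<close> and \<open>d\<close> the translation y = b+d-x makes the
  fourth vertex an integration variable in place of \<open>y\<close>.\<close>

lemma tri_shift:
 assumes f: "(%(y, x, d). f y x d) \<in> \<B> (freq3 L)"
 shows "tri L f = tri L (%x d b. f (b+d-x) x d)"
proof -
 have m: "(%(x, y, d). f y x d) \<in> \<B> (freq3 L)"
  unfolding case_prod_beta' by (rule freq3_compose[OF f]) measurable
 have "tri L f = tri L (%x y d. f y x d)" by (rule tri_swap_yx[OF f])
 also have "... = tri L (%x d y. f y x d)" by (rule tri_swap_xd[OF m])
 also have "... = tri L (%x d b. f (b+d-x) x d)" unfolding tri_def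
 proof (rule nn_integral_cong, rule nn_integral_cong)
  fix x d assume x: "x \<in> space (freq L)" and d: "d \<in> space (freq L)"
  have "(%y. f y x d) \<in> \<B> (freq L)" by (rule freq3_compose[OF f]) (use x d in measurable)
  from nn_integral_freq_translate[OF this space_freq_diff[OF d x]]
  show "(NN y|freq L. f y x d) = (NN b|freq L. f (b+d-x) x d)" by (simp add: algebra_simps)
 qed
 finally show ?thesis .
qed

lemma tri_count_space:
 fixes f :: "'i::countable => _"
 assumes f: "\<And>k. (%(y, x, d). f k y x d) \<in> \<B> (freq3 L)"
 shows "tri L (%y x d. (NN k|count_space UNIV. f k y x d)) = (NN k|count_space UNIV. tri L (f k))"
proof -
 have "tri L (%y x d. (NN k|count_space UNIV. f k y x d)) =
  (NN y|freq L. (NN x|freq L. (NN k|count_space UNIV. (NN d|freq L. f k y x d))))" unfolding tri_def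
  by (intro nn_integral_cong nn_integral_count_space_nn_integral) (auto intro: freq3_section(2)[OF f])
 also have "... = (NN y|freq L. (NN k|count_space UNIV. (NN x|freq L. (NN d|freq L. f k y x d))))"
  by (intro nn_integral_cong nn_integral_count_space_nn_integral) (auto intro: freq3_section(4)[OF f])
 also have "... = (NN k|count_space UNIV. tri L (f k))" unfolding tri_def
  by (intro nn_integral_count_space_nn_integral) (auto intro: freq3_section(5)[OF f])
 finally show ?thesis .
qed

lemma nn_integral_freq_count_space:
 fixes f :: "'i::countable => _"
 assumes "\<And>k. f k \<in> \<B> (freq L)"
 shows "(NN k|count_space UNIV. (NN x|freq L. f k x)) = (NN x|freq L. (NN k|count_space UNIV. f k x))"
 by (rule nn_integral_count_space_nn_integral[symmetric]) (auto intro: assms)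

lemma borel_measurable_nn_integral_count_space [measurable (raw)]:
 fixes f :: "'i::countable => 'a => ennreal"
 assumes f: "\<And>k. f k \<in> \<B> M"
 shows "(%x. (NN k|count_space UNIV. f k x)) \<in> \<B> M"
proof -
 interpret sigma_finite_measure "count_space (UNIV :: 'i set)" by (rule sigma_finite_measure_count_space)
 have "(%z. f (snd z) (fst z)) \<in> \<B> (M \<otimes> count_space UNIV)"
  by (rule measurable_compose_countable[where f = "%k z. f k (fst z)" and g = snd])
   (auto intro: measurable_compose[OF measurable_fst f])
 thus ?thesis by (intro borel_measurable_nn_integral) (simp add: case_prod_beta')
qed

section \<open>Cauchy-Schwarz over a family of sectors\<close>

lemma overlap_le:
 assumes "finite A" and "\<And>k. y \<in> Y k ==> k \<in> A"
 shows "(NN k|count_space UNIV. ind (Y k) y) <= (of_nat (card A) :: ennreal)"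
proof -
 have "(NN k|count_space UNIV. ind (Y k) y) <= (NN k|count_space UNIV. (ind A k :: ennreal))"
  by (intro nn_integral_mono) (auto simp: indicator_def assms)
 also have "... = of_nat (card A)" using assms by simp
 finally show ?thesis .
qed

text \<open>Cauchy-Schwarz pairs the side \<open>y\<close>, \<open>d\<close> with the opposite side
  \<open>x\<close>, \<open>b\<close>, so that each half has one free vertex whose range has measure
  at most \<open>mm\<close>. Restricting to a piece \<open>X k j\<close> beforehand is what makes
  the range of \<open>x\<close> small; the overlaps are the price of adding the pieces up
  again.\<close>

lemma sector_estimate:
 fixes gy gb gx gd :: "real \<times> real => ennreal"
  and Y :: "int => (real \<times> real) set" and X B :: "int => int => (real \<times> real) set"
 assumes [measurable]: "gy \<in> \<B> (freq L)" "gb \<in> \<B> (freq L)"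
   "gx \<in> \<B> (freq L)" "gd \<in> \<B> (freq L)"
  and R [measurable]: "R \<in> sets (freq3 L)"
  and [measurable]: "\<And>k. Y k \<in> sets (freq L)" "\<And>k j. X k j \<in> sets (freq L)"
   "\<And>k j. B k j \<in> sets (freq L)"
  and cover: "\<And>y x d. (y, x, d) \<in> R ==> \<exists>k j. y \<in> Y k \<and> x \<in> X k j \<and> x+y-d \<in> B k j"
  and ov1: "\<And>y. (NN k|count_space UNIV. ind (Y k) y) <= O1"
  and ov2: "\<And>x. (NN k|count_space UNIV. (NN j|count_space UNIV. ind (X k j) x)) <= O2"
  and ov3: "\<And>k b. (NN j|count_space UNIV. ind (B k j) b) <= O3"
  and mx: "\<And>k j y d. y \<in> Y k ==> y \<in> space (freq L) ==> d \<in> space (freq L) ==>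
   emeasure (freq L) {x \<in> space (freq L). (y, x, d) \<in> R \<and> x \<in> X k j} <= mm"
  and md: "\<And>b x. b \<in> space (freq L) ==> x \<in> space (freq L) ==>
   emeasure (freq L) {d \<in> space (freq L). (b+d-x, x, d) \<in> R} <= mm"
 shows "(tri L (%y x d. ind R (y, x, d)*(gy y*gb (x+y-d)*gx x*gd d)))^2 <= mm^2*(O1*O2*O3)*(mass L gy*mass L gb *
    mass L gx*mass L gd)"
proof -
 let ?F = "freq L"
 define T where "T k j = tri L (%y x d. ind R (y, x, d)*ind (Y k) y*ind (X k j) x *
  ind (B k j) (x+y-d)*(gy y*gb (x+y-d)*gx x*gd d))" for k j
 define al where "al k = (NN y|?F. ind (Y k) y*(gy y)^2)" for k
 define \<beta> where "\<beta> k j = (NN y|?F. ind (B k j) y*(gb y)^2)" for k j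
 define ga where "ga k j = (NN y|?F. ind (X k j) y*(gx y)^2)" for k j
 define dl where "dl = mass L gd"
 have mT: "(%(y, x, d). ind R (y, x, d)*ind (Y k) y*ind (X k j) x *
  ind (B k j) (x+y-d)*(gy y*gb (x+y-d)*gx x*gd d)) \<in> \<B> (freq3 L)" for k j
  unfolding case_prod_beta' by measurable
 have le: "tri L (%y x d. ind R (y, x, d)*(gy y*gb (x+y-d)*gx x*gd d))
   <= (NN k|count_space UNIV. (NN j|count_space UNIV. T k j))"
 proof -
  have "tri L (%y x d. ind R (y, x, d)*(gy y*gb (x+y-d)*gx x*gd d)) <=
   tri L (%y x d. (NN kj|count_space UNIV. ind R (y, x, d)*ind (Y (fst kj)) y*ind (X (fst kj) (snd kj)) x *
  ind (B (fst kj) (snd kj)) (x+y-d)*(gy y*gb (x+y-d)*gx x*gd d)))"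
  proof (rule tri_mono)
   fix y x d
   show "ind R (y, x, d)*(gy y*gb (x+y-d)*gx x*gd d) <=
    (NN kj|count_space UNIV. ind R (y, x, d)*ind (Y (fst kj)) y*ind (X (fst kj) (snd kj)) x *
  ind (B (fst kj) (snd kj)) (x+y-d)*(gy y*gb (x+y-d)*gx x*gd d))"
   proof (cases "(y, x, d) \<in> R")
    case True
    then obtain k j where kj: "y \<in> Y k" "x \<in> X k j" "x+y-d \<in> B k j" using cover by blast
    have "ind R (y, x, d)*(gy y*gb (x+y-d)*gx x*gd d) =
     (NN l|count_space UNIV. (gy y*gb (x+y-d)*gx x*gd d)*ind {(k, j)} l)"
     using True by (simp add: nn_integral_cmult_indicator)
    also have "... <= (NN kj|count_space UNIV. ind R (y, x, d)*ind (Y (fst kj)) y*ind (X (fst kj) (snd kj)) x *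
  ind (B (fst kj) (snd kj)) (x+y-d)*(gy y*gb (x+y-d)*gx x*gd d))"
     by (rule nn_integral_mono) (auto simp: indicator_def True kj)
    finally show ?thesis .
   qed simp
  qed
  also have "... = (NN kj|count_space UNIV. T (fst kj) (snd kj))" unfolding T_def by (rule tri_count_space, rule mT)
  also have "... = (NN k|count_space UNIV. (NN j|count_space UNIV. T k j))"
   using nn_integral_fst_count_space[of "%kj. T (fst kj) (snd kj)"] by simp
  finally show ?thesis .
 qed
 \<comment> \<open>The indicator of \<open>X k j\<close> is used in both halves: in the first to
   bound the range of the free \<open>x\<close>, in the second to localise the mass of
   \<open>gx\<close>.\<close>
 have T2: "(T k j)^2 <= (mm*al k*dl)*(mm*ga k j*\<beta> k j)" for k j
 proof -
  define f where "f y x d = ind R (y, x, d)*ind (X k j) x*(ind (Y k) y*(gy y)^2*(gd d)^2)" for y x d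
  define g where "g y x d = ind R (y, x, d)*(ind (X k j) x*(gx x)^2 * (ind (B k j) (x+y-d)*(gb (x+y-d))^2))" for y x d
  have f: "(%(y, x, d). f y x d) \<in> \<B> (freq3 L)" unfolding f_def case_prod_beta' by measurable
  have g: "(%(y, x, d). g y x d) \<in> \<B> (freq3 L)" unfolding g_def case_prod_beta' by measurable
  have "(T k j)^2 <= tri L f*tri L g" unfolding T_def by (rule tri_CS[OF f g])
    (auto simp: f_def g_def indicator_def power_mult_distrib mult_ac)
  also have "tri L f <= mm*al k*dl"
  proof -
   have "tri L f = tri L (%y d x. f y x d)" by (rule tri_swap_xd[OF f])
   also have "... <= (NN y|?F. (NN d|?F. mm*(ind (Y k) y*(gy y)^2)*(gd d)^2))" unfolding tri_def
   proof (intro nn_integral_mono)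
    fix y d assume y: "y \<in> space ?F" and d: "d \<in> space ?F"
    have [measurable]: "Measurable.pred ?F (%x. (y, x, d) \<in> R)" using y d by measurable
    have "(NN x|?F. f y x d) = (NN x|?F. (ind (Y k) y*(gy y)^2*(gd d)^2) *
     ind {x \<in> space ?F. (y, x, d) \<in> R \<and> x \<in> X k j} x)"
     by (rule nn_integral_cong) (auto simp: f_def indicator_def)
    also have "... = (ind (Y k) y*(gy y)^2*(gd d)^2) *
      emeasure ?F {x \<in> space ?F. (y, x, d) \<in> R \<and> x \<in> X k j}"
     by (rule nn_integral_cmult_indicator) measurable
    also have "... <= (ind (Y k) y*(gy y)^2*(gd d)^2)*mm"
     by (cases "y \<in> Y k") (auto intro!: mult_left_mono mx y d)
    finally show "(NN x|?F. f y x d) <= mm*(ind (Y k) y*(gy y)^2)*(gd d)^2" by (simp add: mult_ac)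
   qed
   also have "... = mm*al k*dl" unfolding al_def dl_def by (simp add: nn_integral_cmult nn_integral_multc)
   finally show ?thesis .
  qed
  also have "tri L g <= mm*ga k j*\<beta> k j"
  proof -
   have m: "(%(x, d, b). g (b+d-x) x d) \<in> \<B> (freq3 L)"
    unfolding case_prod_beta' by (rule freq3_compose[OF g]) measurable
   have "tri L g = tri L (%x d b. g (b+d-x) x d)" by (rule tri_shift[OF g])
   also have "... = tri L (%x b d. g (b+d-x) x d)" by (rule tri_swap_xd[OF m])
   also have "... <= (NN x|?F. (NN b|?F. mm*(ind (X k j) x*(gx x)^2)*(ind (B k j) b*(gb b)^2)))" unfolding tri_def
   proof (intro nn_integral_mono)
    fix x b assume x: "x \<in> space ?F" and b: "b \<in> space ?F"
    have [measurable]: "Measurable.pred ?F (%d. (b+d-x, x, d) \<in> R)" using x b by measurable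
    have "(NN d|?F. g (b+d-x) x d) = (NN d|?F. (ind (X k j) x*(gx x)^2*(ind (B k j) b*(gb b)^2)) *
     ind {d \<in> space ?F. (b+d-x, x, d) \<in> R} d)" by (rule nn_integral_cong) (auto simp: g_def indicator_def)
    also have "... = (ind (X k j) x*(gx x)^2*(ind (B k j) b*(gb b)^2)) *
      emeasure ?F {d \<in> space ?F. (b+d-x, x, d) \<in> R}" by (rule nn_integral_cmult_indicator) measurable
    also have "... <= (ind (X k j) x*(gx x)^2*(ind (B k j) b*(gb b)^2))*mm" by (intro mult_left_mono md x b) auto
    finally show "(NN d|?F. g (b+d-x) x d) <= mm*(ind (X k j) x*(gx x)^2)*(ind (B k j) b*(gb b)^2)"
     by (simp add: mult_ac)
   qed
   also have "... = mm*ga k j*\<beta> k j"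
    unfolding \<beta>_def ga_def by (simp add: nn_integral_cmult nn_integral_multc)
   finally show ?thesis .
  qed
  finally show ?thesis by (simp add: mult_left_mono mult_right_mono)
 qed
 define \<Gamma> where "\<Gamma> k = (NN j|count_space UNIV. ga k j)" for k
 define \<beta>0 where "\<beta>0 = mass L gb"
 \<comment> \<open>For fixed \<open>k\<close> the masses of \<open>gb\<close> are counted at most
   \<open>O3\<close> times as \<open>j\<close> varies. The masses of \<open>gx\<close> are kept as
   \<open>\<Gamma> k\<close> and added up over \<open>k\<close> at the end.\<close>
 have S2: "(NN j|count_space UNIV. T k j)^2 <= al k*((mm^2*dl*O3*\<beta>0)*\<Gamma> k)" for k
 proof -
  have "(NN j|count_space UNIV. T k j)^2 <=
   (NN j|count_space UNIV. \<beta> k j)*(NN j|count_space UNIV. (mm^2*dl*al k)*ga k j)"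
   by (rule nn_integral_CS) (use T2 in \<open>auto simp: power2_eq_square mult_ac\<close>)
  also have "(NN j|count_space UNIV. \<beta> k j) <= O3*\<beta>0"
  proof -
   have "(NN j|count_space UNIV. \<beta> k j) = (NN y|?F. (NN j|count_space UNIV. ind (B k j) y*(gb y)^2))"
    unfolding \<beta>_def by (rule nn_integral_freq_count_space) measurable
   also have "... <= (NN y|?F. O3*(gb y)^2)"
    by (rule nn_integral_mono) (simp add: nn_integral_multc ov3 mult_right_mono)
   also have "... = O3*\<beta>0" unfolding \<beta>0_def by (simp add: nn_integral_cmult)
   finally show ?thesis .
  qed
  also have "(NN j|count_space UNIV. (mm^2*dl*al k)*ga k j) = (mm^2*dl*al k)*\<Gamma> k"
   unfolding \<Gamma>_def by (rule nn_integral_cmult) simp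
  finally show ?thesis by (simp add: mult_ac mult_left_mono mult_right_mono)
 qed
 have "(tri L (%y x d. ind R (y, x, d)*(gy y*gb (x+y-d)*gx x*gd d)))^2 <=
  (NN k|count_space UNIV. (NN j|count_space UNIV. T k j))^2" using le by (rule power_mono) simp
 also have "... <= (NN k|count_space UNIV. al k)*(NN k|count_space UNIV. (mm^2*dl*O3*\<beta>0)*\<Gamma> k)"
  by (rule nn_integral_CS) (use S2 in auto)
 also have "... = (NN k|count_space UNIV. al k)*((mm^2*dl*O3*\<beta>0)*(NN k|count_space UNIV. \<Gamma> k))"
  by (simp add: nn_integral_cmult)
 also have "(NN k|count_space UNIV. al k) <= O1*mass L gy"
 proof -
  have "(NN k|count_space UNIV. al k) = (NN y|?F. (NN k|count_space UNIV. ind (Y k) y*(gy y)^2))"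
   unfolding al_def by (rule nn_integral_freq_count_space) measurable
  also have "... <= (NN y|?F. O1*(gy y)^2)"
   by (rule nn_integral_mono) (simp add: nn_integral_multc ov1 mult_right_mono)
  also have "... = O1*mass L gy" by (simp add: nn_integral_cmult)
  finally show ?thesis .
 qed
 also have "(NN k|count_space UNIV. \<Gamma> k) <= O2*mass L gx"
 proof -
  have "(NN k|count_space UNIV. \<Gamma> k) =
   (NN k|count_space UNIV. (NN y|?F. (NN j|count_space UNIV. ind (X k j) y*(gx y)^2)))" unfolding \<Gamma>_def ga_def
   by (rule nn_integral_cong, rule nn_integral_freq_count_space) measurable
  also have "... = (NN y|?F. (NN k|count_space UNIV. (NN j|count_space UNIV. ind (X k j) y*(gx y)^2)))"
   by (rule nn_integral_freq_count_space) measurable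
  also have "... <= (NN y|?F. O2*(gx y)^2)"
   by (rule nn_integral_mono) (simp add: nn_integral_multc ov2 mult_right_mono)
  also have "... = O2*mass L gx" by (simp add: nn_integral_cmult)
  finally show ?thesis .
 qed
 finally show ?thesis unfolding \<beta>0_def dl_def by (simp add: mult_ac mult_left_mono mult_right_mono)
qed


section \<open>Annuli of unit area scale and the quadrilinear bound without loss\<close>

lemma sum_inverse_sqrt_le: "(\<Sum>i\<in>{1..n}. 1/sqrt (real_of_int i)) <= 2 * sqrt (real_of_int n)" if "0 <= n"
 using that
proof (induction n rule: int_ge_induct)
 case (step n)
 have "{1..n+1} = insert (n+1) {1..n}" using step by auto
 hence "(\<Sum>i\<in>{1..n+1}. 1/sqrt (real_of_int i)) <= 2 * sqrt n+1/sqrt (n+1)" using step by simp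
 also have "... <= 2 * sqrt (n+1)"
 proof -
  define u v where "u = sqrt (real_of_int n)" and "v = sqrt (real_of_int n+1)"
  have v: "v > 0" "v^2 = u^2+1" "u \<ge> 0" using step by (auto simp: u_def v_def)
  have "2*u * v <= u^2+v^2" by (rule sum_squares_bound)
  hence "2*u * v+1 <= 2 * v^2" using v by simp
  hence "2*u+1/v <= 2 * v" using v by (simp add: field_simps power2_eq_square)
  thus ?thesis by (simp add: u_def v_def add.commute)
 qed
 finally show ?case by simp
qed simp

lemma abs_diff_le_of_squares:
 fixes u v :: real
 assumes "0 <= u" "0 <= v" "\<bar>u^2-v^2\<bar> <= 1"
 shows "\<bar>u-v\<bar> <= 1" and "0 < m ==> m <= u ==> m <= v ==> \<bar>u-v\<bar> <= 1/m"
proof -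
 have eq: "\<bar>u^2-v^2\<bar> = \<bar>u-v\<bar>*(u+v)"
  using assms by (simp add: power2_eq_square square_diff_square_factored abs_mult mult.commute)
 have "\<bar>u-v\<bar>*\<bar>u-v\<bar> <= \<bar>u-v\<bar>*(u+v)" using assms by (intro mult_left_mono) auto
 hence "\<bar>u-v\<bar>^2 <= 1^2" using eq assms by (simp add: power2_eq_square)
 thus "\<bar>u-v\<bar> <= 1" by (rule power2_le_imp_le) simp
 assume m: "0 < m" "m <= u" "m <= v"
 hence "\<bar>u-v\<bar>*m <= \<bar>u-v\<bar>*(u+v)" by (intro mult_left_mono) auto
 thus "\<bar>u-v\<bar> <= 1/m" using eq assms m by (simp add: field_simps)
qed

lemma norm_prod_power2: "(norm (z :: real \<times> real))^2 = (fst z)^2+(snd z)^2" by (simp add: norm_prod_def)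

lemma measurable_freq_id [measurable]: "(%x. x) \<in> freq L ->M borel" by (rule freq_into_borel) measurable

text \<open>Each quadrant of the annulus is cut into pieces of height \<open>1\<close>, on which the horizontal
 sections have length at most \<open>1 / sqrt (rh i)\<close>, where \<open>i\<close> counts the pieces from the top.\<close>

lemma emeasure_freq_annulus:
 assumes L: "1 <= L"
 shows "emeasure (freq L) {d \<in> space (freq L). R <= (norm (d-w))^2 \<and> (norm (d-w))^2 <= R+1} <= 32"
proof -
 define S where "S = {d \<in> space (freq L). R <= (norm (d-w))^2 \<and> (norm (d-w))^2 <= R+1}"
 define rh where "rh = sqrt (max R 0)"
 define I where "I = {-1..\<lfloor>rh\<rfloor>}"
 define Q where "Q = ({(1,1), (1,-1), (-1,1), (-1,-1)} :: (real \<times> real) set)"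
 define P where "P q i = {d \<in> S. 0 <= fst q*(fst d-fst w) \<and> 0 <= snd q*(snd d-snd w) \<and>
  \<lfloor>rh-snd q*(snd d-snd w)\<rfloor> = i}" for q i
 \<comment> \<open>In the pieces -1 and 0 only |u^2 - v^2| \<le> 1 is available for two horizontal
   distances u, v at the same height, so |u - v| \<le> 1. Further down rh - Y \<ge> i forces u^2 and
   v^2 to be at least rh*i, and the difference is at most the inverse of its root.\<close>
 define l where "l i = (if i <= 0 then 1 else 1/sqrt (rh*real_of_int i))" for i :: int
 have rh: "0 <= rh" "rh^2 = max R 0" by (auto simp: rh_def)
 have [measurable]: "S \<in> sets (freq L)" unfolding S_def by measurable
 have Pm [measurable]: "P q i \<in> sets (freq L)" for q i unfolding P_def by measurable
 have fsq: "(norm (d-w))^2 = (fst q*(fst d-fst w))^2+(snd q*(snd d-snd w))^2" if "q \<in> Q" for q d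
  using that unfolding norm_prod_power2[of "d-w"] by (auto simp: Q_def power2_eq_square algebra_simps)
 have cov: "S \<subseteq> (\<Union>q\<in>Q. \<Union>i\<in>I. P q i)"
 proof
  fix d assume d: "d \<in> S"
  have "\<exists>q\<in>Q. 0 <= fst q*(fst d-fst w) \<and> 0 <= snd q*(snd d-snd w)" by (simp add: Q_def) linarith
  then obtain q where q: "q \<in> Q" "0 <= fst q*(fst d-fst w)" "0 <= snd q*(snd d-snd w)" by blast
  define Y where "Y = snd q*(snd d-snd w)"
  have "Y^2 <= R+1" using d fsq[OF q(1), of d] by (auto simp: S_def Y_def) (smt (verit) zero_le_power2)
  also have "R+1 <= (rh+1)^2" using rh by (simp add: power2_sum)
  finally have "Y <= rh+1" using rh by (intro power2_le_imp_le[of Y]) auto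
  moreover have "0 <= Y" using q by (simp add: Y_def)
  ultimately have "\<lfloor>rh-Y\<rfloor> \<in> I" unfolding I_def atLeastAtMost_iff by linarith
  hence "d \<in> P q \<lfloor>rh-Y\<rfloor>" using d q by (auto simp: P_def Y_def)
  thus "d \<in> (\<Union>q\<in>Q. \<Union>i\<in>I. P q i)" using q \<open>\<lfloor>rh-Y\<rfloor> \<in> I\<close> by blast
 qed
 have piece: "emeasure (freq L) (P q i) <= ennreal (2*l i)" if q: "q \<in> Q" and i: "i \<in> I" for q i
 proof -
  have lpos: "0 <= l i" using rh by (simp add: l_def)
  have "emeasure (freq L) (P q i) <= ennreal ((1+1)*l i)"
  proof (rule emeasure_freq_diam[OF L Pm _ lpos])
   fix xi et assume xi: "xi \<in> P q i" and et: "et \<in> P q i"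
   have "\<bar>snd q*(snd xi-snd w)-snd q*(snd et-snd w)\<bar> <= 1" using xi et by (auto simp: P_def) linarith
   thus "\<bar>snd xi-snd et\<bar> <= 1" using q by (auto simp: Q_def)
   assume eq: "snd xi = snd et"
   define u v Y where "u = fst q*(fst xi-fst w)" and "v = fst q*(fst et-fst w)"
    and "Y = snd q*(snd xi-snd w)"
   have uv: "0 <= u" "0 <= v" "0 <= Y" "R <= u^2+Y^2" "u^2+Y^2 <= R+1" "R <= v^2+Y^2" "v^2+Y^2 <= R+1"
    "\<lfloor>rh-Y\<rfloor> = i"
    using xi et eq fsq[OF q, of xi] fsq[OF q, of et] by (auto simp: P_def S_def u_def v_def Y_def)
   have sq: "\<bar>u^2-v^2\<bar> <= 1" using uv by linarith
   have "\<bar>u-v\<bar> <= l i"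
   proof (cases "i <= 0")
    case True
    thus ?thesis using abs_diff_le_of_squares(1)[OF uv(1,2) sq] by (simp add: l_def)
   next
    case False
    hence i1: "1 <= real_of_int i" by linarith
    have Yi: "real_of_int i <= rh-Y" using uv(8) by linarith
    hence rh1: "rh \<ge> 1" using i1 uv by linarith
    hence R: "R = rh^2" using rh by (cases "R \<ge> 0") (auto simp: max_def)
    have "rh*i <= rh*(rh-Y)" using Yi rh by (intro mult_left_mono) auto
    also have "... <= rh^2-Y^2"
    proof -
     have "Y*Y <= rh*Y" using Yi i1 uv by (intro mult_right_mono) auto
     thus ?thesis by (simp add: power2_eq_square algebra_simps)
    qed
    finally have "rh*i <= u^2" "rh*i <= v^2" using uv R by auto
    hence "sqrt (rh*i) <= u" "sqrt (rh*i) <= v" using uv by (auto intro: real_le_lsqrt)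
    moreover have "0 < sqrt (rh*i)" using rh1 i1 by simp
    ultimately show ?thesis using abs_diff_le_of_squares(2)[OF uv(1,2) sq] False by (simp add: l_def)
   qed
   thus "\<bar>fst xi-fst et\<bar> <= l i" using q by (auto simp: Q_def u_def v_def)
  qed simp
  thus ?thesis by simp
 qed
 have "emeasure (freq L) S <= (\<Sum>q\<in>Q. emeasure (freq L) (\<Union>i\<in>I. P q i))"
  by (rule order_trans[OF emeasure_mono[OF cov] emeasure_subadditive_finite])
   (auto simp: Q_def I_def)
 also have "... <= (\<Sum>q\<in>Q. \<Sum>i\<in>I. ennreal (2*l i))"
  by (intro sum_mono order_trans[OF emeasure_subadditive_finite] sum_mono piece)
   (auto simp: I_def)
 also have "... = ennreal (4*(\<Sum>i\<in>I. 2*l i))"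
  using rh by (simp add: Q_def l_def sum_ennreal sum_nonneg flip: ennreal_mult' ennreal_plus)
   (simp add: ennreal_mult' sum_nonneg)
 \<comment> \<open>In each of the four quadrants the pieces -1 and 0 give 4, and all the others
   together give at most 4.\<close>
 also have "... <= ennreal 32"
 proof (rule ennreal_leI)
  have "{-1..m} = {-1, 0} \<union> {1..m}" if "0 <= m" for m :: int using that by auto
  from this[of "\<lfloor>rh\<rfloor>"] have I: "I = {-1, 0} \<union> {1..\<lfloor>rh\<rfloor>}"
   using rh by (simp add: I_def)
  have "(\<Sum>i\<in>I. 2*l i) = 4+(\<Sum>i\<in>{1..\<lfloor>rh\<rfloor>}. 2*l i)"
   unfolding I by (subst sum.union_disjoint) (auto simp: l_def)
  also have "(\<Sum>i\<in>{1..\<lfloor>rh\<rfloor>}. 2*l i) = 2/sqrt rh*(\<Sum>i\<in>{1..\<lfloor>rh\<rfloor>}. 1/sqrt (real_of_int i))"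
   unfolding sum_distrib_left by (rule sum.cong) (auto simp: l_def real_sqrt_mult)
  also have "... <= 2/sqrt rh*(2 * sqrt (real_of_int \<lfloor>rh\<rfloor>))"
   using rh by (intro mult_left_mono sum_inverse_sqrt_le) auto
  also have "... <= 2/sqrt rh*(2 * sqrt rh)" using rh by (intro mult_left_mono) auto
  also have "... <= 4" using rh by (cases "rh = 0") auto
  finally show "4*(\<Sum>i\<in>I. 2*l i) <= 32" by simp
 qed
 finally show ?thesis by (simp add: S_def)
qed

lemma freq3_components:
 "(%z. fst z) \<in> freq3 L ->M borel" "(%z. fs z) \<in> freq3 L ->M borel"
 "(%z. ss z) \<in> freq3 L ->M borel" by (rule freq_into_borel, measurable)+

text \<open>With y = a and x = c the inner product term is minus the resonance function |a|^2 -
  |b|^2 + |c|^2 - |d|^2; hence the negative centres \<open>- of_int n\<close> later on.\<close>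

definition window :: "real => (real \<times> real) \<times> (real \<times> real) \<times> (real \<times> real) => bool" where
 "window al = (%(y, x, d). \<bar>2*((x-d) \<bullet> (y-d))-al\<bar> <= 1)"

lemma measurable_window [measurable]: "Measurable.pred (freq3 L) (window al)" unfolding window_def case_prod_beta'
proof -
 note freq3_components [measurable]
 show "Measurable.pred (freq3 L) (%z. \<bar>2*((fs z-ss z) \<bullet> (fst z-ss z))-al\<bar> <= 1)" by measurable
qed

text \<open>The local L4 Strichartz bound, without loss. Here Cauchy-Schwarz pairs the diagonal
  \<open>y\<close>, \<open>x\<close> with the diagonal \<open>b\<close>, \<open>d\<close>. Once one
  diagonal is fixed, the window becomes an annulus about its midpoint for a vertex of the other
  diagonal. Both fibres cost 32, and 1024 is the square of 32.\<close>

lemma quadrilinear_L4: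
 assumes L: "1 <= L"
  and [measurable]: "gy \<in> \<B> (freq L)" "gb \<in> \<B> (freq L)"
   "gx \<in> \<B> (freq L)" "gd \<in> \<B> (freq L)"
  and R [measurable]: "R \<in> sets (freq3 L)" and win: "\<And>z. z \<in> R ==> window al z"
 shows "(tri L (%y x d. ind R (y, x, d)*(gy y*gb (x+y-d)*gx x*gd d)))^2 <= 1024*(mass L gy*mass L gb *
    mass L gx*mass L gd)"
proof -
 let ?F = "freq L"
 define f where "f y x d = ind R (y, x, d)*((gy y)^2*(gx x)^2)" for y x d
 define g where "g y x d = ind R (y, x, d)*((gb (x+y-d))^2*(gd d)^2)" for y x d
 have f: "(%(y, x, d). f y x d) \<in> \<B> (freq3 L)" unfolding f_def case_prod_beta' by measurable
 have g: "(%(y, x, d). g y x d) \<in> \<B> (freq3 L)" unfolding g_def case_prod_beta' by measurable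
 have "(tri L (%y x d. ind R (y, x, d)*(gy y*gb (x+y-d)*gx x*gd d)))^2 <= tri L f*tri L g"
  by (rule tri_CS[OF f g]) (auto simp: f_def g_def indicator_def power_mult_distrib mult_ac)
 also have "tri L f <= 32*(mass L gy*mass L gx)"
 proof -
  have "tri L f <= (NN y|?F. (NN x|?F. 32*(gy y)^2*(gx x)^2))" unfolding tri_def
  proof (intro nn_integral_mono)
   fix y x assume y: "y \<in> space ?F" and x: "x \<in> space ?F"
   define w where "w = (1/2) *\<^sub>R (x+y)"
   \<comment> \<open>The window has width 2 for twice the inner product, hence width 1 for the
     squared radius, as the annulus bound requires.\<close>
   define R' where "R' = (al-1)/2+(norm (x-y))^2/4"
   have eq: "(x-d) \<bullet> (y-d) = (norm (d-w))^2-(norm (x-y))^2/4" for d unfolding w_def power2_norm_eq_inner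
    by (simp add: inner_simps inner_commute field_simps)
   have [measurable]: "Measurable.pred ?F (%d. (y, x, d) \<in> R)" using x y by measurable
   have "(NN d|?F. f y x d) = (NN d|?F. ((gy y)^2*(gx x)^2)*ind {d \<in> space ?F. (y, x, d) \<in> R} d)"
    by (rule nn_integral_cong) (auto simp: f_def indicator_def)
   also have "... = ((gy y)^2*(gx x)^2)*emeasure ?F {d \<in> space ?F. (y, x, d) \<in> R}"
    by (rule nn_integral_cmult_indicator) measurable
   also have "emeasure ?F {d \<in> space ?F. (y, x, d) \<in> R} <=
     emeasure ?F {d \<in> space ?F. R' <= (norm (d-w))^2 \<and> (norm (d-w))^2 <= R'+1}"
   proof (rule emeasure_mono)
    have "R' <= (norm (d-w))^2 \<and> (norm (d-w))^2 <= R'+1" if "(y, x, d) \<in> R" for d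
     using win[OF that] unfolding window_def prod.case eq by (auto simp: R'_def abs_le_iff field_simps)
    thus "{d \<in> space ?F. (y, x, d) \<in> R} \<subseteq> {d \<in> space ?F. R' <= (norm (d-w))^2 \<and> (norm (d-w))^2 <= R'+1}"
     by auto
   qed measurable
   also have "... <= 32" by (rule emeasure_freq_annulus[OF L])
   finally show "(NN d|?F. f y x d) <= 32*(gy y)^2*(gx x)^2" by (simp add: mult_ac mult_left_mono mult_right_mono)
  qed
  also have "... = 32*(mass L gy*mass L gx)" by (simp add: nn_integral_cmult nn_integral_multc mult_ac)
  finally show ?thesis .
 qed
 also have "tri L g <= 32*(mass L gb*mass L gd)"
 proof -
  define g' where "g' x d b = g (b+d-x) x d" for x d b
  have m: "(%(x, d, b). g' x d b) \<in> \<B> (freq3 L)"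
   unfolding g'_def case_prod_beta' by (rule freq3_compose[OF g]) measurable
  have m2: "(%(d, x, b). g' x d b) \<in> \<B> (freq3 L)"
   unfolding case_prod_beta' by (rule freq3_compose[OF m]) measurable
  have "tri L g = tri L g'" unfolding g'_def by (rule tri_shift[OF g])
  also have "... = tri L (%d x b. g' x d b)" by (rule tri_swap_yx[OF m])
  also have "... = tri L (%d b x. g' x d b)" by (rule tri_swap_xd[OF m2])
  also have "... <= (NN d|?F. (NN b|?F. 32*(gd d)^2*(gb b)^2))" unfolding tri_def
  proof (intro nn_integral_mono)
   fix d b assume d: "d \<in> space ?F" and b: "b \<in> space ?F"
   define w where "w = (1/2) *\<^sub>R (b+d)"
   define R' where "R' = (- al-1)/2+(norm (b-d))^2/4"
   have eq: "(x-d) \<bullet> (b+d-x-d) = (norm (b-d))^2/4-(norm (x-w))^2" for x unfolding w_def power2_norm_eq_inner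
    by (simp add: inner_simps inner_commute field_simps)
   have [measurable]: "Measurable.pred ?F (%x. (b+d-x, x, d) \<in> R)" using b d by measurable
   have "(NN x|?F. g' x d b) = (NN x|?F. ((gd d)^2*(gb b)^2)*ind {x \<in> space ?F. (b+d-x, x, d) \<in> R} x)"
    by (rule nn_integral_cong) (auto simp: g'_def g_def indicator_def mult_ac)
   also have "... = ((gd d)^2*(gb b)^2)*emeasure ?F {x \<in> space ?F. (b+d-x, x, d) \<in> R}"
    by (rule nn_integral_cmult_indicator) measurable
   also have "emeasure ?F {x \<in> space ?F. (b+d-x, x, d) \<in> R} <=
     emeasure ?F {x \<in> space ?F. R' <= (norm (x-w))^2 \<and> (norm (x-w))^2 <= R'+1}"
   proof (rule emeasure_mono)
    have "R' <= (norm (x-w))^2 \<and> (norm (x-w))^2 <= R'+1" if "(b+d-x, x, d) \<in> R" for x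
     using win[OF that] unfolding window_def prod.case eq by (auto simp: R'_def abs_le_iff field_simps)
    thus "{x \<in> space ?F. (b+d-x, x, d) \<in> R} \<subseteq> {x \<in> space ?F. R' <= (norm (x-w))^2 \<and> (norm (x-w))^2 <= R'+1}"
     by auto
   qed measurable
   also have "... <= 32" by (rule emeasure_freq_annulus[OF L])
   finally show "(NN x|?F. g' x d b) <= 32*(gd d)^2*(gb b)^2" by (simp add: mult_ac mult_left_mono mult_right_mono)
  qed
  also have "... = 32*(mass L gb*mass L gd)" by (simp add: nn_integral_cmult nn_integral_multc mult_ac)
  finally show ?thesis .
 qed
 finally show ?thesis by (simp add: mult_ac mult_left_mono mult_right_mono)
qed

section \<open>Geometry of thin sectors and the estimate on a unit box\<close>

lemma abs_fst_le_norm: "\<bar>fst z\<bar> <= norm (z :: real \<times> real)"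
 using norm_fst_le[of "fst z" "snd z"] by simp

lemma abs_snd_le_norm: "\<bar>snd z\<bar> <= norm (z :: real \<times> real)"
 using norm_snd_le[of "snd z" "fst z"] by simp

lemma norm_le_abs_sum: "norm (z :: real \<times> real) <= \<bar>fst z\<bar> + \<bar>snd z\<bar>"
 unfolding norm_prod_def using sqrt_sum_squares_le_sum_abs[of "fst z" "snd z"] by simp

text \<open>Here \<open>(x1, x2)\<close> and \<open>(y1, y2)\<close> are the two nearly orthogonal sides of the rectangle, and
 \<open>(e1, e2)\<close> is the position of their common vertex in its unit box.\<close>

lemma sector_algebra:
 fixes y1 y2 x1 x2 e1 e2 X Y P sg :: real
 assumes P: "40000 <= P" and X: "P/4 <= X" and Y: "P/4 <= Y"
  and e: "0 <= e1" "e1 <= 1" "0 <= e2" "e2 <= 1"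
  and y: "\<bar>y1\<bar> <= 4*Y" "\<bar>y2\<bar> <= 4*Y" "Y/4 <= \<bar>y1\<bar>"
  and x: "\<bar>x1\<bar> <= 4*X" "\<bar>x2\<bar> <= 4*X" "X <= \<bar>x1\<bar> + \<bar>x2\<bar>"
  and orth: "\<bar>x1*y1+x2*y2\<bar> <= 4*P"
  and sg: "sg <= (y2+e2)/(y1+e1)" "(y2+e2)/(y1+e1) <= sg+1/P"
 shows "\<bar>sg\<bar> <= 22"
  and "\<bar>(y2+e2)-sg*(y1+e1)\<bar> <= 5*Y/P"
  and "\<bar>(x1+e1)+sg*(x2+e2)\<bar> <= 1200*X/P"
  and "X/60 <= \<bar>x2+e2\<bar>"
  and "\<bar>y2-sg*y1\<bar> <= 100*Y/P"
proof -
 define u1 u2 v1 v2 where "u1 = y1+e1" and "u2 = y2+e2" and "v1 = x1+e1" and "v2 = x2+e2"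
 note d = u1_def u2_def v1_def v2_def
 have pos: "0 < P" "0 < X" "0 < Y" "10000 <= X" "10000 <= Y" using P X Y by auto
 have u1: "Y/5 <= \<bar>u1\<bar>" "\<bar>u1\<bar> <= 5*Y" using y e pos unfolding d by linarith+
 have u2: "\<bar>u2\<bar> <= 4*Y+1" using y e by (auto simp: d)
 have v: "\<bar>v1\<bar> <= 5*X" "\<bar>v2\<bar> <= 5*X" "X/2 <= \<bar>v1\<bar> + \<bar>v2\<bar>" using x e pos unfolding d by linarith+
 have nz: "u1 \<noteq> 0" using u1 pos by auto
 define m where "m = u2/u1"
 have m: "u2 = m*u1" using nz by (simp add: m_def)
 have "\<bar>m\<bar>*\<bar>u1\<bar> <= 4*Y+1" using u2 by (simp add: m abs_mult)
 also have "... <= 21*(Y/5)" using pos by simp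
 also have "... <= 21*\<bar>u1\<bar>" using u1 by simp
 finally have m21: "\<bar>m\<bar> <= 21" using nz by simp
 have msg: "0 <= m-sg" "m-sg <= 1/P" using sg by (auto simp: m_def d)
 have "1/P <= 1" using P by simp
 thus sg22: "\<bar>sg\<bar> <= 22" using msg m21 by linarith
 have "u2-sg*u1 = (m-sg)*u1" by (simp add: m algebra_simps)
 hence "\<bar>u2-sg*u1\<bar> = (m-sg)*\<bar>u1\<bar>" using msg by (simp add: abs_mult)
 also have "... <= 1/P*(5*Y)" using msg u1 pos by (intro mult_mono) auto
 finally show a2: "\<bar>(y2+e2)-sg*(y1+e1)\<bar> <= 5*Y/P" by (simp add: d)
 hence a2': "\<bar>u2-sg*u1\<bar> <= 5*Y/P" by (simp add: d)
 have XP: "1 <= 4*X/P" "X/Y <= 4*X/P" "1 <= 4*Y/P" using X Y pos by (auto simp: field_simps)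
 have vu: "\<bar>v1*u1+v2*u2\<bar> <= 26*(X+Y)"
 proof -
  have eq: "v1*u1+v2*u2 = (x1*y1+x2*y2)+(x1*e1+x2*e2+e1*y1+e2*y2)+(e1*e1+e2*e2)" by (simp add: d algebra_simps)
  have b: "\<bar>p*q\<bar> <= r" if "\<bar>p\<bar> <= r" "0 <= q" "q <= 1" for p q r :: real
  proof -
   have "\<bar>p\<bar>*q <= \<bar>p\<bar>*1" using that by (intro mult_left_mono) auto
   thus ?thesis using that by (simp add: abs_mult)
  qed
  have "\<bar>x1*e1\<bar> <= 4*X" "\<bar>x2*e2\<bar> <= 4*X" "\<bar>e1*y1\<bar> <= 4*Y" "\<bar>e2*y2\<bar> <= 4*Y"
   "\<bar>e1*e1\<bar> <= 1" "\<bar>e2*e2\<bar> <= 1"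
   using b[of x1 _ e1] b[of x2 _ e2] b[of y1 _ e1] b[of y2 _ e2] b[of e1 1 e1] b[of e2 1 e2] x y e
   by (auto simp: mult.commute)
  hence "\<bar>x1*e1+x2*e2\<bar> <= 8*X" "\<bar>e1*y1+e2*y2\<bar> <= 8*Y" "\<bar>e1*e1+e2*e2\<bar> <= 2" by linarith+
  moreover have "v1*u1+v2*u2 = (x1*y1+x2*y2)+((x1*e1+x2*e2)+(e1*y1+e2*y2))+(e1*e1+e2*e2)" by (simp add: eq)
  moreover have "4*P <= 16*X" using X by simp
  ultimately have "\<bar>v1*u1+v2*u2\<bar> <= 26*X+26*Y" using orth pos by linarith
  thus ?thesis by simp
 qed
 \<comment> \<open>The component of v along (1, sg), multiplied by \<open>u1\<close>, differs from
   the inner product of u and v only by v2*(u2-sg*u1). Both are O(X*Y/P), and dividing by |u1|,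
   which is of order Y, leaves X/P.\<close>
 have "(v1+sg * v2)*u1 = (v1*u1+v2*u2)-v2*(u2-sg*u1)" by (simp add: algebra_simps)
 hence "\<bar>v1+sg * v2\<bar>*\<bar>u1\<bar> = \<bar>(v1*u1+v2*u2)-v2*(u2-sg*u1)\<bar>"
  by (simp add: abs_mult[symmetric])
 also have "... <= 26*(X+Y)+5*X*(5*Y/P)"
 proof -
  have "\<bar>v2*(u2-sg*u1)\<bar> <= 5*X*(5*Y/P)" unfolding abs_mult using v a2' pos by (intro mult_mono) auto
  thus ?thesis using vu by linarith
 qed
 also have "... <= 1200*X/P*(Y/5)"
 proof -
  have "X*P <= X*(4*Y)" "Y*P <= Y*(4*X)" using X Y pos by (auto intro!: mult_left_mono)
  moreover have "26*(X+Y)*P+25*X*Y = 26*(X*P)+26*(Y*P)+25*(X*Y)"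
   "X*(4*Y) = 4*(X*Y)" "Y*(4*X) = 4*(X*Y)" "0 <= X*Y" using pos by (auto simp: algebra_simps)
  ultimately have "26*(X+Y)*P+25*X*Y <= 240*X*Y" by linarith
  hence "(26*(X+Y)*P+25*X*Y)/P <= 240*X*Y/P" using pos by (intro divide_right_mono) auto
  thus ?thesis using pos by (simp add: add_divide_distrib mult_ac)
 qed
 also have "... <= 1200*X/P*\<bar>u1\<bar>" using u1 pos by (intro mult_left_mono) auto
 finally have a3: "\<bar>v1+sg * v2\<bar> <= 1200*X/P" by (rule mult_right_le_imp_le) (use nz in simp)
 thus "\<bar>(x1+e1)+sg*(x2+e2)\<bar> <= 1200*X/P" by (simp add: d)
 \<comment> \<open>For P \<ge> 40000 the component along (1, sg) is negligible, so a small
   \<open>v2\<close> would force a small \<open>v1\<close>, against |v1| + |v2| \<ge> X/2. The lower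
   bound on \<open>v2\<close> later limits the number of sectors that contain a given point.\<close>
 have "1200*X/P <= X/10" using P pos by (simp add: field_simps)
 moreover have "\<bar>v1\<bar> <= \<bar>v1+sg * v2\<bar> + 22*\<bar>v2\<bar>"
 proof -
  have "\<bar>sg * v2\<bar> <= 22*\<bar>v2\<bar>" unfolding abs_mult using sg22 by (intro mult_right_mono) auto
  thus ?thesis by linarith
 qed
 ultimately have "X/60 <= \<bar>v2\<bar>" using a3 v(3) pos by linarith
 thus "X/60 <= \<bar>x2+e2\<bar>" by (simp add: d)
 have "y2-sg*y1 = (u2-sg*u1)-(e2-sg*e1)" by (simp add: d algebra_simps)
 moreover have "\<bar>sg*e1\<bar> <= 22*1" unfolding abs_mult using sg22 e by (intro mult_mono) auto
 ultimately have "\<bar>y2-sg*y1\<bar> <= 5*Y/P+23" using a2' e by linarith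
 also have "... <= 100*Y/P" using XP(3) pos by (simp add: field_simps)
 finally show "\<bar>y2-sg*y1\<bar> <= 100*Y/P" .
qed

text \<open>(D1, D2) is the difference of two admissible positions of \<open>x\<close> for fixed
  \<open>y\<close> and \<open>d\<close>. It is nearly orthogonal to (y1, y2), a vector nearly
  parallel to (1, sg), and it also stays in a unit strip parallel to (1, sg). The two conditions are
  transversal; the combination in the proof eliminates \<open>D1\<close>.\<close>

lemma sector_section_algebra:
 fixes y1 y2 D1 D2 sg P Y :: real
 assumes P: "40000 <= P" and Y: "P/4 <= Y" and y1: "Y/4 <= \<bar>y1\<bar>" and sg: "\<bar>sg\<bar> <= 22"
  and s: "\<bar>y2-sg*y1\<bar> <= 100*Y/P"
  and D: "\<bar>y1*D1+y2*D2\<bar> <= 1" "\<bar>D2-sg*D1\<bar> <= 1"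
 shows "\<bar>D2\<bar> <= 2"
proof -
 have pos: "0 < P" "0 < Y" "10000 <= Y" using P Y by auto
 have nz: "y1 \<noteq> 0" using y1 pos by auto
 define r where "r = y2-sg*y1"
 have "y1*(D2-sg*D1)+sg*(y1*D1+y2*D2) = y1*D2*(1+sg^2)+sg*r*D2" by (simp add: r_def algebra_simps power2_eq_square)
 moreover have "\<bar>y1*(D2-sg*D1)\<bar> <= \<bar>y1\<bar>*1"
  unfolding abs_mult using D by (intro mult_left_mono) auto
 moreover have "\<bar>sg*(y1*D1+y2*D2)\<bar> <= 22*1" unfolding abs_mult using D sg by (intro mult_mono) auto
 ultimately have "\<bar>y1*D2*(1+sg^2)+sg*r*D2\<bar> <= \<bar>y1\<bar> + 22" by linarith
 moreover have "\<bar>y1\<bar>*\<bar>D2\<bar>*1 <= \<bar>y1*D2*(1+sg^2)\<bar>"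
  unfolding abs_mult by (intro mult_left_mono) auto
 moreover have "\<bar>sg*r*D2\<bar> <= (\<bar>y1\<bar> / 4)*\<bar>D2\<bar>"
 proof -
  have "\<bar>sg*r\<bar> <= 22*(100*Y/P)" unfolding abs_mult using sg s by (intro mult_mono) (auto simp: r_def)
  \<comment> \<open>The origin of the threshold 40000: this step needs P \<ge> 22*100*16 =
    35200.\<close>
  also have "... <= Y/16" using P pos by (simp add: field_simps)
  also have "... <= \<bar>y1\<bar> / 4" using y1 by simp
  finally show ?thesis unfolding abs_mult[of "sg*r"] by (rule mult_right_mono) simp
 qed
 ultimately have "\<bar>y1\<bar>*\<bar>D2\<bar> - (\<bar>y1\<bar> / 4)*\<bar>D2\<bar> <= \<bar>y1\<bar> + 22" by linarith
 hence "\<bar>y1\<bar>*(3/4*\<bar>D2\<bar>) <= \<bar>y1\<bar> + 22" by (simp add: algebra_simps)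
 also have "... <= \<bar>y1\<bar>*(3/2)" using y1 pos by simp
 finally have "3/4*\<bar>D2\<bar> <= 3/2" using nz by simp
 thus ?thesis by simp
qed

lemma inner_prod_real: "(u::real \<times> real) \<bullet> v = fst u*fst v+snd u * snd v" by (simp add: inner_prod_def)

text \<open>Rounds up 4*144*288001*206, the product of the fibre, overlap and side constants that
  arise in the box estimate.\<close>

definition box_const :: real where "box_const = 10 ^ 12"

text \<open>The sectors of \<open>y\<close> are seen from the corner of the box of \<open>d\<close>
  and have angular width 1/P; \<open>x\<close> lies in the orthogonal sector and is cut further into
  unit strips. Both fibres have measure O(1/Y), the strips for \<open>b\<close> overlap O(Y/P)
  times, and the product O(1/(Y*P)) is O(1/P^2). The first component of y-d must be large because
  slopes and horizontal sections are used.\<close>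

lemma box_estimate:
 assumes L: "1 <= L" and P: "40000 <= P" and X: "P/4 <= X" and Y: "P/4 <= Y"
  and meas [measurable]: "gy \<in> \<B> (freq L)" "gb \<in> \<B> (freq L)"
   "gx \<in> \<B> (freq L)" "gd \<in> \<B> (freq L)"
  and R [measurable]: "R \<in> sets (freq3 L)"
  and win: "\<And>z. z \<in> R ==> window al z"
  and box: "\<And>y x d. (y, x, d) \<in> R ==> e1 <= fst d \<and> fst d <= e1+1 \<and> e2 <= snd d \<and> snd d <= e2+1"
  and ry: "\<And>y x d. (y, x, d) \<in> R ==> Y <= norm (y-d) \<and> norm (y-d) <= 4*Y \<and> norm (y-d) <= 4*\<bar>fst y-fst d\<bar>"
  and rx: "\<And>y x d. (y, x, d) \<in> R ==> X <= norm (x-d) \<and> norm (x-d) <= 4*X"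
  and orth: "\<And>y x d. (y, x, d) \<in> R ==> \<bar>(x-d) \<bullet> (y-d)\<bar> <= 4*P"
 shows "(tri L (%y x d. ind R (y, x, d)*(gy y*gb (x+y-d)*gx x*gd d)))^2
  <= ennreal (box_const/P^2)*(mass L gy*mass L gb * mass L gx*mass L gd)"
proof -
 let ?F = "freq L"
 have pos: "0 < P" "0 < X" "0 < Y" "10000 <= Y" using P X Y by auto
 \<comment> \<open>Slopes are spaced by 1/P, because moving \<open>d\<close> inside its unit box
   turns the direction of a side of length at least of order P by O(1/P).\<close>
 define sg where "sg k = real_of_int k/P" for k :: int
 define YY where "YY k = {y \<in> space ?F. \<lfloor>P*(snd y-e2)/(fst y-e1)\<rfloor> = k \<and> Y/5 <= \<bar>fst y-e1\<bar> \<and>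
   \<bar>sg k\<bar> <= 22 \<and> \<bar>(snd y-e2)-sg k*(fst y-e1)\<bar> <= 5*Y/P}" for k
 \<comment> \<open>The component of \<open>x\<close> along (1, sg k) is small, which expresses
   orthogonality to the sector of \<open>y\<close>; the coordinate across that direction lies in [j,
   j+1).\<close>
 define XX where "XX k j = {x \<in> space ?F. \<bar>(fst x-e1)+sg k*(snd x-e2)\<bar> <= 1200*X/P \<and>
   X/60 <= \<bar>snd x-e2\<bar> \<and> \<lfloor>(snd x-e2)-sg k*(fst x-e1)\<rfloor> = j}" for k j
 define BB where "BB k j = {b \<in> space ?F. \<bar>(snd b-e2)-sg k*(fst b-e1)-real_of_int j\<bar> <= 101*Y/P}" for k j
 have [measurable]: "fst \<in> \<B> ?F" "snd \<in> \<B> ?F"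
  by (auto intro: freq_fst measurable_compose[OF freq_snd measurable_lattice_borel] simp: id_def[symmetric])
 have [measurable]: "YY k \<in> sets ?F" "XX k j \<in> sets ?F" "BB k j \<in> sets ?F" for k j
  unfolding YY_def XX_def BB_def by measurable
 have geo: "\<exists>k j. y \<in> YY k \<and> x \<in> XX k j \<and> x+y-d \<in> BB k j"
  if r: "(y, x, d) \<in> R" for y x d
 proof -
  have sp: "y \<in> space ?F" "x \<in> space ?F" "d \<in> space ?F"
   using sets.sets_into_space[OF R] r by (auto simp: space_pair_measure)
  define k where "k = \<lfloor>P*(snd y-e2)/(fst y-e1)\<rfloor>"
  define j where "j = \<lfloor>(snd x-e2)-sg k*(fst x-e1)\<rfloor>"
  have k: "real_of_int k <= P*(snd y-e2)/(fst y-e1)" "P*(snd y-e2)/(fst y-e1) <= real_of_int k+1"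
   unfolding k_def by linarith+
  have sk: "sg k <= (snd y-e2)/(fst y-e1)" "(snd y-e2)/(fst y-e1) <= sg k+1/P"
   using k pos by (auto simp: sg_def field_simps)
  have yb: "\<bar>fst y-fst d\<bar> <= 4*Y" "\<bar>snd y-snd d\<bar> <= 4*Y" "Y/4 <= \<bar>fst y-fst d\<bar>"
   using ry[OF r] abs_fst_le_norm[of "y-d"] abs_snd_le_norm[of "y-d"] by auto
  have xb: "\<bar>fst x-fst d\<bar> <= 4*X" "\<bar>snd x-snd d\<bar> <= 4*X" "X <= \<bar>fst x-fst d\<bar> + \<bar>snd x-snd d\<bar>"
   using rx[OF r] abs_fst_le_norm[of "x-d"] abs_snd_le_norm[of "x-d"] norm_le_abs_sum[of "x-d"] by auto
  have o: "\<bar>(fst x-fst d)*(fst y-fst d)+(snd x-snd d)*(snd y-snd d)\<bar> <= 4*P"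
   using orth[OF r] by (simp add: inner_prod_real)
  have bb: "0 <= fst d-e1" "fst d-e1 <= 1" "0 <= snd d-e2" "snd d-e2 <= 1" using box[OF r] by auto
  note alg = sector_algebra[OF P X Y bb yb xb o, of "sg k", simplified, OF sk]
  have "Y/5 <= \<bar>fst y-e1\<bar>" using yb(3) bb pos by linarith
  hence yk: "y \<in> YY k" using alg sp by (simp add: YY_def k_def[symmetric])
  have xk: "x \<in> XX k j" using alg sp by (simp add: XX_def j_def[symmetric])
  \<comment> \<open>Across the direction (1, sg k) the vertex \<open>x\<close> contributes
    \<open>j\<close> up to 1. The contribution of \<open>y\<close> is O(Y/P) by the choice of the
    sector, and that of \<open>d\<close> is bounded, hence O(Y/P) as well.\<close>
  have "x+y-d \<in> BB k j"
  proof -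
   have eq: "(snd (x+y-d)-e2)-sg k*(fst (x+y-d)-e1)-real_of_int j =
    ((snd x-e2)-sg k*(fst x-e1)-real_of_int j)+((snd y-e2)-sg k*(fst y-e1))-(snd d-e2)+sg k*(fst d-e1)"
    by (simp add: algebra_simps)
   have 1: "0 <= (snd x-e2)-sg k*(fst x-e1)-real_of_int j" "(snd x-e2)-sg k*(fst x-e1)-real_of_int j <= 1"
    by (auto simp: j_def) linarith
   have 2: "\<bar>sg k*(fst d-e1)\<bar> <= 22*1" unfolding abs_mult using alg(1) bb by (intro mult_mono) auto
   have "\<bar>(snd (x+y-d)-e2)-sg k*(fst (x+y-d)-e1)-real_of_int j\<bar> <= 24+5*Y/P"
    unfolding eq using 1 2 alg(2) bb by linarith
   also have "... <= 101*Y/P" using Y pos by (simp add: field_simps)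
   finally show ?thesis using sp by (simp add: BB_def space_freq_add space_freq_diff)
  qed
  with yk xk show ?thesis by blast
 qed
 \<comment> \<open>Two sectors that contain the same \<open>x\<close> have indices at most 2400*60 =
   144000 apart, so there are at most 2*144000 + 1 of them. For each \<open>k\<close> the point
   \<open>x\<close> determines \<open>j\<close>.\<close>
 define N2 where "N2 = (288001::nat)"
 define O3 where "O3 = 206*Y/P"
 define mm where "mm = 12/Y"
 have ov1: "(NN k|count_space UNIV. ind (YY k) y) <= (1::ennreal)" for y
  using overlap_le[of "{\<lfloor>P*(snd y-e2)/(fst y-e1)\<rfloor>}" y YY] by (auto simp: YY_def)
 have ov2: "(NN k|count_space UNIV. (NN j|count_space UNIV. ind (XX k j) x)) <= (of_nat N2 :: ennreal)" for x
 proof -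
  define K where "K = {k. \<exists>j. x \<in> XX k j}"
  have "finite K \<and> card K <= N2"
  proof (cases "K = {}")
   case False
   then obtain k0 where k0: "k0 \<in> K" by auto
   have "K \<subseteq> {k0-144000..k0+144000}"
   proof
    fix k assume "k \<in> K"
    hence a: "\<bar>(fst x-e1)+sg k*(snd x-e2)\<bar> <= 1200*X/P" "\<bar>(fst x-e1)+sg k0*(snd x-e2)\<bar> <= 1200*X/P"
     "X/60 <= \<bar>snd x-e2\<bar>" using k0 by (auto simp: K_def XX_def)
    have "\<bar>sg k-sg k0\<bar>*(X/60) <= \<bar>sg k-sg k0\<bar>*\<bar>snd x-e2\<bar>" using a by (intro mult_left_mono) auto
    also have "... = \<bar>((fst x-e1)+sg k*(snd x-e2))-((fst x-e1)+sg k0*(snd x-e2))\<bar>"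
     by (simp add: abs_mult[symmetric] algebra_simps)
    also have "... <= 2400*X/P" using a by linarith
    finally have "\<bar>sg k-sg k0\<bar>*P <= 144000" using pos by (simp add: field_simps)
    moreover have "\<bar>sg k-sg k0\<bar>*P = \<bar>real_of_int k-real_of_int k0\<bar>"
     using pos by (simp add: sg_def diff_divide_distrib[symmetric] abs_divide)
    ultimately have "\<bar>real_of_int (k-k0)\<bar> <= 144000" by simp
    thus "k \<in> {k0-144000..k0+144000}" by (auto simp: abs_le_iff)
   qed
   thus ?thesis using card_mono[of "{k0-144000..k0+144000}" K] finite_subset by (auto simp: N2_def)
  qed simp
  hence K: "finite K" "card K <= N2" by auto
  have "(NN j|count_space UNIV. ind (XX k j) x) <= (ind K k :: ennreal)" for k
  proof (cases "k \<in> K")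
   case True
   thus ?thesis using overlap_le[of "{\<lfloor>(snd x-e2)-sg k*(fst x-e1)\<rfloor>}" x "XX k"] by (auto simp: XX_def)
  next
   case False
   hence "x \<notin> XX k j" for j by (auto simp: K_def)
   thus ?thesis by simp
  qed
  hence "(NN k|count_space UNIV. (NN j|count_space UNIV. ind (XX k j) x)) <=
    (NN k|count_space UNIV. (ind K k :: ennreal))" by (intro nn_integral_mono)
  also have "... = of_nat (card K)" using K by simp
  also have "... <= of_nat N2" using K by simp
  finally show ?thesis .
 qed
 have ov3: "(NN j|count_space UNIV. ind (BB k j) b) <= ennreal O3" for k b
 proof -
  define t where "t = (snd b-e2)-sg k*(fst b-e1)"
  define c where "c = 101*Y/P"
  define A where "A = {\<lceil>t-c\<rceil>..\<lfloor>t + c\<rfloor>}"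
  have c: "1 <= 4*Y/P" "0 <= c" using Y pos by (auto simp: c_def field_simps)
  have "(NN j|count_space UNIV. ind (BB k j) b) <= (of_nat (card A) :: ennreal)"
   by (rule overlap_le) (auto simp: BB_def A_def t_def c_def abs_le_iff ceiling_le_iff le_floor_iff)
  also have "of_nat (card A) = ennreal (real (card A))" by (simp add: ennreal_of_nat_eq_real_of_nat)
  also have "... <= ennreal O3"
  proof (rule ennreal_leI)
   have "real (card A) <= max 0 (real_of_int (\<lfloor>t + c\<rfloor> - \<lceil>t-c\<rceil> + 1))" by (simp add: A_def max_def)
   also have "... <= 2 * c+1" using c by (simp add: max_def) linarith
   also have "... <= O3" using c by (simp add: O3_def c_def)
   finally show "real (card A) <= O3" .
  qed
  finally show ?thesis .
 qed
 \<comment> \<open>For fixed \<open>y\<close> and \<open>d\<close> the window bounds the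
   displacement of \<open>x\<close> along y-d and the strip bounds its height; in one row the window
   leaves a length of at most 4/Y.\<close>
 have mx: "emeasure ?F {x \<in> space ?F. (y, x, d) \<in> R \<and> x \<in> XX k j} <= ennreal mm"
  if yk: "y \<in> YY k" and sp: "y \<in> space ?F" "d \<in> space ?F" for k j y d
 proof -
  let ?S = "{x \<in> space ?F. (y, x, d) \<in> R \<and> x \<in> XX k j}"
  have [measurable]: "Measurable.pred ?F (%x. (y, x, d) \<in> R)" using sp by measurable
  have "emeasure ?F ?S <= ennreal ((2+1)*(4/Y))"
  proof (rule emeasure_freq_diam[OF L])
   fix xi et assume xi: "xi \<in> ?S" and et: "et \<in> ?S"
   define D1 D2 y1 y2 where "D1 = fst xi-fst et" and "D2 = snd xi-snd et"
    and "y1 = fst y-fst d" and "y2 = snd y-snd d"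
   have y1: "Y/4 <= \<bar>y1\<bar>" using ry[of y xi d] xi by (auto simp: y1_def)
   have sg: "\<bar>sg k\<bar> <= 22" and s0: "\<bar>(snd y-e2)-sg k*(fst y-e1)\<bar> <= 5*Y/P" using yk by (auto simp: YY_def)
   have bb: "0 <= fst d-e1" "fst d-e1 <= 1" "0 <= snd d-e2" "snd d-e2 <= 1" using box[of y xi d] xi by auto
   have s: "\<bar>y2-sg k*y1\<bar> <= 100*Y/P"
   proof -
    have "y2-sg k*y1 = ((snd y-e2)-sg k*(fst y-e1))-(snd d-e2)+sg k*(fst d-e1)"
     by (simp add: y1_def y2_def algebra_simps)
    moreover have "\<bar>sg k*(fst d-e1)\<bar> <= 22*1" unfolding abs_mult using sg bb by (intro mult_mono) auto
    ultimately have "\<bar>y2-sg k*y1\<bar> <= 5*Y/P+23" using s0 bb by linarith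
    also have "... <= 100*Y/P" using Y pos by (simp add: field_simps)
    finally show ?thesis .
   qed
   have "\<bar>2*((xi-d) \<bullet> (y-d))-al\<bar> <= 1" "\<bar>2*((et-d) \<bullet> (y-d))-al\<bar> <= 1"
    using win[of "(y, xi, d)"] win[of "(y, et, d)"] xi et by (auto simp: window_def)
   moreover have "y1*D1+y2*D2 = ((xi-d) \<bullet> (y-d))-((et-d) \<bullet> (y-d))"
    by (simp add: inner_prod_real y1_def y2_def D1_def D2_def algebra_simps)
   ultimately have a: "\<bar>y1*D1+y2*D2\<bar> <= 1" by linarith
   have "D2-sg k*D1 = ((snd xi-e2)-sg k*(fst xi-e1))-((snd et-e2)-sg k*(fst et-e1))"
    by (simp add: D1_def D2_def algebra_simps)
   moreover have "\<lfloor>(snd xi-e2)-sg k*(fst xi-e1)\<rfloor> = \<lfloor>(snd et-e2)-sg k*(fst et-e1)\<rfloor>"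
    using xi et by (simp add: XX_def)
   ultimately have b: "\<bar>D2-sg k*D1\<bar> <= 1" by linarith
   show "\<bar>snd xi-snd et\<bar> <= 2" using sector_section_algebra[OF P Y y1 sg s a b] by (simp add: D2_def)
   assume "snd xi = snd et"
   hence "\<bar>y1\<bar>*\<bar>D1\<bar> <= 1" using a by (simp add: D2_def abs_mult)
   moreover have "Y/4*\<bar>D1\<bar> <= \<bar>y1\<bar>*\<bar>D1\<bar>" using y1 by (intro mult_right_mono) auto
   ultimately show "\<bar>fst xi-fst et\<bar> <= 4/Y" using pos by (simp add: D1_def field_simps)
  qed (use pos in \<open>auto\<close>)
  thus ?thesis by (simp add: mm_def)
 qed
 \<comment> \<open>For fixed \<open>x\<close> and \<open>b\<close> the side y-d = b-x is fixed, so
   the window bounds the displacement of \<open>d\<close> along it. The height is now bounded by the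
   box instead of a strip.\<close>
 have md: "emeasure ?F {d \<in> space ?F. (b+d-x, x, d) \<in> R} <= ennreal mm"
  if sp: "b \<in> space ?F" "x \<in> space ?F" for b x
 proof -
  let ?S = "{d \<in> space ?F. (b+d-x, x, d) \<in> R}"
  have [measurable]: "Measurable.pred ?F (%d. (b+d-x, x, d) \<in> R)" using sp by measurable
  have "emeasure ?F ?S <= ennreal ((1+1)*(4/Y))"
  proof (rule emeasure_freq_diam[OF L])
   fix xi et assume xi: "xi \<in> ?S" and et: "et \<in> ?S"
   show "\<bar>snd xi-snd et\<bar> <= 1" using box[of "b+xi-x" x xi] box[of "b+et-x" x et] xi et by auto
   assume eq: "snd xi = snd et"
   define D1 y1 where "D1 = fst xi-fst et" and "y1 = fst b-fst x"
   have y1: "Y/4 <= \<bar>y1\<bar>" using ry[of "b+xi-x" x xi] xi by (auto simp: y1_def)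
   have "\<bar>2*((x-xi) \<bullet> (b-x))-al\<bar> <= 1" "\<bar>2*((x-et) \<bullet> (b-x))-al\<bar> <= 1"
    using win[of "(b+xi-x, x, xi)"] win[of "(b+et-x, x, et)"] xi et by (auto simp: window_def)
   moreover have "y1*D1 = ((x-et) \<bullet> (b-x))-((x-xi) \<bullet> (b-x))"
    using eq by (simp add: inner_prod_real y1_def D1_def algebra_simps)
   ultimately have "\<bar>y1\<bar>*\<bar>D1\<bar> <= 1" unfolding abs_mult[symmetric] by linarith
   moreover have "Y/4*\<bar>D1\<bar> <= \<bar>y1\<bar>*\<bar>D1\<bar>" using y1 by (intro mult_right_mono) auto
   ultimately show "\<bar>fst xi-fst et\<bar> <= 4/Y" using pos by (simp add: D1_def field_simps)
  qed (use pos in \<open>auto\<close>)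
  also have "... <= ennreal mm" using pos by (intro ennreal_leI) (simp add: mm_def field_simps)
  finally show ?thesis .
 qed
 have "(tri L (%y x d. ind R (y, x, d)*(gy y*gb (x+y-d)*gx x*gd d)))^2
  <= (ennreal mm)^2*(1 * of_nat N2*ennreal O3)*(mass L gy*mass L gb * mass L gx*mass L gd)"
  by (rule sector_estimate[where Y = YY and X = XX and B = BB])
   (use geo ov1 ov2 ov3 mx md in \<open>simp_all\<close>)
 also have "(ennreal mm)^2*(1 * of_nat N2*ennreal O3) <= ennreal (box_const/P^2)"
 proof -
  have "(ennreal mm)^2*(1 * of_nat N2*ennreal O3) = ennreal (mm^2*(real N2*O3))"
  proof -
   have "0 <= mm" "0 <= O3" using pos by (auto simp: mm_def O3_def)
   thus ?thesis by (simp add: ennreal_mult ennreal_power ennreal_of_nat_eq_real_of_nat)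
  qed
  also have "... <= ennreal (box_const/P^2)"
  proof (rule ennreal_leI)
   have "mm^2*(real N2*O3) = (144*288001*206)/(Y*P)"
    using pos by (simp add: mm_def N2_def O3_def field_simps power2_eq_square)
   also have "... <= (144*288001*206)/(P/4*P)" using pos Y by (intro divide_left_mono mult_right_mono) auto
   also have "... = (144*288001*206*4)/P^2" by (simp add: power2_eq_square)
   also have "... <= box_const/P^2" by (intro divide_right_mono) (auto simp: box_const_def)
   finally show "mm^2*(real N2*O3) <= box_const/P^2" .
  qed
  finally show ?thesis .
 qed
 finally show ?thesis by (simp add: mult_right_mono)
qed

section \<open>Summation over unit boxes and side lengths in one dyadic shell\<close>

lemma japanese_ge1: "1 <= japanese r" by (simp add: japanese_def)

lemma japanese_pos: "0 < japanese r" using japanese_ge1[of r] by linarith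

lemma abs_le_japanese: "\<bar>r\<bar> <= japanese r" by (simp add: japanese_def real_le_rsqrt)

lemma japanese_power2: "(japanese r)^2 = 1+r^2" by (simp add: japanese_def)

lemma sum_inverse_le:
 "(\<Sum>n<2 ^ m. 1/(1+real n)) <= real m+1"
proof (induction m)
 case (Suc m)
 have "{..<2 ^ Suc m} = {..<2 ^ m} \<union> {2 ^ m..<(2::nat) ^ Suc m}" by auto
 hence "(\<Sum>n<2 ^ Suc m. 1/(1+real n)) = (\<Sum>n<2 ^ m. 1/(1+real n))+(\<Sum>n\<in>{2 ^ m..<2 ^ Suc m}. 1/(1+real n))"
  by (simp add: sum.union_disjoint ivl_disj_int_one)
 also have "(\<Sum>n\<in>{2 ^ m..<2 ^ Suc m}. 1/(1+real n)) <= (\<Sum>n\<in>{2 ^ m..<(2::nat) ^ Suc m}. 1/2 ^ m)"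
 proof (rule sum_mono)
  fix n :: nat assume "n \<in> {2 ^ m..<2 ^ Suc m}"
  hence "real (2 ^ m) <= real n" by (simp only: of_nat_le_iff atLeastLessThan_iff)
  hence "2 ^ m <= 1+real n" by (simp only: of_nat_power of_nat_numeral)
  thus "1/(1+real n) <= 1/2 ^ m" by (intro divide_left_mono) auto
 qed
 also have "... = 1" by simp
 finally show ?case using Suc by simp
qed simp

lemma sum_inverse_int_le:
 "(\<Sum>n\<in>{- (2 ^ m)<..<2 ^ m :: int}. 1/(1+\<bar>real_of_int n\<bar>)) <= 2*(real m+1)"
proof -
 define f where "f n = 1/(1+\<bar>real_of_int n\<bar>)" for n
 have "{- (2 ^ m)<..<2 ^ m :: int} \<subseteq> (int ` {..<2 ^ m}) \<union> ((%n. - int n) ` {..<2 ^ m})"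
 proof
  fix n :: int assume n: "n \<in> {- (2 ^ m)<..<2 ^ m}"
  show "n \<in> (int ` {..<2 ^ m}) \<union> ((%n. - int n) ` {..<2 ^ m})"
  proof (cases "0 <= n")
   case True
   hence "n = int (nat n)" "nat n < 2 ^ m" using n by (auto simp: nat_less_iff)
   thus ?thesis by blast
  next
   case False
   hence "n = - int (nat (- n))" "nat (- n) < 2 ^ m" using n by (auto simp: nat_less_iff)
   thus ?thesis by blast
  qed
 qed
 hence "(\<Sum>n\<in>{- (2 ^ m)<..<2 ^ m}. f n) <= (\<Sum>n\<in>(int ` {..<2 ^ m}) \<union> ((%n. - int n) ` {..<2 ^ m}). f n)"
  by (intro sum_mono2) (auto simp: f_def)
 also have "... <= (\<Sum>n\<in>int ` {..<2 ^ m}. f n)+(\<Sum>n\<in>(%n. - int n) ` {..<2 ^ m}. f n)"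
  using sum.union_inter[of "int ` {..<2 ^ m}" "(%n. - int n) ` {..<2 ^ m}" f]
   sum_nonneg[of "int ` {..<2 ^ m} \<inter> (%n. - int n) ` {..<2 ^ m}" f] by (simp add: f_def)
 also have "... = (\<Sum>n<2 ^ m. 1/(1+real n))+(\<Sum>n<2 ^ m. 1/(1+real n))"
  by (subst (1 2) sum.reindex) (auto simp: f_def inj_on_def)
 also have "... <= 2*(real m+1)" using sum_inverse_le[of m] by simp
 finally show ?thesis by (simp add: f_def)
qed

lemma tri_cmult:
 assumes "(%(y, x, d). f y x d) \<in> \<B> (freq3 L)"
 shows "tri L (%y x d. c*f y x d) = c*tri L f"
proof -
 have "tri L (%y x d. c*f y x d) = (NN y|freq L. (NN x|freq L. c*(NN d|freq L. f y x d)))" unfolding tri_def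
  by (rule nn_integral_cong, rule nn_integral_cong, rule nn_integral_cmult, rule freq3_section(2)[OF assms])
 also have "... = (NN y|freq L. c*(NN x|freq L. (NN d|freq L. f y x d)))"
  by (rule nn_integral_cong, rule nn_integral_cmult, rule freq3_section(4)[OF assms])
 also have "... = c*tri L f" unfolding tri_def by (rule nn_integral_cmult, rule freq3_section(5)[OF assms])
 finally show ?thesis .
qed

lemma tri_add:
 assumes f: "(%(y, x, d). f y x d) \<in> \<B> (freq3 L)"
  and g: "(%(y, x, d). g y x d) \<in> \<B> (freq3 L)"
 shows "tri L (%y x d. f y x d+g y x d) = tri L f+tri L g"
proof -
 have "tri L (%y x d. f y x d+g y x d) = (NN y|freq L. (NN x|freq L. (NN d|freq L. f y x d)+(NN d|freq L. g y x d)))"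
  unfolding tri_def by (rule nn_integral_cong, rule nn_integral_cong, rule nn_integral_add)
   (rule freq3_section(2)[OF f] freq3_section(2)[OF g]; assumption)+
 also have "... = (NN y|freq L. (NN x|freq L. (NN d|freq L. f y x d))+(NN x|freq L. (NN d|freq L. g y x d)))"
  by (rule nn_integral_cong, rule nn_integral_add)
   (rule freq3_section(4)[OF f] freq3_section(4)[OF g]; assumption)+
 also have "... = tri L f+tri L g"
  unfolding tri_def by (rule nn_integral_add; rule freq3_section(5)[OF f] freq3_section(5)[OF g])
 finally show ?thesis .
qed

lemma ennreal_sum_power2_le: "((x::ennreal)+y)^2 <= 4*B" if "x^2 <= B" "y^2 <= B"
proof -
 have "x <= ennreal_sqrt B" "y <= ennreal_sqrt B" using that by (auto intro: ennreal_power2_le_imp_le)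
 hence "(x+y)^2 <= (ennreal_sqrt B+ennreal_sqrt B)^2" by (intro power_mono add_mono) auto
 also have "... = 4*B" by (simp add: mult_2[symmetric] power_mult_distrib)
 finally show ?thesis .
qed

text \<open>If two vectors are nearly orthogonal, then at least one of them is not nearly vertical.\<close>

lemma orth_not_vertical:
 fixes u v :: "real \<times> real"
 assumes uv: "\<bar>u \<bullet> v\<bar> <= 2*norm u" and v: "40 <= norm v" and u: "0 < norm u"
  and not: "4*\<bar>fst v\<bar> < norm v"
 shows "norm u <= 4*\<bar>fst u\<bar>"
proof (rule ccontr)
 assume n: "\<not> norm u <= 4*\<bar>fst u\<bar>"
 have "norm u <= \<bar>fst u\<bar> + \<bar>snd u\<bar>" "norm v <= \<bar>fst v\<bar> + \<bar>snd v\<bar>" by (rule norm_le_abs_sum)+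
 hence s: "3/4*norm u <= \<bar>snd u\<bar>" "3/4*norm v <= \<bar>snd v\<bar>" using n not by auto
 have "(3/4*norm u)*(3/4*norm v) <= \<bar>snd u\<bar>*\<bar>snd v\<bar>" using s by (intro mult_mono) auto
 moreover have "\<bar>fst u\<bar>*\<bar>fst v\<bar> <= (1/4*norm u)*(1/4*norm v)" using n not by (intro mult_mono) auto
 moreover have "\<bar>snd u\<bar>*\<bar>snd v\<bar> - \<bar>fst u\<bar>*\<bar>fst v\<bar> <= \<bar>u \<bullet> v\<bar>"
  unfolding inner_prod_real abs_mult[symmetric] by linarith
 ultimately have "9/16*(norm u*norm v)-1/16*(norm u*norm v) <= 2*norm u" using uv by (simp add: field_simps)
 hence "norm u*norm v <= norm u*4" by simp
 thus False using u v by simp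
qed

definition core_const :: real where "core_const = 10 ^ 16"

text \<open>The box estimate needs the first of its two sides away from the vertical. Near
  orthogonality leaves at least one good side at \<open>d\<close>, and exchanging \<open>x\<close>
  and \<open>y\<close> covers the case in which it is the side at \<open>x\<close>. The hypothesis
  that |x-d| is large against <d> makes both sides long compared with the box.\<close>

lemma core_large_piece:
 fixes e1 e2 :: int
 assumes L: "1 <= L"
  and [measurable]: "gy \<in> \<B> (freq L)" "gb \<in> \<B> (freq L)"
   "gx \<in> \<B> (freq L)" "gd \<in> \<B> (freq L)"
  and R [measurable]: "R \<in> sets (freq3 L)" and win: "\<And>z. z \<in> R ==> window al z"
  and sorted: "\<And>y x d. (y, x, d) \<in> R ==> norm x <= norm y \<and> norm d <= norm x"
  and shell: "\<And>y x d. (y, x, d) \<in> R ==> 2 ^ k <= 1+norm y \<and> 1+norm y < 2 ^ (k+1)"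
  and orth: "\<And>y x d. (y, x, d) \<in> R ==> \<bar>(x-d) \<bullet> (y-d)\<bar> <= 2*norm (x-d)"
  and large: "\<And>y x d. (y, x, d) \<in> R ==> 100000*japanese (norm d) < norm (x-d)"
  and P: "\<And>y x d. (y, x, d) \<in> R ==> 2 ^ i <= norm (x-d) \<and> norm (x-d) < 2 ^ (i+1)"
  and box: "\<And>y x d. (y, x, d) \<in> R ==> \<lfloor>fst d\<rfloor> = e1 \<and> \<lfloor>snd d\<rfloor> = e2"
 shows "(tri L (%y x d. ind R (y, x, d)*(gy y*gb (x+y-d)*gx x*gd d)))^2
  <= 4*(ennreal (box_const/(2 ^ i)^2)*(mass L gy*mass L gb * mass L gx*mass L gd))"
proof (cases "R = {}")
 case True
 thus ?thesis by (simp add: tri_def)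
next
 case False
 let ?F = "freq L"
 note freq3_components [measurable]
 \<comment> \<open>Since |d| \<le> |x-d|/100000 and |x-d| > 100000, both \<open>d\<close> and the 1
   in the definition of the shell are negligible: |y-d| lies between 9/10 of 2^k and four times
   that.\<close>
 define Pi Y where "Pi = (2::real) ^ i" and "Y = (9/10)*(2::real) ^ k"
 have geo: "50000 <= Pi \<and> Pi/4 <= Y \<and> Y <= norm (y-d) \<and> norm (y-d) <= 4*Y \<and> Pi <= norm (x-d) \<and>
   norm (x-d) <= 4*Pi \<and> 40 <= norm (y-d) \<and> 0 < norm (x-d) \<and> \<bar>(x-d) \<bullet> (y-d)\<bar> <= 4*Pi"
  if r: "(y, x, d) \<in> R" for y x d
 proof -
  note s = sorted[OF r] shell[OF r] orth[OF r] large[OF r] P[OF r]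
  have j: "1 <= japanese (norm d)" "norm d <= japanese (norm d)"
   using japanese_ge1 abs_le_japanese[of "norm d"] by auto
  have Pi: "Pi <= norm (x-d)" "norm (x-d) < 2*Pi" "100000 < norm (x-d)" using s j by (auto simp: Pi_def)
  have t: "norm (x-d) <= norm x+norm d" "norm (y-d) <= norm y+norm d" "norm y <= norm (y-d)+norm d"
   using norm_triangle_ineq4[of x d] norm_triangle_ineq4[of y d] norm_triangle_sub[of y d] by (auto simp: add.commute)
  have k: "2 ^ k <= 1+norm y" "norm y < 2*2 ^ k" using s by auto
  have "norm d <= norm (x-d)/100000" using s j by simp
  thus ?thesis unfolding Y_def using Pi t k s by (auto simp: Y_def)
 qed
 have Pi: "40000 <= Pi" "Pi/4 <= Y" "Pi/4 <= Pi" using geo False by (auto simp: Pi_def) fastforce+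
 define Ra Rb where "Ra = {z \<in> R. norm (fst z-ss z) <= 4*\<bar>fst (fst z)-fss z\<bar>}"
  and "Rb = {z \<in> space (freq3 L). (fs z, fst z, ss z) \<in> R \<and>
    norm (fst z-ss z) <= 4*\<bar>fst (fst z)-fss z\<bar>}"
 have Rsub: "R \<subseteq> space (freq3 L)" using sets.sets_into_space[OF R] .
 have Ra': "Ra = {z \<in> space (freq3 L). z \<in> R \<and> norm (fst z-ss z) <= 4*\<bar>fst (fst z)-fss z\<bar>}"
  using Rsub by (auto simp: Ra_def)
 have [measurable]: "Ra \<in> sets (freq3 L)" unfolding Ra' by measurable
 have [measurable]: "Rb \<in> sets (freq3 L)" unfolding Rb_def by measurable
 let ?Pr = "mass L gy*mass L gb*mass L gx*mass L gd"
 have A: "(tri L (%y x d. ind Ra (y, x, d)*(gy y*gb (x+y-d)*gx x*gd d)))^2 <= ennreal (box_const/Pi^2)*?Pr"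
 proof (rule box_estimate[where X = Pi and Y = Y and al = al and ?e1.0 = "of_int e1" and ?e2.0 = "of_int e2"])
  fix y x d assume "(y, x, d) \<in> Ra"
  hence r: "(y, x, d) \<in> R" and n: "norm (y-d) <= 4*\<bar>fst y-fst d\<bar>" by (auto simp: Ra_def)
  show "real_of_int e1 <= fst d \<and> fst d <= real_of_int e1+1 \<and> real_of_int e2 <= snd d \<and> snd d <= real_of_int e2+1"
   using box[OF r] by linarith
  show "Y <= norm (y-d) \<and> norm (y-d) <= 4*Y \<and> norm (y-d) <= 4*\<bar>fst y-fst d\<bar>"
   "Pi <= norm (x-d) \<and> norm (x-d) <= 4*Pi" "\<bar>(x-d) \<bullet> (y-d)\<bar> <= 4*Pi" using geo[OF r] n by auto
 qed (use L Pi win in \<open>auto simp: Ra_def\<close>)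
 have B: "(tri L (%y x d. ind Rb (y, x, d)*(gx y*gb (x+y-d)*gy x*gd d)))^2 <=
   ennreal (box_const/Pi^2)*(mass L gx*mass L gb*mass L gy*mass L gd)"
 proof (rule box_estimate[where X = Y and Y = Pi and al = al and ?e1.0 = "of_int e1" and ?e2.0 = "of_int e2"])
  fix y x d assume "(y, x, d) \<in> Rb"
  hence r: "(x, y, d) \<in> R" and n: "norm (y-d) <= 4*\<bar>fst y-fst d\<bar>" by (auto simp: Rb_def)
  show "real_of_int e1 <= fst d \<and> fst d <= real_of_int e1+1 \<and> real_of_int e2 <= snd d \<and> snd d <= real_of_int e2+1"
   using box[OF r] by linarith
  show "Pi <= norm (y-d) \<and> norm (y-d) <= 4*Pi \<and> norm (y-d) <= 4*\<bar>fst y-fst d\<bar>"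
   "Y <= norm (x-d) \<and> norm (x-d) <= 4*Y" "\<bar>(x-d) \<bullet> (y-d)\<bar> <= 4*Pi"
   using geo[OF r] n by (auto simp: inner_commute)
 next
  fix z assume "z \<in> Rb"
  thus "window al z" using win[of "(fs z, fst z, ss z)"]
   by (auto simp: Rb_def window_def inner_commute case_prod_beta')
 qed (use L Pi in auto)
 have m: "(%(y, x, d). ind Ra (y, x, d)*(gy y*gb (x+y-d)*gx x*gd d)) \<in> \<B> (freq3 L)"
  "(%(y, x, d). ind Rb (x, y, d)*(gy y*gb (x+y-d)*gx x*gd d)) \<in> \<B> (freq3 L)"
  unfolding case_prod_beta' by measurable
 have "tri L (%y x d. ind R (y, x, d)*(gy y*gb (x+y-d)*gx x*gd d)) <=
  tri L (%y x d. ind Ra (y, x, d)*(gy y*gb (x+y-d)*gx x*gd d) + ind Rb (x, y, d)*(gy y*gb (x+y-d)*gx x*gd d))"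
 proof (rule tri_mono)
  fix y x d
  have "(y, x, d) \<in> Ra \<or> (x, y, d) \<in> Rb" if r: "(y, x, d) \<in> R"
  proof -
   have "(x, y, d) \<in> space (freq3 L)" using r Rsub by (auto simp: space_pair_measure)
   thus ?thesis using orth_not_vertical[OF orth[OF r]] geo[OF r] r
    by (cases "4*\<bar>fst (y-d)\<bar> < norm (y-d)") (auto simp: Ra_def Rb_def)
  qed
  thus "ind R (y, x, d)*(gy y*gb (x+y-d)*gx x*gd d) <= ind Ra (y, x, d)*(gy y*gb (x+y-d)*gx x*gd d) +
   ind Rb (x, y, d)*(gy y*gb (x+y-d)*gx x*gd d)" by (auto simp: indicator_def)
 qed
 also have "... = tri L (%y x d. ind Ra (y, x, d)*(gy y*gb (x+y-d)*gx x*gd d)) +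
   tri L (%y x d. ind Rb (x, y, d)*(gy y*gb (x+y-d)*gx x*gd d))" by (rule tri_add[OF m])
 also have "tri L (%y x d. ind Rb (x, y, d)*(gy y*gb (x+y-d)*gx x*gd d)) =
   tri L (%y x d. ind Rb (y, x, d)*(gx y*gb (x+y-d)*gy x*gd d))"
  using tri_swap_yx[OF m(2)] by (simp add: mult_ac add.commute)
 finally have "(tri L (%y x d. ind R (y, x, d)*(gy y*gb (x+y-d)*gx x*gd d)))^2 <=
  (tri L (%y x d. ind Ra (y, x, d)*(gy y*gb (x+y-d)*gx x*gd d)) +
   tri L (%y x d. ind Rb (y, x, d)*(gx y*gb (x+y-d)*gy x*gd d)))^2" by (rule power_mono) simp
 also have "... <= 4*(ennreal (box_const/Pi^2)*?Pr)"
  by (rule ennreal_sum_power2_le[OF A]) (use B in \<open>simp add: mult_ac\<close>)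
 finally show ?thesis by (simp add: Pi_def)
qed

text \<open>Where |x-d| is O(<d>) the weight is bounded and the lossless bound suffices. Elsewhere
  the gain 1/2^i of the box estimate cancels |x-d|, and the weight 1/<d> has to be summed over boxes
  by Cauchy-Schwarz. In the square this costs four logarithms: two from the harmonic sums over
  boxes, one from the scales \<open>i\<close> in the sum of weights, and one from the scales in the
  sum of masses.\<close>

lemma core_estimate:
 assumes L: "1 <= L"
  and [measurable]: "gy \<in> \<B> (freq L)" "gb \<in> \<B> (freq L)"
   "gx \<in> \<B> (freq L)" "gd \<in> \<B> (freq L)"
  and R [measurable]: "R \<in> sets (freq3 L)" and win: "\<And>z. z \<in> R ==> window al z"
  and sorted: "\<And>y x d. (y, x, d) \<in> R ==> norm x <= norm y \<and> norm d <= norm x"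
  and shell: "\<And>y x d. (y, x, d) \<in> R ==> 2 ^ k <= 1+norm y \<and> 1+norm y < 2 ^ (k+1)"
  and orth: "\<And>y x d. (y, x, d) \<in> R ==> \<bar>(x-d) \<bullet> (y-d)\<bar> <= 2*norm (x-d)"
 shows "(tri L (%y x d. ind R (y, x, d)*ennreal (norm (x-d)/japanese (norm d)) * (gy y*gb (x+y-d)*gx x*gd d)))^2
  <= ennreal (core_const*(real k+3) ^ 4)*(mass L gy*mass L gb * mass L gx*mass L gd)"
proof -
 let ?F = "freq L"
 let ?Pr = "mass L gy*mass L gb*mass L gx*mass L gd"
 note freq3_components [measurable]
 have [measurable]: "(%d. \<lfloor>fst d\<rfloor> = e) \<in> measurable ?F (count_space UNIV)" 
   "(%d. \<lfloor>snd d\<rfloor> = e) \<in> measurable ?F (count_space UNIV)" for e :: int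
  using freq_fst[OF measurable_ident] measurable_compose[OF freq_snd[OF measurable_ident] measurable_lattice_borel]
  by (auto intro!: measurable_compose[of _ ?F borel] simp: id_def)
 have [measurable]: "japanese \<in> \<B> borel" unfolding japanese_def[abs_def] by measurable
 have Rsub: "R \<subseteq> space (freq3 L)" using sets.sets_into_space[OF R] .
 define G where "G y x d = gy y*gb (x+y-d)*gx x*gd d" for y x d
 define Q :: "int \<times> int => (real \<times> real) set" where
  "Q e = {d \<in> space ?F. \<lfloor>fst d\<rfloor> = fst e \<and> \<lfloor>snd d\<rfloor> = snd e}" for e
 have [measurable]: "Q e \<in> sets ?F" for e unfolding Q_def by measurable
 define R0 where "R0 = {z \<in> space (freq3 L). z \<in> R \<and> norm (fs z-ss z) <= 100000*japanese (norm (ss z))}"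
 define R1 :: "nat \<times> int \<times> int => _" where "R1 ie = {z \<in> space (freq3 L). z \<in> R \<and> 100000*japanese (norm (ss z)) < norm (fs z-ss z) \<and>
   2 ^ fst ie <= norm (fs z-ss z) \<and> norm (fs z-ss z) < 2 ^ (fst ie+1) \<and> ss z \<in> Q (snd ie)}" for ie
 have [measurable]: "R0 \<in> sets (freq3 L)" unfolding R0_def by measurable
 have [measurable]: "R1 ie \<in> sets (freq3 L)" for ie unfolding R1_def by measurable
 \<comment> \<open>Up to the factor 6 this dominates 1/<d>^2 on the box \<open>e\<close>, and its
   sum over boxes factors into two harmonic sums.\<close>
 define w where "w e = 1/((1+\<bar>real_of_int (fst e)\<bar>)*(1+\<bar>real_of_int (snd e)\<bar>))" for e
 have wpos: "0 <= w e" for e by (simp add: w_def)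
 define c where "c ie = 2 ^ (fst ie+1) * sqrt (6*w (snd ie))" for ie :: "nat \<times> int \<times> int"
 \<comment> \<open>In the shell |x| and |d| are below 2^(k+1), so only these scales of |x-d| and
   these boxes of \<open>d\<close> occur.\<close>
 define I where "I = {..k+1} \<times> ({- (2 ^ (k+2))<..<2 ^ (k+2) :: int} \<times> {- (2 ^ (k+2))<..<2 ^ (k+2) :: int})"
 have finI: "finite I" by (simp add: I_def)
 have R1_I: "R1 ie = {}" if "ie \<notin> I" for ie
 proof (rule ccontr)
  assume "R1 ie \<noteq> {}"
  then obtain y x d where z: "(y, x, d) \<in> R1 ie" by fastforce
  hence r: "(y, x, d) \<in> R" and i: "2 ^ fst ie <= norm (x-d)" and q: "d \<in> Q (snd ie)" by (auto simp: R1_def)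
  note s = sorted[OF r] shell[OF r]
  have "norm (x-d) <= norm x+norm d" by (rule norm_triangle_ineq4)
  hence "(2::real) ^ fst ie < 2 ^ (k+2)" using i s by simp
  hence "fst ie < k+2" by (rule power_less_imp_less_exp[rotated]) simp
  moreover have "\<bar>fst d\<bar> < 2 ^ (k+1)" "\<bar>snd d\<bar> < 2 ^ (k+1)"
   using s abs_fst_le_norm[of d] abs_snd_le_norm[of d] by linarith+
  hence "\<bar>real_of_int \<lfloor>fst d\<rfloor>\<bar> < 2 ^ (k+1)+1" "\<bar>real_of_int \<lfloor>snd d\<rfloor>\<bar> < 2 ^ (k+1)+1" by linarith+
  moreover have "(2::real) ^ (k+1)+1 <= 2 ^ (k+2)" 
  proof -
   have "(1::real) <= 2 ^ k" "(2::real) ^ (k+1) = 2*2 ^ k" "(2::real) ^ (k+2) = 4*2 ^ k" by auto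
   thus ?thesis by linarith
  qed
  ultimately have "\<bar>real_of_int \<lfloor>fst d\<rfloor>\<bar> < 2 ^ (k+2)" "\<bar>real_of_int \<lfloor>snd d\<rfloor>\<bar> < 2 ^ (k+2)" by linarith+
  hence "real_of_int \<bar>\<lfloor>fst d\<rfloor>\<bar> < real_of_int (2 ^ (k+2))" "real_of_int \<bar>\<lfloor>snd d\<rfloor>\<bar> < real_of_int (2 ^ (k+2))" by simp_all
  hence "\<bar>\<lfloor>fst d\<rfloor>\<bar> < 2 ^ (k+2)" "\<bar>\<lfloor>snd d\<rfloor>\<bar> < 2 ^ (k+2)" unfolding of_int_less_iff by auto
  with \<open>fst ie < k+2\<close> q have "ie \<in> I" by (cases ie) (auto simp: I_def Q_def abs_less_iff)
  with that show False by simp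
 qed
 have mG: "(%(y, x, d). G y x d) \<in> \<B> (freq3 L)" unfolding G_def case_prod_beta' by measurable
 have m0: "(%(y, x, d). ind R0 (y, x, d)*G y x d) \<in> \<B> (freq3 L)" unfolding G_def case_prod_beta' by measurable
 have m0c: "(%(y, x, d). ennreal 100000*(ind R0 (y, x, d)*G y x d)) \<in> \<B> (freq3 L)"
  unfolding G_def case_prod_beta' by measurable
 have m1: "(%(y, x, d). ind (R1 ie) (y, x, d)*G y x d) \<in> \<B> (freq3 L)" for ie
  unfolding G_def case_prod_beta' by measurable
 have m1c: "(%(y, x, d). ennreal (c ie)*(ind (R1 ie) (y, x, d)*G y x d)) \<in> \<B> (freq3 L)" for ie
  using m1[of ie] unfolding case_prod_beta' by measurable
 have m1s: "(%(y, x, d). (NN ie|count_space UNIV. ennreal (c ie)*(ind (R1 ie) (y, x, d)*G y x d))) \<in> \<B> (freq3 L)"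
  using m1c unfolding case_prod_beta' by (intro borel_measurable_nn_integral_count_space)
 define T where "T ie = tri L (%y x d. ind (R1 ie) (y, x, d)*G y x d)" for ie
 define T0 where "T0 = tri L (%y x d. ind R0 (y, x, d)*G y x d)"
 have split: "tri L (%y x d. ind R (y, x, d)*ennreal (norm (x-d)/japanese (norm d))*G y x d) <=
  ennreal 100000*T0+(NN ie|count_space UNIV. ennreal (c ie)*T ie)"
 proof -
  have "tri L (%y x d. ind R (y, x, d)*ennreal (norm (x-d)/japanese (norm d))*G y x d) <=
   tri L (%y x d. ennreal 100000*(ind R0 (y, x, d)*G y x d) +
    (NN ie|count_space UNIV. ennreal (c ie)*(ind (R1 ie) (y, x, d)*G y x d)))"
  proof (rule tri_mono)
   fix y x d assume sp: "y \<in> space ?F" "x \<in> space ?F" "d \<in> space ?F"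
   have sp3: "(y, x, d) \<in> space (freq3 L)" using sp by (simp add: space_pair_measure)
   consider "(y, x, d) \<notin> R" | "(y, x, d) \<in> R" "norm (x-d) <= 100000*japanese (norm d)"
    | "(y, x, d) \<in> R" "100000*japanese (norm d) < norm (x-d)" by linarith
   thus "ind R (y, x, d)*ennreal (norm (x-d)/japanese (norm d))*G y x d <= ennreal 100000*(ind R0 (y, x, d)*G y x d) +
    (NN ie|count_space UNIV. ennreal (c ie)*(ind (R1 ie) (y, x, d)*G y x d))"
   proof cases
    case 2
    hence "norm (x-d)/japanese (norm d) <= 100000" using japanese_pos[of "norm d"] by (simp add: pos_divide_le_eq)
    hence "ennreal (norm (x-d)/japanese (norm d)) <= ennreal 100000" by (rule ennreal_leI)
    moreover have "(y, x, d) \<in> R0" using 2 sp3 by (simp add: R0_def)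
    ultimately show ?thesis using 2 by (simp add: mult_right_mono add_increasing2)
   next
    case 3
    have n1: "1 <= norm (x-d)" using 3 japanese_ge1[of "norm d"] by simp
    define i where "i = nat \<lfloor>log 2 (norm (x-d))\<rfloor>"
    have i: "2 ^ i <= norm (x-d)" "norm (x-d) < 2 ^ (i+1)"
    proof -
     have pos: "0 < norm (x-d)" using n1 by linarith
     hence "0 <= log 2 (norm (x-d))" using n1 by (subst zero_le_log_cancel_iff) auto
     hence "real i <= log 2 (norm (x-d))" "log 2 (norm (x-d)) < real i+1" by (auto simp: i_def)
     hence "2 powr real i <= norm (x-d)" "norm (x-d) < 2 powr (real i+1)"
      using pos by (simp_all add: le_log_iff log_less_iff)
     thus "2 ^ i <= norm (x-d)" "norm (x-d) < 2 ^ (i+1)" by (auto simp: powr_realpow powr_add)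
    qed
    define e where "e = (\<lfloor>fst d\<rfloor>, \<lfloor>snd d\<rfloor>)"
    have mem: "(y, x, d) \<in> R1 (i, e)" using 3 sp sp3 i by (simp add: R1_def Q_def e_def)
    have "norm (x-d)/japanese (norm d) <= c (i, e)"
    proof -
     have "1 <= 6*w e*(japanese (norm d))^2"
     proof -
      define p q where "p = \<bar>fst d\<bar>" and "q = \<bar>snd d\<bar>"
      have "\<bar>real_of_int (fst e)\<bar> <= p+1" "\<bar>real_of_int (snd e)\<bar> <= q+1" unfolding e_def fst_conv snd_conv p_def q_def by linarith+
      hence "(1+\<bar>real_of_int (fst e)\<bar>)*(1+\<bar>real_of_int (snd e)\<bar>) <= (p+2)*(q+2)"
       by (intro mult_mono) (auto simp: p_def)
      also have "... <= 6*(1+(p^2+q^2))"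
      proof -
       have "2*p <= 1+p^2" "2*q <= 1+q^2" "2*(p*q) <= p^2+q^2"
        using sum_squares_bound[of 1 p] sum_squares_bound[of 1 q] sum_squares_bound[of p q] by auto
       moreover have "0 <= p^2" "0 <= q^2" "(p+2)*(q+2) = p*q+2*p+2*q+4" by (auto simp: algebra_simps)
       ultimately have "(p+2)*(q+2) <= 6+6*p^2+6*q^2" by linarith
       thus ?thesis by simp
      qed
      also have "... = 6*(japanese (norm d))^2" by (simp add: japanese_power2 norm_prod_power2[of d] p_def q_def)
      finally show ?thesis by (simp add: w_def pos_le_divide_eq)
     qed
     hence "1/(japanese (norm d))^2 <= 6*w e" using japanese_pos[of "norm d"] by (simp add: pos_divide_le_eq)
     hence "sqrt (1/(japanese (norm d))^2) <= sqrt (6*w e)" by (rule real_sqrt_le_mono)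
     hence "1/japanese (norm d) <= sqrt (6*w e)" using japanese_pos[of "norm d"] by (simp add: real_sqrt_divide)
     hence "norm (x-d)*(1/japanese (norm d)) <= 2 ^ (i+1) * sqrt (6*w e)"
      using i japanese_pos[of "norm d"] by (intro mult_mono) (auto intro: less_imp_le)
     thus ?thesis by (simp add: c_def)
    qed
    hence "ind R (y, x, d)*ennreal (norm (x-d)/japanese (norm d))*G y x d <=
     ennreal (c (i, e))*(ind (R1 (i, e)) (y, x, d)*G y x d)"
     using mem by (auto simp: indicator_def intro!: mult_right_mono ennreal_leI)
    also have "... <= (NN ie|count_space UNIV. ennreal (c ie)*(ind (R1 ie) (y, x, d)*G y x d))"
     by (rule nn_integral_ge_point) simp
    finally show ?thesis by (simp add: add_increasing)
   qed simp
  qed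
  also have "... = tri L (%y x d. ennreal 100000*(ind R0 (y, x, d)*G y x d)) +
    tri L (%y x d. (NN ie|count_space UNIV. ennreal (c ie)*(ind (R1 ie) (y, x, d)*G y x d)))"
   by (rule tri_add[OF m0c m1s])
  also have "... = ennreal 100000*T0+(NN ie|count_space UNIV. ennreal (c ie)*T ie)"
   unfolding T0_def T_def by (simp add: tri_cmult[OF m0] tri_cmult[OF m1] tri_count_space[OF m1c])
  finally show ?thesis .
 qed
 have "(ennreal 100000*T0)^2 <= ennreal (10 ^ 10*1024)*?Pr"
 proof -
  have "T0^2 <= 1024*?Pr" unfolding T0_def G_def
   by (rule quadrilinear_L4[OF L, where al = al]) (use win in \<open>auto simp: R0_def\<close>)
  hence "(ennreal 100000)^2*T0^2 <= (ennreal 100000)^2*(1024*?Pr)" by (rule mult_left_mono) simp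
  moreover have "(ennreal 100000)^2*1024 = ennreal (10 ^ 10*1024)"
  proof -
   have "(ennreal 100000)^2*1024 = ennreal (100000^2)*ennreal 1024" by (simp add: ennreal_power)
   also have "... = ennreal (100000^2*1024)" by (rule ennreal_mult[symmetric]) auto
   finally show ?thesis by simp
  qed
  ultimately show ?thesis by (simp add: power_mult_distrib mult.assoc[symmetric])
 qed
 also have "... <= ennreal (core_const/4*(real k+3) ^ 4)*?Pr"
 proof (intro mult_right_mono ennreal_leI)
  have "1 <= (real k+3) ^ 4" by (rule one_le_power) simp
  moreover have "10 ^ 10*1024 <= core_const/4*z" if "1 <= z" for z using that by (simp add: core_const_def)
  ultimately show "10 ^ 10*1024 <= core_const/4*(real k+3) ^ 4" by blast
 qed simp
 finally have b0: "(ennreal 100000*T0)^2 <= ennreal (core_const/4*(real k+3) ^ 4)*?Pr" .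
 define dl where "dl e = (NN d|?F. (ind (Q e) d*gd d)^2)" for e
 define Pr3 where "Pr3 = mass L gy*mass L gb*mass L gx"
 have piece: "(ennreal (c ie)*T ie)^2 <=
   (ind I ie*ennreal (w (snd ie)))*(ind I ie*(ennreal (96*box_const)*(Pr3*dl (snd ie))))" for ie
 proof (cases "ie \<in> I")
  case False
  hence "T ie = 0" using R1_I by (simp add: T_def tri_def)
  thus ?thesis by simp
 next
  case True
  have "T ie = tri L (%y x d. ind (R1 ie) (y, x, d)*(gy y*gb (x+y-d)*gx x*(ind (Q (snd ie)) d*gd d)))"
   unfolding T_def G_def by (rule arg_cong[where f = "tri L"]) (auto simp: fun_eq_iff indicator_def R1_def)
  also have "...^2 <= 4*(ennreal (box_const/(2 ^ fst ie)^2)*(Pr3*dl (snd ie)))" unfolding Pr3_def dl_def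
  proof (rule core_large_piece[OF L, where al = al and k = k and ?e1.0 = "fs ie" and ?e2.0 = "ss ie"])
   fix y x d assume "(y, x, d) \<in> R1 ie"
   hence r: "(y, x, d) \<in> R" and z: "(y, x, d) \<in> R1 ie" by (auto simp: R1_def)
   show "norm x <= norm y \<and> norm d <= norm x" "2 ^ k <= 1+norm y \<and> 1+norm y < 2 ^ (k+1)"
    "\<bar>(x-d) \<bullet> (y-d)\<bar> <= 2*norm (x-d)" using sorted[OF r] shell[OF r] orth[OF r] by auto
   show "100000*japanese (norm d) < norm (x-d)" "2 ^ fst ie <= norm (x-d) \<and> norm (x-d) < 2 ^ (fst ie+1)"
    "\<lfloor>fst d\<rfloor> = fs ie \<and> \<lfloor>snd d\<rfloor> = ss ie" using z by (auto simp: R1_def Q_def)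
  qed (use win in \<open>auto simp: R1_def\<close>)
  finally have "(ennreal (c ie)*T ie)^2 <= (ennreal (c ie))^2*(4*(ennreal (box_const/(2 ^ fst ie)^2)*(Pr3*dl (snd ie))))"
   unfolding power_mult_distrib by (rule mult_left_mono) simp
  also have "... = ((ennreal (c ie))^2*(4*ennreal (box_const/(2 ^ fst ie)^2)))*(Pr3*dl (snd ie))" by (simp add: mult.assoc)
  \<comment> \<open>The balance on which everything rests: the squared weight is 24*4^i times
    \<open>w\<close>, the box estimate contributes 4/4^i, and the scale \<open>i\<close> drops
    out.\<close>
  also have "(ennreal (c ie))^2*(4*ennreal (box_const/(2 ^ fst ie)^2)) = ennreal (w (snd ie))*ennreal (96*box_const)"
  proof -
   have "0 <= c ie" by (simp add: c_def wpos)
   hence "(ennreal (c ie))^2*(4*ennreal (box_const/(2 ^ fst ie)^2)) =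
     ennreal ((c ie)^2)*(ennreal 4*ennreal (box_const/(2 ^ fst ie)^2))" by (simp add: ennreal_power)
   also have "... = ennreal ((c ie)^2)*ennreal (4*(box_const/(2 ^ fst ie)^2))"
    by (subst ennreal_mult) (auto simp: box_const_def)
   also have "... = ennreal ((c ie)^2*(4*(box_const/(2 ^ fst ie)^2)))"
    by (rule ennreal_mult[symmetric]) (auto simp: box_const_def)
   also have "(c ie)^2*(4*(box_const/(2 ^ fst ie)^2)) = w (snd ie)*(96*box_const)"
    by (simp add: c_def power_mult_distrib wpos field_simps)
   finally show ?thesis by (simp add: ennreal_mult' wpos)
  qed
  finally show ?thesis using True by (simp add: mult.assoc)
 qed
 have cs: "(NN ie|count_space UNIV. ennreal (c ie)*T ie)^2 <=
   (NN ie|count_space UNIV. ind I ie*ennreal (w (snd ie))) *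
   (NN ie|count_space UNIV. ind I ie*(ennreal (96*box_const)*(Pr3*dl (snd ie))))"
  by (rule nn_integral_CS) (use piece in auto)
 have wa: "(NN ie|count_space UNIV. ind I ie*ennreal (w (snd ie))) <= ennreal (4*(real k+3) ^ 3)"
 proof -
  have "(NN ie|count_space UNIV. ind I ie*ennreal (w (snd ie))) = (\<Sum>ie\<in>I. ennreal (w (snd ie)))"
   using finI by (subst nn_integral_count_space'[of I]) (auto simp: indicator_def)
  also have "... = ennreal (\<Sum>ie\<in>I. w (snd ie))" by (rule sum_ennreal) (rule wpos)
  also have "(\<Sum>ie\<in>I. w (snd ie)) = (real k+2)*(\<Sum>n\<in>{- (2 ^ (k+2))<..<2 ^ (k+2) :: int}. 1/(1+\<bar>real_of_int n\<bar>))^2"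
   unfolding I_def sum.cartesian_product' w_def power2_eq_square sum_product by simp
  also have "... <= (real k+3)*(2*(real k+3))^2"
   using sum_inverse_int_le[of "k+2"] by (intro mult_mono power_mono sum_nonneg) auto
  also have "... = 4*(real k+3) ^ 3" by (simp add: power2_eq_square power3_eq_cube algebra_simps)
  finally show ?thesis by (simp add: ennreal_leI)
 qed
 have wb: "(NN ie|count_space UNIV. ind I ie*(ennreal (96*box_const)*(Pr3*dl (snd ie)))) <=
   ennreal (96*box_const*(real k+3))*?Pr"
 proof -
  have "(NN ie|count_space UNIV. ind I ie*(ennreal (96*box_const)*(Pr3*dl (snd ie)))) <=
   (NN ie|count_space UNIV. (ennreal (96*box_const)*Pr3)*(ind {..k+1} (fst ie)*dl (snd ie)))"
   by (rule nn_integral_mono) (auto simp: indicator_def I_def mult.assoc)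
  also have "... = (ennreal (96*box_const)*Pr3)*(NN i|count_space UNIV. (NN e|count_space UNIV. ind {..k+1} i*dl e))"
   by (simp add: nn_integral_cmult nn_integral_fst_count_space[symmetric])
  also have "(NN i|count_space UNIV. (NN e|count_space UNIV. ind {..k+1} i*dl e)) =
    (NN i|count_space UNIV. ind {..k+1} i)*(NN e|count_space UNIV. dl e)"
   by (simp add: nn_integral_cmult nn_integral_multc)
  also have "(NN i|count_space (UNIV::nat set). ind {..k+1} i) = ennreal (real k+2)"
   by (simp add: ennreal_of_nat_eq_real_of_nat add.commute)
  also have "(NN e|count_space UNIV. dl e) = mass L gd"
  proof -
   have "(NN e|count_space UNIV. dl e) = (NN d|?F. (NN e|count_space UNIV. (ind (Q e) d*gd d)^2))"
    unfolding dl_def by (rule nn_integral_freq_count_space) measurable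
   also have "... = mass L gd"
   proof (rule nn_integral_cong)
    fix d assume d: "d \<in> space ?F"
    have "(NN e|count_space UNIV. (ind (Q e) d*gd d)^2) =
     (NN e|count_space UNIV. (gd d)^2*ind {(\<lfloor>fst d\<rfloor>, \<lfloor>snd d\<rfloor>)} e)"
     by (rule nn_integral_cong) (use d in \<open>auto simp: Q_def indicator_def\<close>)
    thus "(NN e|count_space UNIV. (ind (Q e) d*gd d)^2) = (gd d)^2" by (simp add: nn_integral_cmult_indicator)
   qed
   finally show ?thesis .
  qed
  also have "(ennreal (96*box_const)*Pr3)*(ennreal (real k+2)*mass L gd) =
    (ennreal (96*box_const)*ennreal (real k+2))*?Pr" by (simp add: Pr3_def mult_ac)
  also have "... <= ennreal (96*box_const*(real k+3))*?Pr"
   by (subst ennreal_mult[symmetric]) (auto simp: box_const_def intro!: mult_right_mono ennreal_leI)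
  finally show ?thesis .
 qed
 note order_trans[OF cs mult_mono[OF wa wb]]
 also have "ennreal (4*(real k+3) ^ 3)*(ennreal (96*box_const*(real k+3))*?Pr) <=
   ennreal (core_const/4*(real k+3) ^ 4)*?Pr"
 proof -
  have "ennreal (4*(real k+3) ^ 3)*ennreal (96*box_const*(real k+3)) = ennreal (384*box_const*(real k+3) ^ 4)"
   by (subst ennreal_mult[symmetric]) (auto simp: box_const_def power3_eq_cube power4_eq_xxxx mult_ac)
  also have "... <= ennreal (core_const/4*(real k+3) ^ 4)"
   by (intro ennreal_leI mult_right_mono) (auto simp: box_const_def core_const_def)
  finally have "(ennreal (4*(real k+3) ^ 3)*ennreal (96*box_const*(real k+3)))*?Pr <=
    ennreal (core_const/4*(real k+3) ^ 4)*?Pr" by (rule mult_right_mono) simp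
  thus ?thesis by (simp only: mult.assoc)
 qed
 finally have b1: "(NN ie|count_space UNIV. ennreal (c ie)*T ie)^2 <= ennreal (core_const/4*(real k+3) ^ 4)*?Pr"
  by simp
 have "(tri L (%y x d. ind R (y, x, d)*ennreal (norm (x-d)/japanese (norm d))*G y x d))^2 <=
  (ennreal 100000*T0+(NN ie|count_space UNIV. ennreal (c ie)*T ie))^2" using split by (rule power_mono) simp
 also have "... <= 4*(ennreal (core_const/4*(real k+3) ^ 4)*?Pr)" by (rule ennreal_sum_power2_le[OF b0 b1])
 also have "... = (4*ennreal (core_const/4*(real k+3) ^ 4))*?Pr" by (simp only: mult.assoc)
 also have "4*ennreal (core_const/4*(real k+3) ^ 4) = ennreal (core_const*(real k+3) ^ 4)"
  by (simp add: core_const_def flip: ennreal_numeral ennreal_mult')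
 finally show ?thesis unfolding G_def .
qed

section \<open>Pointwise bounds for the profile of the I-operator\<close>

lemma I_profile_bounds:
 assumes p: "I_profile s p" and s: "s < 1"
 shows "\<And>r. 0 <= r ==> 0 < p r" and "\<And>r. 0 <= r ==> p r <= 1"
  and "\<And>r t. 0 <= t ==> t <= r ==> p r <= p t"
  and "\<And>r. 0 <= r ==> r <= 1 ==> p r = 1"
  and "\<And>r. 2 <= r ==> p r = (1/r) powr (1-s)"
proof -
 show anti: "p r <= p t" if "0 <= t" "t <= r" for r t using p that by (auto simp: I_profile_def monotone_on_def)
 show one: "p r = 1" if "0 <= r" "r <= 1" for r using p that by (auto simp: I_profile_def)
 show tail: "p r = (1/r) powr (1-s)" if "2 <= r" for r using p that by (auto simp: I_profile_def)
 show "0 < p r" if "0 <= r" for r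
 proof -
  have "0 < p (max r 2)" using tail[of "max r 2"] by simp
  also have "... <= p r" using that by (intro anti) auto
  finally show ?thesis .
 qed
 show "p r <= 1" if "0 <= r" for r using anti[of 0 r] one[of 0] that by simp
qed

text \<open>The mean value theorem on a compact interval, which reaches into both regions where the
  profile is explicit and so bridges the transition between them.\<close>

lemma I_profile_Lipschitz:
 assumes p: "I_profile s p" and s: "s < 1"
 shows "\<exists>C>0. \<forall>x y. 1/2 <= y --> y <= x --> x <= 3 -->
  \<bar>(p x)\<^sup>2*x^2-(p y)^2*y^2\<bar> <= C*(x-y)"
proof -
 have d0: "p differentiable (at r)" if "0 < r" for r using p that unfolding I_profile_def by (metis funpow_0)
 have d1: "deriv p differentiable (at r)" if "0 < r" for r
 proof -
  have "(deriv ^^ 1) p differentiable (at r)" using p that unfolding I_profile_def by blast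
  thus ?thesis by simp
 qed
 define D where "D r = 2*p r*deriv p r*r^2+(p r)^2*(2*r)" for r
 have cp: "continuous_on {1/2..3} p" "continuous_on {1/2..3} (deriv p)"
  using d0 d1 by (auto intro!: continuous_at_imp_continuous_on differentiable_imp_continuous_within)
 have "continuous_on {1/2..3} D" unfolding D_def by (intro continuous_intros cp)
 hence "bounded (D ` {1/2..3})" by (intro compact_imp_bounded compact_continuous_image) auto
 then obtain C where C: "0 < C" "\<And>r. r \<in> {1/2..3} ==> \<bar>D r\<bar> <= C" unfolding bounded_pos by auto
 have der: "((%r. (p r)^2*r^2) has_real_derivative D r) (at r)" if "0 < r" for r unfolding D_def
  by (rule derivative_eq_intros DERIV_deriv_iff_real_differentiable[THEN iffD2] d0 that refl)+ simp
 have "\<bar>(p x)\<^sup>2*x^2-(p y)^2*y^2\<bar> <= C*(x-y)" if "1/2 <= y" "y <= x" "x <= 3" for x y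
 proof (cases "y = x")
  case False
  hence "y < x" using that by simp
  hence "\<exists>z>y. z < x \<and> (p x)^2*x^2-(p y)^2*y^2 = (x-y)*D z"
   by (rule MVT2) (use that in \<open>auto intro: der\<close>)
  then obtain z where z: "y < z" "z < x" "(p x)^2*x^2-(p y)^2*y^2 = (x-y)*D z" by blast
  thus ?thesis using C(2)[of z] that by (auto simp: abs_mult mult.commute intro!: mult_right_mono)
 qed simp
 thus ?thesis using C(1) by blast
qed

text \<open>As 2*s - 2 is negative, x^(2s-2) * y^2 \<le> y^(2s).\<close>

lemma powr_diff_le:
 fixes x y s :: real
 assumes "0 < y" "y <= x" "0 < s" "s < 1"
 shows "x powr (2 * s)-y powr (2 * s) <= x powr (2 * s-2)*(x^2-y^2)" "y powr (2 * s) <= x powr (2 * s)"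
proof -
 have x: "0 < x" using assms by simp
 show "y powr (2 * s) <= x powr (2 * s)" using assms by (intro powr_mono2) auto
 have "x powr (2 * s-2)*y^2 <= y powr (2 * s-2)*y^2" using assms by (intro mult_right_mono powr_mono2') auto
 also have "... = y powr (2 * s)" using assms by (simp add: powr_diff powr_numeral field_simps)
 finally have "x powr (2 * s-2)*y^2 <= y powr (2 * s)" .
 moreover have "x powr (2 * s-2)*x^2 = x powr (2 * s)" using x by (simp add: powr_diff powr_numeral field_simps)
 ultimately show "x powr (2 * s)-y powr (2 * s) <= x powr (2 * s-2)*(x^2-y^2)" by (simp add: algebra_simps)
qed

lemma I_profile_tail:
 assumes p: "I_profile s p" and s: "s < 1" and r: "2 <= r"
 shows "(p r)^2 = r powr (2 * s-2)" "(p r)^2*r^2 = r powr (2 * s)"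
proof -
 have "p r = r powr (s-1)"
  using I_profile_bounds(5)[OF p s r] r by (simp add: powr_divide powr_minus_divide[symmetric])
 thus 1: "(p r)^2 = r powr (2 * s-2)" by (simp add: power2_eq_square powr_add[symmetric])
 show "(p r)^2*r^2 = r powr (2 * s)" unfolding 1 using r by (simp add: powr_diff powr_numeral field_simps)
qed

text \<open>The increment of p(r)^2 * r^2 is charged to p at the larger argument, where p is
  smallest. This is what lets the multiplier be divided by the symbols. The explicit formulas serve
  at both ends, and the Lipschitz bound serves in between.\<close>

lemma I_profile_increment:
 assumes p: "I_profile s p" and s: "0 < s" "s < 1"
 shows "\<exists>C>0. \<forall>x y. 0 <= y --> y <= x -->
  \<bar>(p x)\<^sup>2*x^2-(p y)^2*y^2\<bar> <= C*(p x)^2*(x^2-y^2)"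
proof -
 note b = I_profile_bounds[OF p s(2)]
 obtain C1 where C1: "0 < C1" "\<And>x y. 1/2 <= y ==> y <= x ==> x <= 3 ==>
  \<bar>(p x)\<^sup>2*x^2-(p y)^2*y^2\<bar> <= C1*(x-y)" using I_profile_Lipschitz[OF p s(2)] by blast
 define m where "m = (p 3)^2"
 have m: "0 < m" "m <= 1" using b(1)[of 3] b(2)[of 3] by (auto simp: m_def power_le_one)
 \<comment> \<open>For x \<le> 3 the factor p(x)^2 is at least \<open>m\<close>, which costs 1/m.
   The remaining 36 = 4*9 belongs to the case y < 2, x > 3, where both terms are at most 4 * p(x)^2
   * x^2 and x^2 \<le> 9 * (x^2 - y^2).\<close>
 define C where "C = 36+(C1+36)/m"
 have "0 < C1/m" "0 < 36/m" "C = 36+(C1/m+36/m)" using m C1(1) by (auto simp: C_def add_divide_distrib)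
 hence C: "0 < C" "36 <= C" "C1/m <= C" "36/m <= C" by linarith+
 have q0: "0 <= (p y)^2*y^2" for y by simp
 have main: "\<bar>(p x)\<^sup>2*x^2-(p y)^2*y^2\<bar> <= C*(p x)^2*(x^2-y^2)" if y: "0 <= y" and yx: "y <= x" for x y
 proof -
  have x: "0 <= x" using y yx by simp
  have sq: "0 <= x^2-y^2" using y yx by (simp add: power_mono)
  have py: "0 <= p y" "p y <= 1" using b(1,2)[of y] y by auto
  have qy: "(p y)^2*y^2 <= y^2" using py by (simp add: mult_left_le_one_le power_le_one)
  have px: "m <= (p x)^2" if "x <= 3" unfolding m_def using b(3)[of x 3] b(1)[of 3] x that by (intro power_mono) auto
  consider "x <= 1" | "1 < x" "x <= 3" "1/2 <= y" | "1 < x" "x <= 3" "y < 1/2" | "3 < x" "2 <= y" | "3 < x" "y < 2" by linarith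
  thus ?thesis
  proof cases
   case 1
   hence "p x = 1" "p y = 1" using b(4) x y yx by auto
   thus ?thesis using sq C(2) by (simp add: mult_le_cancel_right1)
  next
   case 2
   have "\<bar>(p x)\<^sup>2*x^2-(p y)^2*y^2\<bar> <= C1*(x-y)" using C1(2) 2 yx by simp
   also have "... <= C1*(x^2-y^2)"
   proof -
    have "(x-y)*1 <= (x-y)*(x+y)" using 2 yx by (intro mult_left_mono) auto
    hence "x-y <= x^2-y^2" by (simp add: power2_eq_square algebra_simps)
    thus ?thesis using C1(1) by (intro mult_left_mono) auto
   qed
   also have "... = (C1/m)*m*(x^2-y^2)" using m by simp
   also have "... <= C*(p x)^2*(x^2-y^2)" using C m px 2 C1(1) sq by (intro mult_right_mono mult_mono) auto
   finally show ?thesis .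
  next
   case 3
   have "y^2 <= (1/2)^2" using 3 y by (intro power_mono) auto
   moreover have "1^2 <= x^2" using 3 by (intro power_mono) auto
   moreover have "x^2 <= 3^2" using 3 by (intro power_mono) auto
   moreover have "(1/2)^2 = (1/4::real)" "1^2 = (1::real)" "3^2 = (9::real)" by (auto simp: power2_eq_square)
   ultimately have sq4: "3/4 <= x^2-y^2" "x^2 <= 9" "y^2 <= 9" by linarith+
   have "(p x)^2*x^2 <= x^2" using b(1,2)[of x] x by (simp add: mult_left_le_one_le power_le_one)
   hence "\<bar>(p x)\<^sup>2*x^2-(p y)^2*y^2\<bar> <= 9" using qy q0[of x] q0[of y] sq4 by linarith
   also have "... <= 36*(x^2-y^2)" using sq4 by simp
   also have "... = (36/m)*m*(x^2-y^2)" using m by simp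
   also have "... <= C*(p x)^2*(x^2-y^2)" using C m px 3 sq by (intro mult_right_mono mult_mono) auto
   finally show ?thesis .
  next
   case 4
   have e: "(p x)^2*x^2 = x powr (2 * s)" "(p y)^2*y^2 = y powr (2 * s)" "(p x)^2 = x powr (2 * s-2)"
    using I_profile_tail[OF p s(2)] 4 by auto
   have "\<bar>x powr (2 * s)-y powr (2 * s)\<bar> <= x powr (2 * s-2)*(x^2-y^2)"
    using powr_diff_le[of y x s] 4 yx s by auto
   hence "\<bar>(p x)\<^sup>2*x^2-(p y)^2*y^2\<bar> <= 1*(p x)^2*(x^2-y^2)" unfolding e(1,2) unfolding e(3) by simp
   also have "... <= C*(p x)^2*(x^2-y^2)" using C sq by (intro mult_right_mono) auto
   finally show ?thesis .
  next
   case 5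
   have e: "(p x)^2*x^2 = x powr (2 * s)" using I_profile_tail[OF p s(2)] 5 by auto
   have y4: "y^2 <= 4" using 5 y power_mono[of y 2 2] by simp
   have x9: "9 <= x^2" using 5 power_mono[of 3 x 2] by simp
   have "1 <= x powr (2 * s)" using 5 s by (intro ge_one_powr_ge_zero) auto
   hence q4: "(p y)^2*y^2 <= 4*((p x)^2*x^2)" using qy y4 unfolding e by simp
   hence "\<bar>(p x)\<^sup>2*x^2-(p y)^2*y^2\<bar> <= 4*((p x)^2*x^2)" using q0[of x] q0[of y] by linarith
   also have "... <= 4*((p x)^2*(9*(x^2-y^2)))" using x9 y4 by (intro mult_left_mono) auto
   also have "... = 36*(p x)^2*(x^2-y^2)" by simp
   also have "... <= C*(p x)^2*(x^2-y^2)" using C sq by (intro mult_right_mono) auto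
   finally show ?thesis .
  qed
 qed
 thus ?thesis using C(1) by blast
qed

text \<open>Serves for the vertex opposite to \<open>d\<close>, whose norm may exceed the norm of
  \<open>a\<close>, but only up to the factor 3. For r \<le> 2 monotonicity is enough, for larger r
  the power law.\<close>

lemma I_profile_doubling:
 assumes p: "I_profile s p" and s: "s < 1" and r: "0 <= r"
 shows "p 6*p r <= p (3*r)"
proof (cases "r <= 2")
 case True
 hence "p 6*p r <= p 6*1" using I_profile_bounds(1,2)[OF p s] r by (intro mult_left_mono) (auto intro: less_imp_le)
 also have "... <= p (3*r)" using I_profile_bounds(3)[OF p s, of "3*r" 6] True r by simp
 finally show ?thesis .
next
 case False
 have "p 6*p r = (1/6) powr (1-s)*(1/r) powr (1-s)" using I_profile_bounds(5)[OF p s] False by simp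
 also have "... <= (1/3) powr (1-s)*(1/r) powr (1-s)" using s by (intro mult_right_mono powr_mono2) auto
 also have "... = p (3*r)" using I_profile_bounds(5)[OF p s, of "3*r"] False by (simp add: powr_mult[symmetric])
 finally show ?thesis .
qed

text \<open>The constant must depend on \<open>q\<close>, since r^2 is smaller than any multiple of
  r^(2s) near 0. It is applied to the frequency \<open>a\<close>, which is at least ga*N/3.\<close>

lemma I_profile_lower:
 assumes p: "I_profile s p" and s: "s < 1" and q: "0 < q"
 shows "\<exists>c>0. \<forall>r\<ge>q. c*r powr (2 * s) <= (p r)^2*r^2"
proof -
 define c where "c = min 1 ((p 2)^2*q powr (2-2 * s))"
 have c: "0 < c" "c <= 1" "c <= (p 2)^2*q powr (2-2 * s)"
  using I_profile_bounds(1)[OF p s, of 2] q by (auto simp: c_def)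
 have "c*r powr (2 * s) <= (p r)^2*r^2" if r: "q <= r" for r
 proof (cases "2 <= r")
  case True
  thus ?thesis using I_profile_tail(2)[OF p s True] c by (simp add: mult_left_le_one_le)
 next
  case False
  have "c*r powr (2 * s) <= ((p 2)^2*q powr (2-2 * s))*r powr (2 * s)" using c by (intro mult_right_mono) auto
  also have "... <= ((p r)^2*r powr (2-2 * s))*r powr (2 * s)"
   using False r q s I_profile_bounds(1)[OF p s, of 2] I_profile_bounds(3)[OF p s, of r 2]
   by (intro mult_right_mono mult_mono power_mono powr_mono2) auto
  also have "... = (p r)^2*r^2" using r q by (simp add: powr_add[symmetric] powr_numeral)
  finally show ?thesis .
 qed
 thus ?thesis using c by blast
qed

section \<open>The multiplier near a rectangle\<close>

definition theta :: "(real => real) => real => real \<times> real => real" where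
 "theta p N xi = (I_symbol p N xi)^2*(norm xi)^2"

abbreviation bracket :: "real \<times> real => real" where
 "bracket xi \<equiv> japanese (norm xi)"

definition sizemax :: "real \<times> real => real \<times> real => real \<times> real => real \<times> real => real" where
 "sizemax a b c d = max (max (norm a) (norm b)) (max (norm c) (norm d))"

text \<open>The conditions on \<open>S\<^sup>c\<close>, in the variables \<open>a = \<xi>\<^sub>1\<close>, \<open>b = -\<xi>\<^sub>2\<close>, \<open>c = \<xi>\<^sub>3\<close>, \<open>d = -\<xi>\<^sub>4\<close>.\<close>

definition rect :: "real => real => real \<times> real => real \<times> real => real \<times> real => real \<times> real => bool" where
 "rect ga N a b c d \<longleftrightarrow> a + c = b+d \<and> ga*N < sizemax a b c d \<and>
   \<bar>(a-b) \<bullet> (a-d)\<bar>*max 1 (sizemax a b c d) <= norm (a-b)*norm (a-d)"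

text \<open>The multiplier relative to the H1 weights of the four factors after the I-operator has
  been applied to each of them.\<close>

definition quotient_mult ::
  "(real => real) => real => real \<times> real => real \<times> real => real \<times> real => real \<times> real => real" where
 "quotient_mult p N a b c d = \<bar>theta p N a-theta p N b+theta p N c-theta p N d\<bar> /
   ((I_symbol p N a*bracket a)*(I_symbol p N b*bracket b)*(I_symbol p N c*bracket c)*(I_symbol p N d*bracket d))"

text \<open>The smallest vertex is \<open>d\<close>, and \<open>a\<close> is the larger of its two
  neighbours. The vertex \<open>b\<close> opposite to \<open>d\<close> is compared with
  \<open>d\<close> only, so it may be the largest of all; up to the symmetries of the rectangle this
  can always be arranged.\<close>

definition sorted4 :: "real \<times> real => real \<times> real => real \<times> real => real \<times> real => bool" where
 "sorted4 a b c d \<longleftrightarrow> norm c <= norm a \<and> norm d <= norm c \<and> norm d <= norm b"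

text \<open>The sides at \<open>d\<close> are c-d, parallel to a-b, and a-d. The angle condition is
  multiplied out with a bound for the sizes that also controls |a-d|, which leaves 2*|c-d|. In
  particular the resonance function is linear, not quadratic, in the frequencies, and this forces
  <a> and <b> to be comparable.\<close>

lemma rect_geometry:
 assumes r: "rect ga N a b c d" and s: "sorted4 a b c d"
 shows "norm b <= 3*norm a" "sizemax a b c d <= 3*norm a"
  "(norm a)^2-(norm b)^2+(norm c)^2-(norm d)^2 = - 2*((c-d) \<bullet> (a-d))"
  "\<bar>(c-d) \<bullet> (a-d)\<bar> <= 2*norm (c-d)"
  "norm (c-d) <= 2*norm c"
  "bracket a <= 16*bracket b"
proof -
 have b: "b = a + c-d" using r by (auto simp: rect_def algebra_simps)
 have nb: "norm b <= norm a+norm c+norm d" unfolding b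
  using norm_triangle_ineq4[of "a + c" d] norm_triangle_ineq[of a c] by linarith
 thus b3: "norm b <= 3*norm a" using s by (simp add: sorted4_def)
 have "norm a <= 3*norm a" "norm c <= 3*norm a" "norm d <= 3*norm a"
  using s norm_ge_zero[of a] unfolding sorted4_def by linarith+
 with b3 show "sizemax a b c d <= 3*norm a" by (simp add: sizemax_def)
 show h: "(norm a)^2-(norm b)^2+(norm c)^2-(norm d)^2 = - 2*((c-d) \<bullet> (a-d))"
  unfolding b power2_norm_eq_inner by (simp add: inner_simps inner_commute algebra_simps)
 define M where "M = max 1 (sizemax a b c d)"
 have M: "1 <= M" "norm a <= M" "norm d <= M" by (auto simp: M_def sizemax_def)
 have "\<bar>(c-d) \<bullet> (a-d)\<bar> * M <= norm (c-d)*norm (a-d)"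
 proof -
  have "a-b = - (c-d)" by (simp add: b)
  hence "\<bar>(c-d) \<bullet> (a-d)\<bar> = \<bar>(a-b) \<bullet> (a-d)\<bar>" "norm (c-d) = norm (a-b)" by (metis abs_minus_cancel inner_minus_left, metis norm_minus_cancel)
  thus ?thesis using r by (simp add: rect_def M_def)
 qed
 also have "... <= norm (c-d)*(2 * M)" using norm_triangle_ineq4[of a d] M by (intro mult_left_mono) auto
 finally have "\<bar>(c-d) \<bullet> (a-d)\<bar> * M <= (2*norm (c-d)) * M" by simp
 thus o: "\<bar>(c-d) \<bullet> (a-d)\<bar> <= 2*norm (c-d)" using M by simp
 show cd: "norm (c-d) <= 2*norm c" using norm_triangle_ineq4[of c d] s by (simp add: sorted4_def)
 show "bracket a <= 16*bracket b"
 proof (cases "norm c <= norm b")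
  case True
  have "norm a <= norm b+norm c+norm d"
  proof -
   have "a = b-c+d" by (simp add: b)
   thus ?thesis using norm_triangle_ineq[of "b-c" d] norm_triangle_ineq4[of b c] by simp
  qed
  hence "norm a <= 3*norm b" using True s by (simp add: sorted4_def)
  hence "(norm a)^2 <= (3*norm b)^2" by (intro power_mono) auto
  hence "(norm a)^2 <= 9*(norm b)^2" by (simp add: power_mult_distrib)
  moreover have "0 <= (norm b)^2" by simp
  ultimately have "1+(norm a)^2 <= 256+256*(norm b)^2" by linarith
  hence "(bracket a)^2 <= (16*bracket b)^2" unfolding japanese_power2 power_mult_distrib by simp
  thus ?thesis by (rule power2_le_imp_le) (simp add: japanese_pos less_imp_le)
 next
  case False
  \<comment> \<open>If \<open>b\<close> is shorter than \<open>c\<close>, the triangle inequality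
    says nothing about \<open>b\<close>; instead |a|^2 exceeds |b|^2 by at most the resonance
    function, which is at most 8*|a|.\<close>
  have "(norm d)^2 <= (norm c)^2" using s by (auto simp: sorted4_def intro: power_mono)
  moreover have "- 2*((c-d) \<bullet> (a-d)) <= 8*norm a" using o cd s unfolding sorted4_def by linarith
  ultimately have "(norm a)^2 <= (norm b)^2+8*norm a" using h by linarith
  hence *: "(bracket a)^2 <= (bracket b)^2+8*bracket a"
   using abs_le_japanese[of "norm a"] by (simp add: japanese_power2)
  show ?thesis
  proof (cases "bracket a <= 16")
   case True
   thus ?thesis using japanese_ge1[of "norm b"] by simp
  next
   case False
   hence "16*bracket a <= bracket a*bracket a" by (intro mult_right_mono) (auto simp: japanese_pos less_imp_le)
   hence "(bracket a)^2 <= 2*(bracket b)^2" using*by (simp add: power2_eq_square)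
   also have "... <= (16*bracket b)^2" by (simp add: power_mult_distrib)
   finally show ?thesis by (rule power2_le_imp_le) (simp add: japanese_pos less_imp_le)
  qed
 qed
qed

text \<open>Along the parallel sides \<open>a\<close>, \<open>b\<close> and \<open>c\<close>,
  \<open>d\<close> the increments of |.|^2 cancel up to the resonance function, which is O(|c-d|).
  Both increments of \<open>theta\<close> are charged to m(c)^2, because \<open>c\<close> does not
  exceed the larger of \<open>a\<close> and \<open>b\<close>. Then m(c) <c> cancels against the
  weight of \<open>c\<close>, the quotient m(c)/m(d) is at most 1, and the weights of
  \<open>a\<close> and \<open>b\<close> leave (m(a) <a>)^2 in the denominator.\<close>

lemma multiplier_bound:
 assumes p: "I_profile s p" and s: "1/2 < s" "s < 1" and ga: "0 < ga"
 shows "\<exists>C>0. \<forall>N\<ge>1. \<forall>a b c d. rect ga N a b c d --> sorted4 a b c d -->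
  quotient_mult p N a b c d <= C*N powr (2 * s-2)*(1+norm a) powr (- (2 * s))*(norm (c-d)/bracket d)"
proof -
 have s0: "0 < s" using s by simp
 note pb = I_profile_bounds[OF p s(2)]
 obtain C1 where C1: "0 < C1" "\<And>x y. 0 <= y ==> y <= x ==>
  \<bar>(p x)\<^sup>2*x^2-(p y)^2*y^2\<bar> <= C1*(p x)^2*(x^2-y^2)" using I_profile_increment[OF p s0 s(2)] by blast
 obtain c2 where c2: "0 < c2" "\<And>r. ga/3 <= r ==> c2*r powr (2 * s) <= (p r)^2*r^2"
  using I_profile_lower[OF p s(2), of "ga/3"] ga by auto
 \<comment> \<open>The factor 1/16 is for |b| \<le> |a|, where <a> \<le> 16 <b>; the factor p(6) is
   for |b| > |a|, where m(b) may be smaller than m(a).\<close>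
 define c3 where "c3 = p 6/16"
 have c3: "0 < c3" "c3 <= p 6" "c3 <= 1/16" using pb(1,2)[of 6] by (auto simp: c3_def)
 define K where "K = (1+3/ga) powr (2 * s)"
 have "0 < 1+3/ga" using ga by (intro add_pos_pos) auto
 hence K: "0 < K" by (simp add: K_def)
 define C where "C = 12*C1/c3/c2*K"
 have C: "0 < C" using C1(1) c2(1) c3(1) K by (simp add: C_def)
 have main: "quotient_mult p N a b c d <= C*N powr (2 * s-2)*(1+norm a) powr (- (2 * s))*(norm (c-d)/bracket d)"
  if N: "1 <= N" and r: "rect ga N a b c d" and so: "sorted4 a b c d" for N a b c d
 proof -
  note g = rect_geometry[OF r so]
  have N0: "0 < N" using N by simp
  define m where "m xi = I_symbol p N xi" for xi
  have mpos: "0 < m xi" for xi unfolding m_def I_symbol_def using pb(1) N0 by simp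
  have mmono: "m xi <= m et" if "norm et <= norm xi" for xi et
   unfolding m_def I_symbol_def using pb(3) N0 that by (simp add: divide_right_mono)
  have br: "1 <= bracket xi" "0 < bracket xi" for xi by (rule japanese_ge1, rule japanese_pos)
  have inc: "\<bar>theta p N xi-theta p N et\<bar> <= C1*(m xi)^2*((norm xi)^2-(norm et)^2)" if "norm et <= norm xi" for xi et
  proof -
   define x y where "x = norm xi/N" and "y = norm et/N"
   have t: "theta p N xi = N^2*((p x)^2*x^2)" "theta p N et = N^2*((p y)^2*y^2)"
    using N0 by (auto simp: theta_def I_symbol_def x_def y_def power_divide)
   have "\<bar>theta p N xi-theta p N et\<bar> = N^2*\<bar>(p x)\<^sup>2*x^2-(p y)^2*y^2\<bar>"
    unfolding t right_diff_distrib[symmetric] abs_mult by simp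
   also have "... <= N^2*(C1*(p x)^2*(x^2-y^2))"
    using N0 that by (intro mult_left_mono C1(2)) (auto simp: x_def y_def divide_right_mono)
   also have "... = C1*(m xi)^2*((norm xi)^2-(norm et)^2)"
    using N0 by (simp add: m_def I_symbol_def x_def y_def power_divide field_simps)
   finally show ?thesis .
  qed
  define D h where "D = (norm c)^2-(norm d)^2" and "h = (norm a)^2-(norm b)^2+(norm c)^2-(norm d)^2"
  have D0: "0 <= D" using so by (auto simp: D_def sorted4_def power_mono)
  have D1: "D <= 2*norm c*norm (c-d)"
  proof -
   have "D = (norm c-norm d)*(norm c+norm d)" by (simp add: D_def power2_eq_square algebra_simps)
   also have "... <= norm (c-d)*(2*norm c)"
    using norm_triangle_ineq2[of c d] so by (intro mult_mono) (auto simp: sorted4_def)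
   finally show ?thesis by (simp add: mult_ac)
  qed
  have h: "\<bar>h\<bar> <= 4*norm (c-d)" using g(3,4) by (simp add: h_def abs_mult)
  have Dh: "D+\<bar>h\<bar> <= 6*bracket c*norm (c-d)"
  proof -
   have "norm c*norm (c-d) <= bracket c*norm (c-d)" using abs_le_japanese[of "norm c"] by (intro mult_right_mono) auto
   moreover have "1*norm (c-d) <= bracket c*norm (c-d)" using br by (intro mult_right_mono) auto
   ultimately show ?thesis using D1 h by linarith
  qed
  have cd: "\<bar>theta p N c-theta p N d\<bar> <= C1*(m c)^2*(D+\<bar>h\<bar>)"
  proof -
   have "\<bar>theta p N c-theta p N d\<bar> <= C1*(m c)^2*D" using inc[of d c] so by (simp add: sorted4_def D_def)
   also have "... <= C1*(m c)^2*(D+\<bar>h\<bar>)" using C1(1) by (intro mult_left_mono) auto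
   finally show ?thesis .
  qed
  \<comment> \<open>Here |a|^2 - |b|^2 = h - D, so the same majorant D + |h| serves for both sides
    of the rectangle.\<close>
  have ab: "\<bar>theta p N a-theta p N b\<bar> <= C1*(m c)^2*(D+\<bar>h\<bar>)"
  proof -
   have e: "\<bar>(norm a)\<^sup>2-(norm b)^2\<bar> <= D+\<bar>h\<bar>" using D0 unfolding D_def h_def by linarith
   show ?thesis
   proof (cases "norm b <= norm a")
    case True
    have "\<bar>theta p N a-theta p N b\<bar> <= C1*(m a)^2*((norm a)^2-(norm b)^2)" by (rule inc[OF True])
    also have "... <= C1*(m c)^2*(D+\<bar>h\<bar>)" using C1(1) e D0 mpos[of a] so True
     by (intro mult_mono mult_left_mono power_mono mmono) (auto simp: sorted4_def power_mono less_imp_le)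
    finally show ?thesis .
   next
    case False
    have "\<bar>theta p N a-theta p N b\<bar> <= C1*(m b)^2*((norm b)^2-(norm a)^2)"
     using inc[of a b] False by (simp add: abs_minus_commute)
    also have "... <= C1*(m c)^2*(D+\<bar>h\<bar>)" using C1(1) e D0 mpos[of b] so False
     by (intro mult_mono mult_left_mono power_mono mmono) (auto simp: sorted4_def power_mono less_imp_le)
    finally show ?thesis .
   qed
  qed
  have num: "\<bar>theta p N a-theta p N b+theta p N c-theta p N d\<bar> <= 12*C1*(m c)^2*bracket c*norm (c-d)"
  proof -
   have "\<bar>theta p N a-theta p N b+theta p N c-theta p N d\<bar> <= 2*(C1*(m c)^2*(D+\<bar>h\<bar>))"
    using ab cd by linarith
   also have "... <= 2*(C1*(m c)^2*(6*bracket c*norm (c-d)))" using C1(1) Dh by (intro mult_left_mono) auto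
   finally show ?thesis by (simp add: mult_ac)
  qed
  define ma mb mc md where "ma = m a*bracket a" and "mb = m b*bracket b" and "mc = m c*bracket c" and "md = m d*bracket d"
  have pos: "0 < ma" "0 < mb" "0 < mc" "0 < md" using mpos br by (auto simp: ma_def mb_def mc_def md_def)
  have "quotient_mult p N a b c d = \<bar>theta p N a-theta p N b+theta p N c-theta p N d\<bar> / (ma*mb*mc*md)"
   by (simp add: quotient_mult_def ma_def mb_def mc_def md_def m_def)
  also have "... <= (12*C1*(m c)^2*bracket c*norm (c-d))/(ma*mb*mc*md)"
   using num pos by (intro divide_right_mono) auto
  also have "... = (12*C1*norm (c-d))*(m c/(ma*mb*md))"
   using pos mpos[of c] br(2)[of c] by (simp add: mc_def power2_eq_square field_simps)
  also have "... <= (12*C1*norm (c-d))*(1/(ma*mb*bracket d))"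
  proof (rule mult_left_mono)
   have "m c/m d <= 1" using mmono[of d c] so mpos[of d] by (simp add: sorted4_def)
   hence "m c/m d*(1/(ma*mb*bracket d)) <= 1*(1/(ma*mb*bracket d))"
    using pos br(2)[of d] by (intro mult_right_mono) auto
   thus "m c/(ma*mb*md) <= 1/(ma*mb*bracket d)" by (simp add: md_def mult_ac)
  qed (use C1 in auto)
  also have "... <= (12*C1*norm (c-d))*(1/(ma*(c3*ma)*bracket d))"
  proof -
   have "c3*ma <= mb"
   proof (cases "norm b <= norm a")
    case True
    have "c3*ma <= (1/16)*(m b*(16*bracket b))"
     unfolding ma_def using c3 g(6) mmono[OF True] mpos[of a] mpos[of b] br(2)[of a] by (intro mult_mono) auto
    thus ?thesis by (simp add: mb_def)
   next
    case False
    have "p 6*m a <= p (3*(norm a/N))"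
     unfolding m_def I_symbol_def using I_profile_doubling[OF p s(2), of "norm a/N"] N0 by simp
    also have "... <= m b" unfolding m_def I_symbol_def
     using pb(3)[of "norm b/N" "3*(norm a/N)"] g(1) N0 by (simp add: divide_right_mono)
    finally have "p 6*m a <= m b" .
    moreover have "bracket a <= bracket b" unfolding japanese_def using False by (intro real_sqrt_le_mono add_left_mono power_mono) auto
    moreover have "c3*m a <= p 6*m a" using c3 mpos[of a] by (intro mult_right_mono) auto
    ultimately have "(c3*m a)*bracket a <= m b*bracket b" using mpos[of b] br(2)[of a] by (intro mult_mono) linarith+
    thus ?thesis by (simp add: ma_def mb_def mult.assoc)
   qed
   thus ?thesis using C1 pos c3 br(2)[of d] by (intro mult_left_mono divide_left_mono mult_right_mono) auto
  qed
  also have "... = (12*C1/c3)*(1/ma^2)*(norm (c-d)/bracket d)" by (simp add: power2_eq_square)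
  \<comment> \<open>The rectangle condition gives ga*N < 3*|a|, so the power law bounds (m(a) <a>)^2
    from below by a multiple of N^(2-2s) * |a|^(2s). The constant \<open>K\<close> only replaces |a|
    by 1 + |a|.\<close>
  also have "... <= (12*C1/c3)*(K/c2*N powr (2 * s-2)*(1+norm a) powr (- (2 * s)))*(norm (c-d)/bracket d)"
  proof (intro mult_right_mono mult_left_mono)
   define r where "r = norm a/N"
   have rl: "ga/3 <= r"
   proof -
    have "ga*N < 3*norm a" using r g(2) by (simp add: rect_def)
    thus ?thesis using N0 by (simp add: r_def field_simps)
   qed
   have "norm a*1 <= norm a*N" using N by (intro mult_left_mono) auto
   hence "r <= norm a" using N0 by (simp add: r_def pos_divide_le_eq)
   hence na: "ga/3 <= norm a" using rl by linarith
   hence na0: "0 < norm a" using ga by linarith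
   have "(1+norm a) powr (2 * s) <= K*norm a powr (2 * s)"
   proof -
    have "1 <= 3/ga*norm a" using na ga by (simp add: field_simps)
    hence "1+norm a <= (1+3/ga)*norm a" by (simp add: algebra_simps)
    hence "(1+norm a) powr (2 * s) <= ((1+3/ga)*norm a) powr (2 * s)" using s na0 by (intro powr_mono2) auto
    thus ?thesis using ga by (simp add: K_def powr_mult)
   qed
   moreover have "c2*norm a powr (2 * s) <= N powr (2 * s-2)*ma^2"
   proof -
    have "c2*r powr (2 * s) <= (p r)^2*r^2" by (rule c2(2)[OF rl])
    hence "N powr (2 * s)*(c2*r powr (2 * s)) <= N powr (2 * s)*((p r)^2*r^2)" by (intro mult_left_mono) auto
    also have "N powr (2 * s)*(c2*r powr (2 * s)) = c2*norm a powr (2 * s)" using N0 by (simp add: r_def powr_divide)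
    also have "N powr (2 * s)*((p r)^2*r^2) = N powr (2 * s-2)*((m a)^2*(norm a)^2)"
     using N0 by (simp add: r_def m_def I_symbol_def power_divide powr_diff powr_numeral)
    also have "... <= N powr (2 * s-2)*ma^2"
     unfolding ma_def power_mult_distrib using abs_le_japanese[of "norm a"] by (intro mult_left_mono power_mono) auto
    finally show ?thesis .
   qed
   moreover have "c2*x <= K*z" if "x <= K*y" "c2*y <= z" for x y z
   proof -
    have "c2*x <= c2*(K*y)" using that c2(1) by (intro mult_left_mono) auto
    also have "... = K*(c2*y)" by simp
    also have "... <= K*z" using that K by (intro mult_left_mono) auto
    finally show ?thesis .
   qed
   ultimately have "c2*(1+norm a) powr (2 * s) <= K*(N powr (2 * s-2)*ma^2)" by blast
   moreover define u v where "u = (1+norm a) powr (2 * s)" and "v = N powr (2 * s-2)"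
   ultimately have "c2*u/(c2*u*ma^2) <= K*(v * ma^2)/(c2*u*ma^2)"
    using c2(1) by (intro divide_right_mono) (auto simp: u_def)
   moreover have "1+norm a \<noteq> 0" using na0 by linarith
   hence "0 < u" unfolding u_def by (subst powr_gt_zero)
   ultimately have "1/ma^2 <= K/c2 * v * inverse u" using pos c2(1) by (simp add: field_simps)
   thus "1/ma^2 <= K/c2*N powr (2 * s-2)*(1+norm a) powr (- (2 * s))" by (simp add: u_def v_def powr_minus)
  qed (use C1 c3 br(2)[of d] in auto)
  also have "... = C*N powr (2 * s-2)*(1+norm a) powr (- (2 * s))*(norm (c-d)/bracket d)" by (simp add: C_def mult_ac)
  finally show ?thesis .
 qed
 thus ?thesis using C by blast
qed

section \<open>The form on the hyperplane and the symmetries of a rectangle\<close>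

text \<open>The hyperplane a + c = b + d with \<open>b\<close> eliminated. Compared with
  \<open>Sigma4\<close> the signs of the second and fourth variables, which belong to the conjugated
  factors, are reversed.\<close>

definition hyp :: "real => (real \<times> real => real \<times> real => real \<times> real => real \<times> real => ennreal) => ennreal" where
 "hyp L Ph = tri L (%a c d. Ph a (a + c-d) c d)"

abbreviation freq4 :: "real => quad measure" where
 "freq4 L \<equiv> freq L \<otimes> freq L \<otimes> freq L \<otimes> freq L"

lemma freq4_compose:
 assumes f: "(%(a, b, c, d). f a b c d) \<in> \<B> (freq4 L)"
  and "p \<in> M ->M freq L" "q \<in> M ->M freq L" "r \<in> M ->M freq L" "t \<in> M ->M freq L"
 shows "(%u. f (p u) (q u) (r u) (t u)) \<in> \<B> M"
proof -
 have "(%u. (p u, q u, r u, t u)) \<in> M ->M freq4 L" using assms(2-) by measurable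
 from measurable_compose[OF this f] show ?thesis by simp
qed

lemma hyp_measurable:
 assumes f: "(%(a, b, c, d). f a b c d) \<in> \<B> (freq4 L)"
 shows "(%(a, c, d). f a (a + c-d) c d) \<in> \<B> (freq3 L)"
 unfolding case_prod_beta' by (rule freq4_compose[OF f]) measurable

lemma hyp_swap_ac:
 assumes f: "(%(a, b, c, d). f a b c d) \<in> \<B> (freq4 L)"
 shows "hyp L (%a b c d. f c b a d) = hyp L f"
 using tri_swap_yx[OF hyp_measurable[OF f]] by (simp add: hyp_def add.commute)

text \<open>The exchange replaces the eliminated vertex by another one, so it takes the shear that
  makes \<open>b\<close> a variable, followed by permutations of the order of integration.\<close>

lemma hyp_swap_parity:
 assumes f: "(%(a, b, c, d). f a b c d) \<in> \<B> (freq4 L)"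
 shows "hyp L (%a b c d. f b a d c) = hyp L f"
proof -
 define g where "g x y z = f (z+y-x) z x y" for x y z
 have g: "(%(x, y, z). g x y z) \<in> \<B> (freq3 L)"
  unfolding g_def case_prod_beta' by (rule freq4_compose[OF f]) measurable
 have g2: "(%(y, x, z). g x y z) \<in> \<B> (freq3 L)"
  "(%(y, z, x). g x y z) \<in> \<B> (freq3 L)" using freq3_compose[OF g] unfolding case_prod_beta' by measurable
 have "hyp L f = tri L (%x y z. f (z+y-x) z x y)" unfolding hyp_def by (subst tri_shift[OF hyp_measurable[OF f]]) simp
 also have "... = tri L (%y x z. g x y z)" unfolding g_def[symmetric] by (rule tri_swap_yx[OF g])
 also have "... = tri L (%y z x. g x y z)" by (rule tri_swap_xd[OF g2(1)])
 also have "... = tri L (%z y x. g x y z)" by (rule tri_swap_yx[OF g2(2)])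
 also have "... = hyp L (%a b c d. f b a d c)" unfolding hyp_def g_def by (simp add: add.commute)
 finally show ?thesis ..
qed

text \<open>The seven nontrivial elements of the dihedral group of order 8, obtained by applying its
  two generators (a c) and (a b)(c d) alternately.\<close>

lemma hyp_swaps:
 assumes f: "(%(a, b, c, d). f a b c d) \<in> \<B> (freq4 L)"
 shows "hyp L (%a b c d. f c b a d) = hyp L f" "hyp L (%a b c d. f a d c b) = hyp L f"
  "hyp L (%a b c d. f c d a b) = hyp L f" "hyp L (%a b c d. f b a d c) = hyp L f"
  "hyp L (%a b c d. f d a b c) = hyp L f" "hyp L (%a b c d. f b c d a) = hyp L f"
  "hyp L (%a b c d. f d c b a) = hyp L f"
proof -
 have m: "(%(a, b, c, d). f (p1 (a, b, c, d)) (p2 (a, b, c, d)) (p3 (a, b, c, d)) (p4 (a, b, c, d))) \<in> \<B> (freq4 L)"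
  if "p1 \<in> freq4 L ->M freq L" "p2 \<in> freq4 L ->M freq L" "p3 \<in> freq4 L ->M freq L" "p4 \<in> freq4 L ->M freq L" for p1 p2 p3 p4
  using freq4_compose[OF f that] unfolding case_prod_beta' by simp
 have proj: "(%z. fst z) \<in> freq4 L ->M freq L" "(%z. fs z) \<in> freq4 L ->M freq L"
  "(%z. fss z) \<in> freq4 L ->M freq L" "(%z. sss z) \<in> freq4 L ->M freq L" by measurable
 note M1 = m[OF proj(2) proj(1) proj(4) proj(3), simplified]
 note M2 = m[OF proj(2) proj(3) proj(4) proj(1), simplified]
 note M3 = m[OF proj(1) proj(4) proj(3) proj(2), simplified]
 note M4 = m[OF proj(3) proj(4) proj(1) proj(2), simplified]
 note M5 = m[OF proj(4) proj(1) proj(2) proj(3), simplified]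
 show 1: "hyp L (%a b c d. f c b a d) = hyp L f" by (rule hyp_swap_ac[OF f])
 show 2: "hyp L (%a b c d. f b a d c) = hyp L f" by (rule hyp_swap_parity[OF f])
 show 3: "hyp L (%a b c d. f b c d a) = hyp L f" using hyp_swap_ac[OF M1] 2 by simp
 show 4: "hyp L (%a b c d. f a d c b) = hyp L f" using hyp_swap_parity[OF M2] 3 by simp
 show 5: "hyp L (%a b c d. f c d a b) = hyp L f" using hyp_swap_ac[OF M3] 4 by simp
 show 6: "hyp L (%a b c d. f d c b a) = hyp L f" using hyp_swap_parity[OF M4] 5 by simp
 show 7: "hyp L (%a b c d. f d a b c) = hyp L f" using hyp_swap_ac[OF M5] 6 by simp
qed

lemma hyp_mono:
 assumes "\<And>a b c d. a \<in> space (freq L) ==> b \<in> space (freq L) ==> c \<in> space (freq L) ==> d \<in> space (freq L) ==>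
  a + c = b+d ==> f a b c d <= g a b c d"
 shows "hyp L f <= hyp L g"
 unfolding hyp_def by (rule tri_mono, rule assms) (auto intro: space_freq_add space_freq_diff)

text \<open>The kernel \<open>K\<close> in the resonance function is a parameter, because the form
  is used twice: with the oscillatory kernel for the estimate, and with the constant 1 for absolute
  convergence.\<close>

definition mult_form :: "(real => real) => real => real => (real => ennreal) =>
  (real \<times> real => ennreal) => (real \<times> real => ennreal) => (real \<times> real => ennreal) => (real \<times> real => ennreal) =>
  real \<times> real => real \<times> real => real \<times> real => real \<times> real => ennreal" where
 "mult_form p ga N K g1 g2 g3 g4 a b c d = of_bool (rect ga N a b c d)*ennreal (quotient_mult p N a b c d) *
   K ((norm a)^2-(norm b)^2+(norm c)^2-(norm d)^2)*(g1 a*g2 b*g3 c*g4 d)"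

lemma sizemax_swap: "sizemax c b a d = sizemax a b c d" "sizemax b a d c = sizemax a b c d"
 by (auto simp: sizemax_def max_def)

lemma rect_swap: "rect ga N c b a d = rect ga N a b c d" "rect ga N b a d c = rect ga N a b c d"
proof -
 have 1: "rect ga N c b a d \<and> rect ga N b a d c" if r: "rect ga N a b c d" for a b c d
 proof -
  have e: "c-b = - (a-d)" "c-d = - (a-b)" "b-c = a-d" "b-a = - (a-b)" using r by (auto simp: rect_def algebra_simps)
  have e2: "(c-b) \<bullet> (c-d) = (a-b) \<bullet> (a-d)" "(b-a) \<bullet> (b-c) = - ((a-b) \<bullet> (a-d))"
   by (simp_all only: e inner_minus_left inner_minus_right minus_minus inner_commute)
  have e3: "norm (c-b) = norm (a-d)" "norm (c-d) = norm (a-b)" "norm (b-c) = norm (a-d)" "norm (b-a) = norm (a-b)"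
   by (simp_all only: e norm_minus_cancel)
  have e4: "sizemax c b a d = sizemax a b c d" "sizemax b a d c = sizemax a b c d" by (rule sizemax_swap)+
  show ?thesis using r unfolding rect_def e2 e3 e4 abs_minus_cancel by (simp add: mult.commute add.commute)
 qed
 show "rect ga N c b a d = rect ga N a b c d" "rect ga N b a d c = rect ga N a b c d" using 1 by blast+
qed

lemma mult_form_swap:
 "mult_form p ga N K g1 g2 g3 g4 c b a d = mult_form p ga N K g3 g2 g1 g4 a b c d"
 "mult_form p ga N K g1 g2 g3 g4 b a d c = mult_form p ga N (%h. K (- h)) g2 g1 g4 g3 a b c d"
proof -
 have q: "quotient_mult p N c b a d = quotient_mult p N a b c d" "quotient_mult p N b a d c = quotient_mult p N a b c d"
  by (auto simp: quotient_mult_def mult_ac algebra_simps abs_minus_commute)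
 have r: "rect ga N c b a d = rect ga N a b c d" "rect ga N b a d c = rect ga N a b c d" by (rule rect_swap)+
 have h1: "(norm c)^2-(norm b)^2+(norm a)^2-(norm d)^2 = (norm a)^2-(norm b)^2+(norm c)^2-(norm d)^2" by simp
 show "mult_form p ga N K g1 g2 g3 g4 c b a d = mult_form p ga N K g3 g2 g1 g4 a b c d"
  unfolding mult_form_def r q h1 by (simp only: mult_ac)
 have h: "(norm b)^2-(norm a)^2+(norm d)^2-(norm c)^2 = - ((norm a)^2-(norm b)^2+(norm c)^2-(norm d)^2)" by simp
 show "mult_form p ga N K g1 g2 g3 g4 b a d c = mult_form p ga N (%h. K (- h)) g2 g1 g4 g3 a b c d"
  unfolding mult_form_def r q h by (simp only: mult_ac)
qed

text \<open>Some symmetry of the rectangle moves the smallest vertex to the last position, and a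
  reflection that fixes this vertex orders its two neighbours.\<close>

lemma sorted4_exists:
 "sorted4 a b c d \<or> sorted4 c b a d \<or> sorted4 a d c b \<or> sorted4 c d a b \<or>
  sorted4 b a d c \<or> sorted4 d a b c \<or> sorted4 b c d a \<or> sorted4 d c b a"
proof -
 have "(z <= x \<and> w <= z \<and> w <= y) \<or> (x <= z \<and> w <= x \<and> w <= y) \<or> (z <= x \<and> y <= z \<and> y <= w) \<or> (x <= z \<and> y <= x \<and> y <= w) \<or>
  (w <= y \<and> z <= w \<and> z <= x) \<or> (y <= w \<and> z <= y \<and> z <= x) \<or> (w <= y \<and> x <= w \<and> x <= z) \<or> (y <= w \<and> x <= y \<and> x <= z)"
  for x y z w :: real
  by (cases "x <= z"; cases "y <= w"; cases "x <= y"; cases "x <= w"; cases "z <= y"; cases "z <= w"; simp)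
 from this[where x = "norm a" and y = "norm b" and z = "norm c" and w = "norm d"]
 show ?thesis unfolding sorted4_def by blast
qed

lemma freq4_components:
 "(%z. fst z) \<in> freq4 L ->M borel" "(%z. fs z) \<in> freq4 L ->M borel"
 "(%z. fss z) \<in> freq4 L ->M borel" "(%z. sss z) \<in> freq4 L ->M borel" by (rule freq_into_borel, measurable)+

lemma measurable_japanese [measurable]: "japanese \<in> \<B> borel" unfolding japanese_def[abs_def] by measurable

lemma measurable_I_symbol:
 assumes p: "I_profile s p" and s: "s < 1" and N: "0 < N"
 shows "I_symbol p N \<in> \<B> borel"
proof -
 have "mono (%r. - p (max r 0))" using I_profile_bounds(3)[OF p s] by (intro monoI) auto
 hence "(%r. - p (max r 0)) \<in> \<B> borel" by (rule borel_measurable_mono)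
 hence [measurable]: "(%r. - (- p (max r 0))) \<in> \<B> borel" by measurable
 have "(%xi::real \<times> real. - (- p (max (norm xi/N) 0))) \<in> \<B> borel"
  by (rule measurable_compose[of "%xi. norm xi/N" _ borel "%r. - (- p (max r 0))"]) measurable
 moreover have "max (norm xi/N) 0 = norm xi/N" for xi :: "real \<times> real" using N by (intro max_absorb1) simp
 ultimately show ?thesis by (simp add: I_symbol_def[abs_def])
qed

lemma measurable_sizemax [measurable]:
 "(%z. sizemax (fst z) (fs z) (fss z) (sss z)) \<in> \<B> (freq4 L)"
proof -
 note freq4_components [measurable]
 show ?thesis unfolding sizemax_def by (intro borel_measurable_max) measurable
qed

lemma measurable_rect [measurable]:
 "Measurable.pred (freq4 L) (%z. rect ga N (fst z) (fs z) (fss z) (sss z))"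
proof -
 note freq4_components [measurable]
 have [measurable]: "(%z. fst z+fss z-(fs z+sss z)) \<in> freq4 L ->M borel" by measurable
 have "Measurable.pred (freq4 L) (%z. norm (fst z+fss z-(fs z+sss z)) <= 0)" by measurable
 hence 1: "Measurable.pred (freq4 L) (%z. fst z+fss z = fs z+sss z)" by (simp add: algebra_simps)
 have 2: "Measurable.pred (freq4 L) (%z. ga*N < sizemax (fst z) (fs z) (fss z) (sss z))" by measurable
 have 3: "Measurable.pred (freq4 L) (%z. \<bar>(fst z-fs z) \<bullet> (fst z-sss z)\<bar> *
   max 1 (sizemax (fst z) (fs z) (fss z) (sss z)) <= norm (fst z-fs z)*norm (fst z-sss z))" by measurable
 show ?thesis unfolding rect_def by (intro pred_intros_logic 1 2 3)
qed

lemma measurable_sorted4 [measurable]: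
 "Measurable.pred (freq4 L) (%z. sorted4 (fst z) (fs z) (fss z) (sss z))"
proof -
 note freq4_components [measurable]
 show ?thesis unfolding sorted4_def by measurable
qed

lemma measurable_mult_form:
 assumes p: "I_profile s p" and s: "s < 1" and N: "0 < N"
  and [measurable]: "K \<in> \<B> borel" "g1 \<in> \<B> (freq L)" "g2 \<in> \<B> (freq L)"
   "g3 \<in> \<B> (freq L)" "g4 \<in> \<B> (freq L)"
 shows "(%(a, b, c, d). mult_form p ga N K g1 g2 g3 g4 a b c d) \<in> \<B> (freq4 L)"
proof -
 note freq4_components [measurable] measurable_I_symbol[OF p s N, measurable]
 show ?thesis unfolding mult_form_def quotient_mult_def theta_def case_prod_beta' by measurable
qed

text \<open>The form is at most the sum of its eight sorted parts, each of which a symmetry carries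
  to the standard order with permuted functions. Exchanging even and odd vertices reverses the sign
  of the resonance function; hence the class of kernels is closed under reflection. The factor 64 is
  the square of 8.\<close>

lemma hyp_symmetrize:
 assumes p: "I_profile s p" and s: "s < 1" and N: "0 < N"
  and Kcl: "\<And>K. K \<in> \<K> ==> K \<in> \<B> borel \<and> (%h. K (- h)) \<in> \<K>"
  and est: "\<And>K g1 g2 g3 g4. K \<in> \<K> ==> g1 \<in> \<B> (freq L) ==> g2 \<in> \<B> (freq L) ==>
   g3 \<in> \<B> (freq L) ==> g4 \<in> \<B> (freq L) ==>
   (hyp L (%a b c d. of_bool (sorted4 a b c d)*mult_form p ga N K g1 g2 g3 g4 a b c d))^2 <=
    B*(mass L g1*mass L g2*mass L g3*mass L g4)"
  and K: "K \<in> \<K>"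
  and g: "g1 \<in> \<B> (freq L)" "g2 \<in> \<B> (freq L)"
   "g3 \<in> \<B> (freq L)" "g4 \<in> \<B> (freq L)"
 shows "(hyp L (mult_form p ga N K g1 g2 g3 g4))^2 <= 64*(B*(mass L g1*mass L g2*mass L g3*mass L g4))"
proof -
 define Pr where "Pr = mass L g1*mass L g2*mass L g3*mass L g4"
 define S where "S K g1 g2 g3 g4 a b c d = of_bool (sorted4 a b c d)*mult_form p ga N K g1 g2 g3 g4 a b c d" for K g1 g2 g3 g4 a b c d
 have mS: "(%(a, b, c, d). S K g1 g2 g3 g4 a b c d) \<in> \<B> (freq4 L)"
  if "K \<in> \<K>" "g1 \<in> \<B> (freq L)" "g2 \<in> \<B> (freq L)"
   "g3 \<in> \<B> (freq L)" "g4 \<in> \<B> (freq L)" for K g1 g2 g3 g4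
 proof -
  have "(%(a, b, c, d). mult_form p ga N K g1 g2 g3 g4 a b c d) \<in> \<B> (freq4 L)"
   using Kcl that by (intro measurable_mult_form[OF p s N]) auto
  note this[unfolded case_prod_beta', measurable]
  show ?thesis unfolding S_def case_prod_beta' by measurable
 qed
 let ?K' = "%h. K (- h)"
 have K': "?K' \<in> \<K>" using Kcl[OF K] by simp
 note m = mult_form_swap
 have bnd: "(hyp L (S K g1 g2 g3 g4))^2 <= B*Pr" "(hyp L (S K g3 g2 g1 g4))^2 <= B*Pr" "(hyp L (S K g1 g4 g3 g2))^2 <= B*Pr"
  "(hyp L (S K g3 g4 g1 g2))^2 <= B*Pr" "(hyp L (S ?K' g2 g1 g4 g3))^2 <= B*Pr" "(hyp L (S ?K' g4 g1 g2 g3))^2 <= B*Pr"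
  "(hyp L (S ?K' g2 g3 g4 g1))^2 <= B*Pr" "(hyp L (S ?K' g4 g3 g2 g1))^2 <= B*Pr"
  using est[OF K g(1) g(2) g(3) g(4)] est[OF K g(3) g(2) g(1) g(4)] est[OF K g(1) g(4) g(3) g(2)] est[OF K g(3) g(4) g(1) g(2)]
   est[OF K' g(2) g(1) g(4) g(3)] est[OF K' g(4) g(1) g(2) g(3)] est[OF K' g(2) g(3) g(4) g(1)] est[OF K' g(4) g(3) g(2) g(1)]
  unfolding S_def Pr_def by (simp_all add: mult_ac)
 define fsv where "fsv = [S K g1 g2 g3 g4, (%a b c d. S K g3 g2 g1 g4 c b a d), (%a b c d. S K g1 g4 g3 g2 a d c b),
  (%a b c d. S K g3 g4 g1 g2 c d a b), (%a b c d. S ?K' g2 g1 g4 g3 b a d c), (%a b c d. S ?K' g4 g1 g2 g3 d a b c),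
  (%a b c d. S ?K' g2 g3 g4 g1 b c d a), (%a b c d. S ?K' g4 g3 g2 g1 d c b a)]"
 have val: "S K g3 g2 g1 g4 c b a d = of_bool (sorted4 c b a d)*mult_form p ga N K g1 g2 g3 g4 a b c d"
  "S K g1 g4 g3 g2 a d c b = of_bool (sorted4 a d c b)*mult_form p ga N K g1 g2 g3 g4 a b c d"
  "S K g3 g4 g1 g2 c d a b = of_bool (sorted4 c d a b)*mult_form p ga N K g1 g2 g3 g4 a b c d"
  "S ?K' g2 g1 g4 g3 b a d c = of_bool (sorted4 b a d c)*mult_form p ga N K g1 g2 g3 g4 a b c d"
  "S ?K' g4 g1 g2 g3 d a b c = of_bool (sorted4 d a b c)*mult_form p ga N K g1 g2 g3 g4 a b c d"
  "S ?K' g2 g3 g4 g1 b c d a = of_bool (sorted4 b c d a)*mult_form p ga N K g1 g2 g3 g4 a b c d"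
  "S ?K' g4 g3 g2 g1 d c b a = of_bool (sorted4 d c b a)*mult_form p ga N K g1 g2 g3 g4 a b c d" for a b c d
 proof -
  have 1: "mult_form p ga N K g3 g2 g1 g4 c b a d = mult_form p ga N K g1 g2 g3 g4 a b c d" for K g1 g2 g3 g4 a b c d by (rule m(1))
  have 2: "mult_form p ga N (%h. K (- h)) g2 g1 g4 g3 b a d c = mult_form p ga N K g1 g2 g3 g4 a b c d" for K g1 g2 g3 g4 a b c d
   using m(2)[of p ga N "%h. K (- h)" g2 g1 g4 g3 b a d c] by simp
  have 5: "mult_form p ga N (%h. K (- h)) g4 g1 g2 g3 d a b c = mult_form p ga N K g1 g2 g3 g4 a b c d" for K g1 g2 g3 g4 a b c d
   by (rule trans[OF 1 2])
  have 3: "mult_form p ga N K g1 g4 g3 g2 a d c b = mult_form p ga N K g1 g2 g3 g4 a b c d" for K g1 g2 g3 g4 a b c d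
   by (rule trans[OF sym[OF 2] 5])
  have 4: "mult_form p ga N K g3 g4 g1 g2 c d a b = mult_form p ga N K g1 g2 g3 g4 a b c d" for K g1 g2 g3 g4 a b c d
   by (rule trans[OF 1 3])
  have 6: "mult_form p ga N (%h. K (- h)) g2 g3 g4 g1 b c d a = mult_form p ga N K g1 g2 g3 g4 a b c d" for K g1 g2 g3 g4 a b c d
   by (rule trans[OF 2 1])
  have 7: "mult_form p ga N (%h. K (- h)) g4 g3 g2 g1 d c b a = mult_form p ga N K g1 g2 g3 g4 a b c d" for K g1 g2 g3 g4 a b c d
   by (rule trans[OF 2 4])
  show "S K g3 g2 g1 g4 c b a d = of_bool (sorted4 c b a d)*mult_form p ga N K g1 g2 g3 g4 a b c d"
   unfolding S_def by (rule arg_cong[where f = "(*) _", OF 1])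
  show "S K g1 g4 g3 g2 a d c b = of_bool (sorted4 a d c b)*mult_form p ga N K g1 g2 g3 g4 a b c d"
   unfolding S_def by (rule arg_cong[where f = "(*) _", OF 3])
  show "S K g3 g4 g1 g2 c d a b = of_bool (sorted4 c d a b)*mult_form p ga N K g1 g2 g3 g4 a b c d"
   unfolding S_def by (rule arg_cong[where f = "(*) _", OF 4])
  show "S ?K' g2 g1 g4 g3 b a d c = of_bool (sorted4 b a d c)*mult_form p ga N K g1 g2 g3 g4 a b c d"
   unfolding S_def by (rule arg_cong[where f = "(*) _", OF 2])
  show "S ?K' g4 g1 g2 g3 d a b c = of_bool (sorted4 d a b c)*mult_form p ga N K g1 g2 g3 g4 a b c d"
   unfolding S_def by (rule arg_cong[where f = "(*) _", OF 5])
  show "S ?K' g2 g3 g4 g1 b c d a = of_bool (sorted4 b c d a)*mult_form p ga N K g1 g2 g3 g4 a b c d"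
   unfolding S_def by (rule arg_cong[where f = "(*) _", OF 6])
  show "S ?K' g4 g3 g2 g1 d c b a = of_bool (sorted4 d c b a)*mult_form p ga N K g1 g2 g3 g4 a b c d"
   unfolding S_def by (rule arg_cong[where f = "(*) _", OF 7])
 qed
 have mfs: "(%(a, b, c, d). f a b c d) \<in> \<B> (freq4 L) \<and> (hyp L f)^2 <= B*Pr" if "f \<in> set fsv" for f
 proof -
  have m7_1: "(%(a, b, c, d). S K g3 g2 g1 g4 c b a d) \<in> \<B> (freq4 L)"
   unfolding case_prod_beta' by (rule freq4_compose[OF mS[OF K g(3) g(2) g(1) g(4)]]) measurable
  have m7_2: "(%(a, b, c, d). S K g1 g4 g3 g2 a d c b) \<in> \<B> (freq4 L)"
   unfolding case_prod_beta' by (rule freq4_compose[OF mS[OF K g(1) g(4) g(3) g(2)]]) measurable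
  have m7_3: "(%(a, b, c, d). S K g3 g4 g1 g2 c d a b) \<in> \<B> (freq4 L)"
   unfolding case_prod_beta' by (rule freq4_compose[OF mS[OF K g(3) g(4) g(1) g(2)]]) measurable
  have m7_4: "(%(a, b, c, d). S ?K' g2 g1 g4 g3 b a d c) \<in> \<B> (freq4 L)"
   unfolding case_prod_beta' by (rule freq4_compose[OF mS[OF K' g(2) g(1) g(4) g(3)]]) measurable
  have m7_5: "(%(a, b, c, d). S ?K' g4 g1 g2 g3 d a b c) \<in> \<B> (freq4 L)"
   unfolding case_prod_beta' by (rule freq4_compose[OF mS[OF K' g(4) g(1) g(2) g(3)]]) measurable
  have m7_6: "(%(a, b, c, d). S ?K' g2 g3 g4 g1 b c d a) \<in> \<B> (freq4 L)"
   unfolding case_prod_beta' by (rule freq4_compose[OF mS[OF K' g(2) g(3) g(4) g(1)]]) measurable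
  have m7_7: "(%(a, b, c, d). S ?K' g4 g3 g2 g1 d c b a) \<in> \<B> (freq4 L)"
   unfolding case_prod_beta' by (rule freq4_compose[OF mS[OF K' g(4) g(3) g(2) g(1)]]) measurable
  note m7 = m7_1 m7_2 m7_3 m7_4 m7_5 m7_6 m7_7
  show ?thesis
   using that m7 mS[OF K g] bnd hyp_swaps(1)[OF mS[OF K g(3) g(2) g(1) g(4)]] hyp_swaps(2)[OF mS[OF K g(1) g(4) g(3) g(2)]]
    hyp_swaps(3)[OF mS[OF K g(3) g(4) g(1) g(2)]] hyp_swaps(4)[OF mS[OF K' g(2) g(1) g(4) g(3)]] hyp_swaps(5)[OF mS[OF K' g(4) g(1) g(2) g(3)]]
    hyp_swaps(6)[OF mS[OF K' g(2) g(3) g(4) g(1)]] hyp_swaps(7)[OF mS[OF K' g(4) g(3) g(2) g(1)]]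
   unfolding fsv_def by auto
 qed
 have add: "hyp L (%a b c d. \<Sum>f\<leftarrow>xs. f a b c d) = (\<Sum>f\<leftarrow>xs. hyp L f) \<and>
   (%(a, b, c, d). \<Sum>f\<leftarrow>xs. f a b c d) \<in> \<B> (freq4 L)" if "set xs \<subseteq> set fsv" for xs
  using that
 proof (induction xs)
  case Nil
  thus ?case by (simp add: hyp_def tri_def)
 next
  case (Cons f xs)
  have f: "(%(a, b, c, d). f a b c d) \<in> \<B> (freq4 L)" and ih: "hyp L (%a b c d. \<Sum>f\<leftarrow>xs. f a b c d) = (\<Sum>f\<leftarrow>xs. hyp L f)"
   "(%(a, b, c, d). \<Sum>f\<leftarrow>xs. f a b c d) \<in> \<B> (freq4 L)" using Cons mfs by auto
  have "hyp L (%a b c d. \<Sum>f\<leftarrow>f # xs. f a b c d) = hyp L f+hyp L (%a b c d. \<Sum>f\<leftarrow>xs. f a b c d)"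
   unfolding hyp_def using tri_add[OF hyp_measurable[OF f] hyp_measurable[OF ih(2)]] by simp
  moreover have "(%z. (case z of (a, b, c, d) => f a b c d)+(case z of (a, b, c, d) => \<Sum>f\<leftarrow>xs. f a b c d)) \<in> \<B> (freq4 L)"
   using f ih(2) by (rule borel_measurable_add)
  ultimately show ?case using ih by (simp add: case_prod_beta')
 qed
 have "hyp L (mult_form p ga N K g1 g2 g3 g4) <= hyp L (%a b c d. \<Sum>f\<leftarrow>fsv. f a b c d)"
 proof (rule hyp_mono)
  fix a b c d
  have "mult_form p ga N K g1 g2 g3 g4 a b c d <= (of_bool (sorted4 a b c d)+(of_bool (sorted4 c b a d)+(of_bool (sorted4 a d c b) +
   (of_bool (sorted4 c d a b)+(of_bool (sorted4 b a d c)+(of_bool (sorted4 d a b c)+(of_bool (sorted4 b c d a) + of_bool (sorted4 d c b a)))))))) *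
   mult_form p ga N K g1 g2 g3 g4 a b c d" (is "?x <= ?n*?x")
  proof -
   have "1 <= ?n" using sorted4_exists[of a b c d] by (elim disjE) (simp_all add: add_increasing add_increasing2)
   hence "1*?x <= ?n*?x" by (rule mult_right_mono) simp
   thus ?thesis by simp
  qed
  also have "... = (\<Sum>f\<leftarrow>fsv. f a b c d)" unfolding fsv_def by (simp add: val distrib_right) (simp add: S_def)
  finally show "mult_form p ga N K g1 g2 g3 g4 a b c d <= (\<Sum>f\<leftarrow>fsv. f a b c d)" .
 qed
 also have "... = (\<Sum>f\<leftarrow>fsv. hyp L f)" using add[of fsv] by simp
 also have "... <= (\<Sum>f\<leftarrow>fsv. ennreal_sqrt (B*Pr))"
  by (rule sum_list_mono, rule ennreal_power2_le_imp_le) (use mfs in simp)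
 also have "... = 8*ennreal_sqrt (B*Pr)" unfolding sum_list_triv by (simp add: fsv_def)
 finally have "(hyp L (mult_form p ga N K g1 g2 g3 g4))^2 <= (8*ennreal_sqrt (B*Pr))^2" by (rule power_mono) simp
 thus ?thesis unfolding Pr_def by (simp add: power_mult_distrib)
qed

section \<open>Dyadic shells, windows of the resonance function, and their sums\<close>

text \<open>With 1 + |a| in place of |a| the shells are indexed by the natural numbers and also
  cover the origin.\<close>

definition shell :: "nat => real \<times> real => bool" where
 "shell k a \<longleftrightarrow> 2 ^ k <= 1+norm a \<and> 1+norm a < 2 ^ (k+1)"

lemma shell_exists: "\<exists>k. shell k a"
proof -
 define k where "k = nat \<lfloor>log 2 (1+norm a)\<rfloor>"
 have pos: "0 < 1+norm a" by (simp add: add_pos_nonneg)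
 have "0 <= log 2 (1+norm a)" using pos by (subst zero_le_log_cancel_iff) auto
 hence "real k <= log 2 (1+norm a)" "log 2 (1+norm a) < real k+1" by (auto simp: k_def)
 hence "2 powr real k <= 1+norm a" "1+norm a < 2 powr (real k+1)" using pos by (simp_all add: le_log_iff log_less_iff)
 thus ?thesis by (auto simp: shell_def powr_realpow powr_add intro!: exI[of _ k])
qed

text \<open>The resonance function is cut into unit windows about the integers \<open>n\<close>. On
  each of them the kernel is at most \<open>w n\<close>, and the core estimate holds with a constant
  independent of \<open>n\<close>, so only the sum of the \<open>w n\<close> over the relevant
  windows enters.\<close>

lemma shell_estimate:
 fixes w :: "int => real"
 assumes L: "1 <= L"
  and meas [measurable]: "g1 \<in> \<B> (freq L)" "g2 \<in> \<B> (freq L)"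
   "g3 \<in> \<B> (freq L)" "g4 \<in> \<B> (freq L)"
  and v: "0 <= v" "\<And>a b c d. rect ga N a b c d ==> sorted4 a b c d ==> shell k a ==>
    quotient_mult p N a b c d <= v * (norm (c-d)/bracket d)"
  and w: "\<And>n. 0 <= w n" "\<And>h n. \<bar>h-of_int n\<bar> <= 1 ==> K h <= ennreal (w n)"
   "(\<Sum>n\<in>{- (2 ^ (k+5))<..<2 ^ (k+5)}. w n) <= S"
 shows "(hyp L (%a b c d. of_bool (shell k a)*(of_bool (sorted4 a b c d)*mult_form p ga N K g1 g2 g3 g4 a b c d)))^2
  <= ennreal ((S * v)^2*(core_const*(real k+3) ^ 4)) * (mass L g1*mass L g2*mass L g3*mass L g4)"
proof -
 let ?F = "freq L"
 let ?Pr = "mass L g1*mass L g2*mass L g3*mass L g4"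
 define I where "I = {- (2 ^ (k+5))<..<(2 ^ (k+5) :: int)}"
 have finI: "finite I" by (simp add: I_def)
 define E where "E z \<longleftrightarrow> rect ga N (fst z) (fs z) (fss z) (sss z) \<and>
  sorted4 (fst z) (fs z) (fss z) (sss z) \<and> shell k (fst z)" for z
 have mE: "Measurable.pred (freq4 L) E"
 proof -
  note freq4_components [measurable]
  have "Measurable.pred (freq4 L) (%z. shell k (fst z))" unfolding shell_def by measurable
  thus ?thesis unfolding E_def by (intro pred_intros_logic measurable_rect measurable_sorted4)
 qed
 define R where "R n = {z \<in> space (freq3 L). window (- of_int n) z \<and>
  E (fst z, fst z+fs z-ss z, fs z, ss z)}" for n :: int
 have [measurable]: "R n \<in> sets (freq3 L)" for n
 proof -
  have "(%z. (fst z, fst z+fs z-ss z, fs z, ss z)) \<in> freq3 L ->M freq4 L" by measurable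
  from measurable_compose[OF this mE] have m: "Measurable.pred (freq3 L) (%z. E (fst z, fst z+fs z-ss z, fs z, ss z))" .
  show ?thesis unfolding R_def by (rule predE) (intro pred_intros_logic measurable_window m)
 qed
 define J where "J n = tri L (%a c d. ind (R n) (a, c, d)*ennreal (norm (c-d)/bracket d) *
  (g1 a*g2 (c+a-d)*g3 c*g4 d))" for n
 note freq3_components [measurable]
 have mJ: "(%(a, c, d). ind (R n) (a, c, d)*ennreal (norm (c-d)/bracket d) *
  (g1 a*g2 (c+a-d)*g3 c*g4 d)) \<in> \<B> (freq3 L)" for n unfolding case_prod_beta' by measurable
 define B where "B = ennreal (core_const*(real k+3) ^ 4)*?Pr"
 have J2: "(J n)^2 <= B" for n unfolding J_def B_def
 proof (rule core_estimate[OF L])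
  fix y x d assume z: "(y, x, d) \<in> R n"
  hence r: "rect ga N y (y+x-d) x d" "sorted4 y (y+x-d) x d" "shell k y" by (auto simp: R_def E_def)
  show "norm x <= norm y \<and> norm d <= norm x" using r by (simp add: sorted4_def)
  show "2 ^ k <= 1+norm y \<and> 1+norm y < 2 ^ (k+1)" using r by (simp add: shell_def)
  show "\<bar>(x-d) \<bullet> (y-d)\<bar> <= 2*norm (x-d)" using rect_geometry(4)[OF r(1,2)] .
 next
  show "R n \<in> sets (freq3 L)" by measurable
 next
  fix z assume "z \<in> R n"
  thus "window (- of_int n) z" by (simp add: R_def)
 qed measurable
 have "hyp L (%a b c d. of_bool (shell k a)*(of_bool (sorted4 a b c d)*mult_form p ga N K g1 g2 g3 g4 a b c d)) <=
   tri L (%a c d. (NN n|count_space UNIV. ennreal (ind I n*w n * v)*(ind (R n) (a, c, d)*ennreal (norm (c-d)/bracket d) *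
  (g1 a*g2 (c+a-d)*g3 c*g4 d))))" unfolding hyp_def
 proof (rule tri_mono)
  fix a c d assume sp: "a \<in> space ?F" "c \<in> space ?F" "d \<in> space ?F"
  define b where "b = a + c-d"
  show "of_bool (shell k a)*(of_bool (sorted4 a (a + c-d) c d)*mult_form p ga N K g1 g2 g3 g4 a (a + c-d) c d) <=
   (NN n|count_space UNIV. ennreal (ind I n*w n * v)*(ind (R n) (a, c, d)*ennreal (norm (c-d)/bracket d) *
  (g1 a*g2 (c+a-d)*g3 c*g4 d)))"
  proof (cases "rect ga N a b c d \<and> sorted4 a b c d \<and> shell k a")
   case False
   thus ?thesis by (auto simp: mult_form_def b_def)
  next
   case True
   note g = rect_geometry[of ga N a b c d]
   define h where "h = (norm a)^2-(norm b)^2+(norm c)^2-(norm d)^2"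
   have h: "h = - 2*((c-d) \<bullet> (a-d))" "\<bar>(c-d) \<bullet> (a-d)\<bar> <= 2*norm (c-d)" "norm (c-d) <= 2*norm c"
    using g(3,4,5) True unfolding h_def by blast+
   define n where "n = \<lfloor>h\<rfloor>"
   have n: "\<bar>h-of_int n\<bar> <= 1" unfolding n_def by linarith
   have ca: "norm c < 2*2 ^ k" using True by (auto simp: sorted4_def shell_def)
   \<comment> \<open>|h| \<le> 4*|c-d| \<le> 8*|c| < 16*2^k: near orthogonality leaves only about
     2^k windows instead of 4^k.\<close>
   have "\<bar>h\<bar> <= 16*2 ^ k" using h ca by (simp add: abs_mult)
   hence "\<bar>real_of_int n\<bar> <= 16*2 ^ k+1" using n by linarith
   also have "... < 32*2 ^ k"
   proof -
    have "(1::real) <= 2 ^ k" by simp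
    thus ?thesis by linarith
   qed
   finally have "real_of_int \<bar>n\<bar> < real_of_int (2 ^ (k+5))" by (simp add: power_add)
   hence "\<bar>n\<bar> < 2 ^ (k+5)" unfolding of_int_less_iff .
   hence nI: "n \<in> I" by (auto simp: I_def abs_less_iff)
   have "window (- of_int n) (a, c, d)" using n unfolding window_def prod.case h(1) by linarith
   hence nR: "(a, c, d) \<in> R n" using sp True by (auto simp: R_def E_def b_def space_pair_measure)
   have "of_bool (shell k a)*(of_bool (sorted4 a b c d)*mult_form p ga N K g1 g2 g3 g4 a b c d) =
    ennreal (quotient_mult p N a b c d)*K h*(g1 a*g2 b*g3 c*g4 d)" using True by (simp add: mult_form_def h_def)
   also have "... <= ennreal (v * (norm (c-d)/bracket d))*ennreal (w n)*(g1 a*g2 b*g3 c*g4 d)"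
    using True v(2) w(2)[OF n] by (intro mult_right_mono mult_mono ennreal_leI) auto
   also have "... = ennreal (ind I n*w n * v)*(ind (R n) (a, c, d)*ennreal (norm (c-d)/bracket d) *
     (g1 a*g2 (c+a-d)*g3 c*g4 d))"
   proof -
    have "ennreal (v * (norm (c-d)/bracket d)) = ennreal v * ennreal (norm (c-d)/bracket d)"
     using v(1) japanese_pos[of "norm d"] by (intro ennreal_mult) auto
    moreover have "ennreal (ind I n*w n * v) = ennreal (w n)*ennreal v"
     using nI v(1) w(1)[of n] by (simp add: ennreal_mult)
    moreover have "g2 (c+a-d) = g2 b" by (simp add: b_def add.commute)
    ultimately show ?thesis using nR by (simp add: mult_ac)
   qed
   also have "... <= (NN n|count_space UNIV. ennreal (ind I n*w n * v)*(ind (R n) (a, c, d)*ennreal (norm (c-d)/bracket d) *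
     (g1 a*g2 (c+a-d)*g3 c*g4 d)))" by (rule nn_integral_ge_point) simp
   finally show ?thesis by (simp add: b_def)
  qed
 qed
 also have "... = (NN n|count_space UNIV. tri L (%a c d. ennreal (ind I n*w n * v)*(ind (R n) (a, c, d)*ennreal (norm (c-d)/bracket d) *
  (g1 a*g2 (c+a-d)*g3 c*g4 d))))" by (rule tri_count_space) (unfold case_prod_beta', measurable)
 also have "... = (NN n|count_space UNIV. ennreal (ind I n*w n * v)*J n)"
  unfolding J_def by (subst tri_cmult[OF mJ]) simp
 finally have le: "hyp L (%a b c d. of_bool (shell k a)*(of_bool (sorted4 a b c d)*mult_form p ga N K g1 g2 g3 g4 a b c d)) <=
  (NN n|count_space UNIV. ennreal (ind I n*w n * v)*J n)" .
 have "(NN n|count_space UNIV. ennreal (ind I n*w n * v)*J n)^2 <=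
  (NN n|count_space UNIV. ennreal (ind I n*w n * v))*(NN n|count_space UNIV. ennreal (ind I n*w n * v)*B)"
 proof (rule nn_integral_CS)
  fix n :: int
  show "(ennreal (ind I n*w n * v)*J n)^2 <= ennreal (ind I n*w n * v)*(ennreal (ind I n*w n * v)*B)"
  proof -
   have "(u*J n)^2 = u*(u*(J n)^2)" for u by (simp add: power2_eq_square mult_ac)
   thus ?thesis by (simp only:) (intro mult_left_mono J2, auto)
  qed
 qed auto
 also have "(NN n|count_space UNIV. ennreal (ind I n*w n * v)*B) = (NN n|count_space UNIV. ennreal (ind I n*w n * v))*B"
  by (rule nn_integral_multc) simp
 also have "(NN n|count_space UNIV. ennreal (ind I n*w n * v))*((NN n|count_space UNIV. ennreal (ind I n*w n * v))*B) =
   (NN n|count_space UNIV. ennreal (ind I n*w n * v))^2*B" by (simp only: power2_eq_square mult.assoc)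
 also have "(NN n|count_space UNIV. ennreal (ind I n*w n * v)) = (\<Sum>n\<in>I. ennreal (w n * v))"
  using finI by (subst nn_integral_count_space'[of I]) (auto simp: indicator_def)
 also have "... = ennreal ((\<Sum>n\<in>I. w n) * v)" using w(1) v(1) by (simp add: sum_ennreal sum_distrib_right)
 also have "(ennreal ((\<Sum>n\<in>I. w n) * v))^2*B <= (ennreal (S * v))^2*B"
  using w(3) v(1) by (intro mult_right_mono power_mono ennreal_leI) (auto simp: I_def)
 also have "... = ennreal ((S * v)^2*(core_const*(real k+3) ^ 4))*?Pr"
 proof -
  have "0 <= S" using w(1) w(3) by (meson order_trans sum_nonneg)
  hence "ennreal ((S * v)^2*(core_const*(real k+3) ^ 4)) = (ennreal (S * v))^2*ennreal (core_const*(real k+3) ^ 4)"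
   using v(1) by (subst ennreal_mult) (auto simp: ennreal_power core_const_def)
  thus ?thesis unfolding B_def by (simp only: mult.assoc)
 qed
 finally show ?thesis using le by (meson order_trans power_mono zero_le)
qed

lemma cube_le_exp: "x ^ 3 <= 27*exp x" if "0 <= x" for x :: real
proof -
 have "x/3 <= exp (x/3)" using exp_ge_add_one_self[of "x/3"] by linarith
 hence "(x/3) ^ 3 <= exp (x/3) ^ 3" using that by (intro power_mono) auto
 also have "... = exp x" by (simp add: exp_of_nat_mult[symmetric])
 finally show ?thesis by (simp add: power_divide)
qed

text \<open>Half of the exponential decay absorbs the cube, the other half gives the geometric
  series; \<open>th\<close> is half of the rate.\<close>

lemma summable_cube_geometric:
 assumes et: "0 < et"
 shows "summable (%k. (real k+3) ^ 3*2 powr (- et*real k))"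
proof -
 define th where "th = et*ln 2/2"
 have th: "0 < th" using et by (simp add: th_def)
 define r where "r = exp (- th)"
 have r: "0 < r" "r < 1" using th by (auto simp: r_def)
 have b: "(real k+3) ^ 3*2 powr (- et*real k) <= (27/th ^ 3*exp (3*th))*r ^ k" for k
 proof -
  have "(th*(real k+3)) ^ 3 <= 27*exp (th*(real k+3))" using th by (intro cube_le_exp) auto
  hence "th ^ 3*(real k+3) ^ 3/th ^ 3 <= 27*exp (th*(real k+3))/th ^ 3"
   unfolding power_mult_distrib using th by (intro divide_right_mono) auto
  hence "(real k+3) ^ 3 <= 27/th ^ 3*exp (th*(real k+3))" using th by simp
  hence "(real k+3) ^ 3*exp (- 2*th*real k) <= 27/th ^ 3*exp (th*(real k+3))*exp (- 2*th*real k)"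
   by (rule mult_right_mono) simp
  also have "... = 27/th ^ 3*exp (3*th)*r ^ k"
   by (simp add: r_def exp_of_nat_mult[symmetric] exp_add[symmetric] algebra_simps)
  finally have f: "(real k+3) ^ 3*exp (- 2*th*real k) <= 27/th ^ 3*exp (3*th)*r ^ k" .
  have e: "2 powr (- et*real k) = exp (- 2*th*real k)" by (simp add: powr_def th_def mult_ac)
  show ?thesis unfolding e by (rule f)
 qed
 have "summable (%k. (27/th ^ 3*exp (3*th))*r ^ k)" using r by (intro summable_mult summable_geometric) auto
 thus ?thesis by (rule summable_comparison_test') (use b in auto)
qed

text \<open>The bound must not depend on the shift \<open>s\<close>, which is a combination of
  modulations and is not controlled by the shell. Terms with |n-s| \<ge> 2^m contribute at most 2 in
  total; the others form a harmonic sum centred at the integer part of \<open>s\<close>.\<close>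

lemma sum_window_le:
 "(\<Sum>n\<in>{- (2 ^ m)<..<2 ^ m :: int}. 1/(1+\<bar>real_of_int n-s\<bar>)) <= 4*real m+12"
proof -
 define I where "I = {- (2 ^ m)<..<2 ^ m :: int}"
 define n0 where "n0 = \<lfloor>s\<rfloor>"
 define A where "A = {n \<in> I. \<bar>real_of_int n-s\<bar> < 2 ^ m}"
 have finI: "finite I" by (simp add: I_def)
 have "(\<Sum>n\<in>I. 1/(1+\<bar>real_of_int n-s\<bar>)) = (\<Sum>n\<in>A. 1/(1+\<bar>real_of_int n-s\<bar>))+(\<Sum>n\<in>I-A. 1/(1+\<bar>real_of_int n-s\<bar>))"
  using finI by (subst sum.subset_diff[of A I]) (auto simp: A_def)
 also have "(\<Sum>n\<in>I-A. 1/(1+\<bar>real_of_int n-s\<bar>)) <= (\<Sum>n\<in>I-A. 1/2 ^ m)"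
  by (rule sum_mono, rule divide_left_mono) (auto simp: A_def)
 also have "... <= real (card I)/2 ^ m" using card_mono[OF finI, of "I-A"] by (simp add: divide_right_mono)
 also have "... <= 2"
 proof -
  have "real (card I) <= 2*2 ^ m"
  proof -
   have "card I = nat (2 ^ m+2 ^ m-1)" by (simp add: I_def)
   hence "real (card I) = real_of_int (2 ^ m+2 ^ m-1)" by (simp add: of_nat_nat)
   thus ?thesis by simp
  qed
  thus ?thesis by (simp add: field_simps)
 qed
 also have "(\<Sum>n\<in>A. 1/(1+\<bar>real_of_int n-s\<bar>)) <= (\<Sum>n\<in>A. 2*(1/(1+\<bar>real_of_int (n-n0)\<bar>)))"
 proof (rule sum_mono)
  fix n
  have n0: "\<bar>s-real_of_int n0\<bar> <= 1" unfolding n0_def by linarith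
  have "\<bar>real_of_int (n-n0)\<bar> <= \<bar>real_of_int n-s\<bar> + \<bar>s-real_of_int n0\<bar>"
   by (rule order_trans[OF _ abs_triangle_ineq]) simp
  hence "1+\<bar>real_of_int (n-n0)\<bar> <= 2+2*\<bar>real_of_int n-s\<bar>"
   using n0 abs_ge_zero[of "real_of_int n-s"] by argo
  hence "1+\<bar>real_of_int (n-n0)\<bar> <= 2*(1+\<bar>real_of_int n-s\<bar>)" by simp
  moreover have "1/z <= 2*(1/u)" if "0 < z" "0 < u" "u <= 2*z" for z u :: real using that by (simp add: field_simps)
  ultimately show "1/(1+\<bar>real_of_int n-s\<bar>) <= 2*(1/(1+\<bar>real_of_int (n-n0)\<bar>))"
   by (simp only: add_pos_nonneg zero_less_one abs_ge_zero)
 qed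
 also have "... = 2*(\<Sum>n\<in>(%n. n-n0) ` A. 1/(1+\<bar>real_of_int n\<bar>))"
  unfolding sum_distrib_left by (subst sum.reindex) (auto simp: inj_on_def)
 also have "(\<Sum>n\<in>(%n. n-n0) ` A. 1/(1+\<bar>real_of_int n\<bar>)) <= (\<Sum>n\<in>{- (2 ^ (m+1))<..<2 ^ (m+1) :: int}. 1/(1+\<bar>real_of_int n\<bar>))"
 proof (rule sum_mono2)
  show "(%n. n-n0) ` A \<subseteq> {- (2 ^ (m+1))<..<2 ^ (m+1)}"
  proof
   fix l assume "l \<in> (%n. n-n0) ` A"
   then obtain n where n: "n \<in> A" "l = n-n0" by auto
   have n0: "real_of_int n0 <= s" "s < real_of_int n0+1" unfolding n0_def by linarith+
   have "\<bar>real_of_int n-s\<bar> < 2 ^ m" using n by (simp add: A_def)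
   hence "real_of_int n < real_of_int (n0+1+2 ^ m)" "real_of_int (n0-2 ^ m) < real_of_int n" using n0 by auto
   hence "n < n0+1+2 ^ m" "n0-2 ^ m < n" unfolding of_int_less_iff by auto
   moreover have "(1::int) <= 2 ^ m" by simp
   ultimately have "l < 2*2 ^ m" "- (2*2 ^ m) < l" using n(2) by linarith+
   thus "l \<in> {- (2 ^ (m+1))<..<2 ^ (m+1)}" by simp
  qed
 qed auto
 also have "... <= 2*(real (m+1)+1)" by (rule sum_inverse_int_le)
 finally show ?thesis by (simp add: I_def)
qed

text \<open>The triangle inequality in squared form: Cauchy-Schwarz with the bounds
  \<open>y k\<close> themselves as weights.\<close>

lemma sum_of_shells:
 fixes y :: "nat => real"
 assumes f: "\<And>k. (%(a, b, c, d). of_bool (shell k a)*f a b c d) \<in> \<B> (freq4 L)"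
  and y: "\<And>k. 0 <= y k" "summable y" "(\<Sum>k. y k) <= Y"
  and b: "\<And>k. (hyp L (%a b c d. of_bool (shell k a)*f a b c d))^2 <= ennreal ((y k)^2)*B"
 shows "(hyp L f)^2 <= ennreal (Y^2)*B"
proof -
 have "hyp L f <= tri L (%a c d. (NN k|count_space UNIV. of_bool (shell k a)*f a (a + c-d) c d))" unfolding hyp_def
 proof (rule tri_mono)
  fix a c d
  obtain k where k: "shell k a" using shell_exists by blast
  have "f a (a + c-d) c d = of_bool (shell k a)*f a (a + c-d) c d" using k by simp
  also have "... <= (NN k|count_space UNIV. of_bool (shell k a)*f a (a + c-d) c d)"
   by (rule nn_integral_ge_point) simp
  finally show "f a (a + c-d) c d <= (NN k|count_space UNIV. of_bool (shell k a)*f a (a + c-d) c d)" .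
 qed
 also have "... = (NN k|count_space UNIV. hyp L (%a b c d. of_bool (shell k a)*f a b c d))"
  unfolding hyp_def by (rule tri_count_space, rule hyp_measurable[OF f])
 finally have "(hyp L f)^2 <= (NN k|count_space UNIV. hyp L (%a b c d. of_bool (shell k a)*f a b c d))^2"
  by (rule power_mono) simp
 also have "... <= (NN k|count_space UNIV. ennreal (y k))*(NN k|count_space UNIV. ennreal (y k)*B)"
  by (rule nn_integral_CS) (use b y(1) in \<open>auto simp: power2_eq_square ennreal_mult mult.assoc\<close>)
 also have "(NN k|count_space UNIV. ennreal (y k)*B) = (NN k|count_space UNIV. ennreal (y k))*B"
  by (rule nn_integral_multc) simp
 also have "(NN k|count_space UNIV. ennreal (y k))*((NN k|count_space UNIV. ennreal (y k))*B) =
   (NN k|count_space UNIV. ennreal (y k))^2*B" by (simp only: power2_eq_square mult.assoc)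
 also have "(NN k|count_space UNIV. ennreal (y k)) = ennreal (\<Sum>k. y k)"
  using y by (simp add: nn_integral_count_space_nat suminf_ennreal2)
 also have "(ennreal (\<Sum>k. y k))^2*B <= (ennreal Y)^2*B"
  using y by (intro mult_right_mono power_mono ennreal_leI) auto
 also have "(ennreal Y)^2 = ennreal (Y^2)" using y suminf_nonneg[of y] by (intro ennreal_power) auto
 finally show ?thesis .
qed

section \<open>The oscillatory kernel and the two estimates of the form\<close>

text \<open>Up to a constant an upper bound for the Fourier transform of the indicator of a bounded
  time interval.\<close>

definition osc_kernel :: "real => real" where
 "osc_kernel x = 1/max 1 \<bar>x\<bar>"

lemma osc_kernel_window:
 assumes "\<bar>h-n\<bar> <= 1"
 shows "osc_kernel (h-t) <= 4*(1/(1+\<bar>n-t\<bar>))"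
proof -
 have "\<bar>n-t\<bar> <= 1+\<bar>h-t\<bar>" using assms by linarith
 moreover have "1 <= max 1 \<bar>h-t\<bar>" "\<bar>h-t\<bar> <= max 1 \<bar>h-t\<bar>" by auto
 ultimately have "1+\<bar>n-t\<bar> <= 4*max 1 \<bar>h-t\<bar>" by linarith
 hence "4/(4*max 1 \<bar>h-t\<bar>) <= 4/(1+\<bar>n-t\<bar>)"
  by (intro divide_left_mono mult_pos_pos add_pos_nonneg) auto
 thus ?thesis by (simp add: osc_kernel_def)
qed

lemma measurable_osc_kernel [measurable]: "osc_kernel \<in> \<B> borel"
 unfolding osc_kernel_def[abs_def] by measurable

text \<open>Off \<open>S\<close> some frequency exceeds ga*N, so \<open>a\<close> is at least of
  this order and all shells with 6*2^k \<le> ga*N are empty. Negative powers of 2^k thereby become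
  negative powers of N.\<close>

lemma shell_multiplier_bound:
 assumes p: "I_profile s p" and s: "1/2 < s" "s < 1" and ga: "0 < ga"
 shows "\<exists>C>0. \<forall>N\<ge>1. \<forall>k a b c d. rect ga N a b c d --> sorted4 a b c d --> shell k a -->
  quotient_mult p N a b c d <=
   (if ga*N < 6*2 ^ k then C*N powr (2 * s-2)*2 powr (- (2 * s)*real k) else 0)*(norm (c-d)/bracket d)"
proof -
 obtain C where C: "0 < C" "\<And>N a b c d. 1 <= N ==> rect ga N a b c d ==> sorted4 a b c d ==>
  quotient_mult p N a b c d <= C*N powr (2 * s-2)*(1+norm a) powr (- (2 * s))*(norm (c-d)/bracket d)"
  using multiplier_bound[OF p s ga] by blast
 have "quotient_mult p N a b c d <=
   (if ga*N < 6*2 ^ k then C*N powr (2 * s-2)*2 powr (- (2 * s)*real k) else 0)*(norm (c-d)/bracket d)"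
  if N: "1 <= N" and r: "rect ga N a b c d" "sorted4 a b c d" and k: "shell k a" for N k a b c d
 proof -
  have "ga*N < 3*norm a" using rect_geometry(2)[OF r] r by (simp add: rect_def)
  also have "... < 6*2 ^ k" using k by (simp add: shell_def)
  finally have 1: "ga*N < 6*2 ^ k" .
  have "(1+norm a) powr (- (2 * s)) <= (2 ^ k) powr (- (2 * s))"
   using k s by (intro powr_mono2') (auto simp: shell_def)
  also have "... = 2 powr (- (2 * s)*real k)" by (simp add: powr_realpow[symmetric] powr_powr mult_ac)
  finally have "C*N powr (2 * s-2)*(1+norm a) powr (- (2 * s))*(norm (c-d)/bracket d) <=
   C*N powr (2 * s-2)*2 powr (- (2 * s)*real k)*(norm (c-d)/bracket d)"
   using C(1) japanese_pos[of "norm d"] by (intro mult_right_mono mult_left_mono) auto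
  thus ?thesis using C(2)[OF N r] 1 by simp
 qed
 thus ?thesis using C(1) by blast
qed

lemma sqrt_core: "(sqrt core_const*(real k+3) ^ 2)^2 = core_const*(real k+3) ^ 4"
 by (simp add: power_mult_distrib core_const_def)

lemma measurable_shell_form:
 assumes p: "I_profile s p" and s: "s < 1" and N: "0 < N" and K: "K \<in> \<B> borel"
  and g: "g1 \<in> \<B> (freq L)" "g2 \<in> \<B> (freq L)"
   "g3 \<in> \<B> (freq L)" "g4 \<in> \<B> (freq L)"
 shows "(%(a, b, c, d). of_bool (shell k a)*(of_bool (sorted4 a b c d)*mult_form p ga N K g1 g2 g3 g4 a b c d)) \<in> \<B> (freq4 L)"
proof -
 note freq4_components [measurable] measurable_mult_form[OF p s N K g, of ga, unfolded case_prod_beta', measurable]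
 show ?thesis unfolding shell_def case_prod_beta' by measurable
qed

text \<open>The decisive estimate: the oscillation in time is only used through the kernel, and the
 loss of a power of \<open>log N\<close> in each shell is absorbed by \<open>N powr \<epsilon>\<close>.\<close>

lemma oscillatory_estimate:
 assumes p: "I_profile s p" and s: "1/2 < s" "s < 1" and ga: "0 < ga" and \<epsilon>: "0 < \<epsilon>"
 shows "\<exists>C>0. \<forall>L\<ge>1. \<forall>N\<ge>1. \<forall>t. \<forall>(g1 :: real \<times> real => ennreal) g2 g3 g4. g1 \<in> \<B> (freq L) --> g2 \<in> \<B> (freq L) -->
  g3 \<in> \<B> (freq L) --> g4 \<in> \<B> (freq L) -->
  (hyp L (mult_form p ga N (%h. ennreal (osc_kernel (h-t))) g1 g2 g3 g4))^2 <= ennreal ((C*N powr (-2+\<epsilon>))^2) *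
   (mass L g1*mass L g2*mass L g3*mass L g4)"
proof -
 obtain C where C: "0 < C" "\<And>N k a b c d. 1 <= N ==> rect ga N a b c d ==> sorted4 a b c d ==> shell k a ==>
  quotient_mult p N a b c d <=
   (if ga*N < 6*2 ^ k then C*N powr (2 * s-2)*2 powr (- (2 * s)*real k) else 0)*(norm (c-d)/bracket d)"
  using shell_multiplier_bound[OF p s ga] by blast
 \<comment> \<open>The decay 2^(-2s*k) is divided: the exponent \<open>et\<close> makes the sum over
   shells converge in spite of the logarithms, and the rest is traded for a power of N. The minimum
   with 1 keeps \<open>et\<close> below 2*s.\<close>
 define et where "et = min \<epsilon> 1"
 have et: "0 < et" "et <= \<epsilon>" "et < 2 * s" using \<epsilon> s by (auto simp: et_def)
 define Z where "Z = (\<Sum>k. (real k+3) ^ 3*2 powr (- et*real k))"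
 have Z: "0 < Z" unfolding Z_def using summable_cube_geometric[OF et(1)] by (intro suminf_pos) auto
 define D where "D = 8*(sqrt core_const*48*C*(ga/6) powr (et-2 * s)*Z)"
 have D: "0 < D" using C(1) Z ga by (simp add: D_def core_const_def)
 have sorted_est: "(hyp L (%a b c d. of_bool (sorted4 a b c d)*mult_form p ga N (%h. ennreal (osc_kernel (h-t))) g1 g2 g3 g4 a b c d))^2
   <= ennreal ((D/8*N powr (-2+\<epsilon>))^2) * (mass L g1*mass L g2*mass L g3*mass L g4)"
  if L: "1 <= L" and N: "1 <= N" and g: "g1 \<in> \<B> (freq L)" "g2 \<in> \<B> (freq L)"
   "g3 \<in> \<B> (freq L)" "g4 \<in> \<B> (freq L)" for L N t g1 g2 g3 g4
 proof -
  have N0: "0 < N" using N by simp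
  define v where "v k = (if ga*N < 6*2 ^ k then C*N powr (2 * s-2)*2 powr (- (2 * s)*real k) else 0)" for k :: nat
  have v0: "0 <= v k" for k using C(1) by (simp add: v_def)
  define S where "S k = 4*(4*real (k+5)+12)" for k
  define y where "y k = S k * v k*(sqrt core_const*(real k+3) ^ 2)" for k
  define x where "x k = (sqrt core_const*48*C*(ga/6) powr (et-2 * s)*N powr (-2+\<epsilon>))*((real k+3) ^ 3*2 powr (- et*real k))" for k
  have y0: "0 <= y k" for k using v0 by (simp add: y_def S_def core_const_def)
  have yx: "y k <= x k" for k
  proof (cases "ga*N < 6*2 ^ k")
   case False
   thus ?thesis using C(1) by (simp add: y_def x_def v_def core_const_def)
  next
   case True
   \<comment> \<open>The exponent et - 2s is negative, so 2^k may be replaced by its lower bound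
     ga/6*N. Together with N^(2s-2) this gives N^(-2+et), and \<open>s\<close> disappears from the
     exponent.\<close>
   have "2 powr (- (2 * s)*real k) = (2 ^ k) powr (et-2 * s)*2 powr (- et*real k)"
    by (simp add: powr_realpow[symmetric] powr_powr powr_add[symmetric] algebra_simps)
   also have "(2 ^ k) powr (et-2 * s) <= (ga/6*N) powr (et-2 * s)" using True et ga N0 by (intro powr_mono2') auto
   also have "... = (ga/6) powr (et-2 * s)*N powr (et-2 * s)" by (subst powr_mult) (use ga N0 in auto)
   finally have "2 powr (- (2 * s)*real k) <= (ga/6) powr (et-2 * s)*N powr (et-2 * s)*2 powr (- et*real k)"
    by (simp add: mult_right_mono)
   hence "N powr (2 * s-2)*2 powr (- (2 * s)*real k) <=
     N powr (2 * s-2)*((ga/6) powr (et-2 * s)*N powr (et-2 * s)*2 powr (- et*real k))" by (rule mult_left_mono) simp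
   also have "... = (ga/6) powr (et-2 * s)*N powr (-2+et)*2 powr (- et*real k)"
   proof -
    have "N powr (2 * s-2)*N powr (et-2 * s) = N powr (-2+et)" by (simp add: powr_add[symmetric])
    thus ?thesis by (simp add: mult_ac)
   qed
   also have "... <= (ga/6) powr (et-2 * s)*N powr (-2+\<epsilon>)*2 powr (- et*real k)"
    using et N by (intro mult_right_mono mult_left_mono powr_mono) auto
   finally have "v k <= C*((ga/6) powr (et-2 * s)*N powr (-2+\<epsilon>)*2 powr (- et*real k))"
    using True C(1) by (simp add: v_def mult.assoc)
   moreover have "S k <= 48*(real k+3)" by (simp add: S_def)
   ultimately have "y k <= (48*(real k+3))*(C*((ga/6) powr (et-2 * s)*N powr (-2+\<epsilon>)*2 powr (- et*real k))) *
     (sqrt core_const*(real k+3) ^ 2)"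
    unfolding y_def using v0 by (intro mult_right_mono mult_mono) (auto simp: core_const_def)
   also have "... = x k" by (simp add: x_def power3_eq_cube power2_eq_square mult_ac)
   finally show ?thesis .
  qed
  have sx: "summable x" unfolding x_def by (intro summable_mult summable_cube_geometric et)
  have sy: "summable y" using summable_comparison_test'[OF sx, of 0 y] y0 yx by auto
  have "(\<Sum>k. y k) <= (\<Sum>k. x k)" by (intro suminf_le yx sy sx)
  also have "... = (sqrt core_const*48*C*(ga/6) powr (et-2 * s)*N powr (-2+\<epsilon>))*Z"
   unfolding x_def Z_def by (intro suminf_mult summable_cube_geometric et)
  also have "... = D/8*N powr (-2+\<epsilon>)" by (simp add: D_def mult_ac)
  finally have Y: "(\<Sum>k. y k) <= D/8*N powr (-2+\<epsilon>)" .
  show ?thesis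
  proof (rule sum_of_shells[OF measurable_shell_form[OF p s(2) N0 _ g] y0 sy Y])
   fix k
   have "(hyp L (%a b c d. of_bool (shell k a)*(of_bool (sorted4 a b c d)*mult_form p ga N (%h. ennreal (osc_kernel (h-t))) g1 g2 g3 g4 a b c d)))^2
    <= ennreal ((S k * v k)^2*(core_const*(real k+3) ^ 4)) * (mass L g1*mass L g2*mass L g3*mass L g4)"
   proof (rule shell_estimate[OF L g v0, where w = "%n. 4*(1/(1+\<bar>real_of_int n-t\<bar>))"])
    fix a b c d assume "rect ga N a b c d" "sorted4 a b c d" "shell k a"
    thus "quotient_mult p N a b c d <= v k*(norm (c-d)/bracket d)" unfolding v_def by (rule C(2)[OF N])
   next
    fix h n assume "\<bar>h-real_of_int n\<bar> <= 1"
    thus "ennreal (osc_kernel (h-t)) <= ennreal (4*(1/(1+\<bar>real_of_int n-t\<bar>)))"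
     by (intro ennreal_leI osc_kernel_window)
   next
    show "(\<Sum>n\<in>{- (2 ^ (k+5))<..<2 ^ (k+5)}. 4*(1/(1+\<bar>real_of_int n-t\<bar>))) <= S k"
     unfolding S_def sum_distrib_left[symmetric] using sum_window_le[where m = "k+5" and s = t] by (rule mult_left_mono) simp
   qed simp
   also have "(S k * v k)^2*(core_const*(real k+3) ^ 4) = (y k)^2"
    unfolding y_def power_mult_distrib[of "S k * v k"] sqrt_core ..
   finally show "(hyp L (%a b c d. of_bool (shell k a)*(of_bool (sorted4 a b c d)*mult_form p ga N (%h. ennreal (osc_kernel (h-t))) g1 g2 g3 g4 a b c d)))^2
    <= ennreal ((y k)^2) * (mass L g1*mass L g2*mass L g3*mass L g4)" .
  qed measurable
 qed
 have "(hyp L (mult_form p ga N (%h. ennreal (osc_kernel (h-t))) g1 g2 g3 g4))^2 <= ennreal ((D*N powr (-2+\<epsilon>))^2) *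
   (mass L g1*mass L g2*mass L g3*mass L g4)"
  if L: "1 <= L" and N: "1 <= N" and g: "g1 \<in> \<B> (freq L)" "g2 \<in> \<B> (freq L)"
   "g3 \<in> \<B> (freq L)" "g4 \<in> \<B> (freq L)" for L N t g1 g2 g3 g4
 proof -
  have N0: "0 < N" using N by simp
  \<comment> \<open>All translates of the kernel at once: since the kernel is even, a reflection
    turns the shift t into -t.\<close>
  define \<K> where "\<K> = range (%t h. ennreal (osc_kernel (h-t)))"
  have even: "osc_kernel (- h-t) = osc_kernel (h-(- t))" for h t
   unfolding osc_kernel_def by (metis abs_minus_cancel diff_minus_eq_add minus_diff_eq uminus_add_conv_diff add.commute)
  have "(hyp L (mult_form p ga N (%h. ennreal (osc_kernel (h-t))) g1 g2 g3 g4))^2 <= 64*(ennreal ((D/8*N powr (-2+\<epsilon>))^2) *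
   (mass L g1*mass L g2*mass L g3*mass L g4))"
  proof (rule hyp_symmetrize[OF p s(2) N0, where \<K> = \<K>])
   fix K assume "K \<in> \<K>"
   then obtain t where K: "K = (%h. ennreal (osc_kernel (h-t)))" by (auto simp: \<K>_def)
   have "(%h. K (- h)) = (%h. ennreal (osc_kernel (h-(- t))))" unfolding K even ..
   hence "(%h. K (- h)) \<in> \<K>" unfolding \<K>_def by (rule range_eqI)
   thus "K \<in> \<B> borel \<and> (%h. K (- h)) \<in> \<K>" by (simp add: K)
  next
   fix K and g1 g2 g3 g4 :: "real \<times> real => ennreal" assume "K \<in> \<K>" "g1 \<in> \<B> (freq L)" "g2 \<in> \<B> (freq L)"
   "g3 \<in> \<B> (freq L)" "g4 \<in> \<B> (freq L)"
   thus "(hyp L (%a b c d. of_bool (sorted4 a b c d)*mult_form p ga N K g1 g2 g3 g4 a b c d))^2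
   <= ennreal ((D/8*N powr (-2+\<epsilon>))^2) * (mass L g1*mass L g2*mass L g3*mass L g4)"
    using sorted_est[OF L N] by (auto simp: \<K>_def)
  qed (use g in \<open>auto simp: \<K>_def\<close>)
  also have "... = (ennreal 64*ennreal ((D/8*N powr (-2+\<epsilon>))^2)) * (mass L g1*mass L g2*mass L g3*mass L g4)"
   by (simp add: mult.assoc)
  also have "ennreal 64*ennreal ((D/8*N powr (-2+\<epsilon>))^2) = ennreal (64*(D/8*N powr (-2+\<epsilon>))^2)"
   by (rule ennreal_mult[symmetric]) auto
  also have "64*(D/8*N powr (-2+\<epsilon>))^2 = (D*N powr (-2+\<epsilon>))^2" by (simp add: power_mult_distrib power_divide)
  finally show ?thesis .
 qed
 thus ?thesis using D by blast
qed

text \<open>Absolute convergence on the hyperplane; this is where \<open>s > 1/2\<close> enters.\<close>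

lemma absolute_estimate:
 assumes p: "I_profile s p" and s: "1/2 < s" "s < 1" and ga: "0 < ga" and N: "1 <= N"
 shows "\<exists>C. \<forall>L\<ge>1. \<forall>(g1 :: real \<times> real => ennreal) g2 g3 g4. g1 \<in> \<B> (freq L) --> g2 \<in> \<B> (freq L) -->
  g3 \<in> \<B> (freq L) --> g4 \<in> \<B> (freq L) -->
  (hyp L (mult_form p ga N (%_. 1) g1 g2 g3 g4))^2 <= ennreal C * (mass L g1*mass L g2*mass L g3*mass L g4)"
proof -
 have N0: "0 < N" using N by simp
 obtain C where C: "0 < C" "\<And>k a b c d. rect ga N a b c d ==> sorted4 a b c d ==> shell k a ==>
  quotient_mult p N a b c d <=
   (if ga*N < 6*2 ^ k then C*N powr (2 * s-2)*2 powr (- (2 * s)*real k) else 0)*(norm (c-d)/bracket d)"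
  using shell_multiplier_bound[OF p s ga] N by blast
 define v where "v k = (if ga*N < 6*2 ^ k then C*N powr (2 * s-2)*2 powr (- (2 * s)*real k) else 0)" for k :: nat
 have v0: "0 <= v k" for k using C(1) by (simp add: v_def)
 \<comment> \<open>With the constant kernel every one of the fewer than 64*2^k windows counts fully.
   Against the decay 2^(-2s*k) this leaves 2^(-(2s-1)*k).\<close>
 define S where "S k = 64*(2::real) ^ k" for k :: nat
 define y where "y k = S k * v k*(sqrt core_const*(real k+3) ^ 2)" for k
 define x where "x k = (sqrt core_const*64*C*N powr (2 * s-2))*((real k+3) ^ 3*2 powr (- (2 * s-1)*real k))" for k
 have y0: "0 <= y k" for k using v0 by (simp add: y_def S_def core_const_def)
 have yx: "y k <= x k" for k
 proof -
  have "v k <= C*N powr (2 * s-2)*2 powr (- (2 * s)*real k)" using C(1) by (simp add: v_def)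
  hence "y k <= S k*(C*N powr (2 * s-2)*2 powr (- (2 * s)*real k))*(sqrt core_const*(real k+3) ^ 2)"
   unfolding y_def by (intro mult_right_mono mult_left_mono) (auto simp: S_def core_const_def)
  also have "... = (sqrt core_const*64*C*N powr (2 * s-2))*((real k+3) ^ 2*(2 ^ k*2 powr (- (2 * s)*real k)))"
   by (simp add: S_def mult_ac)
  also have "2 ^ k*2 powr (- (2 * s)*real k) = 2 powr (- (2 * s-1)*real k)"
   by (simp add: powr_realpow[symmetric] powr_add[symmetric] algebra_simps)
  also have "(sqrt core_const*64*C*N powr (2 * s-2))*((real k+3) ^ 2*2 powr (- (2 * s-1)*real k)) <= x k"
   unfolding x_def using C(1) by (intro mult_left_mono mult_right_mono power_increasing) (auto simp: core_const_def)
  finally show ?thesis .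
 qed
 have sx: "summable x" unfolding x_def using s by (intro summable_mult summable_cube_geometric) auto
 have sy: "summable y" using summable_comparison_test'[OF sx, of 0 y] y0 yx by auto
 define Y where "Y = (\<Sum>k. y k)"
 have sorted_est: "(hyp L (%a b c d. of_bool (sorted4 a b c d)*mult_form p ga N (%_. 1) g1 g2 g3 g4 a b c d))^2
   <= ennreal (Y^2) * (mass L g1*mass L g2*mass L g3*mass L g4)"
  if L: "1 <= L" and g: "g1 \<in> \<B> (freq L)" "g2 \<in> \<B> (freq L)"
   "g3 \<in> \<B> (freq L)" "g4 \<in> \<B> (freq L)" for L g1 g2 g3 g4
 proof (rule sum_of_shells[OF measurable_shell_form[OF p s(2) N0 _ g] y0 sy])
  show "suminf y <= Y" by (simp add: Y_def)
  fix k
  have "(hyp L (%a b c d. of_bool (shell k a)*(of_bool (sorted4 a b c d)*mult_form p ga N (%_. 1) g1 g2 g3 g4 a b c d)))^2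
    <= ennreal ((S k * v k)^2*(core_const*(real k+3) ^ 4)) * (mass L g1*mass L g2*mass L g3*mass L g4)"
  proof (rule shell_estimate[OF L g v0, where w = "%n. 1"])
   fix a b c d assume "rect ga N a b c d" "sorted4 a b c d" "shell k a"
   thus "quotient_mult p N a b c d <= v k*(norm (c-d)/bracket d)" unfolding v_def by (rule C(2))
  next
   have "card {- (2 ^ (k+5))<..<(2 ^ (k+5)::int)} = nat (2 ^ (k+5)+2 ^ (k+5)-1)" by simp
   hence "real (card {- (2 ^ (k+5))<..<(2 ^ (k+5)::int)}) = real_of_int (2 ^ (k+5)+2 ^ (k+5)-1)"
    by (simp only: of_nat_nat) (simp add: of_nat_nat)
   thus "(\<Sum>n\<in>{- (2 ^ (k+5))<..<2 ^ (k+5)::int}. 1) <= S k" by (simp add: S_def power_add)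
  qed auto
  also have "(S k * v k)^2*(core_const*(real k+3) ^ 4) = (y k)^2"
   unfolding y_def power_mult_distrib[of "S k * v k"] sqrt_core ..
  finally show "(hyp L (%a b c d. of_bool (shell k a)*(of_bool (sorted4 a b c d)*mult_form p ga N (%_. 1) g1 g2 g3 g4 a b c d)))^2
    <= ennreal ((y k)^2) * (mass L g1*mass L g2*mass L g3*mass L g4)" .
 qed simp
 have "(hyp L (mult_form p ga N (%_. 1) g1 g2 g3 g4))^2 <= ennreal (64*Y^2) *
   (mass L g1*mass L g2*mass L g3*mass L g4)"
  if L: "1 <= L" and g: "g1 \<in> \<B> (freq L)" "g2 \<in> \<B> (freq L)"
   "g3 \<in> \<B> (freq L)" "g4 \<in> \<B> (freq L)" for L g1 g2 g3 g4
 proof -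
  have "(hyp L (mult_form p ga N (%_. 1) g1 g2 g3 g4))^2 <= 64*(ennreal (Y^2) *
   (mass L g1*mass L g2*mass L g3*mass L g4))"
   by (rule hyp_symmetrize[OF p s(2) N0, where \<K> = "{%_. 1}"]) (use sorted_est[OF L] g in auto)
  also have "... = (ennreal 64*ennreal (Y^2)) * (mass L g1*mass L g2*mass L g3*mass L g4)" by (simp add: mult.assoc)
  also have "ennreal 64*ennreal (Y^2) = ennreal (64*Y^2)" by (rule ennreal_mult[symmetric]) auto
  finally show ?thesis .
 qed
 thus ?thesis by blast
qed

section \<open>Square-integrable functions and isometric kernels\<close>

lemma measurable_cnj [measurable]: "cnj \<in> \<B> borel" by (intro borel_measurable_continuous_onI continuous_intros)

definition sqn :: "'a measure => ('a => complex) => ennreal" where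
 "sqn M f = (NN x|M. ennreal ((cmod (f x))^2))"

lemma square_integrable_iff:
 "f \<in> L2 M \<longleftrightarrow> f \<in> \<B> M \<and> sqn M f < \<infinity>"
proof
 assume "f \<in> L2 M"
 thus "f \<in> \<B> M \<and> sqn M f < \<infinity>"
  unfolding square_integrable_def sqn_def by (auto simp: integrable_iff_bounded)
next
 assume f: "f \<in> \<B> M \<and> sqn M f < \<infinity>"
 hence [measurable]: "f \<in> \<B> M" by simp
 have "(%x. (cmod (f x))^2) \<in> \<B> M" by measurable
 with f show "f \<in> L2 M" unfolding square_integrable_def sqn_def by (auto simp: integrable_iff_bounded)
qed

lemma sqn_cong_AE: "AE x in M. f x = g x ==> sqn M f = sqn M g" unfolding sqn_def by (rule nn_integral_cong_AE) auto

lemma sqn_mono: "(\<And>x. x \<in> space M ==> cmod (f x) <= cmod (g x)) ==> sqn M f <= sqn M g"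
 unfolding sqn_def by (intro nn_integral_mono ennreal_leI power_mono) auto

lemma sqn_minus_commute: "sqn M (%x. f x-g x) = sqn M (%x. g x-f x)"
 unfolding sqn_def by (simp add: norm_minus_commute)

lemma cmod_add_power2_le: "(cmod (a+b))^2 <= 2*(cmod a)^2+2*(cmod b)^2"
proof -
 have "(cmod (a+b))^2 <= (cmod a + cmod b)^2" by (intro power_mono norm_triangle_ineq) auto
 also have "... <= 2*(cmod a)^2+2*(cmod b)^2" using sum_squares_bound[of "cmod a" "cmod b"] by (simp add: power2_sum)
 finally show ?thesis .
qed

lemma sqn_add_le:
 assumes [measurable]: "f \<in> \<B> M" "g \<in> \<B> M"
 shows "sqn M (%x. f x+g x) <= 2 * sqn M f+2 * sqn M g"
proof -
 have "sqn M (%x. f x+g x) <= (NN x|M. 2*ennreal ((cmod (f x))^2)+2*ennreal ((cmod (g x))^2))" unfolding sqn_def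
 proof (rule nn_integral_mono)
  fix x
  have "ennreal ((cmod (f x+g x))^2) <= ennreal (2*(cmod (f x))^2+2*(cmod (g x))^2)"
   by (intro ennreal_leI cmod_add_power2_le)
  thus "ennreal ((cmod (f x+g x))^2) <= 2*ennreal ((cmod (f x))^2)+2*ennreal ((cmod (g x))^2)"
   by (simp add: ennreal_mult)
 qed
 thus ?thesis unfolding sqn_def by (simp add: nn_integral_add nn_integral_cmult)
qed

lemma sqn_triangle:
 assumes [measurable]: "f \<in> \<B> M" "g \<in> \<B> M" "h \<in> \<B> M"
 shows "sqn M (%x. f x-h x) <= 2 * sqn M (%x. f x-g x)+2 * sqn M (%x. g x-h x)"
proof -
 have "sqn M (%x. (f x-g x)+(g x-h x)) <= 2 * sqn M (%x. f x-g x)+2 * sqn M (%x. g x-h x)"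
  by (intro sqn_add_le) measurable
 thus ?thesis by simp
qed

lemma square_integrable_add:
 assumes "f \<in> L2 M" "g \<in> L2 M"
 shows "(%x. f x+g x) \<in> L2 M"
proof -
 have "sqn M (%x. f x+g x) <= 2 * sqn M f+2 * sqn M g"
  using assms by (intro sqn_add_le) (auto simp: square_integrable_iff)
 also have "... < \<infinity>" using assms by (simp add: square_integrable_iff ennreal_mult_less_top)
 finally show ?thesis using assms by (auto simp: square_integrable_iff)
qed

lemma square_integrable_uminus:
 "f \<in> L2 M ==> (%x. - f x) \<in> L2 M" by (auto simp: square_integrable_iff sqn_def)

lemma square_integrable_diff:
 assumes "f \<in> L2 M" "g \<in> L2 M"
 shows "(%x. f x-g x) \<in> L2 M"
 using square_integrable_add[OF assms(1) square_integrable_uminus[OF assms(2)]] by simp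

lemma sqn_zero_AE:
 assumes [measurable]: "f \<in> \<B> M" "g \<in> \<B> M"
  and 0: "sqn M (%x. f x-g x) = 0"
 shows "AE x in M. f x = g x"
proof -
 have "AE x in M. ennreal ((cmod (f x-g x))^2) = 0"
  using 0 unfolding sqn_def by (subst (asm) nn_integral_0_iff_AE) measurable
 thus ?thesis by eventually_elim simp
qed

text \<open>Riesz--Fischer: a subsequence with summable increments converges almost everywhere, and
 Fatou's lemma identifies the limit.\<close>

lemma L2_complete:
 fixes f :: "nat => 'a => complex"
 assumes f: "\<And>n. f n \<in> L2 M"
  and cauchy: "\<And>e::real. 0 < e ==> \<exists>N. \<forall>m\<ge>N. \<forall>n\<ge>N. sqn M (%x. f m x-f n x) < ennreal e"
 obtains g where "g \<in> L2 M" "(%n. sqn M (%x. f n x-g x)) -->> 0"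
proof -
 have [measurable]: "f n \<in> \<B> M" for n using f by (simp add: square_integrable_iff)
 have "\<forall>k::nat. \<exists>N. \<forall>m\<ge>N. \<forall>n\<ge>N. sqn M (%x. f m x-f n x) < ennreal (1/4 ^ k)"
  using cauchy by simp
 then obtain N where N: "\<And>k m n. N k <= m ==> N k <= n ==> sqn M (%x. f m x-f n x) < ennreal (1/4 ^ k)" by metis
 define r where "r k = (\<Sum>j\<le>k. N j)+k" for k
 have r: "N k <= r k" "r k <= r (Suc k)" "k <= r k" for k
  by (auto simp: r_def intro: order_trans[OF member_le_sum[of k "{..k}" N]])
 have rinc: "sqn M (%x. f (r (Suc k)) x-f (r k) x) < ennreal (1/4 ^ k)" for k by (rule N) (use r[of k] in auto)
 define d where "d k x = cmod (f (r (Suc k)) x-f (r k) x)" for k x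
 have [measurable]: "d k \<in> \<B> M" for k unfolding d_def by measurable
 have "(NN x|M. (\<Sum>k. ennreal (2 ^ k*(d k x)^2))) = (\<Sum>k. (NN x|M. ennreal (2 ^ k*(d k x)^2)))"
  by (rule nn_integral_suminf) measurable
 also have "... <= (\<Sum>k. ennreal ((1/2) ^ k))"
 proof (rule suminf_le)
  fix k
  have "(NN x|M. ennreal (2 ^ k*(d k x)^2)) = ennreal (2 ^ k) * sqn M (%x. f (r (Suc k)) x-f (r k) x)"
   unfolding sqn_def d_def by (simp add: ennreal_mult nn_integral_cmult)
  also have "... <= ennreal (2 ^ k)*ennreal (1/4 ^ k)" by (intro mult_left_mono less_imp_le rinc) auto
  also have "... = ennreal ((1/2) ^ k)"
   by (simp add: ennreal_mult[symmetric] power_divide field_simps flip: power_mult_distrib)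
  finally show "(NN x|M. ennreal (2 ^ k*(d k x)^2)) <= ennreal ((1/2) ^ k)" .
 qed auto
 also have "... = ennreal (\<Sum>k. (1/2) ^ k)" by (rule suminf_ennreal2) auto
 also have "... < \<infinity>" by simp
 finally have "AE x in M. (\<Sum>k. ennreal (2 ^ k*(d k x)^2)) \<noteq> \<infinity>"
  by (intro nn_integral_PInf_AE) auto
 hence conv: "AE x in M. convergent (%k. f (r k) x)"
 proof eventually_elim
  case (elim x)
  hence s2: "summable (%k. 2 ^ k*(d k x)^2)" by (intro summable_suminf_not_top) auto
  \<comment> \<open>Only the weighted squares of the increments are known to be summable; this
    inequality passes from them to the increments themselves.\<close>
  have dk: "d k x <= 2 ^ k*(d k x)^2+(1/2) ^ k" for k
  proof -
   have "2*(2 ^ k*d k x) <= (2 ^ k*d k x)^2+1" using sum_squares_bound[of "2 ^ k*d k x" 1] by simp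
   hence "2 ^ k*d k x <= (2 ^ k*d k x)^2+1" using zero_le_power2[of "2 ^ k*d k x"] by linarith
   hence "(2 ^ k*d k x)/2 ^ k <= ((2 ^ k*d k x)^2+1)/2 ^ k" by (rule divide_right_mono) simp
   thus ?thesis by (simp add: power_mult_distrib power2_eq_square[of "2 ^ k"] add_divide_distrib power_divide)
  qed
  have "summable (%k. 2 ^ k*(d k x)^2+(1/2) ^ k)" by (intro summable_add s2 summable_geometric) simp
  hence "summable (%k. norm (f (r (Suc k)) x-f (r k) x))"
   by (rule summable_comparison_test'[where N = 0]) (use dk in \<open>auto simp: d_def\<close>)
  hence "summable (%k. f (r (Suc k)) x-f (r k) x)" by (rule summable_norm_cancel)
  hence "convergent (%n. \<Sum>k<n. f (r (Suc k)) x-f (r k) x)" by (rule summable_iff_convergent[THEN iffD1])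
  hence "convergent (%n. f (r n) x-f (r 0) x)" by (simp add: sum_lessThan_telescope[of "%k. f (r k) x"])
  thus ?case using convergent_add[OF _ convergent_const[of "f (r 0) x"], of "%n. f (r n) x-f (r 0) x"] by simp
 qed
 define g where "g x = lim (%k. f (r k) x)" for x
 have [measurable]: "g \<in> \<B> M" unfolding g_def by measurable
 have lim: "AE x in M. (%k. f (r k) x) -->> g x" using conv by eventually_elim (simp add: g_def convergent_LIMSEQ_iff)
 have small: "\<exists>N. \<forall>m\<ge>N. sqn M (%x. f m x-g x) <= ennreal e" if e: "0 < e" for e :: real
 proof -
  obtain N0 where N0: "\<And>m n. N0 <= m ==> N0 <= n ==> sqn M (%x. f m x-f n x) < ennreal e" using cauchy[OF e] by blast
  have "sqn M (%x. f m x-g x) <= ennreal e" if m: "N0 <= m" for m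
  proof -
   have "sqn M (%x. f m x-g x) = (NN x|M. liminf (%k. ennreal ((cmod (f m x-f (r k) x))^2)))" unfolding sqn_def
   proof (rule nn_integral_cong_AE)
    show "AE x in M. ennreal ((cmod (f m x-g x))^2) = liminf (%k. ennreal ((cmod (f m x-f (r k) x))^2))" using lim
    proof eventually_elim
     case (elim x)
     hence "(%k. ennreal ((cmod (f m x-f (r k) x))^2)) -->> ennreal ((cmod (f m x-g x))^2)"
      by (intro tendsto_ennrealI tendsto_intros)
     from lim_imp_Liminf[OF _ this] show ?case by simp
    qed
   qed
   also have "... <= liminf (%k. (NN x|M. ennreal ((cmod (f m x-f (r k) x))^2)))"
    by (rule nn_integral_liminf) measurable
   also have "... <= ennreal e"
   proof (rule Liminf_le)
    show "\<forall>\<^sub>F k in sequentially. (NN x|M. ennreal ((cmod (f m x-f (r k) x))^2)) <= ennreal e"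
     using eventually_ge_at_top[of N0]
    proof eventually_elim
     case (elim k)
     hence "N0 <= r k" using r(3)[of k] by simp
     from N0[OF m this] show ?case by (simp add: sqn_def less_imp_le)
    qed
   qed simp
   finally show ?thesis .
  qed
  thus ?thesis by blast
 qed
 have "(%n. sqn M (%x. f n x-g x)) -->> 0"
 proof (rule order_tendstoI)
  fix a :: ennreal assume "a < 0"
  thus "\<forall>\<^sub>F n in sequentially. a < sqn M (%x. f n x-g x)" by simp
 next
  fix a :: ennreal assume a: "0 < a"
  then obtain e where e: "0 < e" "ennreal e < a"
  proof -
   obtain b where "0 < b" "b < a" using dense[OF a] by blast
   moreover then obtain e where "b = ennreal e" "0 <= e" by (cases b) (auto simp: top_unique)
   ultimately show ?thesis using that[of e] by (auto simp: ennreal_less_zero_iff)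
  qed
  obtain N where "\<forall>m\<ge>N. sqn M (%x. f m x-g x) <= ennreal e" using small[OF e(1)] by blast
  thus "\<forall>\<^sub>F n in sequentially. sqn M (%x. f n x-g x) < a"
   using e(2) by (intro eventually_sequentiallyI[of N]) (auto intro: le_less_trans)
 qed
 moreover have "g \<in> L2 M"
 proof -
  obtain N where N: "\<forall>m\<ge>N. sqn M (%x. f m x-g x) <= ennreal 1" using small[of 1] by auto
  have "(%x. f N x-g x) \<in> L2 M" using N by (auto simp: square_integrable_iff intro: le_less_trans)
  from square_integrable_diff[OF f[of N] this] show ?thesis by simp
 qed
 ultimately show thesis using that by blast
qed

lemma cmod_diff_power2: "(cmod (a-b))^2 = (cmod a)^2+(cmod b)^2-2 * Re (a * cnj b)"
 unfolding cmod_power2 by (simp add: power2_eq_square algebra_simps)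

lemma integrable_mult_cnj:
 assumes "f \<in> L2 M" "g \<in> L2 M"
 shows "integrable M (%x. f x * cnj (g x))"
proof (rule Bochner_Integration.integrable_bound)
 show "integrable M (%x. (cmod (f x))^2+(cmod (g x))^2)" using assms by (auto simp: square_integrable_def)
 have [measurable]: "f \<in> \<B> M" "g \<in> \<B> M" using assms by (auto simp: square_integrable_def)
 show "(%x. f x * cnj (g x)) \<in> \<B> M" by measurable
 have "cmod (f x) * cmod (g x) <= (cmod (f x))^2+(cmod (g x))^2" for x
 proof -
  have "2*(cmod (f x) * cmod (g x)) <= (cmod (f x))^2+(cmod (g x))^2"
   using sum_squares_bound[of "cmod (f x)" "cmod (g x)"] by (simp add: mult.assoc)
  moreover have "0 <= cmod (f x) * cmod (g x)" by simp
  ultimately show ?thesis by linarith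
 qed
 thus "AE x in M. norm (f x * cnj (g x)) <= norm ((cmod (f x))^2+(cmod (g x))^2)" by (simp add: norm_mult)
qed

lemma sqn_eq_integral: "f \<in> L2 M ==> sqn M f = ennreal (LINT x|M. (cmod (f x))^2)"
 unfolding sqn_def square_integrable_def by (subst nn_integral_eq_integral) auto

lemma integral_cmod_diff_power2:
 assumes "f \<in> L2 M" "g \<in> L2 M"
 shows "(LINT x|M. (cmod (f x-g x))^2) =
  (LINT x|M. (cmod (f x))^2)+(LINT x|M. (cmod (g x))^2)-2 * Re (LINT x|M. f x * cnj (g x))"
proof -
 have i: "integrable M (%x. (cmod (f x))^2)" "integrable M (%x. (cmod (g x))^2)"
  using assms by (auto simp: square_integrable_def)
 have m: "integrable M (%x. f x * cnj (g x))" by (rule integrable_mult_cnj[OF assms])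
 define r where "r x = Re (f x * cnj (g x))" for x
 have r: "integrable M r" "Re (LINT x|M. f x * cnj (g x)) = (LINT x|M. r x)"
  unfolding r_def using integrable_Re[OF m] integral_Re[OF m] by auto
 have "(LINT x|M. (cmod (f x-g x))^2) = (LINT x|M. (cmod (f x))^2+(cmod (g x))^2-2*r x)"
  by (simp only: cmod_diff_power2 r_def)
 thus ?thesis using i r by simp
qed

lemma sqn_diff_expand:
 assumes "f \<in> L2 M" "g \<in> L2 M"
 shows "sqn M (%x. f x-g x) =
  ennreal ((LINT x|M. (cmod (f x))^2)+(LINT x|M. (cmod (g x))^2)-2 * Re (LINT x|M. f x * cnj (g x)))"
 by (subst sqn_eq_integral[OF square_integrable_diff[OF assms]]) (simp only: integral_cmod_diff_power2[OF assms])

text \<open>A kernel defines an isometry of \<open>L\<^sup>2\<close>, where the integral is only taken for integrable functions.\<close>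

definition isometric_kernel :: "'a measure => 'b measure => ('a => 'b => complex) => bool" where
 "isometric_kernel M M' k \<longleftrightarrow> sigma_finite_measure M \<and> sigma_finite_measure M' \<and>
   (%(x, y). k x y) \<in> \<B> (M \<otimes> M') \<and> (\<exists>B. \<forall>x y. cmod (k x y) <= B) \<and>
   (\<forall>f. integrable M f --> f \<in> L2 M --> sqn M' (%y. LINT x|M. f x * k x y) = sqn M f)"

lemma isometric_kernel_cnj:
 assumes "isometric_kernel M M' k"
 shows "isometric_kernel M M' (%x y. cnj (k x y))"
proof -
 have "(%(x, y). cnj (k x y)) \<in> \<B> (M \<otimes> M')"
 proof -
  have "(%z. cnj (case z of (x, y) => k x y)) \<in> \<B> (M \<otimes> M')"
   using assms by (intro measurable_compose[OF _ measurable_cnj]) (auto simp: isometric_kernel_def)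
  thus ?thesis by (simp add: case_prod_beta')
 qed
 moreover have "sqn M' (%y. LINT x|M. f x * cnj (k x y)) = sqn M f" if f: "integrable M f" "f \<in> L2 M" for f
 proof -
  have [measurable]: "f \<in> \<B> M" using f by simp
  have "integrable M (%x. cnj (f x))" "(%x. cnj (f x)) \<in> L2 M" using f by (auto simp: square_integrable_def)
  hence "sqn M' (%y. LINT x|M. cnj (f x) * k x y) = sqn M (%x. cnj (f x))"
   using assms by (auto simp: isometric_kernel_def)
  moreover have "(LINT x|M. f x * cnj (k x y)) = cnj (LINT x|M. cnj (f x) * k x y)" for y
   using Bochner_Integration.integral_cnj[of M "%x. cnj (f x) * k x y"] by simp
  ultimately show ?thesis by (simp add: sqn_def)
 qed
 ultimately show ?thesis using assms by (simp add: isometric_kernel_def)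
qed

lemma isometric_kernelD:
 assumes "isometric_kernel M M' k"
 shows "sigma_finite_measure M" "sigma_finite_measure M'" "(%(x, y). k x y) \<in> \<B> (M \<otimes> M')"
  "\<And>f. integrable M f ==> f \<in> L2 M ==> sqn M' (%y. LINT x|M. f x * k x y) = sqn M f"
 using assms by (auto simp: isometric_kernel_def)

lemma isometric_kernel_measurable:
 assumes k: "isometric_kernel M M' k" and f: "f \<in> \<B> M"
 shows "(%y. LINT x|M. f x * k x y) \<in> \<B> M'"
proof -
 interpret sigma_finite_measure M using isometric_kernelD(1)[OF k] .
 have "(%(y, x). k x y) \<in> \<B> (M' \<otimes> M)"
  using measurable_pair_swap[OF isometric_kernelD(3)[OF k]] by (simp add: case_prod_beta')
 hence "(%(y, x). f x * k x y) \<in> \<B> (M' \<otimes> M)" using f unfolding case_prod_beta' by measurable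
 thus ?thesis by (rule borel_measurable_lebesgue_integral)
qed

lemma isometric_kernel_square_integrable:
 assumes k: "isometric_kernel M M' k" and f: "integrable M f" "f \<in> L2 M"
 shows "(%y. LINT x|M. f x * k x y) \<in> L2 M'"
 using isometric_kernelD(4)[OF k f] isometric_kernel_measurable[OF k, of f] f by (auto simp: square_integrable_iff)

lemma isometric_kernel_integrable:
 assumes k: "isometric_kernel M M' k" and f: "integrable M f" and y: "y \<in> space M'"
 shows "integrable M (%x. f x * k x y)"
proof -
 obtain B where B: "\<And>x y. cmod (k x y) <= B" using k by (auto simp: isometric_kernel_def)
 have km: "(%x. k x y) \<in> \<B> M" using measurable_Pair1[OF isometric_kernelD(3)[OF k] y] by simp
 show ?thesis
 proof (rule Bochner_Integration.integrable_bound)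
  show "integrable M (%x. B*norm (f x))" using f by simp
  show "(%x. f x * k x y) \<in> \<B> M" using f km by measurable
  show "AE x in M. norm (f x * k x y) <= norm (B*norm (f x))"
  proof (rule AE_I2)
   fix x
   have "cmod (f x) * cmod (k x y) <= cmod (f x)*B" by (intro mult_left_mono B) simp
   also have "... <= \<bar>B * cmod (f x)\<bar>" by (simp add: mult.commute)
   finally show "norm (f x * k x y) <= norm (B*norm (f x))" by (simp add: norm_mult)
  qed
 qed
qed

text \<open>Both norms are expanded, and the mixed terms agree by Fubini's theorem. This replaces the
 inversion formula in everything that follows.\<close>

lemma isometric_kernel_adjoint:
 assumes k: "isometric_kernel M M' k" and k': "isometric_kernel M' M (%y x. cnj (k x y))"
  and V: "integrable M V" "V \<in> L2 M"
  and W: "integrable M' W" "W \<in> L2 M'"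
 shows "sqn M (%x. (LINT y|M'. W y * cnj (k x y))-V x) = sqn M' (%y. W y-(LINT x|M. V x * k x y))"
proof -
 interpret A: sigma_finite_measure M using isometric_kernelD(1)[OF k] .
 interpret B: sigma_finite_measure M' using isometric_kernelD(2)[OF k] .
 interpret pair_sigma_finite M M' ..
 obtain B where B: "\<And>x y. cmod (k x y) <= B" using k by (auto simp: isometric_kernel_def)
 define FV where "FV y = (LINT x|M. V x * k x y)" for y
 define IW where "IW x = (LINT y|M'. W y * cnj (k x y))" for x
 have FV: "FV \<in> L2 M'" "sqn M' FV = sqn M V"
  unfolding FV_def using isometric_kernel_square_integrable[OF k V] isometric_kernelD(4)[OF k V] by auto
 have IW: "IW \<in> L2 M" "sqn M IW = sqn M' W"
  unfolding IW_def using isometric_kernel_square_integrable[OF k' W] isometric_kernelD(4)[OF k' W] by auto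
 have VW: "integrable (M \<otimes> M') (%(x, y). cnj (V x)*W y * cnj (k x y))"
 proof (rule Bochner_Integration.integrable_bound)
  have "integrable (M \<otimes> M') (%(x, y). norm (V x)*norm (W y))"
  proof (rule Fubini_integrable)
   show "(%(x, y). norm (V x)*norm (W y)) \<in> \<B> (M \<otimes> M')"
    using V W unfolding case_prod_beta' by measurable
   show "integrable M (%x. LINT y|M'. norm (case (x, y) of (x, y) => norm (V x)*norm (W y)))" using V by simp
   show "AE x in M. integrable M' (%y. case (x, y) of (x, y) => norm (V x)*norm (W y))" using W by simp
  qed
  thus "integrable (M \<otimes> M') (%z. B*(case z of (x, y) => norm (V x)*norm (W y)))" by simp
  have "(%(x, y). cnj (k x y)) \<in> \<B> (M \<otimes> M')"
   using isometric_kernelD(3)[OF isometric_kernel_cnj[OF k]] .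
  note this[unfolded case_prod_beta', measurable]
  have [measurable]: "V \<in> \<B> M" "W \<in> \<B> M'" using V W by auto
  show "(%(x, y). cnj (V x)*W y * cnj (k x y)) \<in> \<B> (M \<otimes> M')" unfolding case_prod_beta' by measurable
  show "AE z in M \<otimes> M'. norm (case z of (x, y) => cnj (V x)*W y * cnj (k x y)) <=
    norm (B*(case z of (x, y) => norm (V x)*norm (W y)))"
  proof (rule AE_I2)
   fix z :: "'a \<times> 'b"
   obtain x y where z: "z = (x, y)" by (cases z)
   have "cmod (V x) * cmod (W y) * cmod (k x y) <= cmod (V x) * cmod (W y)*B" by (intro mult_left_mono B) simp
   also have "... <= \<bar>B*(cmod (V x) * cmod (W y))\<bar>" by (simp add: mult_ac)
   finally show "norm (case z of (x, y) => cnj (V x)*W y * cnj (k x y)) <=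
    norm (B*(case z of (x, y) => norm (V x)*norm (W y)))" by (simp add: norm_mult z)
  qed
 qed
 have "(LINT x|M. IW x * cnj (V x)) = (LINT x|M. LINT y|M'. cnj (V x)*W y * cnj (k x y))"
  unfolding IW_def by (simp add: mult_ac flip: integral_mult_right_zero)
 also have "... = (LINT y|M'. LINT x|M. cnj (V x)*W y * cnj (k x y))" using Fubini_integral[OF VW] by simp
 also have "... = (LINT y|M'. W y * cnj (FV y))"
 proof -
  have "(LINT x|M. cnj (V x)*W y * cnj (k x y)) = W y * cnj (FV y)" for y
  proof -
   have "(LINT x|M. cnj (V x)*W y * cnj (k x y)) = (LINT x|M. W y * cnj (V x * k x y))" by (simp add: mult_ac)
   also have "... = W y*(LINT x|M. cnj (V x * k x y))" by (rule integral_mult_right_zero)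
   also have "... = W y * cnj (FV y)" unfolding FV_def Bochner_Integration.integral_cnj ..
   finally show ?thesis .
  qed
  thus ?thesis by simp
 qed
 finally have mixed: "(LINT x|M. IW x * cnj (V x)) = (LINT y|M'. W y * cnj (FV y))" .
 have e: "(LINT x|M. (cmod (IW x))^2) = (LINT y|M'. (cmod (W y))^2)" "(LINT x|M. (cmod (V x))^2) = (LINT y|M'. (cmod (FV y))^2)"
  using IW FV V W by (auto simp: sqn_eq_integral)
 have "sqn M (%x. IW x-V x) = sqn M' (%y. W y-FV y)"
  unfolding sqn_diff_expand[OF IW(1) V(2)] sqn_diff_expand[OF W(2) FV(1)] e mixed by simp
 thus ?thesis unfolding IW_def FV_def .
qed

lemma integrable_mult_bounded:
 fixes f c :: "'a => complex"
 assumes f: "integrable M f" and c: "c \<in> \<B> M" and B: "\<And>x. cmod (c x) <= B"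
 shows "integrable M (%x. f x * c x)"
proof (rule Bochner_Integration.integrable_bound)
 show "integrable M (%x. B*norm (f x))" using f by simp
 show "(%x. f x * c x) \<in> \<B> M" using f c by measurable
 show "AE x in M. norm (f x * c x) <= norm (B*norm (f x))"
 proof (rule AE_I2)
  fix x
  have "cmod (f x) * cmod (c x) <= cmod (f x)*B" by (intro mult_left_mono B) simp
  also have "... <= \<bar>B * cmod (f x)\<bar>" by (simp add: mult.commute)
  finally show "norm (f x * c x) <= norm (B*norm (f x))" by (simp add: norm_mult)
 qed
qed

lemma sqn_pair_fst:
 assumes "sigma_finite_measure N" and f: "f \<in> \<B> (M \<otimes> N)"
 shows "sqn (M \<otimes> N) f = (NN x|M. sqn N (%y. f (x, y)))"
  "(%x. sqn N (%y. f (x, y))) \<in> \<B> M"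
proof -
 interpret sigma_finite_measure N by fact
 have m: "(%z. ennreal ((cmod (f z))^2)) \<in> \<B> (M \<otimes> N)" using f by measurable
 show "sqn (M \<otimes> N) f = (NN x|M. sqn N (%y. f (x, y)))"
  unfolding sqn_def by (rule nn_integral_fst[OF m, symmetric])
 show "(%x. sqn N (%y. f (x, y))) \<in> \<B> M" unfolding sqn_def using borel_measurable_nn_integral_fst[OF m] .
qed

lemma sqn_pair_snd:
 assumes "sigma_finite_measure M" "sigma_finite_measure N" and f: "f \<in> \<B> (M \<otimes> N)"
 shows "sqn (M \<otimes> N) f = (NN y|N. sqn M (%x. f (x, y)))"
  "(%y. sqn M (%x. f (x, y))) \<in> \<B> N"
proof -
 interpret A: sigma_finite_measure M by fact
 interpret B: sigma_finite_measure N by fact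
 interpret pair_sigma_finite M N ..
 have m: "(%z. ennreal ((cmod (f z))^2)) \<in> \<B> (M \<otimes> N)" using f by measurable
 show "sqn (M \<otimes> N) f = (NN y|N. sqn M (%x. f (x, y)))"
  unfolding sqn_def by (rule nn_integral_snd[OF m, symmetric])
 have "(%(y, x). ennreal ((cmod (f (x, y)))^2)) \<in> \<B> (N \<otimes> M)"
  using measurable_pair_swap[OF m] by (simp add: case_prod_beta')
 from A.borel_measurable_nn_integral[OF this]
 show "(%y. sqn M (%x. f (x, y))) \<in> \<B> N" unfolding sqn_def by simp
qed

lemma AE_slice_fst:
 assumes N: "sigma_finite_measure N" and f: "f \<in> L2 (M \<otimes> N)"
 shows "AE x in M. (%y. f (x, y)) \<in> L2 N"
proof -
 have fm: "f \<in> \<B> (M \<otimes> N)" using f by (simp add: square_integrable_iff)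
 have "AE x in M. sqn N (%y. f (x, y)) \<noteq> \<infinity>"
  using sqn_pair_fst[OF N fm] f by (intro nn_integral_PInf_AE) (auto simp: square_integrable_iff)
 with AE_space show ?thesis
 proof eventually_elim
  case (elim x)
  thus ?case using measurable_Pair2[OF fm, of x] by (auto simp: square_integrable_iff less_top)
 qed
qed

lemma AE_slice_snd:
 assumes M: "sigma_finite_measure M" and N: "sigma_finite_measure N" and f: "f \<in> L2 (M \<otimes> N)"
 shows "AE y in N. (%x. f (x, y)) \<in> L2 M"
proof -
 have fm: "f \<in> \<B> (M \<otimes> N)" using f by (simp add: square_integrable_iff)
 have "AE y in N. sqn M (%x. f (x, y)) \<noteq> \<infinity>"
  using sqn_pair_snd[OF M N fm] f by (intro nn_integral_PInf_AE) (auto simp: square_integrable_iff)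
 with AE_space show ?thesis
 proof eventually_elim
  case (elim y)
  thus ?case using measurable_Pair1[OF fm, of y] by (auto simp: square_integrable_iff less_top)
 qed
qed

text \<open>The transform is taken in one variable after the other: \<open>a\<close> is the partial
  transform in the first one. The isometry of \<open>k1\<close> is applied for almost every
  \<open>y\<close>, that of \<open>k2\<close> for almost every \<open>xi\<close>. The integrable
  bound on \<open>f\<close> makes the slices of \<open>a\<close> integrable, so the second step is
  again an honest integral.\<close>

lemma isometric_kernel_prod:
 assumes k1: "isometric_kernel M1 M1' k1" and k2: "isometric_kernel M2 M2' k2"
 shows "isometric_kernel (M1 \<otimes> M2) (M1' \<otimes> M2') (%x y. k1 (fst x) (fst y) * k2 (snd x) (snd y))"
proof -
 interpret A1: sigma_finite_measure M1 using isometric_kernelD(1)[OF k1] .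
 interpret A2: sigma_finite_measure M2 using isometric_kernelD(1)[OF k2] .
 interpret A1': sigma_finite_measure M1' using isometric_kernelD(2)[OF k1] .
 interpret A2': sigma_finite_measure M2' using isometric_kernelD(2)[OF k2] .
 interpret P: pair_sigma_finite M1 M2 ..
 interpret P': pair_sigma_finite M1' M2' ..
 interpret Q: pair_sigma_finite M1' M2 ..
 obtain B1 where B1: "\<And>x y. cmod (k1 x y) <= B1" using k1 by (auto simp: isometric_kernel_def)
 obtain B2 where B2: "\<And>x y. cmod (k2 x y) <= B2" using k2 by (auto simp: isometric_kernel_def)
 have k1m: "(%z. k1 (fst z) (snd z)) \<in> \<B> (M1 \<otimes> M1')" and k2m: "(%z. k2 (fst z) (snd z)) \<in> \<B> (M2 \<otimes> M2')"
  using isometric_kernelD(3)[OF k1] isometric_kernelD(3)[OF k2] by (auto simp: case_prod_beta')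
 have km: "(%(x, y). k1 (fst x) (fst y) * k2 (snd x) (snd y)) \<in> \<B> ((M1 \<otimes> M2) \<otimes> M1' \<otimes> M2')"
 proof -
  have "(%z. (fst (fst z), fs z)) \<in> (M1 \<otimes> M2) \<otimes> M1' \<otimes> M2' ->M M1 \<otimes> M1'" by measurable
  from measurable_compose[OF this k1m] have 1: "(%z. k1 (fst (fst z)) (fs z)) \<in> \<B> ((M1 \<otimes> M2) \<otimes> M1' \<otimes> M2')" by simp
  have "(%z. (snd (fst z), ss z)) \<in> (M1 \<otimes> M2) \<otimes> M1' \<otimes> M2' ->M M2 \<otimes> M2'" by measurable
  from measurable_compose[OF this k2m] have 2: "(%z. k2 (snd (fst z)) (ss z)) \<in> \<B> ((M1 \<otimes> M2) \<otimes> M1' \<otimes> M2')" by simp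
  show ?thesis unfolding case_prod_beta' using 1 2 by measurable
 qed
 have kB: "cmod (k1 (fst x) (fst y) * k2 (snd x) (snd y)) <= B1*B2" for x y
  unfolding norm_mult using B1 B2 by (intro mult_mono) (auto intro: order_trans[OF norm_ge_zero])
 have iso: "sqn (M1' \<otimes> M2') (%y. LINT x|(M1 \<otimes> M2). f x*(k1 (fst x) (fst y) * k2 (snd x) (snd y))) = sqn (M1 \<otimes> M2) f"
  if fi: "integrable (M1 \<otimes> M2) f" and f2: "f \<in> L2 (M1 \<otimes> M2)" for f
 proof -
  have fm [measurable]: "f \<in> \<B> (M1 \<otimes> M2)" using fi by simp
  define a where "a xi y = (LINT x|M1. f (x, y) * k1 x xi)" for xi y
  have am: "(%(xi, y). a xi y) \<in> \<B> (M1' \<otimes> M2)"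
  proof -
   have "(%z. (snd z, fst (fst z))) \<in> (M1' \<otimes> M2) \<otimes> M1 ->M M1 \<otimes> M1'" by measurable
   from measurable_compose[OF this k1m] have [measurable]: "(%z. k1 (snd z) (fst (fst z))) \<in> \<B> ((M1' \<otimes> M2) \<otimes> M1)" by simp
   have "(%(z, x). f (x, snd z) * k1 x (fst z)) \<in> \<B> ((M1' \<otimes> M2) \<otimes> M1)"
    unfolding case_prod_beta' by measurable
   from A1.borel_measurable_lebesgue_integral[OF this] show ?thesis unfolding a_def by (simp add: case_prod_beta')
  qed
  note sf = A1.sigma_finite_measure_axioms A2.sigma_finite_measure_axioms A1'.sigma_finite_measure_axioms A2'.sigma_finite_measure_axioms
  have i1: "AE y in M2. integrable M1 (%x. f (x, y))" using P.AE_integrable_snd[of "%x y. f (x, y)"] fi by simp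
  have "AE y in M2. sqn M1' (%xi. a xi y) = sqn M1 (%x. f (x, y))" using i1 AE_slice_snd[OF sf(1,2) f2]
  proof eventually_elim
   case (elim y)
   from isometric_kernelD(4)[OF k1 elim] show ?case by (simp add: a_def)
  qed
  hence s2: "sqn (M1' \<otimes> M2) (%(xi, y). a xi y) = sqn (M1 \<otimes> M2) f"
   unfolding sqn_pair_snd(1)[OF sf(1,2) fm] sqn_pair_snd(1)[OF sf(3,2) am] by (simp cong: nn_integral_cong_AE)
  hence "(%(xi, y). a xi y) \<in> L2 (M1' \<otimes> M2)" using am f2 by (simp add: square_integrable_iff)
  from AE_slice_fst[OF sf(2) this] have a2: "AE xi in M1'. a xi \<in> L2 M2" by simp
  have a_int: "integrable M2 (%y. a xi y)" and a_ft: "\<And>et. et \<in> space M2' ==> (LINT y|M2. a xi y * k2 y et) =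
    (LINT x|(M1 \<otimes> M2). f x*(k1 (fst x) xi * k2 (snd x) et))" if xi: "xi \<in> space M1'" for xi
  proof -
   have k1xi [measurable]: "(%x. k1 x xi) \<in> \<B> M1" using measurable_Pair1[OF isometric_kernelD(3)[OF k1] xi] by simp
   have "integrable (M1 \<otimes> M2) (%z. f z * k1 (fst z) xi)"
    by (rule integrable_mult_bounded[OF fi, where B = B1]) (use B1 in auto)
   thus "integrable M2 (%y. a xi y)"
    unfolding a_def using P.integrable_snd[of "%x y. f (x, y) * k1 x xi"] by (simp add: case_prod_beta')
   fix et assume et: "et \<in> space M2'"
   have [measurable]: "(%y. k2 y et) \<in> \<B> M2" using measurable_Pair1[OF isometric_kernelD(3)[OF k2] et] by simp
   have "integrable (M1 \<otimes> M2) (%z. f z*(k1 (fst z) xi * k2 (snd z) et))"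
    by (rule integrable_mult_bounded[OF fi, where B = "B1*B2"]) (use kB[of _ "(xi, et)"] in auto)
   hence "(LINT y|M2. LINT x|M1. f (x, y)*(k1 x xi * k2 y et)) = (LINT x|(M1 \<otimes> M2). f x*(k1 (fst x) xi * k2 (snd x) et))"
    using P.integral_snd[of "%x y. f (x, y)*(k1 x xi * k2 y et)"] by (simp add: case_prod_beta')
   moreover have "(LINT x|M1. f (x, y)*(k1 x xi * k2 y et)) = a xi y * k2 y et" for y
    unfolding a_def by (simp add: mult.assoc[symmetric])
   ultimately show "(LINT y|M2. a xi y * k2 y et) = (LINT x|(M1 \<otimes> M2). f x*(k1 (fst x) xi * k2 (snd x) et))" by simp
  qed
  define Ff where "Ff y = (LINT x|(M1 \<otimes> M2). f x*(k1 (fst x) (fst y) * k2 (snd x) (snd y)))" for y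
  have Ffm: "Ff \<in> \<B> (M1' \<otimes> M2')"
  proof -
   have "(%(y, x). k1 (fst x) (fst y) * k2 (snd x) (snd y)) \<in> \<B> ((M1' \<otimes> M2') \<otimes> (M1 \<otimes> M2))"
    using measurable_pair_swap[OF km] by (simp add: case_prod_beta')
   hence "(%(y, x). f x*(k1 (fst x) (fst y) * k2 (snd x) (snd y))) \<in> \<B> ((M1' \<otimes> M2') \<otimes> (M1 \<otimes> M2))"
    unfolding case_prod_beta' by measurable
   from P.borel_measurable_lebesgue_integral[OF this] show ?thesis unfolding Ff_def[abs_def] by simp
  qed
  have "AE xi in M1'. sqn M2' (%et. Ff (xi, et)) = sqn M2 (a xi)" using a2 AE_space
  proof eventually_elim
   case (elim xi)
   have "sqn M2' (%et. Ff (xi, et)) = sqn M2' (%et. LINT y|M2. a xi y * k2 y et)"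
    unfolding sqn_def by (rule nn_integral_cong) (simp add: a_ft[OF elim(2)] Ff_def)
   also have "... = sqn M2 (a xi)" by (rule isometric_kernelD(4)[OF k2 a_int[OF elim(2)] elim(1)])
   finally show ?case .
  qed
  hence "sqn (M1' \<otimes> M2') Ff = sqn (M1' \<otimes> M2) (%(xi, y). a xi y)"
   unfolding sqn_pair_fst(1)[OF sf(4) Ffm] sqn_pair_fst(1)[OF sf(2) am] prod.case by (rule nn_integral_cong_AE)
  thus ?thesis unfolding s2 Ff_def .
 qed
 show ?thesis
  unfolding isometric_kernel_def using km kB iso P.sigma_finite_measure_axioms P'.sigma_finite_measure_axioms by blast
qed

section \<open>Products of integrable functions and limits in L2\<close>

declare measurable_lattice_borel [measurable del]

lemma integrable_pair_mult:
 fixes f :: "'a => complex" and g :: "'b => complex"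
 assumes "sigma_finite_measure M" "sigma_finite_measure M'" and f: "integrable M f" and g: "integrable M' g"
 shows "integrable (M \<otimes> M') (%z. f (fst z)*g (snd z))"
proof -
 interpret A: sigma_finite_measure M by fact
 interpret B: sigma_finite_measure M' by fact
 interpret pair_sigma_finite M M' ..
 have "integrable (M \<otimes> M') (%(x, y). f x*g y)"
 proof (rule Fubini_integrable)
  show "(%(x, y). f x*g y) \<in> \<B> (M \<otimes> M')" using f g unfolding case_prod_beta' by measurable
  show "integrable M (%x. LINT y|M'. norm (case (x, y) of (x, y) => f x*g y))" using f by (simp add: norm_mult)
  show "AE x in M. integrable M' (%y. case (x, y) of (x, y) => f x*g y)" using g by simp
 qed
 thus ?thesis by (simp add: case_prod_beta')
qed

lemma measurable_cis [measurable]: "cis \<in> \<B> borel" by (intro borel_measurable_continuous_onI continuous_intros)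

lemma sqn_dominated:
 fixes f :: "nat => 'a => complex"
 assumes [measurable]: "\<And>n. f n \<in> \<B> M" "g \<in> \<B> M" "h \<in> \<B> M"
  and lim: "AE x in M. (%n. f n x) -->> g x"
  and bnd: "\<And>n. AE x in M. cmod (f n x) <= h x" "\<And>x. 0 <= h x"
  and h: "(NN x|M. ennreal ((h x)^2)) < \<infinity>"
 shows "(%n. sqn M (%x. f n x-g x)) -->> 0"
proof -
 have allb: "AE x in M. \<forall>n. cmod (f n x) <= h x" using bnd(1) by (simp add: AE_all_countable)
 have "(%n. (NN x|M. ennreal ((cmod (f n x-g x))^2))) -->> (NN x|M. 0)"
 proof (rule nn_integral_dominated_convergence[where w = "%x. 4*ennreal ((h x)^2)"])
  show "AE x in M. ennreal ((cmod (f n x-g x))^2) <= 4*ennreal ((h x)^2)" for n using lim allb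
  proof eventually_elim
   case (elim x)
   have "cmod (g x) <= h x" by (rule LIMSEQ_le_const2[OF tendsto_norm[OF elim(1)]]) (use elim(2) in auto)
   hence "cmod (f n x-g x) <= 2*h x" using elim(2)[rule_format, of n] norm_triangle_ineq4[of "f n x" "g x"] by linarith
   hence "(cmod (f n x-g x))^2 <= 4*(h x)^2" using power_mono[of "cmod (f n x-g x)" "2*h x" 2] by (simp add: power_mult_distrib)
   hence "ennreal ((cmod (f n x-g x))^2) <= ennreal (4*(h x)^2)" by (rule ennreal_leI)
   thus ?case by (simp add: ennreal_mult)
  qed
  show "(NN x|M. 4*ennreal ((h x)^2)) < \<infinity>" using h by (simp add: nn_integral_cmult ennreal_mult_less_top)
  show "AE x in M. (%n. ennreal ((cmod (f n x-g x))^2)) -->> 0" using lim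
  proof eventually_elim
   case (elim x)
   have "(%n. (cmod (f n x-g x))^2) -->> (cmod (g x-g x))\<^sup>2" by (intro tendsto_intros elim)
   hence "(%n. ennreal ((cmod (f n x-g x))^2)) -->> ennreal ((cmod (g x-g x))^2)" by (rule tendsto_ennrealI)
   thus ?case by simp
  qed
 qed measurable
 thus ?thesis by (simp add: sqn_def)
qed

text \<open>Young's inequality with a free parameter \<open>d\<close>, to be balanced against the
  distance of the two functions in order to obtain continuity of the squared norm.\<close>

lemma abs_sqn_diff_le:
 assumes f: "f \<in> L2 M" and g: "g \<in> L2 M" and d: "0 < d"
 shows "\<bar>(LINT x|M. (cmod (f x))^2)-(LINT x|M. (cmod (g x))^2)\<bar> <=
  d*(LINT x|M. (cmod (g x))^2)+(1+1/d)*(LINT x|M. (cmod (f x-g x))^2)"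
proof -
 have i: "integrable M (%x. (cmod (f x))^2)" "integrable M (%x. (cmod (g x))^2)" "integrable M (%x. (cmod (f x-g x))^2)"
  using f g square_integrable_diff[OF f g] by (auto simp: square_integrable_def)
 have pw: "\<bar>(cmod a)\<^sup>2-(cmod b)^2\<bar> <= d*(cmod b)^2+(1+1/d)*(cmod (a-b))^2" for a b
 proof -
  define x y z where "x = cmod a" and "y = cmod b" and "z = cmod (a-b)"
  have xy: "x <= y+z" "y <= x+z" "0 <= x" "0 <= y" "0 <= z"
   unfolding x_def y_def z_def using norm_triangle_ineq[of "a-b" b] norm_triangle_ineq[of a "b-a"]
   by (auto simp: norm_minus_commute)
  have "\<bar>x-y\<bar>*(x+y) <= z*(2*y+z)" by (intro mult_mono) (use xy in auto)
  moreover have "\<bar>x^2-y^2\<bar> = \<bar>x-y\<bar>*(x+y)"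
   using xy by (simp add: power2_eq_square square_diff_square_factored abs_mult mult.commute)
  moreover have "2*z*y <= d*y^2+(1/d)*z^2"
  proof -
   have "0 <= (d*y-z)^2/d" using d by simp
   also have "(d*y-z)^2/d = d*y^2+(1/d)*z^2-2*z*y" using d by (simp add: power2_eq_square field_simps)
   finally show ?thesis by simp
  qed
  moreover have "z*(2*y+z) = 2*z*y+z^2" by (simp add: power2_eq_square algebra_simps)
  ultimately have "\<bar>x^2-y^2\<bar> <= d*y^2+(1/d)*z^2+z^2" by linarith
  thus ?thesis unfolding x_def y_def z_def by (simp add: algebra_simps)
 qed
 have "\<bar>(LINT x|M. (cmod (f x))^2)-(LINT x|M. (cmod (g x))^2)\<bar> = \<bar>LINT x|M. (cmod (f x))^2-(cmod (g x))^2\<bar>"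
  using i by simp
 also have "... <= (LINT x|M. \<bar>(cmod (f x))\<^sup>2-(cmod (g x))^2\<bar>)" by (rule integral_abs_bound)
 also have "... <= (LINT x|M. d*(cmod (g x))^2+(1+1/d)*(cmod (f x-g x))^2)" by (rule integral_mono) (use i pw in auto)
 also have "... = d*(LINT x|M. (cmod (g x))^2)+(1+1/d)*(LINT x|M. (cmod (f x-g x))^2)" using i by simp
 finally show ?thesis .
qed

lemma sqn_tendsto:
 assumes f: "\<And>n. f n \<in> L2 M" and g: "g \<in> L2 M"
  and lim: "(%n. sqn M (%x. f n x-g x)) -->> 0"
 shows "(%n. sqn M (f n)) -->> sqn M g"
proof -
 define E where "E n = (LINT x|M. (cmod (f n x-g x))^2)" for n
 define A where "A = (LINT x|M. (cmod (g x))^2)"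
 \<comment> \<open>Slightly more than the distance of \<open>f n\<close> from \<open>g\<close>: it
   tends to 0, stays positive, and keeps E n / e n below sqrt (E n).\<close>
 define e where "e n = sqrt (E n)+1/real (Suc n)" for n
 have E0: "0 <= E n" "0 <= A" for n unfolding E_def A_def by auto
 have "E -->> 0"
 proof -
  have "sqn M (%x. f n x-g x) = ennreal (E n)" for n
   unfolding E_def by (rule sqn_eq_integral[OF square_integrable_diff[OF f g]])
  with lim have "(%n. ennreal (E n)) -->> ennreal 0" by simp
  thus ?thesis using E0 by (subst (asm) tendsto_ennreal_iff) auto
 qed
 hence sE: "(%n. sqrt (E n)) -->> 0" using tendsto_real_sqrt[of E 0 sequentially] by simp
 have "(%n. (sqrt (E n)+1/real (Suc n))*A+(E n+sqrt (E n))) -->> (0+0)*A+(0+0)"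
  by (intro tendsto_intros sE \<open>E -->> 0\<close> LIMSEQ_Suc[OF lim_1_over_n])
 hence l: "(%n. e n*A+(E n+sqrt (E n))) -->> 0" unfolding e_def by simp
 have b: "\<bar>(LINT x|M. (cmod (f n x))^2)-A\<bar> <= e n*A+(E n+sqrt (E n))" for n
 proof -
  have e: "0 < e n" "sqrt (E n) <= e n" unfolding e_def using E0(1)[of n] by (auto intro: add_nonneg_pos)
  have "\<bar>(LINT x|M. (cmod (f n x))^2)-A\<bar> <= e n*A+(1+1/e n)*E n"
   unfolding A_def E_def by (rule abs_sqn_diff_le[OF f g e(1)])
  moreover have "E n <= sqrt (E n)*e n" using mult_left_mono[OF e(2), of "sqrt (E n)"] E0(1)[of n] by simp
  hence "E n/e n <= sqrt (E n)" using e by (simp add: pos_divide_le_eq)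
  ultimately show ?thesis by (simp add: algebra_simps)
 qed
 have "(%n. LINT x|M. (cmod (f n x))^2) -->> A"
  by (rule LIM_zero_cancel, rule Lim_null_comparison[OF _ l]) (simp add: b)
 hence "(%n. ennreal (LINT x|M. (cmod (f n x))^2)) -->> ennreal A" by (rule tendsto_ennrealI)
 thus ?thesis unfolding A_def using f g by (simp add: sqn_eq_integral)
qed

lemma L2_truncate:
 assumes f: "f \<in> L2 M" and P: "\<And>n. Measurable.pred M (P n)" "\<And>x. \<forall>\<^sub>F n in sequentially. P n x"
 shows "(%n. sqn M (%x. (if P n x then f x else 0)-f x)) -->> 0"
proof (rule sqn_dominated[where h = "%x. cmod (f x)"])
 have [measurable]: "f \<in> \<B> M" using f by (simp add: square_integrable_iff)
 note P(1)[measurable]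
 show "(%x. if P n x then f x else 0) \<in> \<B> M" for n by measurable
 show "AE x in M. (%n. if P n x then f x else 0) -->> f x"
 proof (intro AE_I2 tendsto_eventually)
  fix x
  show "\<forall>\<^sub>F n in sequentially. (if P n x then f x else 0) = f x" using P(2)[of x] by eventually_elim simp
 qed
 show "(NN x|M. ennreal ((cmod (f x))^2)) < \<infinity>" using f by (simp add: square_integrable_iff sqn_def)
qed (use f in \<open>auto simp: square_integrable_iff\<close>)

text \<open>A norm identity, known along an approximating sequence, passes to the limit once
  differences are controlled. For the transforms below this control is the Bessel inequality or its
  analogue on the line.\<close>

lemma isometric_limit:
 assumes F: "\<And>f. f \<in> A ==> F f \<in> L2 M'"
  and A: "A \<subseteq> L2 M"
  and le: "\<And>f g. f \<in> A ==> g \<in> A ==> sqn M' (%x. F f x-F g x) <= ennreal c * sqn M (%x. f x-g x)"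
  and g: "\<And>n. g n \<in> A" "f \<in> A" "(%n. sqn M (%x. g n x-f x)) -->> 0"
  and eq: "\<And>n. sqn M' (F (g n)) = ennreal c * sqn M (g n)"
 shows "sqn M' (F f) = ennreal c * sqn M f"
proof -
 have c: "(%n. ennreal c*h n) -->> ennreal c*l" if "h -->> l" for h :: "nat => ennreal" and l
  using that by (intro ennreal_tendsto_cmult) auto
 have "(%n. sqn M' (%x. F (g n) x-F f x)) -->> 0"
  by (rule tendsto_sandwich[OF _ _ tendsto_const c[OF g(3), simplified]])
   (use le g in auto)
 hence "(%n. sqn M' (F (g n))) -->> sqn M' (F f)" by (intro sqn_tendsto F g)
 moreover have "(%n. ennreal c * sqn M (g n)) -->> ennreal c * sqn M f" by (intro c sqn_tendsto) (use A g in auto)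
 ultimately show ?thesis unfolding eq by (rule LIMSEQ_unique)
qed

section \<open>Fourier series: the Plancherel theorem on the torus\<close>

text \<open>The intersection of L1 and L2, on which the Fourier integral converges and an isometry
  can be stated without limits.\<close>

definition L12 :: "'a measure => ('a => complex) set" where
 "L12 M = {f. integrable M f \<and> f \<in> L2 M}"

abbreviation torus :: "real => real measure" where
 "torus L \<equiv> restrict_space lborel {0..<2*pi*L}"

lemma latmeas_density: "latmeas L = density (lat L) (%_. ennreal (1/L))"
 by (intro measure_eqI) (auto simp: emeasure_density nn_integral_cmult_indicator)

lemma integral_latmeas_finite:
 fixes f :: "real => complex"
 assumes L: "1 <= L" and K: "finite K" "K \<subseteq> lattice L"
 shows "(LINT y|latmeas L. (if y \<in> K then f y else 0)) = of_real (1/L)*(\<Sum>y\<in>K. f y)"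
proof -
 have "(LINT y|latmeas L. (if y \<in> K then f y else 0)) = (LINT y|lat L. (1/L) *\<^sub>R (if y \<in> K then f y else 0))"
  unfolding latmeas_density using L by (subst integral_density) auto
 also have "... = (\<Sum>y | y \<in> lattice L \<and> (1/L) *\<^sub>R (if y \<in> K then f y else 0) \<noteq> 0. (1/L) *\<^sub>R (if y \<in> K then f y else 0))"
  by (rule lebesgue_integral_count_space_finite_support) (rule finite_subset[OF _ K(1)], auto)
 also have "... = (\<Sum>y\<in>K. (1/L) *\<^sub>R f y)" using K by (intro sum.mono_neutral_cong_left) auto
 finally show ?thesis by (simp add: scaleR_conv_of_real sum_distrib_left)
qed

lemma sqn_latmeas_finite:
 assumes L: "1 <= L" and K: "finite K" "K \<subseteq> lattice L"
 shows "sqn (latmeas L) (%y. if y \<in> K then f y else 0) = ennreal (1/L*(\<Sum>y\<in>K. (cmod (f y))^2))"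
proof -
 have "(NN y|lat L. ennreal ((cmod (if y \<in> K then f y else 0))^2)) = (\<Sum>y\<in>K. ennreal ((cmod (f y))^2))"
  by (subst nn_integral_count_space'[OF K(1) _ K(2)]) auto
 thus ?thesis unfolding sqn_def nn_integral_latmeas using L by (subst ennreal_mult) (simp_all add: sum_nonneg sum_ennreal)
qed

lemma finite_lattice_ball: "1 <= L ==> 0 <= r ==> finite {y \<in> lattice L. \<bar>y\<bar> <= r}"
 by (rule card_lattice_interval(1)[where w = "2*r" and L = L]) auto

lemma sigma_finite_torus: "sigma_finite_measure (torus L)"
 by (intro sigma_finite_measure_restrict_space lborel.sigma_finite_measure_axioms) auto

lemma finite_torus: "finite_measure (torus L)"
proof (rule finite_measureI)
 have "emeasure lborel {0..<2*pi*L} <= emeasure lborel {0..2*pi*L}" by (rule emeasure_mono) auto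
 also have "... < \<infinity>" by (simp add: emeasure_lborel_Icc_eq)
 finally show "emeasure (torus L) (space (torus L)) \<noteq> \<infinity>"
  by (simp add: emeasure_restrict_space space_restrict_space)
qed

lemma integral_torus_cis:
 assumes L: "1 <= L" and y: "y \<in> lattice L"
 shows "(LINT x|torus L. cis (x*y)) = (if y = 0 then of_real (2*pi*L) else 0)"
proof -
 have "(LINT x|torus L. cis (x*y)) = (LINT x|lborel. ind {0..<2*pi*L} x *\<^sub>R cis (x*y))"
  by (rule integral_restrict_space) simp
 also have "... = (LINT x|lborel. ind {0..2*pi*L} x *\<^sub>R cis (x*y))"
 proof (rule integral_cong_AE)
  have "AE x in lborel. x \<noteq> 2*pi*L" by (rule AE_lborel_singleton)
  thus "AE x in lborel. ind {0..<2*pi*L} x *\<^sub>R cis (x*y) = ind {0..2*pi*L} x *\<^sub>R cis (x*y)"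
   by eventually_elim (auto simp: indicator_def)
 qed auto
 also have "... = (if y = 0 then of_real (2*pi*L) else 0)"
 proof (cases "y = 0")
  case True
  thus ?thesis using L by (simp add: scaleR_conv_of_real)
 next
  case False
  obtain k :: int where k: "y = of_int k/L" using y by (auto simp: lattice_def)
  have der: "((%x. cis (x*y)/(\<i> * of_real y)) has_vector_derivative cis (x*y)) (at x within S)" for x S
  proof -
   have "((%w. exp (w*(\<i> * of_real y))/(\<i> * of_real y)) has_field_derivative exp (of_real x*(\<i> * of_real y))) (at (of_real x))"
    using False by (auto intro!: derivative_eq_intros)
   from has_vector_derivative_real_field[OF this, of S] show ?thesis by (simp add: cis_conv_exp mult_ac)
  qed
  have "(LINT x|lborel. ind {0..2*pi*L} x *\<^sub>R cis (x*y)) = cis (2*pi*L*y)/(\<i> * of_real y)-cis (0*y)/(\<i> * of_real y)"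
   using L by (intro integral_FTC_atLeastAtMost der continuous_intros) auto
  also have "2*pi*L*y = 2*pi * of_int k" using k L by simp
  also have "cis (2*pi * of_int k) = 1" by (rule cis_multiple_2pi) simp
  finally show ?thesis using False by simp
 qed
 finally show ?thesis .
qed

lemma measurable_torus_cis [measurable]: "(%x. cis (x*y)) \<in> \<B> (torus L)"
 by (rule measurable_restrict_space1) simp

lemma integrable_torus_cis: "integrable (torus L) (%x. cis (x*y))"
 by (rule finite_measure.integrable_const_bound[OF finite_torus, where B = 1]) auto

lemma parseval_finite:
 assumes L: "1 <= L" and K: "finite K" "K \<subseteq> lattice L"
 shows "(LINT x|torus L. (cmod (\<Sum>y\<in>K. w y * cis (x*y)))^2) = 2*pi*L*(\<Sum>y\<in>K. (cmod (w y))^2)"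
proof -
 have pw: "of_real ((cmod (\<Sum>y\<in>K. w y * cis (x*y)))^2) = (\<Sum>y\<in>K. \<Sum>y'\<in>K. w y * cnj (w y') * cis (x*(y-y')))" for x
 proof -
  have "w y * cis (x*y) * cnj (w y' * cis (x*y')) = w y * cnj (w y') * cis (x*(y-y'))" for y y'
  proof -
   have "w y * cis (x*y) * cnj (w y' * cis (x*y')) = w y * cnj (w y')*(cis (x*y) * cis (- (x*y')))"
    by (simp add: cis_cnj mult_ac)
   thus ?thesis by (simp add: cis_mult right_diff_distrib)
  qed
  thus ?thesis unfolding complex_norm_square cnj_sum sum_product by (simp only:)
 qed
 have "complex_of_real (LINT x|torus L. (cmod (\<Sum>y\<in>K. w y * cis (x*y)))^2) =
   (LINT x|torus L. (\<Sum>y\<in>K. \<Sum>y'\<in>K. w y * cnj (w y') * cis (x*(y-y'))))"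
  unfolding pw[symmetric] by (rule integral_complex_of_real[symmetric])
 also have "... = (\<Sum>y\<in>K. \<Sum>y'\<in>K. w y * cnj (w y')*(LINT x|torus L. cis (x*(y-y'))))"
  by (simp add: Bochner_Integration.integral_sum integrable_torus_cis)
 also have "... = (\<Sum>y\<in>K. \<Sum>y'\<in>K. if y = y' then w y * cnj (w y') * of_real (2*pi*L) else 0)"
  using K(2) by (intro sum.cong refl) (auto simp: integral_torus_cis[OF L] lattice_diff subset_eq)
 also have "... = (\<Sum>y\<in>K. w y * cnj (w y) * of_real (2*pi*L))" using K(1) by (simp add: sum.delta)
 also have "... = of_real (2*pi*L*(\<Sum>y\<in>K. (cmod (w y))^2))"
  by (simp add: sum_distrib_left mult_ac flip: complex_norm_square)
 finally show ?thesis by (simp only: of_real_eq_iff)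
qed

lemma square_integrable_torus_integrable:
 assumes f: "f \<in> L2 (torus L)"
 shows "integrable (torus L) f"
proof (rule Bochner_Integration.integrable_bound)
 interpret finite_measure "torus L" by (rule finite_torus)
 show "integrable (torus L) (%x. 1+(cmod (f x))^2)" using f by (simp add: square_integrable_def)
 have "cmod (f x) <= 1+(cmod (f x))^2" for x
  using sum_squares_bound[of 1 "cmod (f x)"] norm_ge_zero[of "f x"] by (simp, linarith)
 thus "AE x in torus L. norm (f x) <= norm (1+(cmod (f x))^2)" by simp
qed (use f in \<open>auto simp: square_integrable_def\<close>)

lemma bounded_torus_square_integrable:
 assumes "f \<in> \<B> (torus L)" "\<And>x. cmod (f x) <= B"
 shows "f \<in> L2 (torus L)"
proof -
 interpret finite_measure "torus L" by (rule finite_torus)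
 have "integrable (torus L) (%x. (cmod (f x))^2)"
  by (rule integrable_const_bound[where B = "B^2"]) (use assms in \<open>auto intro!: power_mono\<close>)
 with assms show ?thesis by (simp add: square_integrable_def)
qed

text \<open>Expansion of the norm of f - P, where \<open>P\<close> is the partial Fourier sum;
  \<open>t\<close> is the inverse of the length 2*pi*L of the torus.\<close>

lemma bessel_finite:
 assumes L: "1 <= L" and K: "finite K" "K \<subseteq> lattice L" and f: "f \<in> L2 (torus L)"
 shows "(\<Sum>y\<in>K. (cmod (LINT x|torus L. f x * cis (- (x*y))))^2) <= 2*pi*L*(LINT x|torus L. (cmod (f x))^2)"
proof -
 define F where "F y = (LINT x|torus L. f x * cis (- (x*y)))" for y
 define S where "S = (\<Sum>y\<in>K. (cmod (F y))^2)"
 define t where "t = 1/(2*pi*L)"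
 have t: "0 < t" using L by (simp add: t_def)
 define P where "P x = (\<Sum>y\<in>K. (of_real t*F y) * cis (x*y))" for x
 have P2: "P \<in> L2 (torus L)" unfolding P_def
  by (rule bounded_torus_square_integrable[where B = "\<Sum>y\<in>K. cmod (of_real t*F y)"])
   (auto intro!: order_trans[OF norm_sum] sum_mono simp: norm_mult)
 have "(LINT x|torus L. (cmod (P x))^2) = 2*pi*L*(\<Sum>y\<in>K. (cmod (of_real t*F y))^2)"
  unfolding P_def by (rule parseval_finite[OF L K])
 also have "... = t*S"
 proof -
  have "2*pi*L*(cmod (of_real t*F y))^2 = t*(cmod (F y))^2" for y
  proof -
   have "(cmod (of_real t*F y))^2 = t*t*(cmod (F y))^2" using t by (simp add: norm_mult power_mult_distrib power2_eq_square)
   moreover have "2*pi*L*t = 1" using L by (simp add: t_def)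
   ultimately show ?thesis by (metis mult.assoc mult_1)
  qed
  thus ?thesis unfolding S_def sum_distrib_left by (simp only:)
 qed
 finally have PP: "(LINT x|torus L. (cmod (P x))^2) = t*S" .
 have "(LINT x|torus L. f x * cnj (P x)) = (LINT x|torus L. (\<Sum>y\<in>K. cnj (of_real t*F y)*(f x * cis (- (x*y)))))"
  unfolding P_def by (simp add: cis_cnj sum_distrib_left mult_ac)
 also have "... = (\<Sum>y\<in>K. cnj (of_real t*F y)*F y)"
 proof -
  have "integrable (torus L) (%x. f x * cis (- (x*y)))" for y
   by (rule integrable_mult_bounded[OF square_integrable_torus_integrable[OF f], where B = 1])
    (use measurable_torus_cis[of "- y"] in auto)
  thus ?thesis unfolding F_def by (simp add: Bochner_Integration.integral_sum)
 qed
 also have "... = of_real (t*S)"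
 proof -
  have "cnj (of_real t*F y)*F y = of_real (t*(cmod (F y))^2)" for y
   unfolding of_real_mult complex_norm_square by (simp add: mult_ac)
  thus ?thesis unfolding S_def sum_distrib_left of_real_sum by (simp only:)
 qed
 finally have fP: "(LINT x|torus L. f x * cnj (P x)) = of_real (t*S)" .
 have "0 <= (LINT x|torus L. (cmod (f x-P x))^2)" by simp
 also have "... = (LINT x|torus L. (cmod (f x))^2)+t*S-2*(t*S)"
  unfolding integral_cmod_diff_power2[OF f P2] PP fP by simp
 finally have "t*S <= (LINT x|torus L. (cmod (f x))^2)" by linarith
 thus ?thesis unfolding S_def[symmetric] F_def[symmetric] using L by (simp add: t_def field_simps)
qed

lemma bessel:
 assumes L: "1 <= L" and f: "f \<in> L2 (torus L)"
 shows "sqn (latmeas L) (%y. LINT x|torus L. f x * cis (- (x*y))) <= ennreal (2*pi) * sqn (torus L) f"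
proof -
 define F where "F y = (LINT x|torus L. f x * cis (- (x*y)))" for y
 define K where "K n = {y \<in> lattice L. \<bar>y\<bar> <= real n}" for n
 have K: "finite (K n)" "K n \<subseteq> lattice L" for n using finite_lattice_ball[OF L] by (auto simp: K_def)
 have "sqn (latmeas L) F = (NN y|latmeas L. liminf (%n. ennreal ((cmod (if y \<in> K n then F y else 0))^2)))"
  unfolding sqn_def
 proof (rule nn_integral_cong)
  fix y assume y: "y \<in> space (latmeas L)"
  obtain n where "\<bar>y\<bar> <= real n" using real_arch_simple by blast
  hence "\<forall>\<^sub>F n in sequentially. y \<in> K n"
   using y by (intro eventually_sequentiallyI[of n]) (auto simp: K_def)
  hence "\<forall>\<^sub>F n in sequentially. ennreal ((cmod (if y \<in> K n then F y else 0))^2) = ennreal ((cmod (F y))^2)"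
   by eventually_elim simp
  hence "(%n. ennreal ((cmod (if y \<in> K n then F y else 0))^2)) -->> ennreal ((cmod (F y))^2)"
   by (rule tendsto_eventually)
  from lim_imp_Liminf[OF _ this] show "ennreal ((cmod (F y))^2) = liminf (%n. ennreal ((cmod (if y \<in> K n then F y else 0))^2))" by simp
 qed
 also have "... <= liminf (%n. sqn (latmeas L) (%y. if y \<in> K n then F y else 0))"
  unfolding sqn_def by (rule nn_integral_liminf) simp
 also have "... <= ennreal (2*pi) * sqn (torus L) f"
 proof (rule Liminf_le)
  have "sqn (latmeas L) (%y. if y \<in> K n then F y else 0) <= ennreal (2*pi) * sqn (torus L) f" for n
  proof -
   have "1/L*(\<Sum>y\<in>K n. (cmod (F y))^2) <= 1/L*(2*pi*L*(LINT x|torus L. (cmod (f x))^2))"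
    unfolding F_def using L by (intro mult_left_mono bessel_finite[OF L K f]) auto
   also have "... = 2*pi*(LINT x|torus L. (cmod (f x))^2)" using L by simp
   finally show ?thesis
    unfolding sqn_latmeas_finite[OF L K] sqn_eq_integral[OF f] by (simp add: ennreal_leI flip: ennreal_mult')
  qed
  thus "\<forall>\<^sub>F n in sequentially. sqn (latmeas L) (%y. if y \<in> K n then F y else 0) <= ennreal (2*pi) * sqn (torus L) f"
   by simp
 qed simp
 finally show ?thesis unfolding F_def .
qed

lemma measurable_lattice_pair:
 fixes f :: "real => real => ennreal"
 assumes "\<And>y. (%x. f x y) \<in> \<B> borel"
 shows "(%(x, y). f x y) \<in> \<B> (lborel \<otimes> lat L)"
proof -
 have "(%z. f (snd z) (fst z)) \<in> \<B> (lat L \<otimes> lborel)"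
  by (rule measurable_pair_measure_countable1) (use assms in auto)
 from measurable_pair_swap[OF this] show ?thesis by (simp add: case_prod_beta')
qed

lemma measurable_lattice_translate:
 assumes [measurable]: "h \<in> \<B> (borel :: real measure)"
 shows "(%th. (NN y|latmeas L. h (y+th))) \<in> \<B> borel"
proof -
 interpret C: sigma_finite_measure "lat L" by (rule sigma_finite_measure_count_space_countable) simp
 have "(%(th, y). h (y+th)) \<in> \<B> (lborel \<otimes> lat L)" by (rule measurable_lattice_pair) measurable
 from C.borel_measurable_nn_integral[OF this]
 have [measurable]: "(%th. (NN y|lat L. h (y+th))) \<in> \<B> lborel" by simp
 show ?thesis unfolding nn_integral_latmeas by measurable
qed

text \<open>Every real number is uniquely y + th with \<open>y\<close> in the lattice and
  \<open>th\<close> in a cell of length 1/L. The factor L undoes the weight 1/L of the lattice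
  measure. This is the bridge from tori to the line.\<close>

lemma nn_integral_lattice_decompose:
 assumes L: "1 <= L" and h [measurable]: "h \<in> \<B> (borel :: real measure)"
 shows "(NN xi|lborel. h xi) = ennreal L*(NN th|lborel. ind {0..<1/L} th*(NN y|latmeas L. h (y+th)))"
proof -
 interpret C: sigma_finite_measure "lat L" by (rule sigma_finite_measure_count_space_countable) simp
 interpret pair_sigma_finite "lborel :: real measure" "lat L" ..
 have ind: "(NN y|lat L. ind {0..<1/L} (x-y)) = (1::ennreal)" for x
 proof -
  define k where "k = \<lfloor>x*L\<rfloor>"
  have k: "of_int k <= x*L" "x*L < of_int k+1" unfolding k_def by (simp_all add: floor_correct)
  have y0: "of_int k/L \<in> lattice L" by (auto simp: lattice_def)
  have "(NN y|lat L. ind {0..<1/L} (x-y)) = (\<Sum>y\<in>{of_int k/L}. ind {0..<1/L} (x-y) :: ennreal)"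
  proof (rule nn_integral_count_space')
   fix y assume y: "y \<in> lattice L" "y \<notin> {of_int k/L}"
   then obtain j :: int where j: "y = of_int j/L" by (auto simp: lattice_def)
   show "ind {0..<1/L} (x-y) = (0::ennreal)"
   proof (rule ccontr)
    assume "ind {0..<1/L} (x-y) \<noteq> (0::ennreal)"
    hence "0 <= x-of_int j/L" "x-of_int j/L < 1/L" by (auto simp: j indicator_def split: if_splits)
    hence "of_int j/L <= x" "x < (of_int j+1)/L" using L by (auto simp: add_divide_distrib)
    hence "of_int j <= x*L" "x*L < of_int j+1" using L by (auto simp: pos_divide_le_eq pos_less_divide_eq)
    hence "j = k" using k by linarith
    with y j show False by simp
   qed
  qed (use y0 in auto)
  also have "... = 1" using k L by (auto simp: indicator_def field_simps)
  finally show ?thesis .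
 qed
 have "(NN xi|lborel. h xi) = (NN xi|lborel. (NN y|lat L. h xi*ind {0..<1/L} (xi-y)))"
  by (intro nn_integral_cong) (simp add: nn_integral_cmult ind)
 also have "... = (NN y|lat L. (NN xi|lborel. h xi*ind {0..<1/L} (xi-y)))"
  by (rule Fubini'[symmetric], rule measurable_lattice_pair) measurable
 also have "... = (NN y|lat L. (NN th|lborel. h (y+th)*ind {0..<1/L} th))"
 proof (rule nn_integral_cong)
  fix y
  show "(NN xi|lborel. h xi*ind {0..<1/L} (xi-y)) = (NN th|lborel. h (y+th)*ind {0..<1/L} th)"
   by (subst nn_integral_real_affine[where c = 1 and t = y]) auto
 qed
 also have "... = (NN th|lborel. (NN y|lat L. h (y+th)*ind {0..<1/L} th))"
  by (rule Fubini', rule measurable_lattice_pair) measurable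
 also have "... = (NN th|lborel. ennreal L*(ind {0..<1/L} th*(NN y|latmeas L. h (y+th))))"
 proof (rule nn_integral_cong)
  fix th :: real
  have "ennreal L*(ennreal (1/L) * c) = c" for c using L by (simp add: mult.assoc[symmetric] flip: ennreal_mult)
  thus "(NN y|lat L. h (y+th)*ind {0..<1/L} th) = ennreal L*(ind {0..<1/L} th*(NN y|latmeas L. h (y+th)))"
   unfolding nn_integral_latmeas by (cases "th \<in> {0..<1/L}") simp_all
 qed
 also have "... = ennreal L*(NN th|lborel. ind {0..<1/L} th*(NN y|latmeas L. h (y+th)))"
  using measurable_lattice_translate[OF h, of L] by (intro nn_integral_cmult) measurable
 finally show ?thesis .
qed

text \<open>By Stone-Weierstrass the characters span a dense subspace of the functions on the torus.\<close>

inductive trig :: "real => (real => complex) => bool" for L where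
 cis: "y \<in> lattice L ==> trig L (%x. c * cis (x*y))"
| add: "trig L P ==> trig L Q ==> trig L (%x. P x+Q x)"

lemma trig_mult:
 assumes "trig L P" "trig L Q"
 shows "trig L (%x. P x * Q x)" using assms
proof (induction P)
 case P: (cis y c)
 from P(2) show ?case
 proof (induction Q)
  case (cis y' d)
  thus ?case using trig.cis[OF lattice_add[OF P(1) cis], of "c*d"] by (simp add: cis_mult[symmetric] distrib_left mult_ac)
 qed (simp add: distrib_left trig.add)
qed (simp add: distrib_right trig.add)

lemma trig_sum:
 assumes "trig L P"
 shows "\<exists>K w. finite K \<and> K \<subseteq> lattice L \<and> P = (%x. \<Sum>y\<in>K. w y * cis (x*y))"
 using assms
proof induction
 case (cis y c)
 thus ?case by (intro exI[of _ "{y}"] exI[of _ "%_. c"]) simp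
next
 case (add P Q)
 then obtain K w K' w' where K: "finite K" "K \<subseteq> lattice L" "finite K'" "K' \<subseteq> lattice L"
  and P: "P = (%x. \<Sum>y\<in>K. w y * cis (x*y))" "Q = (%x. \<Sum>y\<in>K'. w' y * cis (x*y))" by blast
 have "P x+Q x = (\<Sum>y\<in>K \<union> K'. ((if y \<in> K then w y else 0)+(if y \<in> K' then w' y else 0)) * cis (x*y))" for x
  unfolding P distrib_right sum.distrib
  by (intro arg_cong2[where f = plus] sum.mono_neutral_cong_left) (use K in auto)
 thus ?case using K by (intro exI[of _ "K \<union> K'"] exI conjI) auto
qed

text \<open>A real linear form evaluated at cis (x/L) is a combination of the characters of
  frequency 1/L and -1/L; closure under sums and products does the rest.\<close>

lemma trig_polynomial:
 assumes "1 <= L" "real_polynomial_function g"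
 shows "trig L (%x. of_real (g (cis (x/L))))" using assms(2)
proof induction
 case (linear g)
 interpret bounded_linear g by fact
 have y: "1/L \<in> lattice L" unfolding lattice_def by (rule range_eqI[of _ _ 1]) simp
 have "g (cis t) = cos t*g 1+sin t*g \<i>" for t
  using add[of "cos t *\<^sub>R 1" "sin t *\<^sub>R \<i>"] by (simp only: scaleR real_scaleR_def) (simp add: cis.code complex_eq_iff scaleR_conv_of_real Complex_eq mult.commute)
 hence e: "complex_of_real (g (cis (x/L))) =
   (of_real (g 1)-\<i> * of_real (g \<i>))/2 * cis (x*(1/L))+(of_real (g 1)+\<i> * of_real (g \<i>))/2 * cis (x*- (1/L))" for x
  by (simp add: complex_eq_iff field_simps)
 show ?case unfolding e by (intro trig.intros y lattice_uminus)
next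
 case (const c)
 have "0 \<in> lattice L" unfolding lattice_def by (rule range_eqI[of _ _ 0]) simp
 from trig.cis[OF this, of "of_real c"] show ?case by simp
qed (simp_all add: trig.add trig_mult)

lemma square_integrable_cis:
 assumes f: "f \<in> L2 (torus L)"
 shows "(%x. f x * cis (- (x*th))) \<in> L2 (torus L)"
  "integrable (torus L) (%x. f x * cis (- (x*th)))"
proof -
 have "(%x. f x * cis (- (x*th))) \<in> \<B> (torus L)"
  using f measurable_torus_cis[of "- th"] by (intro borel_measurable_times) (auto simp: square_integrable_iff)
 with f show *: "(%x. f x * cis (- (x*th))) \<in> L2 (torus L)" by (simp add: square_integrable_iff sqn_def norm_mult)
 thus "integrable (torus L) (%x. f x * cis (- (x*th)))" by (rule square_integrable_torus_integrable)
qed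

abbreviation parseval :: "real => (real => complex) => bool" where
 "parseval L f \<equiv> sqn (latmeas L) (%y. LINT x|torus L. f x * cis (- (x*y))) = ennreal (2*pi) * sqn (torus L) f"

lemma parseval_trig:
 assumes L: "1 <= L" and P: "trig L P"
 shows "P \<in> L2 (torus L)" "parseval L P"
proof -
 obtain K w where K: "finite K" "K \<subseteq> lattice L" and P: "P = (%x. \<Sum>y\<in>K. w y * cis (x*y))"
  using trig_sum[OF P] by blast
 show P2: "P \<in> L2 (torus L)" unfolding P
  by (rule bounded_torus_square_integrable[where B = "\<Sum>y\<in>K. cmod (w y)"])
   (auto intro!: order_trans[OF norm_sum] sum_mono simp: norm_mult)
 have "(LINT x|torus L. P x * cis (- (x*y))) = (if y \<in> K then of_real (2*pi*L)*w y else 0)" if y: "y \<in> lattice L" for y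
 proof -
  have "(LINT x|torus L. P x * cis (- (x*y))) = (LINT x|torus L. (\<Sum>k\<in>K. w k * cis (x*(k-y))))"
   unfolding P sum_distrib_right mult.assoc cis_mult by (simp add: right_diff_distrib)
  also have "... = (\<Sum>k\<in>K. w k*(LINT x|torus L. cis (x*(k-y))))"
   by (simp add: Bochner_Integration.integral_sum integrable_torus_cis)
  also have "... = (\<Sum>k\<in>K. if k = y then of_real (2*pi*L)*w k else 0)"
   using K(2) y by (intro sum.cong refl) (auto simp: integral_torus_cis[OF L] lattice_diff subset_eq)
  finally show ?thesis using K(1) by simp
 qed
 hence "sqn (latmeas L) (%y. LINT x|torus L. P x * cis (- (x*y))) =
   sqn (latmeas L) (%y. if y \<in> K then of_real (2*pi*L)*w y else 0)"
  unfolding sqn_def by (intro nn_integral_cong) simp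
 also have "... = ennreal (2*pi*(2*pi*L*(\<Sum>y\<in>K. (cmod (w y))^2)))"
  unfolding sqn_latmeas_finite[OF L K] using L
  by (intro arg_cong[where f = ennreal]) (simp add: norm_mult power_mult_distrib sum_distrib_left power2_eq_square mult_ac)
 also have "... = ennreal (2*pi) * sqn (torus L) P"
  unfolding sqn_eq_integral[OF P2] unfolding P parseval_finite[OF L K] by (rule ennreal_mult') simp
 finally show "parseval L P" .
qed

lemma parseval_limit:
 assumes L: "1 <= L" and g: "\<And>n. g n \<in> L2 (torus L)" "\<And>n. parseval L (g n)"
  and f: "f \<in> L2 (torus L)" and lim: "(%n. sqn (torus L) (%x. g n x-f x)) -->> 0"
 shows "parseval L f"
proof (rule isometric_limit[where A = "L2 (torus L)" and F = "%f y. LINT x|torus L. f x * cis (- (x*y))" and g = g])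
 show "(%y. LINT x|torus L. f x * cis (- (x*y))) \<in> L2 (latmeas L)"
  if "f \<in> L2 (torus L)" for f
  using le_less_trans[OF bessel[OF L that]] that by (auto simp: square_integrable_iff ennreal_mult_less_top)
 show "sqn (latmeas L) (%y. (LINT x|torus L. f x * cis (- (x*y)))-(LINT x|torus L. g x * cis (- (x*y))))
   <= ennreal (2*pi) * sqn (torus L) (%x. f x-g x)"
  if "f \<in> L2 (torus L)" "g \<in> L2 (torus L)" for f g using bessel[OF L square_integrable_diff[OF that]]
  by (simp add: left_diff_distrib square_integrable_cis that)
qed (use g f lim in auto)

lemma torus_L2_dominated:
 assumes "\<And>n. g n \<in> \<B> (torus L)" "f \<in> \<B> (torus L)"
  "\<And>n x. cmod (g n x) <= B" "AE x in torus L. (%n. g n x) -->> f x"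
 shows "(%n. sqn (torus L) (%x. g n x-f x)) -->> 0"
proof (rule sqn_dominated[where h = "%_. B"])
 interpret finite_measure "torus L" by (rule finite_torus)
 show "(NN x|torus L. ennreal (B^2)) < \<infinity>"
  using emeasure_finite[of "{0..<2*pi*L}"] by (simp add: ennreal_mult_eq_top_iff less_top[symmetric])
 show "0 <= B" using order_trans[OF norm_ge_zero assms(3)] .
qed (use assms in auto)

text \<open>A continuous function on the circle is approximated uniformly by trigonometric sums, the
  real and the imaginary part separately; on a finite measure space this gives convergence in
  L2.\<close>

lemma parseval_circle:
 assumes L: "1 <= L" and c: "continuous_on (sphere 0 1) \<phi>" and m: "(%x. \<phi> (cis (x/L))) \<in> \<B> (torus L)"
 shows "(%x. \<phi> (cis (x/L))) \<in> L2 (torus L)" "parseval L (%x. \<phi> (cis (x/L)))"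
proof -
 have S: "compact (sphere (0 :: complex) 1)" by simp
 have "\<exists>P. trig L P \<and> (\<forall>x. cmod (P x-\<phi> (cis (x/L))) <= 2/real (Suc n))" for n
 proof -
  obtain g where g: "real_polynomial_function g" "\<And>z. z \<in> sphere 0 1 ==> \<bar>Re (\<phi> z)-g z\<bar> < 1/real (Suc n)"
   by (rule Stone_Weierstrass_real_polynomial_function[OF S, of "%z. Re (\<phi> z)" "1/real (Suc n)"]) (auto intro!: continuous_intros c)
  obtain h where h: "real_polynomial_function h" "\<And>z. z \<in> sphere 0 1 ==> \<bar>Im (\<phi> z)-h z\<bar> < 1/real (Suc n)"
   by (rule Stone_Weierstrass_real_polynomial_function[OF S, of "%z. Im (\<phi> z)" "1/real (Suc n)"]) (auto intro!: continuous_intros c)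
  have "0 \<in> lattice L" unfolding lattice_def by (rule range_eqI[of _ _ 0]) simp
  from trig.cis[OF this, of \<i>] have "trig L (%x. \<i>)" by simp
  hence "trig L (%x. of_real (g (cis (x/L)))+\<i> * of_real (h (cis (x/L))))"
   by (intro trig.add trig_mult trig_polynomial L g h)
  moreover have "cmod (of_real (g z)+\<i> * of_real (h z)-\<phi> z) <= 2/real (Suc n)" if "z \<in> sphere 0 1" for z
   using cmod_le[of "of_real (g z)+\<i> * of_real (h z)-\<phi> z"] g(2)[OF that] h(2)[OF that] by simp
  ultimately show ?thesis by (intro exI conjI) auto
 qed
 then obtain P where P: "\<And>n. trig L (P n)" "\<And>n x. cmod (P n x-\<phi> (cis (x/L))) <= 2/real (Suc n)" by metis
 obtain B where B: "\<And>z. z \<in> sphere 0 1 ==> cmod (\<phi> z) <= B"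
  using compact_imp_bounded[OF compact_continuous_image[OF c S]] unfolding bounded_iff by (metis imageI)
 show F: "(%x. \<phi> (cis (x/L))) \<in> L2 (torus L)"
  by (rule bounded_torus_square_integrable[OF m, of B]) (simp add: B)
 show "parseval L (%x. \<phi> (cis (x/L)))"
 proof (rule parseval_limit[OF L parseval_trig[OF L P(1)] F torus_L2_dominated])
  show "cmod (P n x) <= B+2" for n x
  proof -
   have "cmod (P n x) <= cmod (P n x-\<phi> (cis (x/L))) + cmod (\<phi> (cis (x/L)))"
    using norm_triangle_ineq[of "P n x-\<phi> (cis (x/L))" "\<phi> (cis (x/L))"] by simp
   moreover have "2/real (Suc n) <= 2" by (simp add: divide_le_eq)
   ultimately show ?thesis using P(2)[of n x] B[of "cis (x/L)"] by simp
  qed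
  show "AE x in torus L. (%n. P n x) -->> \<phi> (cis (x/L))"
  proof (intro AE_I2)
   fix x
   have "(%n. 2/real (Suc n)) -->> 0" by real_asymp
   hence "(%n. P n x-\<phi> (cis (x/L))) -->> 0" by (rule Lim_null_comparison[rotated]) (intro always_eventually allI P)
   thus "(%n. P n x) -->> \<phi> (cis (x/L))" by (simp add: LIM_zero_iff)
  qed
 qed (use m parseval_trig(1)[OF L P(1)] in \<open>auto simp: square_integrable_iff\<close>)
qed

text \<open>\<open>f\<close> is an almost everywhere limit of continuous functions on the line.
  These are clipped at the height \<open>B\<close> and multiplied by a cut-off at angle 0, where the
  angle function jumps; the products are continuous on the circle and dominated by
  \<open>B\<close>.\<close>

lemma plancherel_torus_bounded:
 assumes L: "1 <= L" and f: "f \<in> \<B> (torus L)" and B: "0 < B" "\<And>x. cmod (f x) <= B"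
 shows "parseval L f"
proof -
 define f0 where "f0 x = ind {0..<2*pi*L} x *\<^sub>R f x" for x
 have "f0 \<in> \<B> lborel" using f unfolding f0_def by (subst (asm) borel_measurable_restrict_space_iff) auto
 hence "f0 \<in> \<B> lebesgue" by (rule measurable_completion)
 hence "f0 measurable_on UNIV" by (rule lebesgue_measurable_imp_measurable_on) simp
 then obtain N h where N: "negligible N" and h: "\<And>n::nat. continuous_on UNIV (h n)"
  and lim: "\<And>x. x \<notin> N ==> (%n. h n x) -->> f0 x" unfolding measurable_on_def by auto
 have [measurable]: "h n \<in> \<B> borel" for n by (rule borel_measurable_continuous_onI[OF h])
 \<comment> \<open>Vanishes at z = 1, which is the only discontinuity of the angle on the circle,
   and is eventually 1 at every other point.\<close>
 define c where "c n z = min 1 (real n*(1-Re z))" for n z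
 define q where "q n x = of_real (B/max B (cmod (h n x)))*h n x" for n x
 define \<phi> where "\<phi> n z = of_real (c n z)*q n (L*Arg2pi z)" for n z
 have c: "0 <= c n z" "c n z <= 1" if "z \<in> sphere 0 1" for n z
  using that complex_Re_le_cmod[of z] by (auto simp: c_def)
 have q: "cmod (q n x) <= B" for n x
 proof -
  have "cmod (q n x) = B * cmod (h n x)/max B (cmod (h n x))"
   using B(1) by (simp add: q_def norm_mult norm_divide max_def)
  also have "... <= B" using B(1) by (simp add: max_def field_simps)
  finally show ?thesis .
 qed
 have qc: "isCont (q n) x" for n x
  using h[of n] B(1) unfolding q_def by (intro continuous_intros) (auto simp: max_def continuous_on_eq_continuous_at)
 have \<phi>c: "continuous_on (sphere 0 1) (\<phi> n)" for n
 proof (intro continuous_at_imp_continuous_on ballI)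
  fix z :: complex assume z: "z \<in> sphere 0 1"
  show "isCont (\<phi> n) z"
  proof (cases "z = 1")
   case False
   hence "z \<notin> \<real>\<^sub>\<ge>\<^sub>0" using z by (auto elim!: nonneg_Reals_cases)
   hence "isCont (%z. L*Arg2pi z) z" by (intro continuous_intros continuous_at_Arg2pi)
   from isCont_o2[OF this qc] show ?thesis unfolding \<phi>_def c_def
    by (intro continuous_intros linear_continuous_at[OF bounded_linear_Re])
  next
   case True
   have l: "((%z. real n*\<bar>1-Re z\<bar>*B) \<longlongrightarrow> 0) (at 1)" by (auto intro!: tendsto_eq_intros)
   have le: "cmod (\<phi> n z) <= real n*\<bar>1-Re z\<bar>*B" for z
   proof -
    have "\<bar>min 1 t\<bar> <= \<bar>t\<bar>" for t :: real by (auto simp: min_def)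
    from mult_mono[OF this[of "real n*(1-Re z)"] q] show ?thesis by (simp add: \<phi>_def c_def norm_mult abs_mult)
   qed
   have "(\<phi> n \<longlongrightarrow> 0) (at 1)" by (rule Lim_null_comparison[OF always_eventually l]) (intro allI le)
   thus ?thesis using True by (simp add: isCont_def \<phi>_def c_def)
  qed
 qed
 have \<phi>q: "\<phi> n (cis (x/L)) = of_real (c n (cis (x/L)))*q n x" if "x \<in> space (torus L)" for n x
 proof -
  have "Arg2pi (cis (x/L)) = x/L"
   using Arg2pi_exp[of "\<i> * of_real (x/L)"] that L by (simp add: cis_conv_exp space_restrict_space field_simps)
  thus ?thesis using L by (simp add: \<phi>_def)
 qed
 have \<phi>m: "(%x. \<phi> n (cis (x/L))) \<in> \<B> (torus L)" for n
 proof (subst measurable_cong[OF \<phi>q])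
  have "(%x. of_real (c n (cis (x/L)))*q n x) \<in> \<B> borel" unfolding c_def q_def by simp
  thus "(%x. of_real (c n (cis (x/L)))*q n x) \<in> \<B> (torus L)" by (intro measurable_restrict_space1) simp
 qed
 note PC = parseval_circle[OF L \<phi>c \<phi>m]
 have f2: "f \<in> L2 (torus L)" by (rule bounded_torus_square_integrable[OF f B(2)])
 show ?thesis
 proof (rule parseval_limit[OF L PC f2 torus_L2_dominated[OF \<phi>m f]])
  show "cmod (\<phi> n (cis (x/L))) <= B" for n x
   using mult_mono[of "c n (cis (x/L))" 1 "cmod (q n (L*Arg2pi (cis (x/L))))" B] c[of "cis (x/L)" n] q B(1)
   by (simp add: \<phi>_def norm_mult)
  have "AE x in lebesgue. x \<notin> N" using N by (simp add: negligible_iff_null_sets AE_not_in)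
  hence "AE x in lborel. x \<notin> N" by (simp add: AE_completion_iff)
  moreover have "AE x in lborel. x \<noteq> (0 :: real)" by (rule AE_lborel_singleton)
  ultimately have "AE x in lborel. x \<in> {0..<2*pi*L} --> (%n. \<phi> n (cis (x/L))) -->> f x"
  proof eventually_elim
   case (elim x)
   show ?case
   proof
    assume x: "x \<in> {0..<2*pi*L}"
    have "cos (x/L) \<noteq> 1"
    proof
     assume "cos (x/L) = 1"
     hence "cis (x/L) = 1" using sin_cos_squared_add[of "x/L"] by (simp add: complex_eq_iff)
     moreover have "Arg2pi (cis (x/L)) = x/L"
      using Arg2pi_exp[of "\<i> * of_real (x/L)"] x L by (simp add: cis_conv_exp field_simps)
     ultimately show False using elim L Arg2pi_exp[of 0] by simp
    qed
    hence d: "0 < 1-cos (x/L)" using cos_le_one[of "x/L"] by linarith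
    obtain m where m: "1/(1-cos (x/L)) <= real m" using real_arch_simple by blast
    have "\<forall>\<^sub>F n in sequentially. c n (cis (x/L)) = 1"
    proof (rule eventually_sequentiallyI)
     fix n assume "m <= n"
     hence "1/(1-cos (x/L)) <= real n" using m by linarith
     with d show "c n (cis (x/L)) = 1" by (simp add: c_def field_simps min_def)
    qed
    hence "(%n. c n (cis (x/L))) -->> 1" by (rule tendsto_eventually)
    moreover have "(%n. q n x) -->> of_real (B/max B (cmod (f0 x)))*f0 x"
     unfolding q_def by (intro tendsto_intros lim) (use elim B(1) in auto)
    moreover have "of_real (B/max B (cmod (f0 x)))*f0 x = f x" using B(1) B(2)[of x] x by (auto simp: f0_def max_def)
    ultimately have "(%n. of_real (c n (cis (x/L)))*q n x) -->> of_real 1*f x" by (intro tendsto_intros) simp_all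
    thus "(%n. \<phi> n (cis (x/L))) -->> f x" using x \<phi>q by (simp add: space_restrict_space)
   qed
  qed
  thus "AE x in torus L. (%n. \<phi> n (cis (x/L))) -->> f x" by (subst AE_restrict_space_iff) auto
 qed
qed

lemma plancherel_torus:
 assumes L: "1 <= L" and f: "f \<in> L2 (torus L)"
 shows "parseval L f"
proof (rule parseval_limit[OF L _ _ f])
 define g where "g n x = (if cmod (f x) <= real n then f x else 0)" for n x
 have [measurable]: "f \<in> \<B> (torus L)" using f by (simp add: square_integrable_iff)
 have g: "g n \<in> \<B> (torus L)" "cmod (g n x) <= real n" for n x unfolding g_def by simp_all
 show "g n \<in> L2 (torus L)" for n by (rule bounded_torus_square_integrable[OF g])
 show "parseval L (g n)" for n
  by (rule plancherel_torus_bounded[OF L g(1), of "real n+1"]) (auto intro: order_trans[OF g(2)])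
 show "(%n. sqn (torus L) (%x. g n x-f x)) -->> 0" unfolding g_def
 proof (rule L2_truncate[OF f])
  show "\<forall>\<^sub>F n in sequentially. cmod (f x) <= real n" for x
  proof -
   obtain m where "cmod (f x) <= real m" using real_arch_simple by blast
   thus ?thesis by (intro eventually_sequentiallyI[of m]) (auto intro: order_trans)
  qed
 qed measurable
qed

section \<open>The Plancherel theorem on the line\<close>

text \<open>Such an \<open>f\<close> lives on the torus of scale \<open>n\<close>. For a frequency y
  + th the factor with \<open>th\<close> is absorbed into \<open>f\<close> without changing its
  modulus, so the torus identity holds for each \<open>th\<close>, and the integral over the cell of
  length 1/n restores the line.\<close>

lemma plancherel_support:
 assumes n: "0 < n" and f: "f \<in> L12 lborel" and supp: "\<And>x. x \<notin> {0..<2*pi*real n} ==> f x = 0"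
 shows "sqn lborel (%xi. LINT x|lborel. f x * cis (- (x*xi))) = ennreal (2*pi) * sqn lborel f"
proof -
 have L: "1 <= real n" using n by simp
 have [measurable]: "f \<in> \<B> borel" using f by (auto simp: L12_def)
 have fm: "f \<in> \<B> (torus n)" by (rule measurable_restrict_space1) simp
 have s: "sqn (torus n) f = sqn lborel f"
  unfolding sqn_def by (subst nn_integral_restrict_space) (auto intro!: nn_integral_cong simp: indicator_def supp)
 have f2: "f \<in> L2 (torus n)" using f fm s by (simp add: L12_def square_integrable_iff)
 have F: "(LINT x|lborel. f x * cis (- (x*(y+th)))) = (LINT x|torus n. f x * cis (- (x*th)) * cis (- (x*y)))" for y th
  by (subst integral_restrict_space)
   (auto intro!: Bochner_Integration.integral_cong simp: indicator_def supp mult.assoc cis_mult algebra_simps)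
 have "sqn lborel (%xi. LINT x|lborel. f x * cis (- (x*xi))) =
   ennreal n*(NN th|lborel. ind {0..<1/n} th * sqn (latmeas n) (%y. LINT x|lborel. f x * cis (- (x*(y+th)))))"
  unfolding sqn_def by (rule nn_integral_lattice_decompose[OF L]) measurable
 also have "... = ennreal n*(NN th|lborel. ind {0..<1/n} th*(ennreal (2*pi) * sqn lborel f))"
  unfolding F plancherel_torus[OF L square_integrable_cis(1)[OF f2]] using s by (simp add: sqn_def norm_mult)
 also have "... = (ennreal n*ennreal (1/n))*(ennreal (2*pi) * sqn lborel f)"
  by (subst nn_integral_multc) (simp_all add: mult.assoc)
 also have "ennreal n*ennreal (1/n) = 1" using n by (simp flip: ennreal_mult)
 finally show ?thesis by simp
qed

text \<open>Truncations to symmetric intervals are translated into the supports just treated, which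
  changes the transform by a phase only. Fatou's lemma then bounds the transform of every function
  in the class, and with this bound the identity passes to the limit.\<close>

lemma plancherel_lborel:
 fixes f :: "real => complex"
 assumes f: "f \<in> L12 lborel"
 shows "sqn lborel (%xi. LINT x|lborel. f x * cis (- (x*xi))) = ennreal (2*pi) * sqn lborel f"
proof -
 let ?F = "%f xi. LINT x|lborel. f x * cis (- (x*xi))"
 define g where "g h n x = (if \<bar>x\<bar> < pi*real (Suc n) then h x else 0)" for h :: "real => complex" and n x
 have ci: "integrable lborel (%x. h x * cis (- (x*xi)))" if "h \<in> L12 lborel" for h xi
  by (rule integrable_mult_bounded[where B = 1]) (use that in \<open>auto simp: L12_def\<close>)
 have hm: "h \<in> \<B> borel" "?F h \<in> \<B> borel" if "h \<in> L12 lborel" for h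
 proof -
  show [measurable]: "h \<in> \<B> borel" using that by (auto simp: L12_def)
  show "?F h \<in> \<B> borel" by measurable
 qed
 have gh: "cmod (g h n x) <= cmod (h x)" for h n x by (simp add: g_def)
 have gL: "g h n \<in> L12 lborel" if h: "h \<in> L12 lborel" for h n
 proof -
  note hm(1)[OF h, measurable]
  have m: "g h n \<in> \<B> borel" unfolding g_def by measurable
  have "sqn lborel (g h n) <= sqn lborel h" by (rule sqn_mono) (rule gh)
  moreover have "integrable lborel (g h n)"
   by (rule Bochner_Integration.integrable_bound[of _ h]) (use h m gh in \<open>auto simp: L12_def\<close>)
  ultimately show ?thesis using h m by (auto simp: L12_def square_integrable_iff intro: le_less_trans)
 qed
 have iso: "sqn lborel (?F (g h n)) = ennreal (2*pi) * sqn lborel (g h n)" if h: "h \<in> L12 lborel" for h n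
 proof -
  define a where "a = pi*real (Suc n)"
  define k where "k x = g h n (- a+1*x)" for x
  note [measurable] = hm[OF gL[OF h]]
  have ks: "sqn lborel k = sqn lborel (g h n)"
   unfolding sqn_def k_def by (subst nn_integral_real_affine[where c = 1 and t = "- a"]) auto
  have "integrable lborel k"
   unfolding k_def by (rule lborel_integrable_real_affine) (use gL[OF h] in \<open>auto simp: L12_def\<close>)
  hence k: "k \<in> L12 lborel" using gL[OF h, of n] ks by (simp add: L12_def square_integrable_iff)
  have "?F (g h n) xi = cis (a*xi)*?F k xi" for xi
  proof -
   have "?F (g h n) xi = (LINT x|lborel. k x * cis (- ((- a+1*x)*xi)))"
    unfolding k_def using lborel_integral_real_affine[of 1 "%x. g h n x * cis (- (x*xi))" "- a"] by simp
   also have "... = (LINT x|lborel. cis (a*xi)*(k x * cis (- (x*xi))))"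
    by (simp add: mult.left_commute cis_mult algebra_simps)
   finally show ?thesis by simp
  qed
  moreover have "sqn lborel (?F k) = ennreal (2*pi) * sqn lborel k"
   by (rule plancherel_support[of "Suc n", OF _ k]) (auto simp: k_def g_def a_def)
  ultimately show ?thesis unfolding ks[symmetric] by (simp add: sqn_def norm_mult)
 qed
 have lim: "\<forall>\<^sub>F n in sequentially. \<bar>x\<bar> < pi*real (Suc n)" for x
 proof -
  obtain m where m: "\<bar>x\<bar> < real m" using reals_Archimedean2 by blast
  show ?thesis
  proof (rule eventually_sequentiallyI)
   fix n assume "m <= n"
   moreover have "1*real n <= pi*real (Suc n)" using pi_gt3 by (intro mult_mono) auto
   ultimately show "\<bar>x\<bar> < pi*real (Suc n)" using m by linarith
  qed
 qed
 have contr: "sqn lborel (?F h) <= ennreal (2*pi) * sqn lborel h" if h: "h \<in> L12 lborel" for h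
 proof -
  have "(%n. ?F (g h n) xi) -->> ?F h xi" for xi
  proof (rule integral_dominated_convergence[where w = "%x. cmod (h x)"])
   show "AE x in lborel. (%n. g h n x * cis (- (x*xi))) -->> h x * cis (- (x*xi))"
   proof (intro AE_I2 tendsto_eventually)
    show "\<forall>\<^sub>F n in sequentially. g h n x * cis (- (x*xi)) = h x * cis (- (x*xi))" for x
     using lim[of x] by eventually_elim (simp add: g_def)
   qed
  qed (use h ci gL gh in \<open>auto simp: L12_def norm_mult\<close>)
  hence "(%n. ennreal ((cmod (?F (g h n) xi))^2)) -->> ennreal ((cmod (?F h xi))^2)" for xi by (intro tendsto_intros)
  from lim_imp_Liminf[OF _ this] have "sqn lborel (?F h) = (NN xi|lborel. liminf (%n. ennreal ((cmod (?F (g h n) xi))^2)))"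
   by (simp add: sqn_def)
  also have "... <= liminf (%n. sqn lborel (?F (g h n)))"
   unfolding sqn_def by (rule nn_integral_liminf) (use hm(2)[OF gL[OF h]] in measurable)
  also have "... <= ennreal (2*pi) * sqn lborel h"
   by (intro Liminf_le always_eventually allI) (auto simp: iso[OF h] intro!: mult_left_mono sqn_mono gh)
  finally show ?thesis .
 qed
 show ?thesis
 proof (rule isometric_limit[where A = "L12 lborel" and F = ?F and g = "g f"])
  show "?F h \<in> L2 lborel" if h: "h \<in> L12 lborel" for h
   using le_less_trans[OF contr[OF h]] h hm[OF h] by (auto simp: L12_def square_integrable_iff ennreal_mult_less_top)
  show "sqn lborel (%xi. ?F h xi-?F k xi) <= ennreal (2*pi) * sqn lborel (%x. h x-k x)"
   if h: "h \<in> L12 lborel" and k: "k \<in> L12 lborel" for h k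
  proof -
   have "(%x. h x-k x) \<in> L12 lborel" using h k square_integrable_diff[of h lborel k] by (simp add: L12_def)
   from contr[OF this] show ?thesis using ci[OF h] ci[OF k] by (simp add: left_diff_distrib)
  qed
  show "(%n. sqn lborel (%x. g f n x-f x)) -->> 0"
   unfolding g_def by (rule L2_truncate[OF _ _ lim]) (use f in \<open>auto simp: L12_def\<close>)
 qed (use gL[OF f] iso[OF f] f in \<open>auto simp: L12_def\<close>)
qed

section \<open>The dual isometry from the lattice to the torus\<close>

lemma measurable_torus_lattice_cis:
 "(%z. cis (- (snd z*fst z))) \<in> \<B> (torus L \<otimes> latmeas L)"
proof -
 have 1: "fst \<in> torus L \<otimes> latmeas L ->M borel"
  by (rule measurable_compose[OF measurable_fst measurable_restrict_space1]) simp
 have 2: "snd \<in> torus L \<otimes> latmeas L ->M borel"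
  by (rule measurable_compose[OF measurable_snd]) (use measurable_lattice_borel[of L] in simp)
 show ?thesis using 1 2 by measurable
qed

text \<open>For finitely supported \<open>W\<close> this is Parseval's identity for trigonometric
  sums. An integrable \<open>W\<close> is restricted to balls; the sums then converge pointwise
  under the constant bound given by the L1 norm, and a constant is square integrable on the
  torus.\<close>

lemma plancherel_lattice:
 assumes L: "1 <= L" and W: "W \<in> L12 (latmeas L)"
 shows "sqn (torus L) (%x. LINT y|latmeas L. W y * cis (- (y*x))) = ennreal (2*pi) * sqn (latmeas L) W"
proof -
 interpret T: finite_measure "torus L" by (rule finite_torus)
 interpret A: sigma_finite_measure "latmeas L" by (rule sigma_finite_latmeas)
 have Wi: "integrable (latmeas L) W" and W2: "W \<in> L2 (latmeas L)" using W by (auto simp: L12_def)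
 define K where "K n = {y \<in> lattice L. \<bar>y\<bar> <= real n}" for n
 have K: "finite (K n)" "K n \<subseteq> lattice L" for n using finite_lattice_ball[OF L] by (auto simp: K_def)
 define V where "V n y = (if y \<in> K n then W y else 0)" for n y
 define P where "P U x = (LINT y|latmeas L. U y * cis (- (y*x)))" for U :: "real => complex" and x
 have Pm [measurable]: "P U \<in> \<B> (torus L)" for U
 proof -
  have "(%z. U (snd z)) \<in> \<B> (torus L \<otimes> latmeas L)" by (rule measurable_compose[OF measurable_snd]) simp
  hence "(%(x, y). U y * cis (- (y*x))) \<in> \<B> (torus L \<otimes> latmeas L)"
   using measurable_torus_lattice_cis[of L] unfolding case_prod_beta' by measurable
  from A.borel_measurable_lebesgue_integral[OF this] show ?thesis unfolding P_def[abs_def] by simp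
 qed
 have VW: "(%n. V n y) -->> W y" if "y \<in> lattice L" for y
 proof -
  obtain n where "\<bar>y\<bar> <= real n" using real_arch_simple by blast
  hence "\<forall>\<^sub>F n in sequentially. V n y = W y"
   using that by (intro eventually_sequentiallyI[of n]) (auto simp: V_def K_def)
  thus ?thesis by (rule tendsto_eventually)
 qed
 have Vb: "cmod (V n y) <= cmod (W y)" for n y by (simp add: V_def)
 have PV: "(%n. P (V n) x) -->> P W x" for x unfolding P_def
 proof (rule integral_dominated_convergence[where w = "%y. cmod (W y)"])
  show "AE y in latmeas L. (%n. V n y * cis (- (y*x))) -->> W y * cis (- (y*x))"
   by (intro AE_I2 tendsto_intros VW) simp
 qed (use Wi Vb in \<open>auto simp: norm_mult\<close>)
 have Pb: "cmod (P U x) <= (LINT y|latmeas L. cmod (W y))" if "\<And>y. cmod (U y) <= cmod (W y)" for U x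
  unfolding P_def
 proof (rule Bochner_Integration.integral_norm_bound_integral)
  show "integrable (latmeas L) (%y. U y * cis (- (y*x)))"
   by (rule Bochner_Integration.integrable_bound[OF integrable_norm[OF Wi]]) (use that in \<open>auto simp: norm_mult\<close>)
 qed (use Wi that in \<open>auto simp: norm_mult\<close>)
 have Psq: "P U \<in> L2 (torus L)" if "\<And>y. cmod (U y) <= cmod (W y)" for U
  by (rule bounded_torus_square_integrable[OF Pm Pb[OF that]])
 have V2: "V n \<in> L2 (latmeas L)" for n
 proof -
  have "sqn (latmeas L) (V n) <= sqn (latmeas L) W" using Vb by (intro sqn_mono)
  with W2 show ?thesis by (auto simp: square_integrable_iff intro: le_less_trans)
 qed
 have "(%n. sqn (torus L) (%x. P (V n) x-P W x)) -->> 0"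
 proof (rule sqn_dominated[where h = "%_. LINT y|latmeas L. cmod (W y)"])
  show "(NN x|torus L. ennreal ((LINT y|latmeas L. cmod (W y))^2)) < \<infinity>"
   using T.emeasure_finite[of "{0..<2*pi*L}"] by (simp add: ennreal_mult_eq_top_iff less_top[symmetric])
 qed (use PV Pb Vb in auto)
 hence 1: "(%n. sqn (torus L) (P (V n))) -->> sqn (torus L) (P W)" by (intro sqn_tendsto Psq Vb) auto
 have "(%n. sqn (latmeas L) (%y. V n y-W y)) -->> 0"
 proof (rule sqn_dominated[where h = "%y. cmod (W y)"])
  show "(NN y|latmeas L. ennreal ((cmod (W y))^2)) < \<infinity>" using W2 by (simp add: square_integrable_iff sqn_def)
 qed (use VW Vb in auto)
 hence "(%n. sqn (latmeas L) (V n)) -->> sqn (latmeas L) W" by (intro sqn_tendsto V2 W2)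
 hence 2: "(%n. ennreal (2*pi) * sqn (latmeas L) (V n)) -->> ennreal (2*pi) * sqn (latmeas L) W"
  by (intro ennreal_tendsto_cmult) auto
 have "sqn (torus L) (P (V n)) = ennreal (2*pi) * sqn (latmeas L) (V n)" for n
 proof -
  have PVn: "cmod (P (V n) x) = 1/L * cmod (\<Sum>y\<in>K n. cnj (W y) * cis (x*y))" for x
  proof -
   have "P (V n) x = (LINT y|latmeas L. (if y \<in> K n then W y * cis (- (y*x)) else 0))"
    unfolding P_def V_def by (intro Bochner_Integration.integral_cong) auto
   also have "... = of_real (1/L)*(\<Sum>y\<in>K n. W y * cis (- (y*x)))" by (rule integral_latmeas_finite[OF L K])
   also have "(\<Sum>y\<in>K n. W y * cis (- (y*x))) = cnj (\<Sum>y\<in>K n. cnj (W y) * cis (x*y))"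
    by (simp add: cis_cnj mult.commute)
   finally show ?thesis using L by (simp add: norm_mult norm_divide del: cnj_sum)
  qed
  have "sqn (torus L) (P (V n)) = ennreal (LINT x|torus L. (cmod (P (V n) x))^2)"
   by (rule sqn_eq_integral[OF Psq[OF Vb]])
  also have "(LINT x|torus L. (cmod (P (V n) x))^2) = (1/L)^2*(2*pi*L*(\<Sum>y\<in>K n. (cmod (cnj (W y)))^2))"
   unfolding PVn power_mult_distrib by (simp add: parseval_finite[OF L K] del: complex_mod_cnj)
  also have "... = 2*pi*(1/L*(\<Sum>y\<in>K n. (cmod (W y))^2))" using L by (simp add: power2_eq_square)
  finally have "sqn (torus L) (P (V n)) = ennreal (2*pi*(1/L*(\<Sum>y\<in>K n. (cmod (W y))^2)))" .
  also have "... = ennreal (2*pi)*ennreal (1/L*(\<Sum>y\<in>K n. (cmod (W y))^2))" by (rule ennreal_mult') simp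
  finally show ?thesis unfolding sqn_latmeas_finite[OF L K, symmetric] by (simp only: V_def[abs_def])
 qed
 with 1 2 have "sqn (torus L) (P W) = ennreal (2*pi) * sqn (latmeas L) W" by (simp add: LIMSEQ_unique)
 thus ?thesis unfolding P_def[abs_def] .
qed

section \<open>Normalised Fourier kernels and their products\<close>

text \<open>The normalisation is part of the kernel, so that the kernel of a product space is the
  product of the kernels and each factor is an isometry by itself.\<close>

definition fourier_kernel :: "'a::euclidean_space => 'a => complex" where
 "fourier_kernel x y = of_real ((2*pi) powr (- (real DIM('a)/2))) * cis (- (x \<bullet> y))"

lemma fourier_integral_kernel: "fourier_integral M f y = (LINT x|M. f x*fourier_kernel x y)"
proof -
 have "(LINT x|M. f x*fourier_kernel x y) =
  (LINT x|M. of_real ((2*pi) powr (- (real DIM('a)/2)))*(f x * cis (- (x \<bullet> y))))"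
  unfolding fourier_kernel_def by (simp add: mult_ac)
 thus ?thesis unfolding fourier_integral_def integral_mult_right_zero by simp
qed

lemma fourier_kernel_commute: "fourier_kernel x y = fourier_kernel y x"
 by (simp add: fourier_kernel_def inner_commute)

lemma fourier_kernel_prod: "fourier_kernel x y = fourier_kernel (fst x) (fst y)*fourier_kernel (snd x) (snd y)"
proof -
 have "(2*pi) powr (- (real (DIM('a)+DIM('b))/2)) = (2*pi) powr (- (real DIM('a)/2))*(2*pi) powr (- (real DIM('b)/2))"
  by (simp flip: powr_add add: add_divide_distrib)
 moreover have "cis (- (x \<bullet> y)) = cis (- (fst x \<bullet> fst y)) * cis (- (snd x \<bullet> snd y))"
  by (simp add: cis_mult inner_prod_def)
 ultimately show ?thesis by (simp add: fourier_kernel_def)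
qed

lemma norm_fourier_kernel_le: "cmod (fourier_kernel x y) <= 1"
proof -
 have "(2*pi) powr (- (real DIM('a)/2)) <= (2*pi) powr 0" using pi_gt3 by (intro powr_mono) auto
 thus ?thesis by (simp add: fourier_kernel_def norm_mult)
qed

lemma isometric_fourier_kernel_real:
 fixes M M' :: "real measure"
 assumes "sigma_finite_measure M" "sigma_finite_measure M'"
  and m: "(%z. cis (- (fst z * snd z))) \<in> \<B> (M \<otimes> M')"
  and iso: "\<And>f. f \<in> L12 M ==> sqn M' (%y. LINT x|M. f x * cis (- (x*y))) = ennreal (2*pi) * sqn M f"
 shows "isometric_kernel M M' fourier_kernel" unfolding isometric_kernel_def
proof (intro conjI allI impI exI)
 show "cmod (fourier_kernel x y) <= 1" for x y :: real by (rule norm_fourier_kernel_le)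
 show "(%(x, y). fourier_kernel x y) \<in> \<B> (M \<otimes> M')"
  using m unfolding fourier_kernel_def case_prod_beta' by simp
 fix f assume f: "integrable M f" "f \<in> L2 M"
 have "(LINT x|M. f x*fourier_kernel x y) = of_real ((2*pi) powr (- (1/2)))*(LINT x|M. f x * cis (- (x*y)))" for y
  using fourier_integral_kernel[of M f y] by (simp add: fourier_integral_def)
 hence "sqn M' (%y. LINT x|M. f x*fourier_kernel x y) =
   (NN y|M'. ennreal (((2*pi) powr (- (1/2)))^2)*ennreal ((cmod (LINT x|M. f x * cis (- (x*y))))^2))"
  by (simp add: sqn_def norm_mult power_mult_distrib ennreal_mult)
 also have "... = ennreal (((2*pi) powr (- (1/2)))^2) * sqn M' (%y. LINT x|M. f x * cis (- (x*y)))" unfolding sqn_def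
 proof (rule nn_integral_cmult)
  interpret sigma_finite_measure M by fact
  have "(%z. f (snd z)) \<in> \<B> (M' \<otimes> M)" using f by (intro measurable_compose[OF measurable_snd]) auto
  moreover have "(%z. cis (- (snd z*fst z))) \<in> \<B> (M' \<otimes> M)"
   using measurable_pair_swap[OF m] by (simp add: case_prod_beta')
  ultimately have "(%(y, x). f x * cis (- (x*y))) \<in> \<B> (M' \<otimes> M)" unfolding case_prod_beta' by measurable
  from borel_measurable_lebesgue_integral[OF this]
  show "(%y. ennreal ((cmod (LINT x|M. f x * cis (- (x*y))))^2)) \<in> \<B> M'" by measurable
 qed
 also have "... = ennreal (((2*pi) powr (- (1/2)))^2*(2*pi)) * sqn M f"
  using f by (simp add: iso L12_def ennreal_mult mult.assoc)
 also have "((2*pi) powr (- (1/2)))^2*(2*pi) = 1" by (simp add: powr_minus powr_half_sqrt power_inverse)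
 finally show "sqn M' (%y. LINT x|M. f x*fourier_kernel x y) = sqn M f" by simp
qed (use assms in auto)

lemma isometric_fourier_lborel: "isometric_kernel lborel lborel (fourier_kernel :: real => _)"
 by (rule isometric_fourier_kernel_real[OF lborel.sigma_finite_measure_axioms lborel.sigma_finite_measure_axioms _ plancherel_lborel])
  auto

lemma isometric_fourier_torus:
 assumes "1 <= L"
 shows "isometric_kernel (torus L) (latmeas L) fourier_kernel"
proof (rule isometric_fourier_kernel_real[OF sigma_finite_torus sigma_finite_latmeas])
 show "(%z. cis (- (fst z * snd z))) \<in> \<B> (torus L \<otimes> latmeas L)"
  using measurable_torus_lattice_cis[of L] by (simp only: mult.commute)
 show "sqn (latmeas L) (%y. LINT x|torus L. f x * cis (- (x*y))) = ennreal (2*pi) * sqn (torus L) f" if "f \<in> L12 (torus L)" for f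
  by (rule plancherel_torus[OF assms]) (use that in \<open>simp add: L12_def\<close>)
qed

lemma isometric_fourier_lattice:
 assumes "1 <= L"
 shows "isometric_kernel (latmeas L) (torus L) fourier_kernel"
proof (rule isometric_fourier_kernel_real[OF sigma_finite_latmeas sigma_finite_torus _ plancherel_lattice[OF assms]])
 show "(%z. cis (- (fst z * snd z))) \<in> \<B> (latmeas L \<otimes> torus L)"
  using measurable_pair_swap[OF measurable_torus_lattice_cis[of L]] by (simp add: case_prod_beta')
qed

lemma isometric_fourier_prod:
 fixes M M' :: "'a::euclidean_space measure" and N N' :: "'b::euclidean_space measure"
 assumes "isometric_kernel M M' fourier_kernel" "isometric_kernel N N' fourier_kernel"
 shows "isometric_kernel (M \<otimes> N) (M' \<otimes> N') fourier_kernel"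
 using isometric_kernel_prod[OF assms] unfolding fourier_kernel_prod[symmetric] .

section \<open>The L2 Fourier transform for a dual pair of measures\<close>

lemma ennreal_double_less_half:
 assumes "x < ennreal (e/4)" "0 < e"
 shows "2*x < ennreal (e/2)"
proof -
 have "2*x < 2*ennreal (e/4)" using assms by (intro ennreal_mult_strict_left_mono) auto
 also have "2*ennreal (e/4) = ennreal (e/2)" using ennreal_mult[of 2 "e/4"] assms(2) by simp
 finally show ?thesis .
qed

text \<open>Common setting for the line, the torus, the waveguide and space-time. Isometry is
  required in both directions, because surjectivity uses the inverse transform. Balls of finite
  measure make the truncation of an L2 function integrable.\<close>

locale fourier_pair =
 fixes M M' :: "'a::euclidean_space measure"
 assumes kernel: "isometric_kernel M M' fourier_kernel" and kernel': "isometric_kernel M' M fourier_kernel"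
  and norm_measurable [measurable]: "norm \<in> \<B> M" "norm \<in> \<B> M'"
  and ball_finite: "\<And>R::real. emeasure M {x \<in> space M. norm x <= R} < \<infinity>"
   "\<And>R::real. emeasure M' {x \<in> space M'. norm x <= R} < \<infinity>"
begin

definition trunc :: "real => ('a => complex) => 'a => complex" where
 "trunc R f z = (if norm z <= R then f z else 0)"

lemma sym: "fourier_pair M' M" by (rule fourier_pair.intro) (fact kernel kernel' norm_measurable ball_finite)+

lemma trunc_L12:
 assumes f: "f \<in> L2 M"
 shows "trunc R f \<in> L12 M"
proof -
 have [measurable]: "f \<in> \<B> M" using f by (simp add: square_integrable_iff)
 have m [measurable]: "trunc R f \<in> \<B> M" unfolding trunc_def[abs_def] by measurable
 have "(NN x|M. ennreal (norm (trunc R f x))) <= (NN x|M. ind {x \<in> space M. norm x <= R} x+ennreal ((cmod (f x))^2))"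
 proof (rule nn_integral_mono)
  fix x assume x: "x \<in> space M"
  have "cmod (f x) <= 1+(cmod (f x))^2"
   using sum_squares_bound[of 1 "cmod (f x)"] norm_ge_zero[of "f x"] by (simp, linarith)
  hence "ennreal (cmod (f x)) <= 1+ennreal ((cmod (f x))^2)" using ennreal_leI by fastforce
  thus "ennreal (norm (trunc R f x)) <= ind {x \<in> space M. norm x <= R} x+ennreal ((cmod (f x))^2)"
   using x by (simp add: trunc_def)
 qed
 also have "... = emeasure M {x \<in> space M. norm x <= R} + sqn M f"
  unfolding sqn_def by (subst nn_integral_add) auto
 also have "... < \<infinity>" using ball_finite(1) f by (simp add: square_integrable_iff)
 finally have "integrable M (trunc R f)" by (simp add: integrable_iff_bounded)
 moreover have "sqn M (trunc R f) <= sqn M f" by (rule sqn_mono) (simp add: trunc_def)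
 hence "trunc R f \<in> L2 M" using f by (auto simp: square_integrable_iff intro: le_less_trans)
 ultimately show ?thesis by (simp add: L12_def)
qed

lemma trunc_tendsto:
 assumes f: "f \<in> L2 M"
 shows "((%R. sqn M (%x. trunc R f x-f x)) \<longlongrightarrow> 0) at_top"
proof (rule tendsto_at_topI_sequentially)
 fix X :: "nat => real" assume X: "filterlim X at_top sequentially"
 show "(%n. sqn M (%x. trunc (X n) f x-f x)) -->> 0" unfolding trunc_def
 proof (rule L2_truncate[OF f])
  show "Measurable.pred M (%x. norm x <= X n)" for n by measurable
  show "\<forall>\<^sub>F n in sequentially. norm x <= X n" for x using X by (simp add: filterlim_at_top)
 qed
qed

lemma fourier_integral_diff:
 assumes "integrable M f" "integrable M g" and y: "y \<in> space M'"
 shows "fourier_integral M f y-fourier_integral M g y = fourier_integral M (%x. f x-g x) y"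
 unfolding fourier_integral_kernel
 using isometric_kernel_integrable[OF kernel assms(1) y] isometric_kernel_integrable[OF kernel assms(2) y]
 by (simp add: left_diff_distrib)

lemma sqn_fourier_integral: "f \<in> L12 M ==> sqn M' (fourier_integral M f) = sqn M f"
 unfolding fourier_integral_kernel[abs_def] by (rule isometric_kernelD(4)[OF kernel]) (simp_all add: L12_def)

lemma fourier_integral_L2: "f \<in> L12 M ==> fourier_integral M f \<in> L2 M'"
 unfolding fourier_integral_kernel[abs_def] by (rule isometric_kernel_square_integrable[OF kernel]) (simp_all add: L12_def)

lemma L12_diff: "f \<in> L12 N ==> g \<in> L12 N ==> (%x. f x-g x) \<in> L12 N"
 by (simp add: L12_def square_integrable_diff)

lemma sqn_fourier_integral_diff:
 assumes "f \<in> L12 M" "g \<in> L12 M"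
 shows "sqn M' (%y. fourier_integral M f y-fourier_integral M g y) = sqn M (%x. f x-g x)"
proof -
 have "sqn M' (%y. fourier_integral M f y-fourier_integral M g y) = sqn M' (fourier_integral M (%x. f x-g x))"
  by (rule sqn_cong_AE) (use assms in \<open>auto intro!: AE_I2 fourier_integral_diff simp: L12_def\<close>)
 also have "... = sqn M (%x. f x-g x)" by (rule sqn_fourier_integral[OF L12_diff[OF assms]])
 finally show ?thesis .
qed

lemma is_fourier_iff:
 "is_fourier M M' f g \<longleftrightarrow> f \<in> L2 M \<and> g \<in> L2 M' \<and>
   ((%R. sqn M' (%y. fourier_integral M (trunc R f) y-g y)) \<longlongrightarrow> 0) at_top"
 unfolding is_fourier_def sqn_def trunc_def[abs_def] ..

lemma L2D: "f \<in> L2 N ==> f \<in> \<B> N" by (simp add: square_integrable_iff)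

lemma L12D: "f \<in> L12 N ==> f \<in> \<B> N" "f \<in> L12 N ==> f \<in> L2 N" by (auto simp: L12_def)

text \<open>The constant 4 is the price of two triangle inequalities for squared norms, through the
  truncations of \<open>f\<close>, each with the factor 2; the other terms vanish in the
  limit.\<close>

lemma is_fourier_approx:
 assumes fg: "is_fourier M M' f g" and V: "V \<in> L12 M"
 shows "sqn M' (%y. fourier_integral M V y-g y) <= 4 * sqn M (%x. V x-f x)"
proof (rule tendsto_le[OF _ _ tendsto_const])
 have f: "f \<in> L2 M" and g: "g \<in> L2 M'"
  and lim: "((%R. sqn M' (%y. fourier_integral M (trunc R f) y-g y)) \<longlongrightarrow> 0) at_top"
  using fg by (auto simp: is_fourier_iff)
 let ?b = "%R. 2*(2 * sqn M (%x. V x-f x)+2 * sqn M (%x. trunc R f x-f x))+2 * sqn M' (%y. fourier_integral M (trunc R f) y-g y)"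
 have "(?b \<longlongrightarrow> 2*(2 * sqn M (%x. V x-f x)+2*0)+2*0) at_top"
  by (intro tendsto_add ennreal_tendsto_cmult lim trunc_tendsto[OF f] tendsto_const) auto
 thus "(?b \<longlongrightarrow> 4 * sqn M (%x. V x-f x)) at_top" by (simp add: mult.assoc[symmetric])
 have "sqn M' (%y. fourier_integral M V y-g y) <= ?b R" for R
 proof -
  have "sqn M' (%y. fourier_integral M V y-g y) <= 2 * sqn M' (%y. fourier_integral M V y-fourier_integral M (trunc R f) y)
    + 2 * sqn M' (%y. fourier_integral M (trunc R f) y-g y)"
   by (intro sqn_triangle L2D fourier_integral_L2 V trunc_L12 f g)
  also have "sqn M' (%y. fourier_integral M V y-fourier_integral M (trunc R f) y) = sqn M (%x. V x-trunc R f x)"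
   by (rule sqn_fourier_integral_diff[OF V trunc_L12[OF f]])
  also have "2 * sqn M (%x. V x-trunc R f x)+2 * sqn M' (%y. fourier_integral M (trunc R f) y-g y) <=
    2*(2 * sqn M (%x. V x-f x)+2 * sqn M (%x. f x-trunc R f x))+2 * sqn M' (%y. fourier_integral M (trunc R f) y-g y)"
   by (intro add_right_mono mult_left_mono sqn_triangle L2D f L12D(1)[OF V] L12D(1)[OF trunc_L12[OF f]]) auto
  finally show ?thesis by (simp add: sqn_minus_commute[of M f])
 qed
 thus "\<forall>\<^sub>F R in at_top. sqn M' (%y. fourier_integral M V y-g y) <= ?b R" by simp
qed simp

text \<open>Completeness supplies the limit along integer radii; a comparison with these radii
  extends the convergence to all real radii, as the definition demands.\<close>

lemma is_fourier_exists:
 assumes f: "f \<in> L2 M"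
 shows "\<exists>g. is_fourier M M' f g"
proof -
 let ?F = "%R. fourier_integral M (trunc R f)"
 have T: "trunc R f \<in> L12 M" for R by (rule trunc_L12[OF f])
 have F2: "?F R \<in> L2 M'" for R by (rule fourier_integral_L2[OF T])
 have d: "sqn M' (%y. ?F R y-?F R' y) <= 2 * sqn M (%x. trunc R f x-f x)+2 * sqn M (%x. trunc R' f x-f x)" for R R'
 proof -
  have "sqn M' (%y. ?F R y-?F R' y) = sqn M (%x. trunc R f x-trunc R' f x)" by (rule sqn_fourier_integral_diff[OF T T])
  also have "... <= 2 * sqn M (%x. trunc R f x-f x)+2 * sqn M (%x. f x-trunc R' f x)"
   by (intro sqn_triangle L2D f L12D(2)[OF T])
  finally show ?thesis by (simp add: sqn_minus_commute[of M f])
 qed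
 have small: "\<exists>R0. \<forall>R\<ge>R0. sqn M (%x. trunc R f x-f x) < ennreal e" if "0 < e" for e :: real
  using order_tendstoD(2)[OF trunc_tendsto[OF f], of "ennreal e"] that by (simp add: eventually_at_top_linorder)
 obtain g where g: "g \<in> L2 M'" "(%n. sqn M' (%y. ?F (real n) y-g y)) -->> 0"
 proof (rule L2_complete[of "%n. ?F (real n)" M'])
  fix e :: real assume e: "0 < e"
  then obtain R0 where R0: "\<forall>R\<ge>R0. sqn M (%x. trunc R f x-f x) < ennreal (e/4)" using small[of "e/4"] by auto
  obtain N :: nat where N: "R0 <= real N" using real_arch_simple by blast
  have "sqn M' (%y. ?F (real m) y-?F (real n) y) < ennreal e" if "N <= m" "N <= n" for m n
  proof -
   have a: "sqn M (%x. trunc (real m) f x-f x) < ennreal (e/4)" "sqn M (%x. trunc (real n) f x-f x) < ennreal (e/4)"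
    using R0 N that by auto
   note t = ennreal_double_less_half[OF _ e]
   have "2 * sqn M (%x. trunc (real m) f x-f x)+2 * sqn M (%x. trunc (real n) f x-f x) < ennreal (e/2)+ennreal (e/2)"
    by (intro add_strict_mono t a)
   also have "... = ennreal e" using e by (simp flip: ennreal_plus)
   finally show ?thesis using d[of "real m" "real n"] by (rule le_less_trans[rotated])
  qed
  thus "\<exists>N. \<forall>m\<ge>N. \<forall>n\<ge>N. sqn M' (%x. ?F (real m) x-?F (real n) x) < ennreal e" by blast
 qed (use F2 that in auto)
 have lim: "((%R. sqn M' (%y. ?F R y-g y)) \<longlongrightarrow> 0) at_top"
 proof (rule tendsto_sandwich[OF _ _ tendsto_const])
  show "((%R. 4 * sqn M (%x. trunc R f x-f x)) \<longlongrightarrow> 0) at_top"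
   using ennreal_tendsto_cmult[OF _ trunc_tendsto[OF f], of 4] by simp
  have "sqn M' (%y. ?F R y-g y) <= 4 * sqn M (%x. trunc R f x-f x)" for R
  proof (rule LIMSEQ_le_const)
   let ?b = "%n. 2*(2 * sqn M (%x. trunc R f x-f x)+2 * sqn M (%x. trunc (real n) f x-f x))+2 * sqn M' (%y. ?F (real n) y-g y)"
   have tn: "(%n. sqn M (%x. trunc (real n) f x-f x)) -->> 0"
    by (rule filterlim_compose[OF trunc_tendsto[OF f] filterlim_real_sequentially])
   have "?b -->> 2*(2 * sqn M (%x. trunc R f x-f x)+2*0)+2*0"
    by (intro tendsto_add ennreal_tendsto_cmult g tn tendsto_const) auto
   thus "?b -->> 4 * sqn M (%x. trunc R f x-f x)" by (simp add: mult.assoc[symmetric])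
   have "sqn M' (%y. ?F R y-g y) <= ?b n" for n
   proof -
    have "sqn M' (%y. ?F R y-g y) <= 2 * sqn M' (%y. ?F R y-?F (real n) y)+2 * sqn M' (%y. ?F (real n) y-g y)"
     by (intro sqn_triangle L2D F2 g)
    also have "... <= ?b n" by (intro add_right_mono mult_left_mono d) simp
    finally show ?thesis .
   qed
   thus "\<exists>N. \<forall>n\<ge>N. sqn M' (%y. ?F R y-g y) <= ?b n" by blast
  qed
  thus "\<forall>\<^sub>F R in at_top. sqn M' (%y. ?F R y-g y) <= 4 * sqn M (%x. trunc R f x-f x)" by simp
 qed simp
 thus ?thesis using f g(1) by (auto simp: is_fourier_iff)
qed

lemma is_fourier_fourier: "f \<in> L2 M ==> is_fourier M M' f (fourier M M' f)"
 unfolding fourier_def by (rule someI_ex[OF is_fourier_exists])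

text \<open>Any approximation of \<open>f\<close> may be used instead of the truncations to balls.\<close>

lemma is_fourier_limit_unique:
 assumes fg: "is_fourier M M' f g" and V: "\<And>n. V n \<in> L12 M"
  and lim: "(%n. sqn M (%x. V n x-f x)) -->> 0"
  and h: "h \<in> \<B> M'" "(%n. sqn M' (%y. fourier_integral M (V n) y-h y)) -->> 0"
 shows "AE y in M'. g y = h y"
proof (rule sqn_zero_AE)
 have gm: "g \<in> \<B> M'" using fg by (simp add: is_fourier_iff square_integrable_iff)
 have "sqn M' (%y. g y-h y) <= 0"
 proof (rule LIMSEQ_le_const)
  let ?b = "%n. 8 * sqn M (%x. V n x-f x)+2 * sqn M' (%y. fourier_integral M (V n) y-h y)"
  have "?b -->> 8*0+2*0" by (intro tendsto_add ennreal_tendsto_cmult lim h) auto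
  thus "?b -->> 0" by simp
  have "sqn M' (%y. g y-h y) <= ?b n" for n
  proof -
   have "sqn M' (%y. g y-h y) <= 2 * sqn M' (%y. g y-fourier_integral M (V n) y)+2 * sqn M' (%y. fourier_integral M (V n) y-h y)"
    by (intro sqn_triangle gm h L2D fourier_integral_L2 V)
   also have "... <= 2*(4 * sqn M (%x. V n x-f x))+2 * sqn M' (%y. fourier_integral M (V n) y-h y)"
    using is_fourier_approx[OF fg V[of n]] by (intro add_right_mono mult_left_mono) (simp_all add: sqn_minus_commute[of _ g])
   finally show ?thesis by (simp add: mult.assoc[symmetric])
  qed
  thus "\<exists>N. \<forall>n\<ge>N. sqn M' (%y. g y-h y) <= ?b n" by blast
 qed
 thus "sqn M' (%y. g y-h y) = 0" by simp
qed (use fg h in \<open>auto simp: is_fourier_iff square_integrable_iff\<close>)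

lemma is_fourier_cong:
 assumes fg: "is_fourier M M' f g" and f: "f' \<in> \<B> M" "AE x in M. f x = f' x"
  and g: "g' \<in> \<B> M'" "AE y in M'. g y = g' y"
 shows "is_fourier M M' f' g'"
proof -
 have "sqn M f' = sqn M f" using f(2) by (auto intro!: sqn_cong_AE)
 hence f2: "f \<in> L2 M" "f' \<in> L2 M" using fg f(1) by (auto simp: is_fourier_iff square_integrable_iff)
 have FI: "fourier_integral M (trunc R f) y = fourier_integral M (trunc R f') y" if y: "y \<in> space M'" for R y
  unfolding fourier_integral_kernel
 proof (rule integral_cong_AE)
  have "integrable M (%x. trunc R h x*fourier_kernel x y)" if "h \<in> L2 M" for h
   by (rule isometric_kernel_integrable[OF kernel _ y]) (use trunc_L12[OF that] in \<open>simp add: L12_def\<close>)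
  with f2 show "(%x. trunc R f x*fourier_kernel x y) \<in> \<B> M"
   "(%x. trunc R f' x*fourier_kernel x y) \<in> \<B> M" by auto
  show "AE x in M. trunc R f x*fourier_kernel x y = trunc R f' x*fourier_kernel x y"
   using f(2) by eventually_elim (simp add: trunc_def)
 qed
 have "sqn M' (%y. fourier_integral M (trunc R f') y-g' y) = sqn M' (%y. fourier_integral M (trunc R f) y-g y)" for R
 proof (rule sqn_cong_AE)
  show "AE y in M'. fourier_integral M (trunc R f') y-g' y = fourier_integral M (trunc R f) y-g y"
   using g(2) AE_space by eventually_elim (simp add: FI)
 qed
 moreover have "sqn M' g' = sqn M' g" using g(2) by (auto intro!: sqn_cong_AE)
 ultimately show ?thesis using fg f2 g(1) by (simp add: is_fourier_iff square_integrable_iff)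
qed

lemma is_fourier_unique:
 assumes "is_fourier M M' f g" "is_fourier M M' f h"
 shows "AE y in M'. g y = h y"
proof (rule is_fourier_limit_unique[OF assms(1)])
 have f: "f \<in> L2 M" using assms by (simp add: is_fourier_iff)
 show "trunc (real n) f \<in> L12 M" for n by (rule trunc_L12[OF f])
 show "(%n. sqn M (%x. trunc (real n) f x-f x)) -->> 0"
  by (rule filterlim_compose[OF trunc_tendsto[OF f] filterlim_real_sequentially])
 have l: "((%R. sqn M' (%y. fourier_integral M (trunc R f) y-h y)) \<longlongrightarrow> 0) at_top"
  using assms(2) by (simp add: is_fourier_iff)
 show "(%n. sqn M' (%y. fourier_integral M (trunc (real n) f) y-h y)) -->> 0"
  by (rule filterlim_compose[OF l filterlim_real_sequentially])
qed (use assms in \<open>auto simp: is_fourier_iff square_integrable_iff\<close>)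

text \<open>By the adjoint identity, the inverse transforms of the truncations of \<open>h\<close> converge to a
 function with transform \<open>h\<close>.\<close>

lemma is_fourier_surj:
 assumes h: "h \<in> L2 M'"
 shows "\<exists>f. is_fourier M M' f h"
proof -
 interpret S: fourier_pair M' M by (rule sym)
 have kc: "isometric_kernel M' M (%y x. cnj (fourier_kernel x y))"
  using isometric_kernel_cnj[OF kernel'] by (simp add: fourier_kernel_commute)
 define W where "W n = S.trunc (real n) h" for n :: nat
 have W: "W n \<in> L12 M'" for n unfolding W_def by (rule S.trunc_L12[OF h])
 have Wl: "(%n. sqn M' (%y. W n y-h y)) -->> 0"
  unfolding W_def by (rule filterlim_compose[OF S.trunc_tendsto[OF h] filterlim_real_sequentially])
 define I where "I n x = (LINT y|M'. W n y * cnj (fourier_kernel x y))" for n x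
 have I2: "I n \<in> L2 M" for n
  unfolding I_def[abs_def] by (rule isometric_kernel_square_integrable[OF kc]) (use W in \<open>auto simp: L12_def\<close>)
 have Id: "sqn M (%x. I m x-I n x) = sqn M' (%y. W m y-W n y)" for m n
 proof -
  have "sqn M (%x. I m x-I n x) = sqn M (%x. LINT y|M'. (W m y-W n y) * cnj (fourier_kernel x y))"
  proof (rule sqn_cong_AE, rule AE_I2)
   fix x assume x: "x \<in> space M"
   have i: "integrable M' (%y. W k y * cnj (fourier_kernel x y))" for k
    using isometric_kernel_integrable[OF kc _ x, of "W k"] W[of k] by (simp add: L12_def)
   show "I m x-I n x = (LINT y|M'. (W m y-W n y) * cnj (fourier_kernel x y))"
    unfolding I_def using i by (simp add: left_diff_distrib)
  qed
  also have "... = sqn M' (%y. W m y-W n y)"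
   by (rule isometric_kernelD(4)[OF kc]) (use L12_diff[OF W W] in \<open>auto simp: L12_def\<close>)
  finally show ?thesis .
 qed
 obtain f where f: "f \<in> L2 M" "(%n. sqn M (%x. I n x-f x)) -->> 0"
 proof (rule L2_complete[of I M])
  fix e :: real assume e: "0 < e"
  hence "\<forall>\<^sub>F n in sequentially. sqn M' (%y. W n y-h y) < ennreal (e/4)"
   using order_tendstoD(2)[OF Wl, of "ennreal (e/4)"] by simp
  then obtain N where N: "\<And>n. N <= n ==> sqn M' (%y. W n y-h y) < ennreal (e/4)"
   by (auto simp: eventually_sequentially)
  have "sqn M (%x. I m x-I n x) < ennreal e" if "N <= m" "N <= n" for m n
  proof -
   have "sqn M (%x. I m x-I n x) <= 2 * sqn M' (%y. W m y-h y)+2 * sqn M' (%y. h y-W n y)"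
    unfolding Id by (intro sqn_triangle L12D(1)[OF W] L2D[OF h])
   also have "... = 2 * sqn M' (%y. W m y-h y)+2 * sqn M' (%y. W n y-h y)" by (simp add: sqn_minus_commute[of _ h])
   also have "... < ennreal (e/2)+ennreal (e/2)"
   proof -
    note t = ennreal_double_less_half[OF _ e]
    show ?thesis by (intro add_strict_mono t N that)
   qed
   also have "... = ennreal e" using e by (simp flip: ennreal_plus)
   finally show ?thesis .
  qed
  thus "\<exists>N. \<forall>m\<ge>N. \<forall>n\<ge>N. sqn M (%x. I m x-I n x) < ennreal e" by blast
 qed (use I2 that in auto)
 have "((%R. sqn M' (%y. fourier_integral M (trunc R f) y-h y)) \<longlongrightarrow> 0) at_top"
 proof (rule tendsto_sandwich[OF _ _ tendsto_const])
  show "((%R. 4 * sqn M (%x. trunc R f x-f x)) \<longlongrightarrow> 0) at_top"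
   using ennreal_tendsto_cmult[OF _ trunc_tendsto[OF f(1)], of 4] by simp
  have "sqn M' (%y. fourier_integral M (trunc R f) y-h y) <= 4 * sqn M (%x. trunc R f x-f x)" for R
  proof (rule LIMSEQ_le_const)
   have T: "trunc R f \<in> L12 M" by (rule trunc_L12[OF f(1)])
   let ?b = "%n. 2*(2 * sqn M (%x. I n x-f x)+2 * sqn M (%x. trunc R f x-f x))+2 * sqn M' (%y. W n y-h y)"
   have "?b -->> 2*(2*0+2 * sqn M (%x. trunc R f x-f x))+2*0"
    by (intro tendsto_add ennreal_tendsto_cmult f Wl tendsto_const) auto
   thus "?b -->> 4 * sqn M (%x. trunc R f x-f x)" by (simp add: mult.assoc[symmetric])
   have "sqn M' (%y. fourier_integral M (trunc R f) y-h y) <= ?b n" for n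
   proof -
    have "sqn M' (%y. fourier_integral M (trunc R f) y-h y) <=
      2 * sqn M' (%y. fourier_integral M (trunc R f) y-W n y)+2 * sqn M' (%y. W n y-h y)"
     by (intro sqn_triangle L2D fourier_integral_L2 T h L12D(1)[OF W])
    also have "sqn M' (%y. fourier_integral M (trunc R f) y-W n y) = sqn M (%x. I n x-trunc R f x)"
     unfolding I_def fourier_integral_kernel
     by (subst sqn_minus_commute, rule isometric_kernel_adjoint[OF kernel kc, symmetric])
      (use T W[of n] in \<open>auto simp: L12_def\<close>)
    also have "2 * sqn M (%x. I n x-trunc R f x)+2 * sqn M' (%y. W n y-h y) <=
      2*(2 * sqn M (%x. I n x-f x)+2 * sqn M (%x. f x-trunc R f x))+2 * sqn M' (%y. W n y-h y)"
     by (intro add_right_mono mult_left_mono sqn_triangle L2D I2 f(1) L12D(2)[OF T]) auto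
    finally show ?thesis by (simp add: sqn_minus_commute[of M f])
   qed
   thus "\<exists>N. \<forall>n\<ge>N. sqn M' (%y. fourier_integral M (trunc R f) y-h y) <= ?b n" by blast
  qed
  thus "\<forall>\<^sub>F R in at_top. sqn M' (%y. fourier_integral M (trunc R f) y-h y) <= 4 * sqn M (%x. trunc R f x-f x)" by simp
 qed simp
 thus ?thesis using f(1) h by (auto simp: is_fourier_iff)
qed

end

lemma (in fourier_pair) sigma_finite: "sigma_finite_measure M" "sigma_finite_measure M'"
 using isometric_kernelD(1,2)[OF kernel] by auto

lemma ball_finite_prod:
 fixes M :: "'a::euclidean_space measure" and N :: "'b::euclidean_space measure"
 assumes "sigma_finite_measure N"
  and [measurable]: "norm \<in> \<B> M" "norm \<in> \<B> N"
  and "emeasure M {x \<in> space M. norm x <= R} < \<infinity>" "emeasure N {x \<in> space N. norm x <= R} < \<infinity>"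
 shows "emeasure (M \<otimes> N) {z \<in> space (M \<otimes> N). norm z <= R} < \<infinity>"
proof -
 interpret N: sigma_finite_measure N by fact
 have m: "{x \<in> space M. norm x <= R} \<in> sets M" "{x \<in> space N. norm x <= R} \<in> sets N" by measurable
 have "{z \<in> space (M \<otimes> N). norm z <= R} \<subseteq> {x \<in> space M. norm x <= R} \<times> {x \<in> space N. norm x <= R}"
 proof (rule subsetI)
  fix z assume z: "z \<in> {z \<in> space (M \<otimes> N). norm z <= R}"
  have "norm (fst z) <= norm z" "norm (snd z) <= norm z" by (simp_all add: norm_prod_def)
  with z show "z \<in> {x \<in> space M. norm x <= R} \<times> {x \<in> space N. norm x <= R}"
   by (cases z) (auto simp: space_pair_measure)
 qed
 hence "emeasure (M \<otimes> N) {z \<in> space (M \<otimes> N). norm z <= R} <= emeasure (M \<otimes> N) ({x \<in> space M. norm x <= R} \<times> {x \<in> space N. norm x <= R})"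
  using m by (intro emeasure_mono) auto
 also have "... < \<infinity>"
  unfolding N.emeasure_pair_measure_Times[OF m] using assms by (simp add: ennreal_mult_less_top)
 finally show ?thesis .
qed

lemma norm_measurable_prod:
 fixes M :: "'a::euclidean_space measure" and N :: "'b::euclidean_space measure"
 assumes "norm \<in> \<B> M" "norm \<in> \<B> N"
 shows "norm \<in> \<B> (M \<otimes> N)"
proof -
 have "(%z. norm (fst z)) \<in> \<B> (M \<otimes> N)" "(%z. norm (snd z)) \<in> \<B> (M \<otimes> N)"
  using measurable_compose[OF measurable_fst assms(1)] measurable_compose[OF measurable_snd assms(2)] by auto
 hence "(%z. sqrt ((norm (fst z))^2+(norm (snd z))^2)) \<in> \<B> (M \<otimes> N)" by measurable
 moreover have "norm = (%z::'a \<times> 'b. sqrt ((norm (fst z))^2+(norm (snd z))^2))" by (auto simp: norm_Pair)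
 ultimately show ?thesis by metis
qed

lemma fourier_pair_prod:
 assumes "fourier_pair M M'" "fourier_pair N N'"
 shows "fourier_pair (M \<otimes> N) (M' \<otimes> N')"
proof -
 interpret A: fourier_pair M M' by fact
 interpret B: fourier_pair N N' by fact
 show ?thesis
  by (intro fourier_pair.intro isometric_fourier_prod A.kernel B.kernel A.kernel' B.kernel' norm_measurable_prod
    ball_finite_prod A.norm_measurable B.norm_measurable A.ball_finite B.ball_finite B.sigma_finite)
qed

lemma fourier_pair_lborel: "fourier_pair lborel (lborel :: real measure)"
proof -
 have "{x :: real. \<bar>x\<bar> <= R} = {- R..R}" for R by auto
 thus ?thesis by (intro fourier_pair.intro isometric_fourier_lborel) (auto simp: emeasure_lborel_Icc_eq)
qed

lemma fourier_pair_torus: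
 assumes "1 <= L"
 shows "fourier_pair (torus L) (latmeas L)"
proof (rule fourier_pair.intro)
 show "norm \<in> \<B> (torus L)" by (rule measurable_restrict_space1) simp
 show "emeasure (torus L) {x \<in> space (torus L). norm x <= R} < \<infinity>" for R
  using finite_measure.emeasure_finite[OF finite_torus] by (simp add: less_top[symmetric])
 show "emeasure (latmeas L) {x \<in> space (latmeas L). norm x <= R} < \<infinity>" for R
 proof (cases "0 <= R")
  case True
  hence "finite {y \<in> lattice L. \<bar>y\<bar> <= R}" by (rule finite_lattice_ball[OF assms])
  thus ?thesis by (simp add: ennreal_mult_less_top of_nat_less_top)
 next
  case False
  hence "{x \<in> space (latmeas L). norm x <= R} = {}" by auto
  thus ?thesis by (simp only: emeasure_empty) simp
 qed
qed (auto intro: isometric_fourier_torus isometric_fourier_lattice assms)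

lemma fourier_pair_waveguide: "1 <= L ==> fourier_pair (waveguide L) (freq L)"
 unfolding waveguide_def freq_def by (intro fourier_pair_prod fourier_pair_lborel fourier_pair_torus)

lemma fourier_pair_spacetime: "1 <= L ==> fourier_pair (spacetime L) (spacetime_freq L)"
 unfolding spacetime_def spacetime_freq_def by (intro fourier_pair_prod fourier_pair_lborel fourier_pair_waveguide)

section \<open>Time slices of the space-time transform\<close>

lemma AE_subsequence_zero:
 fixes a :: "nat => 'a => ennreal"
 assumes [measurable]: "\<And>n. a n \<in> \<B> M" and lim: "(%n. (NN x|M. a n x)) -->> 0"
 obtains r :: "nat => nat" where "AE x in M. (%k. a (r k) x) -->> 0"
proof -
 have "\<exists>n. (NN x|M. a n x) < ennreal ((1/2) ^ k)" for k :: nat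
  using order_tendstoD(2)[OF lim, of "ennreal ((1/2) ^ k)"] by (auto simp: eventually_sequentially)
 then obtain r where r: "\<And>k::nat. (NN x|M. a (r k) x) < ennreal ((1/2) ^ k)" by metis
 have "(NN x|M. (\<Sum>k. a (r k) x)) = (\<Sum>k. (NN x|M. a (r k) x))" by (rule nn_integral_suminf) measurable
 also have "... <= (\<Sum>k. ennreal ((1/2) ^ k))" by (intro suminf_le less_imp_le r) auto
 also have "... = ennreal (\<Sum>k. (1/2) ^ k)" by (rule suminf_ennreal2) auto
 also have "... < \<infinity>" by simp
 finally have "AE x in M. (\<Sum>k. a (r k) x) \<noteq> \<infinity>" by (intro nn_integral_PInf_AE) auto
 hence "AE x in M. (%k. a (r k) x) -->> 0"
 proof eventually_elim
  case (elim x)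
  have fin: "a (r k) x \<noteq> \<infinity>" for k
   using elim ennreal_suminf_lessD[of "%k. a (r k) x" "\<infinity>" k] by (auto simp: less_top)
  hence e: "a (r k) x = ennreal (enn2real (a (r k) x))" for k by (simp add: less_top)
  have "summable (%k. enn2real (a (r k) x))"
   by (rule summable_suminf_not_top) (use elim e in \<open>auto simp: e[symmetric]\<close>)
  hence "(%k. enn2real (a (r k) x)) -->> 0" by (rule summable_LIMSEQ_zero)
  hence "(%k. ennreal (enn2real (a (r k) x))) -->> ennreal 0" by (rule tendsto_ennrealI)
  thus ?case by (simp add: e[symmetric])
 qed
 thus thesis by (rule that)
qed

text \<open>The transform in time alone of the truncations of \<open>w\<close> turns the convergence of their
 space-time transforms into the convergence of their spatial transforms, for almost every time.\<close>

lemma is_fourier_slices: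
 fixes N N' :: "'b::euclidean_space measure"
 assumes NN: "fourier_pair N N'" and wW: "is_fourier (lborel \<otimes> N) (lborel \<otimes> N') w W"
  and Wi: "AE xi in N'. integrable lborel (%tt::real. W (tt, xi))"
 shows "AE t in lborel. is_fourier N N' (%z. w (t, z)) (%xi. LINT tt|lborel. W (tt, xi) * cnj (fourier_kernel t tt))"
proof -
 interpret N: fourier_pair N N' by fact
 interpret R: fourier_pair lborel "lborel :: real measure" by (rule fourier_pair_lborel)
 interpret P: fourier_pair "lborel \<otimes> N" "(lborel :: real measure) \<otimes> N'" by (rule fourier_pair_prod[OF fourier_pair_lborel NN])
 interpret sN: sigma_finite_measure N by (rule N.sigma_finite)
 interpret sN': sigma_finite_measure N' by (rule N.sigma_finite)
 interpret A: pair_sigma_finite "lborel :: real measure" N ..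
 interpret B: pair_sigma_finite "lborel :: real measure" N' ..
 have lsf: "sigma_finite_measure (lborel :: real measure)" by (rule lborel.sigma_finite_measure_axioms)
 have w2: "w \<in> L2 (lborel \<otimes> N)" and W2: "W \<in> L2 (lborel \<otimes> N')"
  and WF: "((%R. sqn (lborel \<otimes> N') (%y. fourier_integral (lborel \<otimes> N) (P.trunc R w) y-W y)) \<longlongrightarrow> 0) at_top"
  using wW by (auto simp: P.is_fourier_iff)
 have wm [measurable]: "w \<in> \<B> (lborel \<otimes> N)" and Wm [measurable]: "W \<in> \<B> (lborel \<otimes> N')"
  using w2 W2 by (auto simp: square_integrable_iff)
 define wn where "wn n = P.trunc (real n) w" for n :: nat
 have wnL: "wn n \<in> L12 (lborel \<otimes> N)" for n unfolding wn_def by (rule P.trunc_L12[OF w2])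
 have wni: "integrable (lborel \<otimes> N) (wn n)" and wn2: "wn n \<in> L2 (lborel \<otimes> N)" for n
  using wnL[of n] by (auto simp: L12_def)
 have wnm [measurable]: "wn n \<in> \<B> (lborel \<otimes> N)" for n using wni by auto
 define Wn where "Wn n = fourier_integral (lborel \<otimes> N) (wn n)" for n
 have Wn2: "Wn n \<in> L2 (lborel \<otimes> N')" for n unfolding Wn_def by (rule P.fourier_integral_L2[OF wnL])
 have Wlim: "(%n. sqn (lborel \<otimes> N') (%y. W y-Wn n y)) -->> 0"
  using filterlim_compose[OF WF filterlim_real_sequentially] unfolding Wn_def wn_def by (subst sqn_minus_commute)
 have wlim: "(%n. sqn (lborel \<otimes> N) (%z. wn n z-w z)) -->> 0"
  unfolding wn_def by (rule filterlim_compose[OF P.trunc_tendsto[OF w2] filterlim_real_sequentially])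
 have slice_L12: "AE t in lborel. (%z. wn n (t, z)) \<in> L12 N" for n
 proof -
  have "AE t in lborel. integrable N (%z. wn n (t, z))" using A.AE_integrable_fst'[OF wni] .
  with AE_slice_fst[OF N.sigma_finite(1) wn2[of n]] show ?thesis by eventually_elim (simp add: L12_def)
 qed
 \<comment> \<open>The spatial transform of a slice of the truncation: an ordinary integral, whose
   transform in time is the space-time transform \<open>Wn n\<close>.\<close>
 define V where "V n t xi = fourier_integral N (%z. wn n (t, z)) xi" for n t xi
 have fkm: "(%z. fourier_kernel (fst z) (snd z)) \<in> \<B> (N \<otimes> N')"
  using isometric_kernelD(3)[OF N.kernel] by (simp add: case_prod_beta')
 have Vm: "(%z. V n (fst z) (snd z)) \<in> \<B> (lborel \<otimes> N')" for n
 proof -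
  have 1: "(%q. wn n (fst (fst q), snd q)) \<in> \<B> ((lborel \<otimes> N') \<otimes> N)"
   by (rule measurable_compose[OF _ wnm]) measurable
  have "(%q. (snd q, snd (fst q))) \<in> (lborel \<otimes> N') \<otimes> N ->M N \<otimes> N'" by measurable
  from measurable_compose[OF this fkm]
  have 2: "(%q. fourier_kernel (snd q) (snd (fst q))) \<in> \<B> ((lborel \<otimes> N') \<otimes> N)" by simp
  have "(%(p, z). wn n (fst p, z)*fourier_kernel z (snd p)) \<in> \<B> ((lborel \<otimes> N') \<otimes> N)"
   unfolding case_prod_beta' using 1 2 by measurable
  from sN.borel_measurable_lebesgue_integral[OF this] show ?thesis unfolding V_def fourier_integral_kernel .
 qed
 have V2: "(%z. V n (fst z) (snd z)) \<in> L2 (lborel \<otimes> N')" for n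
 proof -
  have "sqn (lborel \<otimes> N') (%z. V n (fst z) (snd z)) = (NN t|lborel. sqn N' (V n t))"
   using sqn_pair_fst(1)[OF N.sigma_finite(2) Vm] by simp
  also have "... = (NN t|lborel. sqn N (%z. wn n (t, z)))"
  proof (rule nn_integral_cong_AE)
   show "AE t in lborel. sqn N' (V n t) = sqn N (%z. wn n (t, z))" using slice_L12[of n]
   proof eventually_elim
    case (elim t)
    thus ?case unfolding V_def[abs_def] by (rule N.sqn_fourier_integral)
   qed
  qed
  also have "... = sqn (lborel \<otimes> N) (wn n)" by (rule sqn_pair_fst(1)[OF N.sigma_finite(1) wnm, symmetric])
  also have "... < \<infinity>" using wn2 by (simp add: square_integrable_iff)
  finally show ?thesis using Vm by (simp add: square_integrable_iff)
 qed
 have Vi: "integrable lborel (%t. V n t xi)" and VW: "(LINT t|lborel. V n t xi*fourier_kernel t tt) = Wn n (tt, xi)"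
  if xi: "xi \<in> space N'" for n xi tt
 proof -
  have km: "(%z. fourier_kernel z xi) \<in> \<B> N" using measurable_Pair1[OF fkm xi] by simp
  have k2: "(%q. fourier_kernel (snd q) xi) \<in> \<B> (lborel \<otimes> N)"
   by (rule measurable_compose[OF measurable_snd km])
  have k1: "(%q. fourier_kernel (fst q) tt) \<in> \<B> (lborel \<otimes> N)"
   unfolding fourier_kernel_def by measurable
  have "integrable (lborel \<otimes> N) (%q. wn n q*fourier_kernel (snd q) xi)"
   by (rule integrable_mult_bounded[OF wni k2 norm_fourier_kernel_le])
  from A.integrable_fst'[OF this] show "integrable lborel (%t. V n t xi)" by (simp add: V_def fourier_integral_kernel)
  have "integrable (lborel \<otimes> N) (%q. wn n q*fourier_kernel q (tt, xi))"
   by (rule integrable_mult_bounded[OF wni _ norm_fourier_kernel_le])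
    (use borel_measurable_times[OF k1 k2] in \<open>subst fourier_kernel_prod, simp\<close>)
  from A.integral_fst'[OF this]
  have "Wn n (tt, xi) = (LINT t|lborel. LINT z|N. wn n (t, z)*fourier_kernel (t, z) (tt, xi))"
   by (simp add: Wn_def fourier_integral_kernel)
  also have "... = (LINT t|lborel. V n t xi*fourier_kernel t tt)"
  proof (rule Bochner_Integration.integral_cong)
   fix t
   have "(LINT z|N. wn n (t, z)*fourier_kernel (t, z) (tt, xi)) = (LINT z|N. fourier_kernel t tt*(wn n (t, z)*fourier_kernel z xi))"
    by (subst fourier_kernel_prod) (simp add: mult_ac)
   also have "... = fourier_kernel t tt*V n t xi"
    unfolding V_def fourier_integral_kernel by (rule integral_mult_right_zero)
   finally show "(LINT z|N. wn n (t, z)*fourier_kernel (t, z) (tt, xi)) = V n t xi*fourier_kernel t tt" by simp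
  qed simp
  finally show "(LINT t|lborel. V n t xi*fourier_kernel t tt) = Wn n (tt, xi)" ..
 qed
 define H where "H t xi = (LINT tt|lborel. W (tt, xi) * cnj (fourier_kernel t tt))" for t xi
 have Hm: "(%z. H (fst z) (snd z)) \<in> \<B> (lborel \<otimes> N')"
 proof -
  have 1: "(%q. W (snd q, snd (fst q))) \<in> \<B> ((lborel \<otimes> N') \<otimes> lborel)"
   by (rule measurable_compose[OF _ Wm]) measurable
  have 2: "(%q. cnj (fourier_kernel (fst (fst q)) (snd q))) \<in> \<B> (((lborel :: real measure) \<otimes> N') \<otimes> lborel)"
   unfolding fourier_kernel_def inner_real_def by measurable
  have "(%(p, tt). W (tt, snd p) * cnj (fourier_kernel (fst p) tt)) \<in> \<B> ((lborel \<otimes> N') \<otimes> lborel)"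
   unfolding case_prod_beta' using 1 2 by measurable
  from lborel.borel_measurable_lebesgue_integral[OF this] show ?thesis unfolding H_def .
 qed
 have kc: "isometric_kernel lborel lborel (%tt t :: real. cnj (fourier_kernel t tt))"
  using isometric_kernel_cnj[OF R.kernel] by (simp add: fourier_kernel_commute)
 \<comment> \<open>For almost every \<open>xi\<close> this is the adjoint identity in the time
   variable alone: \<open>H\<close> is the inverse transform of \<open>W\<close> in time, while
   \<open>Wn n\<close> is the transform of \<open>V n\<close>.\<close>
 have HV: "sqn (lborel \<otimes> N') (%z. H (fst z) (snd z)-V n (fst z) (snd z)) = sqn (lborel \<otimes> N') (%y. W y-Wn n y)" for n
 proof -
  have m1: "(%z. H (fst z) (snd z)-V n (fst z) (snd z)) \<in> \<B> (lborel \<otimes> N')" using Hm Vm by measurable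
  have m2: "(%y. W y-Wn n y) \<in> \<B> (lborel \<otimes> N')"
   using W2 Wn2[of n] by (auto simp: square_integrable_iff)
  have "sqn (lborel \<otimes> N') (%z. H (fst z) (snd z)-V n (fst z) (snd z)) = (NN xi|N'. sqn lborel (%t. H t xi-V n t xi))"
   using sqn_pair_snd(1)[OF lsf N.sigma_finite(2) m1] by simp
  also have "... = (NN xi|N'. sqn lborel (%tt. W (tt, xi)-Wn n (tt, xi)))"
  proof (rule nn_integral_cong_AE)
   have "AE xi in N'. (%t. V n t xi) \<in> L2 lborel" using AE_slice_snd[OF lsf N.sigma_finite(2) V2[of n]] by simp
   with Wi AE_slice_snd[OF lsf N.sigma_finite(2) W2] AE_space
   show "AE xi in N'. sqn lborel (%t. H t xi-V n t xi) = sqn lborel (%tt. W (tt, xi)-Wn n (tt, xi))"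
   proof eventually_elim
    case (elim xi)
    show ?case unfolding H_def VW[OF elim(3), symmetric]
     by (rule isometric_kernel_adjoint[OF R.kernel kc]) (use elim Vi in auto)
   qed
  qed
  also have "... = sqn (lborel \<otimes> N') (%y. W y-Wn n y)"
   by (rule sqn_pair_snd(1)[OF lsf N.sigma_finite(2) m2, symmetric])
  finally show ?thesis .
 qed
 \<comment> \<open>Both errors are added, so that a single subsequence makes the slices and their
   transforms converge for almost every \<open>t\<close>.\<close>
 define a where "a n t = sqn N' (%xi. H t xi-V n t xi)+sqn N (%z. wn n (t, z)-w (t, z))" for n t
 have m1: "(%z. H (fst z) (snd z)-V n (fst z) (snd z)) \<in> \<B> (lborel \<otimes> N')" for n
  using Hm Vm by measurable
 have m2: "(%z. wn n z-w z) \<in> \<B> (lborel \<otimes> N)" for n by measurable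
 note s1 = sqn_pair_fst[OF N.sigma_finite(2) m1, simplified fst_conv snd_conv] and s2 = sqn_pair_fst[OF N.sigma_finite(1) m2]
 have am: "a n \<in> \<B> lborel" for n unfolding a_def[abs_def] using s1(2) s2(2) by measurable
 have "(%n. (NN t|lborel. a n t)) -->> 0"
 proof -
  have "(NN t|lborel. a n t) = sqn (lborel \<otimes> N') (%y. W y-Wn n y)+sqn (lborel \<otimes> N) (%z. wn n z-w z)" for n
   unfolding a_def HV[symmetric] s1(1) s2(1) by (rule nn_integral_add[OF s1(2) s2(2)])
  thus ?thesis using tendsto_add[OF Wlim wlim] by simp
 qed
 then obtain r where r: "AE t in lborel. (%k. a (r k) t) -->> 0" using AE_subsequence_zero[of a lborel] am by blast
 have "AE t in lborel. \<forall>n. (%z. wn n (t, z)) \<in> L12 N" using slice_L12 by (simp add: AE_all_countable)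
 with r AE_slice_fst[OF N.sigma_finite(1) w2]
 have "AE t in lborel. is_fourier N N' (%z. w (t, z)) (H t)"
 proof eventually_elim
  case (elim t)
  have Ht: "H t \<in> \<B> N'" using measurable_Pair2[OF Hm, of t] by simp
  have f: "is_fourier N N' (%z. w (t, z)) (fourier N N' (%z. w (t, z)))" by (rule N.is_fourier_fourier[OF elim(2)])
  have "AE xi in N'. fourier N N' (%z. w (t, z)) xi = H t xi"
  proof (rule N.is_fourier_limit_unique[OF f])
   show "(%z. wn (r k) (t, z)) \<in> L12 N" for k using elim(3) by simp
   show "(%k. sqn N (%z. wn (r k) (t, z)-w (t, z))) -->> 0"
    by (rule tendsto_sandwich[OF _ _ tendsto_const elim(1)]) (auto simp: a_def)
   show "(%k. sqn N' (%y. fourier_integral N (%z. wn (r k) (t, z)) y-H t y)) -->> 0" unfolding V_def[symmetric]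
    by (rule tendsto_sandwich[OF _ _ tendsto_const elim(1)]) (auto simp: a_def sqn_minus_commute[of N' "H t"])
  qed (rule Ht)
  thus ?case by (intro N.is_fourier_cong[OF f]) (use elim(2) Ht in \<open>auto simp: square_integrable_iff\<close>)
 qed
 thus ?thesis unfolding H_def[abs_def] .
qed

section \<open>Superposition over the four modulations\<close>

text \<open>The dictionary between the coordinates of the statement and those of the form: b is
  minus the second frequency, and d is the sum of the first three, that is, minus the
  fourth.\<close>

lemma nn_integral_freq3_hyp:
 assumes f: "(%(a, b, c, d). f a b c d) \<in> \<B> (freq4 L)"
 shows "(NN x|freq3 L. f (fst x) (- fs x) (ss x) (fst x+fs x+ss x)) = hyp L f"
proof -
 interpret F: sigma_finite_measure "freq L" by (rule sigma_finite_freq)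
 interpret FF: pair_sigma_finite "freq L" "freq L" ..
 have m3: "(%x. f (fst x) (- fs x) (ss x) (fst x+fs x+ss x)) \<in> \<B> (freq3 L)"
  by (rule freq4_compose[OF f]) measurable
 have "(NN x|freq3 L. f (fst x) (- fs x) (ss x) (fst x+fs x+ss x)) =
   (NN x|freq L. (NN w|(freq L \<otimes> freq L). f x (- fst w) (snd w) (x+fst w+snd w)))"
  using FF.nn_integral_fst[OF m3] by simp
 also have "... = (NN x|freq L. (NN y|freq L. (NN z|freq L. f x (- y) z (x+y+z))))"
 proof (rule nn_integral_cong)
  fix x assume x: "x \<in> space (freq L)"
  have "(%w. f x (- fst w) (snd w) (x+fst w+snd w)) \<in> \<B> (freq L \<otimes> freq L)"
   by (rule freq4_compose[OF f]) (use x in measurable)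
  from F.nn_integral_fst[OF this]
  show "(NN w|(freq L \<otimes> freq L). f x (- fst w) (snd w) (x+fst w+snd w)) = (NN y|freq L. (NN z|freq L. f x (- y) z (x+y+z)))"
   by simp
 qed
 also have "... = (NN x|freq L. (NN z|freq L. (NN y|freq L. f x (- y) z (x+y+z))))"
 proof (rule nn_integral_cong)
  fix x assume x: "x \<in> space (freq L)"
  show "(NN y|freq L. (NN z|freq L. f x (- y) z (x+y+z))) = (NN z|freq L. (NN y|freq L. f x (- y) z (x+y+z)))"
  proof (rule nn_integral_freq_swap)
   show "(%(y, z). f x (- y) z (x+y+z)) \<in> \<B> (freq L \<otimes> freq L)"
    unfolding case_prod_beta' by (rule freq4_compose[OF f]) (use x in measurable)
  qed
 qed
 also have "... = (NN x|freq L. (NN z|freq L. (NN d|freq L. f x (x+z-d) z d)))"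
 proof (rule nn_integral_cong, rule nn_integral_cong)
  fix x z assume x: "x \<in> space (freq L)" and z: "z \<in> space (freq L)"
  have v: "- (x+z) \<in> space (freq L)"
  proof -
   have "snd (- (x+z)) \<in> lattice L"
    unfolding snd_uminus snd_add by (intro lattice_uminus lattice_add) (use x z in \<open>auto simp: space_freq mem_Times_iff\<close>)
   thus ?thesis by (simp add: space_freq mem_Times_iff)
  qed
  have "(%y. f x (- y) z (x+y+z)) \<in> \<B> (freq L)" by (rule freq4_compose[OF f]) (use x z in measurable)
  from nn_integral_freq_translate[OF this v]
  show "(NN y|freq L. f x (- y) z (x+y+z)) = (NN d|freq L. f x (x+z-d) z d)" by (simp add: algebra_simps)
 qed
 finally show ?thesis by (simp add: hyp_def tri_def)
qed

lemma nn_integral_pair_mult: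
 fixes f g :: "_ => ennreal"
 assumes "sigma_finite_measure N" and [measurable]: "f \<in> \<B> M" "g \<in> \<B> N"
 shows "(NN z|(M \<otimes> N). f (fst z)*g (snd z)) = (NN x|M. f x)*(NN y|N. g y)"
proof -
 interpret sigma_finite_measure N by fact
 have "(NN z|(M \<otimes> N). f (fst z)*g (snd z)) = (NN x|M. (NN y|N. f x*g y))"
  by (subst nn_integral_fst[symmetric]) auto
 thus ?thesis by (simp add: nn_integral_cmult nn_integral_multc)
qed

abbreviation real4 :: "(real \<times> real \<times> real \<times> real) measure" where
 "real4 \<equiv> lborel \<otimes> lborel \<otimes> lborel \<otimes> lborel"

lemma sigma_finite_real2: "sigma_finite_measure (lborel \<otimes> lborel :: (real \<times> real) measure)"
 by (rule lborel_pair.sigma_finite_measure_axioms)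

lemma sigma_finite_real3: "sigma_finite_measure (lborel \<otimes> lborel \<otimes> lborel :: (real \<times> real \<times> real) measure)"
 by (intro sigma_finite_pair_measure sigma_finite_real2 lborel.sigma_finite_measure_axioms)

lemma sigma_finite_real4: "sigma_finite_measure real4"
 by (intro sigma_finite_pair_measure sigma_finite_real3 lborel.sigma_finite_measure_axioms)

lemma nn_integral_real4:
 fixes f :: "real => ennreal"
 assumes [measurable]: "f \<in> \<B> borel"
 shows "(NN s|real4. f (fst s)*(f (fs s)*(f (fss s)*f (sss s)))) = (NN x|lborel. f x) ^ 4"
proof -
 have 2: "(NN s|(lborel \<otimes> lborel). f (fst s)*f (snd s)) = (NN x|lborel. f x)*(NN x|lborel. f x)"
  by (rule nn_integral_pair_mult[OF lborel.sigma_finite_measure_axioms]) measurable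
 have 3: "(NN s|(lborel \<otimes> lborel \<otimes> lborel). f (fst s)*(f (fs s)*f (ss s))) =
   (NN x|lborel. f x)*((NN x|lborel. f x)*(NN x|lborel. f x))"
  unfolding 2[symmetric] by (rule nn_integral_pair_mult[OF sigma_finite_real2, where g = "%s. f (fst s)*f (snd s)"]) measurable
 have "(NN s|real4. f (fst s)*(f (fs s)*(f (fss s)*f (sss s)))) =
   (NN x|lborel. f x)*((NN x|lborel. f x)*((NN x|lborel. f x)*(NN x|lborel. f x)))"
  unfolding 3[symmetric] by (rule nn_integral_pair_mult[OF sigma_finite_real3, where g = "%s. f (fst s)*(f (fs s)*f (ss s))"]) measurable
 thus ?thesis by (simp add: power4_eq_xxxx mult_ac)
qed

definition phase :: "real \<times> real \<times> real \<times> real => real" where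
 "phase s = fst s-fs s+fss s-sss s"

text \<open>For fixed modulations the frequency bound gives E times the roots of four slice masses.
  Cauchy-Schwarz in all modulations together splits each mass into <sg>^(2b) times itself and
  <sg>^(-2b). The squared form thus carries fourth powers of two one-dimensional integrals, whence
  the exponents 2.\<close>

lemma spacetime_form_bound:
 assumes gm: "(%z. g (fst z) (snd z)) \<in> \<B> (lborel \<otimes> freq L)"
  and est: "\<And>t (g1 :: real \<times> real => ennreal) g2 g3 g4. g1 \<in> \<B> (freq L) ==> g2 \<in> \<B> (freq L) ==>
   g3 \<in> \<B> (freq L) ==> g4 \<in> \<B> (freq L) ==>
   (hyp L (mult_form p ga N (%h. k (h-t)) g1 g2 g3 g4))^2 <= E^2 * (mass L g1*mass L g2*mass L g3*mass L g4)"
 shows "(NN s|real4. hyp L (mult_form p ga N (%h. k (h-phase s)) (g (fst s)) (g (fs s)) (g (fss s)) (g (sss s)))) <=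
  E*(NN sg|lborel. ennreal (japanese sg powr (- 2*b)))^2 *
   (NN sg|lborel. ennreal (japanese sg powr (2*b))*(NN xi|freq L. (g sg xi)^2))^2"
  (is "(NN s|_. ?h s) <= E*?B^2*?X^2")
proof (rule ennreal_power2_le_imp_le)
 interpret F: sigma_finite_measure "freq L" by (rule sigma_finite_freq)
 define Y where "Y sg = (NN xi|freq L. (g sg xi)^2)" for sg
 have [measurable]: "Y \<in> \<B> borel"
 proof -
  have "(%(sg, xi). (g sg xi)^2) \<in> \<B> (lborel \<otimes> freq L)"
   using gm unfolding case_prod_beta' by measurable
  from F.borel_measurable_nn_integral[OF this] show ?thesis unfolding Y_def[abs_def] by simp
 qed
 have gs: "g sg \<in> \<B> (freq L)" for sg using measurable_Pair2[OF gm, of sg] by simp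
 define u where "u sg = ennreal (japanese sg powr (2*b))*Y sg" for sg
 define v where "v sg = ennreal (japanese sg powr (- 2*b))" for sg
 have [measurable]: "u \<in> \<B> borel" "v \<in> \<B> borel" unfolding u_def[abs_def] v_def[abs_def] by measurable
 have uv: "u sg * v sg = Y sg" for sg
 proof -
  have "ennreal (japanese sg powr (2*b))*ennreal (japanese sg powr (- 2*b)) = ennreal (japanese sg powr (2*b)*japanese sg powr (- 2*b))"
   by (simp add: ennreal_mult)
  also have "japanese sg powr (2*b)*japanese sg powr (- 2*b) = 1" using japanese_pos[of sg] by (simp flip: powr_add)
  finally have "ennreal (japanese sg powr (2*b))*ennreal (japanese sg powr (- 2*b)) = 1" by simp
  thus ?thesis unfolding u_def v_def by (metis mult.commute mult.left_commute mult.right_neutral)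
 qed
 have "(NN s|real4. ?h s)^2 <= (NN s|real4. E^2*(u (fst s)*(u (fs s)*(u (fss s)*u (sss s))))) *
   (NN s|real4. v (fst s)*(v (fs s)*(v (fss s) * v (sss s))))"
 proof (rule nn_integral_CS)
  fix s
  have "(?h s)^2 <= E^2*(Y (fst s)*Y (fs s)*Y (fss s)*Y (sss s))" unfolding Y_def by (rule est[OF gs gs gs gs])
  also have "... = E^2*(u (fst s)*(u (fs s)*(u (fss s)*u (sss s)))) * (v (fst s)*(v (fs s)*(v (fss s) * v (sss s))))"
   unfolding uv[symmetric] by (simp only: mult_ac)
  finally show "(?h s)^2 <= E^2*(u (fst s)*(u (fs s)*(u (fss s)*u (sss s)))) *
   (v (fst s)*(v (fs s)*(v (fss s) * v (sss s))))" .
 qed measurable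
 also have "... = E^2*?X ^ 4*?B ^ 4"
 proof -
  have "(NN s|real4. E^2*(u (fst s)*(u (fs s)*(u (fss s)*u (sss s))))) = E^2*?X ^ 4"
   unfolding Y_def[symmetric] u_def[symmetric] by (subst nn_integral_cmult) (auto simp: nn_integral_real4)
  moreover have "(NN s|real4. v (fst s)*(v (fs s)*(v (fss s) * v (sss s)))) = ?B ^ 4"
   unfolding v_def[symmetric] by (rule nn_integral_real4) measurable
  ultimately show ?thesis by (simp only:)
 qed
 also have "... = (E*?B^2*?X^2)^2" by (simp add: power_mult_distrib mult_ac flip: power_mult)
 finally show "(NN s|real4. ?h s)^2 <= (E*?B^2*?X^2)^2" .
qed

lemma measurable_mult_form_param:
 assumes p: "I_profile s p" and s: "s < 1" and N: "0 < N"
  and k [measurable]: "k \<in> \<B> borel"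
  and gm: "(%z. g (fst z) (snd z)) \<in> \<B> (lborel \<otimes> freq L)"
  and q: "q1 \<in> M ->M freq L" "q2 \<in> M ->M freq L" "q3 \<in> M ->M freq L" "q4 \<in> M ->M freq L"
  and sg: "sg \<in> M ->M real4"
 shows "(%w. mult_form p ga N (%h. k (h-phase (sg w))) (g (fst (sg w))) (g (fs (sg w)))
   (g (fss (sg w))) (g (sss (sg w))) (q1 w) (q2 w) (q3 w) (q4 w)) \<in> \<B> M"
proof -
 have s4: "(%w. fst (sg w)) \<in> M ->M lborel" "(%w. fs (sg w)) \<in> M ->M lborel"
  "(%w. fss (sg w)) \<in> M ->M lborel" "(%w. sss (sg w)) \<in> M ->M lborel" using sg by measurable
 have gq: "(%w. g (c w) (q w)) \<in> \<B> M" if "c \<in> M ->M lborel" "q \<in> M ->M freq L" for c q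
  using measurable_compose[OF measurable_Pair[OF that] gm] by simp
 note G = gq[OF s4(1) q(1)] gq[OF s4(2) q(2)] gq[OF s4(3) q(3)] gq[OF s4(4) q(4)]
 have sb [measurable]: "(%w. fst (sg w)) \<in> \<B> M" "(%w. fs (sg w)) \<in> \<B> M"
  "(%w. fss (sg w)) \<in> \<B> M" "(%w. sss (sg w)) \<in> \<B> M" using s4 by auto
 have [measurable]: "(%w. q1 w) \<in> \<B> M" "(%w. q2 w) \<in> \<B> M" "(%w. q3 w) \<in> \<B> M" "(%w. q4 w) \<in> \<B> M"
  using q by (auto intro: freq_into_borel)
 have K: "(%w. k ((norm (q1 w))^2-(norm (q2 w))^2+(norm (q3 w))^2-(norm (q4 w))^2-phase (sg w))) \<in> \<B> M"
  unfolding phase_def by measurable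
 have R: "(%w. mult_form p ga N (%_. 1) (%_. 1) (%_. 1) (%_. 1) (%_. 1) (q1 w) (q2 w) (q3 w) (q4 w)) \<in> \<B> M"
  by (rule freq4_compose[OF measurable_mult_form[OF p s N] q]) auto
 have e: "mult_form p ga N k' g1 g2 g3 g4 a b c d = mult_form p ga N (%_. 1) (%_. 1) (%_. 1) (%_. 1) (%_. 1) a b c d *
   (k' ((norm a)^2-(norm b)^2+(norm c)^2-(norm d)^2)*(g1 a*g2 b*g3 c*g4 d))" for k' and g1 g2 g3 g4 :: "real \<times> real => ennreal" and a b c d
  unfolding mult_form_def by (simp add: mult.assoc)
 show ?thesis by (subst e) (intro borel_measurable_times_ennreal R K G)
qed

lemma spacetime_form_fubini:
 assumes p: "I_profile s p" and s: "s < 1" and N: "0 < N"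
  and k [measurable]: "k \<in> \<B> borel"
  and gm: "(%z. g (fst z) (snd z)) \<in> \<B> (lborel \<otimes> freq L)"
 shows "(NN w|(freq3 L \<otimes> real4). mult_form p ga N (%h. k (h-phase (snd w))) (g (fs w)) (g (fss w))
   (g (fss (snd w))) (g (sss (snd w)))
   (fst (fst w)) (- fs (fst w)) (ss (fst w)) (fst (fst w)+fs (fst w)+ss (fst w))) =
  (NN s|real4. hyp L (mult_form p ga N (%h. k (h-phase s)) (g (fst s)) (g (fs s)) (g (fss s)) (g (sss s))))"
proof -
 interpret A: sigma_finite_measure "freq3 L" by (intro sigma_finite_pair_measure sigma_finite_freq)
 interpret B: sigma_finite_measure real4 by (rule sigma_finite_real4)
 interpret pair_sigma_finite "freq3 L" real4 ..
 have m: "(%w. mult_form p ga N (%h. k (h-phase (snd w))) (g (fs w)) (g (fss w)) (g (fss (snd w))) (g (sss (snd w)))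
   (fst (fst w)) (- fs (fst w)) (ss (fst w)) (fst (fst w)+fs (fst w)+ss (fst w))) \<in> \<B> (freq3 L \<otimes> real4)"
  by (rule measurable_mult_form_param[OF p s N k gm]) measurable
 have "(NN w|(freq3 L \<otimes> real4). mult_form p ga N (%h. k (h-phase (snd w))) (g (fs w)) (g (fss w))
   (g (fss (snd w))) (g (sss (snd w)))
   (fst (fst w)) (- fs (fst w)) (ss (fst w)) (fst (fst w)+fs (fst w)+ss (fst w))) =
  (NN s|real4. (NN x|freq3 L. mult_form p ga N (%h. k (h-phase s)) (g (fst s)) (g (fs s)) (g (fss s)) (g (sss s))
   (fst x) (- fs x) (ss x) (fst x+fs x+ss x)))" using nn_integral_snd[OF m] by simp
 also have "... = (NN s|real4. hyp L (mult_form p ga N (%h. k (h-phase s))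
   (g (fst s)) (g (fs s)) (g (fss s)) (g (sss s))))"
 proof (rule nn_integral_cong)
  fix s'
  have gs: "g sg \<in> \<B> (freq L)" for sg using measurable_Pair2[OF gm, of sg] by simp
  show "(NN x|freq3 L. mult_form p ga N (%h. k (h-phase s')) (g (fst s')) (g (fs s')) (g (fss s')) (g (sss s'))
   (fst x) (- fs x) (ss x) (fst x+fs x+ss x)) =
   hyp L (mult_form p ga N (%h. k (h-phase s')) (g (fst s')) (g (fs s')) (g (fss s')) (g (sss s')))"
   by (rule nn_integral_freq3_hyp, rule measurable_mult_form[OF p s N _ gs gs gs gs]) measurable
 qed
 finally show ?thesis .
qed

section \<open>The multiplier off \<open>S\<close>\<close>

text \<open>A point off \<open>S\<close> violates the condition for every choice of dyadic sizes
  that fits it. The least powers of 2 above the four norms fit as soon as K \<ge> 2, and their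
  maximum is at least max 1 of the largest norm, so the angle bound can be restated with the norms
  themselves. Zero sides satisfy the multiplied form trivially.\<close>

lemma S_complement_rect:
 assumes q: "(xi1, xi2, xi3, xi4) \<in> Sigma4 L-S_set K c N L" and K: "2 <= K"
 shows "rect c N xi1 (- xi2) xi3 (- xi4)"
proof -
 have sig: "(xi1, xi2, xi3, xi4) \<in> Sigma4 L" and sum0: "xi1+xi2+xi3+xi4 = 0" using q by (auto simp: Sigma4_def)
 define n where "n xi = (LEAST n. norm xi <= 2 ^ n)" for xi :: "real \<times> real"
 have n: "norm xi <= 2 ^ n xi" "dyadic_size K (n xi) xi" for xi
 proof -
  have "\<exists>n. norm xi <= 2 ^ n" using real_arch_pow[of 2 "norm xi"] by (auto intro: less_imp_le)
  thus le: "norm xi <= 2 ^ n xi" unfolding n_def by (rule LeastI_ex)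
  have "2 ^ n xi/K <= norm xi" if nz: "n xi \<noteq> 0"
  proof -
   obtain m where m: "n xi = Suc m" using nz by (cases "n xi") auto
   hence "\<not> norm xi <= 2 ^ m" using not_less_Least[of m "%n. norm xi <= 2 ^ n"] by (simp add: n_def)
   hence "2 ^ n xi/2 <= norm xi" by (simp add: m)
   moreover have "2 ^ n xi/K <= 2 ^ n xi/2" using K by (intro divide_left_mono) auto
   ultimately show ?thesis by linarith
  qed
  moreover have "1*2 ^ n xi <= K*2 ^ n xi" using K by (intro mult_right_mono) auto
  hence "norm xi <= K*2 ^ n xi" using le by linarith
  ultimately show "dyadic_size K (n xi) xi" by (auto simp: dyadic_size_def)
 qed
 have "(xi1, xi2, xi3, xi4) \<notin> dyadic_S K c N L (n xi1) (n xi2) (n xi3) (n xi4)" using q by (auto simp: S_set_def)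
 hence no: "\<bar>cos_angle (xi1+xi2) (xi1+xi4)\<bar> < 1/Max {2 ^ n xi1, 2 ^ n xi2, 2 ^ n xi3, 2 ^ n xi4}"
  "c*N < Max {norm xi1, norm xi2, norm xi3, norm xi4}"
  using sig n(2)[of xi1] n(2)[of xi2] n(2)[of xi3] n(2)[of xi4] unfolding dyadic_S_def mem_Collect_eq case_prod_conv not_le[symmetric] by blast+
 define S where "S = sizemax xi1 (- xi2) xi3 (- xi4)"
 have S: "S = Max {norm xi1, norm xi2, norm xi3, norm xi4}" by (simp add: S_def sizemax_def max.assoc)
 define D where "D = Max {2 ^ n xi1, 2 ^ n xi2, 2 ^ n xi3, 2 ^ n xi4 :: real}"
 have "2 ^ n xi1 <= D" "2 ^ n xi2 <= D" "2 ^ n xi3 <= D" "2 ^ n xi4 <= D" unfolding D_def by (rule Max_ge; simp)+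
 moreover have "1 <= (2::real) ^ n xi1" by simp
 ultimately have "1 <= D" "norm xi1 <= D" "norm xi2 <= D" "norm xi3 <= D" "norm xi4 <= D"
  using n(1)[of xi1] n(1)[of xi2] n(1)[of xi3] n(1)[of xi4] by linarith+
 hence "max 1 S <= D" by (simp add: S_def sizemax_def)
 hence "1/D <= 1/max 1 S" by (intro divide_left_mono mult_pos_pos) auto
 with no(1)[folded D_def] have cs: "\<bar>cos_angle (xi1+xi2) (xi1+xi4)\<bar> <= 1/max 1 S" by linarith
 have "\<bar>(xi1+xi2) \<bullet> (xi1+xi4)\<bar>*max 1 S <= norm (xi1+xi2)*norm (xi1+xi4)"
 proof (cases "norm (xi1+xi2)*norm (xi1+xi4) = 0")
  case True
  hence "(xi1+xi2) \<bullet> (xi1+xi4) = 0" by auto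
  thus ?thesis by simp
 next
  case False
  hence pos: "0 < norm (xi1+xi2)*norm (xi1+xi4)" by (simp add: zero_less_mult_iff)
  have "\<bar>(xi1+xi2) \<bullet> (xi1+xi4)\<bar> / (norm (xi1+xi2)*norm (xi1+xi4)) <= 1/max 1 S"
   using cs by (simp add: cos_angle_def abs_mult)
  hence "\<bar>(xi1+xi2) \<bullet> (xi1+xi4)\<bar> <= 1/max 1 S*(norm (xi1+xi2)*norm (xi1+xi4))"
   using pos by (simp only: pos_divide_le_eq)
  hence "\<bar>(xi1+xi2) \<bullet> (xi1+xi4)\<bar>*max 1 S <= 1/max 1 S*(norm (xi1+xi2)*norm (xi1+xi4))*max 1 S"
   by (rule mult_right_mono) simp
  thus ?thesis by (simp add: max_def)
 qed
 moreover have "xi1+xi3 = - xi2 + - xi4" using sum0 by (simp add: algebra_simps eq_neg_iff_add_eq_0)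
 ultimately show ?thesis using no(2) unfolding rect_def S_def[symmetric] S[symmetric] by simp
qed

lemma A_mult_bound:
 assumes "2 <= K"
 shows "\<bar>A_mult p K c N L (xi1, xi2, xi3, xi4)\<bar> <=
  of_bool (rect c N xi1 (- xi2) xi3 (- xi4))*\<bar>theta p N xi1-theta p N (- xi2)+theta p N xi3-theta p N (- xi4)\<bar>"
 using S_complement_rect[OF _ assms, of xi1 xi2 xi3 xi4 L c N]
 by (auto simp: A_mult_def theta_def I_symbol_def indicator_def)

lemma measurable_S_set:
 "Measurable.pred (freq4 L) (%q. q \<in> S_set K c N L)" "Measurable.pred (freq4 L) (%q. q \<in> Sigma4 L)"
proof -
 note freq4_components [measurable]
 have eq: "Measurable.pred (freq4 L) (%q. fst q+fs q+fss q+sss q = 0)"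
 proof -
  have "Measurable.pred (freq4 L) (%q. norm (fst q+fs q+fss q+sss q) <= 0)" by measurable
  thus ?thesis by simp
 qed
 have sg: "q \<in> Sigma4 L \<longleftrightarrow> fst q+fs q+fss q+sss q = 0"
  if "q \<in> space (freq4 L)" for q using that by (auto simp: Sigma4_def space_pair_measure space_freq)
 show S4: "Measurable.pred (freq4 L) (%q. q \<in> Sigma4 L)" using eq by (subst measurable_cong[OF sg]) auto
 note S4 [measurable]
 have d: "Measurable.pred (freq4 L) (%q. q \<in> dyadic_S K c N L n1 n2 n3 n4)" for n1 n2 n3 n4
 proof -
  have "q \<in> dyadic_S K c N L n1 n2 n3 n4 \<longleftrightarrow> q \<in> Sigma4 L \<and>
    dyadic_size K n1 (fst q) \<and> dyadic_size K n2 (fs q) \<and> dyadic_size K n3 (fss q) \<and> dyadic_size K n4 (sss q) \<and>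
    (1/Max {2 ^ n1, 2 ^ n2, 2 ^ n3, 2 ^ n4} <= \<bar>cos_angle (fst q+fs q) (fst q+sss q)\<bar> \<or>
     max (norm (fst q)) (max (norm (fs q)) (max (norm (fss q)) (norm (sss q)))) <= c*N)" for q
  proof -
   have "Max {x, y, z, w} = max x (max y (max z w))" for x y z w :: real by simp
   thus ?thesis unfolding dyadic_S_def by (cases q) (simp only: mem_Collect_eq case_prod_conv fst_conv snd_conv)
  qed
  note eq = this
  define D where "D = 1/Max {2 ^ n1, 2 ^ n2, 2 ^ n3, 2 ^ n4 :: real}"
  show ?thesis unfolding eq dyadic_size_def cos_angle_def D_def[symmetric] by measurable
 qed
 show "Measurable.pred (freq4 L) (%q. q \<in> S_set K c N L)" unfolding S_set_def UN_iff using d by measurable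
qed

lemma measurable_A_mult:
 assumes p: "I_profile s p" and s: "s < 1" and N: "0 < N"
 shows "A_mult p K c N L \<in> \<B> (freq4 L)"
proof -
 note freq4_components [measurable] measurable_S_set[measurable] measurable_I_symbol[OF p s N, measurable]
 have "A_mult p K c N L = (%q. ((I_symbol p N (fst q))^2*(norm (fst q))^2-(I_symbol p N (fs q))^2*(norm (fs q))^2
   + (I_symbol p N (fss q))^2*(norm (fss q))^2-(I_symbol p N (sss q))^2*(norm (sss q))^2)
   * of_bool (q \<in> Sigma4 L \<and> \<not> q \<in> S_set K c N L))" by (auto simp: A_mult_def indicator_def)
 moreover have "... \<in> \<B> (freq4 L)" by measurable
 ultimately show ?thesis by simp
qed

section \<open>The time integral of a product of free evolutions\<close>

lemma nn_integral_japanese_finite: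
 assumes b: "1/2 < b"
 shows "(NN sg|lborel. ennreal (japanese sg powr (- 2*b))) < \<infinity>"
proof -
 define u where "u sg = ennreal (sg powr (- 2*b))*ind {1..} sg" for sg :: real
 have [measurable]: "u \<in> \<B> borel" unfolding u_def[abs_def] by measurable
 have ui: "(NN sg|lborel. u sg) < \<infinity>"
 proof -
  have "(NN sg|lborel. u sg) = ennreal (0-1 powr (1-2*b)/(1-2*b))" unfolding u_def
  proof (rule nn_integral_FTC_atLeast[where F = "%sg. sg powr (1-2*b)/(1-2*b)" and T = 0])
   show "DERIV (%sg. sg powr (1-2*b)/(1-2*b)) x :> x powr (- 2*b)" if "1 <= x" for x :: real
    using that b by (auto intro!: derivative_eq_intros)
   have "((%sg::real. sg powr (1-2*b)) \<longlongrightarrow> 0) at_top"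
    using b by (intro tendsto_neg_powr filterlim_ident) auto
   from tendsto_divide[OF this tendsto_const[of "1-2*b"]]
   show "((%sg::real. sg powr (1-2*b)/(1-2*b)) \<longlongrightarrow> 0) at_top" using b by simp
  qed auto
  thus ?thesis by simp
 qed
 have un: "(NN sg|lborel. u (- sg)) = (NN sg|lborel. u sg)" using nn_integral_real_affine[of u "-1" 0] by simp
 have le: "ennreal (japanese sg powr (- 2*b)) <= ind {-1..1} sg+(u sg+u (- sg))" for sg
 proof (cases "\<bar>sg\<bar> <= 1")
  case True
  have "japanese sg powr (- 2*b) <= japanese sg powr 0" using b japanese_ge1[of sg] by (intro powr_mono) auto
  hence "ennreal (japanese sg powr (- 2*b)) <= 1" using japanese_pos[of sg] by simp
  also have "... <= ind {-1..1} sg+(u sg+u (- sg))" using True by (simp add: abs_le_iff)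
  finally show ?thesis .
 next
  case False
  have "japanese sg powr (- 2*b) <= \<bar>sg\<bar> powr (- 2*b)"
   using b False abs_le_japanese[of sg] by (intro powr_mono2') auto
  hence "ennreal (japanese sg powr (- 2*b)) <= ennreal (\<bar>sg\<bar> powr (- 2*b))" by (rule ennreal_leI)
  also have "... <= u sg+u (- sg)" using False by (auto simp: u_def indicator_def abs_if)
  finally show ?thesis by (simp add: add_increasing)
 qed
 have "(NN sg|lborel. ennreal (japanese sg powr (- 2*b))) <= (NN sg|lborel. ind {-1..1} sg+(u sg+u (- sg)))"
  by (intro nn_integral_mono le)
 also have "... = emeasure lborel {-1..1::real} + ((NN sg|lborel. u sg)+(NN sg|lborel. u sg))"
  by (subst nn_integral_add) (auto simp: nn_integral_add un)
 also have "... < \<infinity>" using ui by simp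
 finally show ?thesis .
qed

text \<open>The trivial bound \<open>dl\<close> for |th| \<le> 1 and the bound 2/|th| from the
  antiderivative otherwise; 2*C covers both.\<close>

lemma integral_cis_le_osc_kernel:
 assumes "0 <= dl" "dl <= C" "1 <= C"
 shows "cmod (LINT t|lborel. of_real (ind {0..dl} t) * cis (t*th)) <= 2*C * osc_kernel th"
proof (cases "\<bar>th\<bar> <= 1")
 case True
 have "cmod (LINT t|lborel. of_real (ind {0..dl} t) * cis (t*th)) <= (LINT t|lborel. ind {0..dl} t)"
 proof (rule Bochner_Integration.integral_norm_bound_integral)
  have "integrable lborel (%t. complex_of_real (ind {0..dl} t))" by (simp add: emeasure_lborel_Icc_eq)
  from integrable_mult_bounded[OF this, of "%t. cis (t*th)" 1]
  show "integrable lborel (%t. of_real (ind {0..dl} t) * cis (t*th))" by simp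
 qed (auto simp: norm_mult emeasure_lborel_Icc_eq)
 also have "... = dl" using assms by simp
 also have "... <= 2*C * osc_kernel th" using True assms by (simp add: osc_kernel_def)
 finally show ?thesis .
next
 case False
 have der: "((%t. cis (t*th)/(\<i> * of_real th)) has_vector_derivative cis (t*th)) (at t within S)" for t S
 proof -
  have "((%w. exp (w*(\<i> * of_real th))/(\<i> * of_real th)) has_field_derivative exp (of_real t*(\<i> * of_real th))) (at (of_real t))"
   using False by (auto intro!: derivative_eq_intros)
  from has_vector_derivative_real_field[OF this, of S] show ?thesis by (simp add: cis_conv_exp mult_ac)
 qed
 have "(LINT t|lborel. of_real (ind {0..dl} t) * cis (t*th)) = (LINT t|lborel. ind {0..dl} t *\<^sub>R cis (t*th))"
  by (simp add: scaleR_conv_of_real)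
 also have "... = cis (dl*th)/(\<i> * of_real th)-cis (0*th)/(\<i> * of_real th)"
  using assms by (intro integral_FTC_atLeastAtMost der continuous_intros) auto
 finally have "cmod (LINT t|lborel. of_real (ind {0..dl} t) * cis (t*th)) <=
   cmod (cis (dl*th)/(\<i> * of_real th)) + cmod (cis (0*th)/(\<i> * of_real th))" by (simp only: norm_triangle_ineq4)
 also have "... = 2*(1/\<bar>th\<bar>)" by (simp add: norm_divide norm_mult)
 also have "... <= 2*C*(1/\<bar>th\<bar>)" using assms by (intro mult_right_mono) auto
 also have "... = 2*C * osc_kernel th" using False by (simp add: osc_kernel_def)
 finally show ?thesis .
qed

lemma integral_pair_mult:
 fixes f :: "'a => complex" and g :: "'b => complex"
 assumes M: "sigma_finite_measure M" and N: "sigma_finite_measure N" and f: "integrable M f" and g: "integrable N g"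
 shows "(LINT z|(M \<otimes> N). f (fst z)*g (snd z)) = (LINT x|M. f x)*(LINT y|N. g y)"
proof -
 interpret A: sigma_finite_measure M by fact
 interpret B: sigma_finite_measure N by fact
 interpret pair_sigma_finite M N ..
 have "(LINT x|M. LINT y|N. f x*g y) = (LINT z|(M \<otimes> N). f (fst z)*g (snd z))"
  using integral_fst'[OF integrable_pair_mult[OF M N f g]] by simp
 thus ?thesis by simp
qed

lemma integral_real4:
 fixes f1 f2 f3 f4 :: "real => complex"
 assumes "integrable lborel f1" "integrable lborel f2" "integrable lborel f3" "integrable lborel f4"
 shows "(LINT s|real4. f1 (fst s)*(f2 (fs s)*(f3 (fss s)*f4 (sss s)))) =
  (LINT x|lborel. f1 x)*((LINT x|lborel. f2 x)*((LINT x|lborel. f3 x)*(LINT x|lborel. f4 x)))"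
proof -
 note l = lborel.sigma_finite_measure_axioms
 have 2: "integrable (lborel \<otimes> lborel) (%s. f3 (fst s)*f4 (snd s))" by (rule integrable_pair_mult[OF l l assms(3,4)])
 have 3: "integrable (lborel \<otimes> lborel \<otimes> lborel) (%s. f2 (fst s)*(f3 (fs s)*f4 (ss s)))"
  by (rule integrable_pair_mult[OF l sigma_finite_real2 assms(2) 2])
 show ?thesis
  unfolding integral_pair_mult[OF l l assms(3,4), symmetric] integral_pair_mult[OF l sigma_finite_real2 assms(2) 2, symmetric]
  by (rule integral_pair_mult[OF l sigma_finite_real3 assms(1) 3])
qed

text \<open>Written with the signs of the variables a, b, c, d of the form, so that it literally
  matches the argument of the kernel in \<open>mult_form\<close>.\<close>

definition resonance :: "(real \<times> real) \<times> (real \<times> real) \<times> (real \<times> real) => real" where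
 "resonance x = (norm (fst x))^2-(norm (- fs x))^2+(norm (ss x))^2-(norm (fst x+fs x+ss x))^2"

lemma measurable_resonance [measurable]: "resonance \<in> \<B> (freq3 L)"
proof -
 note freq3_components [measurable]
 show ?thesis unfolding resonance_def[abs_def] by measurable
qed

definition four :: "(real \<times> (real \<times> real) => complex) => ((real \<times> real) \<times> (real \<times> real) \<times> (real \<times> real)) \<times> (real \<times> real \<times> real \<times> real) => complex" where
 "four Ph w = Ph (fs w, fst (fst w))*(cnj (Ph (fss w, - fs (fst w))) * (Ph (fss (snd w), ss (fst w)) *
   cnj (Ph (sss (snd w), fst (fst w)+fs (fst w)+ss (fst w)))))"

lemma measurable_four:
 assumes Ph: "Ph \<in> \<B> (lborel \<otimes> freq L)"
 shows "four Ph \<in> \<B> (freq3 L \<otimes> real4)"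
proof -
 have c: "(%w. Ph (s w, q w)) \<in> \<B> M" if "s \<in> M ->M lborel" "q \<in> M ->M freq L" for s q and M :: "'z measure"
  using measurable_compose[OF measurable_Pair[OF that] Ph] .
 have "(%w. Ph (fs w, fst (fst w))) \<in> \<B> (freq3 L \<otimes> real4)"
  "(%w. Ph (fss w, - fs (fst w))) \<in> \<B> (freq3 L \<otimes> real4)"
  "(%w. Ph (fss (snd w), ss (fst w))) \<in> \<B> (freq3 L \<otimes> real4)"
  "(%w. Ph (sss (snd w), fst (fst w)+fs (fst w)+ss (fst w))) \<in> \<B> (freq3 L \<otimes> real4)"
  by (rule c; measurable)+
 note [measurable] = this
 show ?thesis unfolding four_def[abs_def] by measurable
qed

text \<open>The inverse time transform of a profile whose first argument is sg = \<tau> + |xi|^2: a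
  superposition over sg of free evolutions multiplied by characters in time.\<close>

definition evolution :: "(real \<times> (real \<times> real) => complex) => real => real \<times> real => complex" where
 "evolution Ph t xi = (LINT sg|lborel. Ph (sg, xi) * cnj (fourier_kernel t (sg-(norm xi)\<^sup>2)))"

lemma evolution_product:
 assumes Ph: "Ph \<in> \<B> (lborel \<otimes> freq L)"
  and Phi: "\<And>xi. xi \<in> space (freq L) ==> integrable lborel (%sg. Ph (sg, xi))"
  and x: "x \<in> space (freq3 L)"
 shows "evolution Ph t (fst x)*(cnj (evolution Ph t (- fs x))*(evolution Ph t (ss x) *
   cnj (evolution Ph t (fst x+fs x+ss x)))) =
  (LINT s|real4. of_real (((2*pi) powr (- (1/2))) ^ 4)*four Ph (x, s) * cis (t*(phase s-resonance x)))"
proof -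
 define r where "r = (2*pi) powr (- (1/2 :: real))"
 have k: "cnj (fourier_kernel t tt) = of_real r * cis (t*tt)" for tt :: real
  by (simp add: fourier_kernel_def r_def cis_cnj)
 have q: "fst x \<in> space (freq L)" "- fs x \<in> space (freq L)" "ss x \<in> space (freq L)" "fst x+fs x+ss x \<in> space (freq L)"
  using x by (auto simp: space_pair_measure space_freq mem_Times_iff intro: lattice_add lattice_uminus)
 define f where "f xi sg = Ph (sg, xi)*(of_real r * cis (t*(sg-(norm xi)\<^sup>2)))" for xi sg
 have fi: "integrable lborel (f xi)" if "xi \<in> space (freq L)" for xi
 proof -
  have "cmod (of_real r * cis (t*(sg-(norm xi)\<^sup>2))) <= r" for sg by (simp add: norm_mult r_def)
  thus ?thesis unfolding f_def by (intro integrable_mult_bounded[OF Phi[OF that]]) auto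
 qed
 have ev: "evolution Ph t xi = (LINT sg|lborel. f xi sg)" for xi by (simp add: evolution_def f_def k)
 have evc: "cnj (evolution Ph t xi) = (LINT sg|lborel. cnj (f xi sg))" for xi by (simp add: ev)
 have fci: "integrable lborel (%sg. cnj (f xi sg))" if "xi \<in> space (freq L)" for xi using fi[OF that] by simp
 have "evolution Ph t (fst x)*(cnj (evolution Ph t (- fs x))*(evolution Ph t (ss x) *
   cnj (evolution Ph t (fst x+fs x+ss x)))) =
  (LINT s|real4. f (fst x) (fst s)*(cnj (f (- fs x) (fs s))*(f (ss x) (fss s) * cnj (f (fst x+fs x+ss x) (sss s)))))"
  unfolding evc unfolding ev by (rule integral_real4[symmetric, OF fi fci fi fci]) (rule q)+
 also have "... = (LINT s|real4. of_real (r ^ 4)*four Ph (x, s) * cis (t*(phase s-resonance x)))"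
 proof (rule Bochner_Integration.integral_cong)
  fix s :: "real \<times> real \<times> real \<times> real"
  define h where "h xi sg = t*(sg-(norm xi)\<^sup>2)" for xi :: "real \<times> real" and sg
  have fh: "f xi sg = Ph (sg, xi)*(of_real r * cis (h xi sg))" for xi sg by (simp add: f_def h_def)
  have "cis (t*(phase s-resonance x)) = cis (h (fst x) (fst s))*(cis (- h (- fs x) (fs s)) *
    (cis (h (ss x) (fss s)) * cis (- h (fst x+fs x+ss x) (sss s))))"
   unfolding cis_mult by (rule arg_cong[where f = cis]) (simp add: h_def phase_def resonance_def algebra_simps)
  thus "f (fst x) (fst s)*(cnj (f (- fs x) (fs s))*(f (ss x) (fss s) * cnj (f (fst x+fs x+ss x) (sss s)))) =
   of_real (r ^ 4)*four Ph (x, s) * cis (t*(phase s-resonance x))"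
   by (simp add: fh four_def cis_cnj power4_eq_xxxx mult_ac)
 qed simp
 finally show ?thesis by (simp add: r_def)
qed

text \<open>Absolute convergence over frequencies and modulations lets the time integral be taken
  innermost, where it only sees the phase. Measurability in time is obtained by the same use of
  Fubini's theorem.\<close>

lemma oscillatory_time_integral:
 assumes Ph: "Ph \<in> \<B> (lborel \<otimes> freq L)"
  and Phi: "\<And>xi. xi \<in> space (freq L) ==> integrable lborel (%sg. Ph (sg, xi))"
  and km: "kap \<in> \<B> (freq3 L)"
  and fin: "(NN w|(freq3 L \<otimes> real4). ennreal (\<bar>kap (fst w)\<bar> * cmod (four Ph w))) < \<infinity>"
  and dl: "0 <= dl" "dl <= C" "1 <= C"
  and \<Lambda>: "\<And>t. \<Lambda> t = (LINT x|freq3 L. of_real (kap x)*(evolution Ph t (fst x)*(cnj (evolution Ph t (- fs x)) *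
   (evolution Ph t (ss x) * cnj (evolution Ph t (fst x+fs x+ss x))))))"
 shows "(%t. of_real (ind {0..dl} t)*\<Lambda> t) \<in> \<B> lborel"
  "ennreal (cmod (LINT t|lborel. of_real (ind {0..dl} t)*\<Lambda> t)) <=
   ennreal (2*C)*(NN w|(freq3 L \<otimes> real4). ennreal (\<bar>kap (fst w)\<bar> * cmod (four Ph w))*ennreal (osc_kernel (resonance (fst w)-phase (snd w))))"
proof -
 let ?Om = "freq3 L \<otimes> real4"
 have sO: "sigma_finite_measure ?Om" by (intro sigma_finite_pair_measure sigma_finite_freq sigma_finite_real4)
 interpret A: sigma_finite_measure "freq3 L" by (intro sigma_finite_pair_measure sigma_finite_freq)
 interpret B: sigma_finite_measure real4 by (rule sigma_finite_real4)
 interpret AB: pair_sigma_finite "freq3 L" real4 ..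
 interpret O: sigma_finite_measure ?Om by (rule sO)
 interpret T: pair_sigma_finite "lborel :: real measure" ?Om ..
 note measurable_four[OF Ph, measurable] km[measurable]
 define r where "r = (2*pi) powr (- (1/2 :: real))"
 have r: "0 <= r" "r <= 1"
 proof -
  have "(2*pi) powr (- (1/2 :: real)) <= (2*pi) powr 0" using pi_gt3 by (intro powr_mono) auto
  thus "0 <= r" "r <= 1" by (auto simp: r_def)
 qed
 define th where "th w = phase (snd w)-resonance (fst w)" for w :: "((real \<times> real) \<times> (real \<times> real) \<times> (real \<times> real)) \<times> (real \<times> real \<times> real \<times> real)"
 have [measurable]: "th \<in> \<B> ?Om"
 proof -
  have 1: "(%w. resonance (fst w)) \<in> \<B> ?Om" by measurable
  have 2: "(%w. phase (snd w)) \<in> \<B> ?Om" unfolding phase_def by measurable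
  show ?thesis unfolding th_def[abs_def] using 1 2 by measurable
 qed
 define G where "G w = of_real (kap (fst w))*(of_real (r ^ 4)*four Ph w)" for w
 have Gm [measurable]: "G \<in> \<B> ?Om" unfolding G_def[abs_def] by measurable
 have Gle: "cmod (G w) <= \<bar>kap (fst w)\<bar> * cmod (four Ph w)" for w
 proof -
  have "r ^ 4 <= 1" using r by (intro power_le_one)
  hence "r ^ 4 * cmod (four Ph w) <= 1 * cmod (four Ph w)" by (intro mult_right_mono) auto
  hence "\<bar>kap (fst w)\<bar>*(r ^ 4 * cmod (four Ph w)) <= \<bar>kap (fst w)\<bar>*(1 * cmod (four Ph w))" by (intro mult_left_mono) auto
  thus ?thesis using r by (simp add: G_def norm_mult norm_power)
 qed
 have Gi: "integrable ?Om G"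
 proof -
  have "(NN w|?Om. ennreal (norm (G w))) <= (NN w|?Om. ennreal (\<bar>kap (fst w)\<bar> * cmod (four Ph w)))"
   by (intro nn_integral_mono ennreal_leI Gle)
  also note fin
  finally show ?thesis using Gm by (simp add: integrable_iff_bounded)
 qed
 have cism: "(%w. cis (t*th w)) \<in> \<B> ?Om" for t by measurable
 have Gti: "integrable ?Om (%w. G w * cis (t*th w))" for t
  by (rule integrable_mult_bounded[OF Gi cism, where B = 1]) simp
 have \<Lambda>G: "\<Lambda> t = (LINT w|?Om. G w * cis (t*th w))" for t
 proof -
  have "(LINT w|?Om. G w * cis (t*th w)) = (LINT x|freq3 L. LINT s|real4. G (x, s) * cis (t*th (x, s)))"
   by (rule AB.integral_fst'[OF Gti, symmetric])
  also have "... = \<Lambda> t" unfolding \<Lambda>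
  proof (rule Bochner_Integration.integral_cong)
   fix x assume x: "x \<in> space (freq3 L)"
   have "(LINT s|real4. G (x, s) * cis (t*th (x, s))) =
     (LINT s|real4. of_real (kap x)*(of_real (r ^ 4)*four Ph (x, s) * cis (t*(phase s-resonance x))))"
    by (simp add: G_def th_def mult_ac)
   also have "... = of_real (kap x)*(LINT s|real4. of_real (r ^ 4)*four Ph (x, s) * cis (t*(phase s-resonance x)))"
    by (rule integral_mult_right_zero)
   finally have "(LINT s|real4. G (x, s) * cis (t*th (x, s))) = of_real (kap x) *
    (LINT s|real4. of_real (r ^ 4)*four Ph (x, s) * cis (t*(phase s-resonance x)))" .
   moreover have "evolution Ph t (fst x)*(cnj (evolution Ph t (- fs x)) *
    (evolution Ph t (ss x) * cnj (evolution Ph t (fst x+fs x+ss x)))) =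
    (LINT s|real4. of_real (r ^ 4)*four Ph (x, s) * cis (t*(phase s-resonance x)))"
    unfolding r_def by (rule evolution_product[OF Ph _ x]) (rule Phi)
   ultimately show "(LINT s|real4. G (x, s) * cis (t*th (x, s))) = of_real (kap x)*(evolution Ph t (fst x)*(cnj (evolution Ph t (- fs x)) *
    (evolution Ph t (ss x) * cnj (evolution Ph t (fst x+fs x+ss x)))))" by (simp only:)
  qed simp
  finally show ?thesis ..
 qed
 have tG: "integrable (lborel \<otimes> ?Om) (%z. (of_real (ind {0..dl} (fst z))*G (snd z)) * cis (fst z*th (snd z)))"
 proof (rule integrable_mult_bounded[where B = 1])
  show "integrable (lborel \<otimes> ?Om) (%z. of_real (ind {0..dl} (fst z))*G (snd z))"
   by (rule integrable_pair_mult[where f = "%t. of_real (ind {0..dl} t)", OF lborel.sigma_finite_measure_axioms sO _ Gi])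
    (simp add: emeasure_lborel_Icc_eq)
  have "(%z. th (snd z)) \<in> \<B> ((lborel :: real measure) \<otimes> ?Om)" by measurable
  thus "(%z. cis (fst z*th (snd z))) \<in> \<B> (lborel \<otimes> ?Om)" by measurable
 qed simp
 have in_t: "of_real (ind {0..dl} t)*\<Lambda> t = (LINT w|?Om. of_real (ind {0..dl} t)*G w * cis (t*th w))" for t
  unfolding \<Lambda>G by (simp add: mult.assoc)
 have "integrable lborel (%t. of_real (ind {0..dl} t)*\<Lambda> t)"
  unfolding in_t using T.integrable_fst'[OF tG] by simp
 thus "(%t. of_real (ind {0..dl} t)*\<Lambda> t) \<in> \<B> lborel" by (rule borel_measurable_integrable)
 define E where "E w = (LINT t|lborel. of_real (ind {0..dl} t) * cis (t*th w))" for w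
 have "(LINT t|lborel. of_real (ind {0..dl} t)*\<Lambda> t) =
   (LINT t|lborel. LINT w|?Om. of_real (ind {0..dl} t)*G w * cis (t*th w))" unfolding in_t ..
 also have "... = (LINT w|?Om. LINT t|lborel. of_real (ind {0..dl} t)*G w * cis (t*th w))"
  by (rule T.Fubini_integral[symmetric]) (use tG in \<open>simp add: case_prod_beta'\<close>)
 also have "... = (LINT w|?Om. G w*E w)"
 proof (rule Bochner_Integration.integral_cong)
  fix w
  have "(LINT t|lborel. of_real (ind {0..dl} t)*G w * cis (t*th w)) = (LINT t|lborel. G w*(of_real (ind {0..dl} t) * cis (t*th w)))"
   by (simp add: mult_ac)
  also have "... = G w*E w" unfolding E_def by (rule integral_mult_right_zero)
  finally show "(LINT t|lborel. of_real (ind {0..dl} t)*G w * cis (t*th w)) = G w*E w" .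
 qed simp
 finally have eq: "(LINT t|lborel. of_real (ind {0..dl} t)*\<Lambda> t) = (LINT w|?Om. G w*E w)" .
 have Ele: "cmod (E w) <= 2*C * osc_kernel (resonance (fst w)-phase (snd w))" for w
 proof -
  have "osc_kernel (th w) = osc_kernel (resonance (fst w)-phase (snd w))" by (simp add: osc_kernel_def th_def abs_minus_commute)
  thus ?thesis unfolding E_def using integral_cis_le_osc_kernel[OF dl, of "th w"] by simp
 qed
 have osc0: "0 <= osc_kernel y" for y by (simp add: osc_kernel_def)
 have "ennreal (cmod (LINT w|?Om. G w*E w)) <= (NN w|?Om. ennreal (cmod (G w*E w)))"
 \<comment> \<open>If the integrand were not integrable, its integral would be 0 by convention and
   the bound trivial.\<close>
 proof (cases "integrable ?Om (%w. G w*E w)")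
  case True
  thus ?thesis by (rule integral_norm_bound_ennreal)
 qed (simp add: not_integrable_integral_eq)
 also have "... <= (NN w|?Om. ennreal (2*C)*(ennreal (\<bar>kap (fst w)\<bar> * cmod (four Ph w))*ennreal (osc_kernel (resonance (fst w)-phase (snd w)))))"
 proof (rule nn_integral_mono)
  fix w
  have "cmod (G w*E w) <= (\<bar>kap (fst w)\<bar> * cmod (four Ph w))*(2*C * osc_kernel (resonance (fst w)-phase (snd w)))"
   unfolding norm_mult by (intro mult_mono Gle Ele) auto
  also have "... = 2*C*((\<bar>kap (fst w)\<bar> * cmod (four Ph w)) * osc_kernel (resonance (fst w)-phase (snd w)))" by (simp only: mult_ac)
  finally have "ennreal (cmod (G w*E w)) <= ennreal (2*C*((\<bar>kap (fst w)\<bar> * cmod (four Ph w)) * osc_kernel (resonance (fst w)-phase (snd w))))" by (rule ennreal_leI)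
  thus "ennreal (cmod (G w*E w)) <= ennreal (2*C)*(ennreal (\<bar>kap (fst w)\<bar> * cmod (four Ph w))*ennreal (osc_kernel (resonance (fst w)-phase (snd w))))"
   using dl osc0 by (subst (asm) ennreal_mult, simp, simp, subst (asm) ennreal_mult, simp_all)
 qed
 also have "... = ennreal (2*C)*(NN w|?Om. ennreal (\<bar>kap (fst w)\<bar> * cmod (four Ph w))*ennreal (osc_kernel (resonance (fst w)-phase (snd w))))"
 proof (rule nn_integral_cmult)
  have "(%w. osc_kernel (- th w)) \<in> \<B> ?Om" by measurable
  hence "(%w. osc_kernel (resonance (fst w)-phase (snd w))) \<in> \<B> ?Om" by (simp add: th_def)
  thus "(%w. ennreal (\<bar>kap (fst w)\<bar> * cmod (four Ph w))*ennreal (osc_kernel (resonance (fst w)-phase (snd w)))) \<in> \<B> ?Om"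
   by measurable
 qed
 finally show "ennreal (cmod (LINT t|lborel. of_real (ind {0..dl} t)*\<Lambda> t)) <=
   ennreal (2*C)*(NN w|?Om. ennreal (\<bar>kap (fst w)\<bar> * cmod (four Ph w))*ennreal (osc_kernel (resonance (fst w)-phase (snd w))))"
  unfolding eq .
qed

section \<open>Null sets on the hyperplane and the transform of the I-operator\<close>

lemma AE_freq_pullback:
 assumes P: "AE xi in freq L. P xi" and q: "q \<in> M ->M freq L"
  and null: "\<And>f. f \<in> \<B> (freq L) ==> (NN xi|freq L. f xi) = 0 ==> (NN x|M. f (q x)) = (0 :: ennreal)"
 shows "AE x in M. P (q x)"
proof -
 obtain Z where Z: "Z \<in> null_sets (freq L)" "{xi \<in> space (freq L). \<not> P xi} \<subseteq> Z" using P by (rule AE_E) blast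
 have m: "(ind Z :: _ => ennreal) \<in> \<B> (freq L)" using Z by auto
 have "(NN x|M. ind Z (q x)) = (0 :: ennreal)" by (rule null[OF m]) (use Z in \<open>simp add: null_sets_def\<close>)
 hence "AE x in M. ind Z (q x) = (0 :: ennreal)"
  using measurable_compose[OF q m] by (subst (asm) nn_integral_0_iff_AE) auto
 with AE_space show ?thesis
 proof eventually_elim
  case (elim x)
  hence "q x \<notin> Z" "q x \<in> space (freq L)" using measurable_space[OF q] by (auto simp: indicator_def split: if_splits)
  with Z(2) show ?case by auto
 qed
qed

lemma AE_freq_uminus:
 assumes "AE xi in freq L. P xi"
 shows "AE xi in freq L. P (- xi)"
proof (rule AE_freq_pullback[OF assms, where q = uminus])
 show "uminus \<in> freq L ->M freq L" by measurable
qed (simp add: nn_integral_freq_uminus)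

text \<open>Transforms are determined up to null sets of the frequency space, so identities between
  them must survive composition with the four coordinate maps of the hyperplane. The fourth one is a
  translation and a reflection when two of the other coordinates are held fixed.\<close>

lemma AE_freq3:
 assumes P: "AE xi in freq L. P xi"
 shows "AE x in freq3 L. P (fst x)" "AE x in freq3 L. P (fs x)" "AE x in freq3 L. P (ss x)"
  "AE x in freq3 L. P (- fst x-fs x-ss x)"
proof -
 note s2 = sigma_finite_pair_measure[OF sigma_finite_freq sigma_finite_freq, of L L]
 show "AE x in freq3 L. P (fst x)"
 proof (rule AE_freq_pullback[OF P])
  fix f :: "_ => ennreal" assume "f \<in> \<B> (freq L)" "(NN xi|freq L. f xi) = 0"
  thus "(NN x|freq3 L. f (fst x)) = 0" using nn_integral_pair_mult[OF s2, of f "freq L" "%_. 1"] by simp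
 qed measurable
 show "AE x in freq3 L. P (fs x)"
 proof (rule AE_freq_pullback[OF P])
  fix f :: "_ => ennreal" assume f: "f \<in> \<B> (freq L)" "(NN xi|freq L. f xi) = 0"
  hence 0: "(NN y|(freq L \<otimes> freq L). f (fst y)) = 0"
   using nn_integral_pair_mult[OF sigma_finite_freq, of f "freq L" "%_. 1" L] by simp
  have "(%y. f (fst y)) \<in> \<B> (freq L \<otimes> freq L)" using f by measurable
  thus "(NN x|freq3 L. f (fs x)) = 0"
   using 0 nn_integral_pair_mult[OF s2, of "%_. 1" "freq L" "%y. f (fst y)"] by simp
 qed measurable
 show "AE x in freq3 L. P (ss x)"
 proof (rule AE_freq_pullback[OF P])
  fix f :: "_ => ennreal" assume f: "f \<in> \<B> (freq L)" "(NN xi|freq L. f xi) = 0"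
  hence 0: "(NN y|(freq L \<otimes> freq L). f (snd y)) = 0"
   using nn_integral_pair_mult[OF sigma_finite_freq, of "%_. 1" "freq L" f L] by simp
  have "(%y. f (snd y)) \<in> \<B> (freq L \<otimes> freq L)" using f by measurable
  thus "(NN x|freq3 L. f (ss x)) = 0"
   using 0 nn_integral_pair_mult[OF s2, of "%_. 1" "freq L" "%y. f (snd y)"] by simp
 qed measurable
 show "AE x in freq3 L. P (- fst x-fs x-ss x)"
 proof (rule AE_freq_pullback[OF P])
  fix f :: "_ => ennreal" assume f: "f \<in> \<B> (freq L)" "(NN xi|freq L. f xi) = 0"
  have m: "(%(a, b, c, d). f (- d)) \<in> \<B> (freq4 L)"
   unfolding case_prod_beta' by (rule measurable_compose[OF _ f(1)]) measurable
  have e: "- (x+y+z) = - x-y-z" for x y z :: "real \<times> real" by simp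
  have "(NN x|freq3 L. f (- fst x-fs x-ss x)) = hyp L (%a b c d. f (- d))"
   unfolding e[symmetric] by (rule nn_integral_freq3_hyp[OF m])
  thus "(NN x|freq3 L. f (- fst x-fs x-ss x)) = 0"
   using nn_integral_freq_uminus[OF f(1)] f(2) by (simp add: hyp_def tri_def)
 qed measurable
qed

lemma is_fourier_cnj:
 assumes L: "1 <= L" and fg: "is_fourier (waveguide L) (freq L) f g"
 shows "is_fourier (waveguide L) (freq L) (%z. cnj (f z)) (%xi. cnj (g (- xi)))"
proof -
 interpret fourier_pair "waveguide L" "freq L" by (rule fourier_pair_waveguide[OF L])
 have f: "f \<in> L2 (waveguide L)" and g: "g \<in> L2 (freq L)"
  and lim: "((%R. sqn (freq L) (%y. fourier_integral (waveguide L) (trunc R f) y-g y)) \<longlongrightarrow> 0) at_top"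
  using fg by (auto simp: is_fourier_iff)
 have refl: "sqn (freq L) (%xi. cnj (h (- xi))) = sqn (freq L) h" if [measurable]: "h \<in> \<B> (freq L)" for h
  unfolding sqn_def using nn_integral_freq_uminus[of "%xi. ennreal ((cmod (h xi))^2)" L] by simp
 have m: "(%xi. cnj (h (- xi))) \<in> \<B> (freq L)" if h: "h \<in> \<B> (freq L)" for h :: "real \<times> real => complex"
 proof -
  have "(%xi. h (- xi)) \<in> \<B> (freq L)" by (rule measurable_compose[OF _ h]) measurable
  thus ?thesis by measurable
 qed
 have FI: "fourier_integral (waveguide L) (trunc R (%z. cnj (f z))) xi = cnj (fourier_integral (waveguide L) (trunc R f) (- xi))" for R xi
 proof -
  have "(LINT z|waveguide L. trunc R (%z. cnj (f z)) z * cis (- (z \<bullet> xi))) = (LINT z|waveguide L. cnj (trunc R f z * cis (- (z \<bullet> - xi))))"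
   by (intro Bochner_Integration.integral_cong) (simp_all add: trunc_def cis_cnj)
  also have "... = cnj (LINT z|waveguide L. trunc R f z * cis (- (z \<bullet> - xi)))" by (rule Bochner_Integration.integral_cnj)
  finally have eq: "(LINT z|waveguide L. trunc R (%z. cnj (f z)) z * cis (- (z \<bullet> xi))) = cnj (LINT z|waveguide L. trunc R f z * cis (- (z \<bullet> - xi)))" .
  show ?thesis unfolding fourier_integral_def eq by simp
 qed
 have "sqn (freq L) (%y. fourier_integral (waveguide L) (trunc R (%z. cnj (f z))) y-cnj (g (- y))) =
   sqn (freq L) (%y. fourier_integral (waveguide L) (trunc R f) y-g y)" for R
 proof -
  have "(%y. fourier_integral (waveguide L) (trunc R f) y-g y) \<in> \<B> (freq L)"
   by (rule L2D[OF square_integrable_diff[OF fourier_integral_L2[OF trunc_L12[OF f]] g]])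
  from refl[OF this] show ?thesis by (simp add: FI)
 qed
 moreover have "(%z. cnj (f z)) \<in> L2 (waveguide L)"
 proof -
  have "f \<in> \<B> (waveguide L)" by (rule L2D[OF f])
  hence "(%z. cnj (f z)) \<in> \<B> (waveguide L)" by measurable
  with f show ?thesis by (simp add: square_integrable_iff sqn_def)
 qed
 moreover have "(%xi. cnj (g (- xi))) \<in> L2 (freq L)"
  using g m[OF L2D[OF g]] refl[OF L2D[OF g]] by (simp add: square_integrable_iff)
 ultimately show ?thesis using lim by (simp add: is_fourier_iff)
qed

lemma I_symbol_bounds:
 assumes p: "I_profile s p" and s: "s < 1" and N: "0 < N"
 shows "0 < I_symbol p N xi" "I_symbol p N xi <= 1" "I_symbol p N (- xi) = I_symbol p N xi"
 using I_profile_bounds(1,2)[OF p s, of "norm xi/N"] N by (auto simp: I_symbol_def)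

text \<open>\<open>I_op\<close> chooses a function with a prescribed transform. That such a function
  exists is the surjectivity of the L2 transform, since the symbol is bounded by 1.\<close>

lemma is_fourier_I_op:
 assumes L: "1 <= L" and p: "I_profile s p" and s: "s < 1" and N: "0 < N"
  and f: "f \<in> L2 (waveguide L)"
 shows "is_fourier (waveguide L) (freq L) (I_op p N L f) (%xi. of_real (I_symbol p N xi)*wg_fourier L f xi)"
proof -
 interpret fourier_pair "waveguide L" "freq L" by (rule fourier_pair_waveguide[OF L])
 have F: "wg_fourier L f \<in> L2 (freq L)" using is_fourier_fourier[OF f] by (simp add: is_fourier_iff)
 have "(%xi. of_real (I_symbol p N xi)*wg_fourier L f xi) \<in> \<B> (freq L)"
  using L2D[OF F] measurable_compose[OF measurable_freq_id measurable_I_symbol[OF p s N], of L] by measurable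
 moreover have "sqn (freq L) (%xi. of_real (I_symbol p N xi)*wg_fourier L f xi) <= sqn (freq L) (wg_fourier L f)"
 proof (rule sqn_mono)
  fix xi
  show "cmod (of_real (I_symbol p N xi)*wg_fourier L f xi) <= cmod (wg_fourier L f xi)"
   using I_symbol_bounds[OF p s N, of xi] by (simp add: norm_mult mult_left_le_one_le)
 qed
 ultimately have "(%xi. of_real (I_symbol p N xi)*wg_fourier L f xi) \<in> L2 (freq L)"
  using F by (auto simp: square_integrable_iff intro: le_less_trans)
 from someI_ex[OF is_fourier_surj[OF this]] show ?thesis unfolding I_op_def .
qed

text \<open>The symbol is strictly positive, so the transform of \<open>f\<close> is recovered from
  that of any function equal to the smoothed \<open>f\<close> almost everywhere. In the application
  \<open>v\<close> is a time slice of an extension and \<open>h\<close> its evolution.\<close>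

lemma wg_fourier_of_I_op:
 assumes L: "1 <= L" and p: "I_profile s p" and s: "s < 1" and N: "0 < N"
  and f: "f \<in> L2 (waveguide L)"
  and v: "is_fourier (waveguide L) (freq L) v h" and eq: "AE z in waveguide L. v z = I_op p N L f z"
 shows "AE xi in freq L. wg_fourier L f xi = h xi/of_real (I_symbol p N xi)"
  "AE xi in freq L. wg_fourier L (%z. cnj (f z)) xi = cnj (h (- xi))/of_real (I_symbol p N xi)"
proof -
 interpret fourier_pair "waveguide L" "freq L" by (rule fourier_pair_waveguide[OF L])
 note I = is_fourier_I_op[OF L p s N f]
 have "is_fourier (waveguide L) (freq L) (I_op p N L f) h"
  by (rule is_fourier_cong[OF v _ eq]) (use I v in \<open>auto simp: is_fourier_iff square_integrable_iff\<close>)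
 from is_fourier_unique[OF this I]
 show 1: "AE xi in freq L. wg_fourier L f xi = h xi/of_real (I_symbol p N xi)"
 proof eventually_elim
  case (elim xi)
  thus ?case using I_symbol_bounds(1)[OF p s N, of xi] by simp
 qed
 have c2: "(%z. cnj (f z)) \<in> L2 (waveguide L)"
  using is_fourier_cnj[OF L is_fourier_fourier[OF f]] by (simp add: is_fourier_iff)
 have "AE xi in freq L. wg_fourier L (%z. cnj (f z)) xi = cnj (wg_fourier L f (- xi))"
  by (rule is_fourier_unique[OF is_fourier_fourier[OF c2] is_fourier_cnj[OF L is_fourier_fourier[OF f]]])
 with AE_freq_uminus[OF 1]
 show "AE xi in freq L. wg_fourier L (%z. cnj (f z)) xi = cnj (h (- xi))/of_real (I_symbol p N xi)"
  by eventually_elim (simp add: I_symbol_bounds(3)[OF p s N])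
qed

text \<open>Taking the fourth root of the left side turns it into a fixed lower bound for every
  member of the family, so that the infimum can be formed before the power.\<close>

lemma ennreal_le_mult_INF_power4:
 assumes q: "0 < q" and x: "0 <= x" and le: "\<And>w. w \<in> A ==> ennreal x <= ennreal q*f w ^ 4"
 shows "ennreal x <= ennreal q*(INF w\<in>A. f w) ^ 4"
proof -
 define r where "r = root 4 (x/q)"
 have r: "0 <= r" "r ^ 4 = x/q" using x q by (auto simp: r_def)
 have "ennreal r <= f w" if w: "w \<in> A" for w
 proof (rule ccontr)
  assume "\<not> ennreal r <= f w"
  hence lt: "f w < ennreal r" by simp
  then obtain y where y: "f w = ennreal y" "0 <= y" by (cases "f w") auto
  with lt r have "y < r" by (simp add: ennreal_less_iff)
  hence "y ^ 4 < r ^ 4" using y by (intro power_strict_mono) auto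
  hence "q*y ^ 4 < x" using q r by (simp add: pos_less_divide_eq mult.commute)
  moreover have "ennreal x <= ennreal (q*y ^ 4)" using le[OF w] y q by (simp add: ennreal_mult ennreal_power)
  ultimately show False using x q y by (simp add: ennreal_le_iff)
 qed
 hence "ennreal r <= (INF w\<in>A. f w)" by (intro INF_greatest)
 hence "ennreal q*ennreal r ^ 4 <= ennreal q*(INF w\<in>A. f w) ^ 4" by (intro mult_left_mono power_mono) auto
 moreover have "ennreal q*ennreal r ^ 4 = ennreal x" using q x r ennreal_mult[of q "x/q"] by (simp add: ennreal_power)
 ultimately show ?thesis by simp
qed

section \<open>Profiles of functions in the Bourgain space and the weighted multiplier\<close>

lemma measurable_evolution:
 assumes Ph: "Ph \<in> \<B> (lborel \<otimes> freq L)"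
 shows "evolution Ph t \<in> \<B> (freq L)"
proof -
 have 1: "(%z. Ph (snd z, fst z)) \<in> \<B> (freq L \<otimes> lborel)"
  by (rule measurable_compose[OF _ Ph]) measurable
 have [measurable]: "(%z. fst z) \<in> \<B> (freq L \<otimes> lborel)" by (rule freq_into_borel) measurable
 have 2: "(%z. cnj (fourier_kernel t (snd z-(norm (fst z))^2))) \<in> \<B> (freq L \<otimes> lborel)"
  unfolding fourier_kernel_def inner_real_def by measurable
 have "(%(xi, sg). Ph (sg, xi) * cnj (fourier_kernel t (sg-(norm xi)\<^sup>2))) \<in> \<B> (freq L \<otimes> lborel)"
  unfolding case_prod_beta' using 1 2 by measurable
 from lborel.borel_measurable_lebesgue_integral[OF this] show ?thesis unfolding evolution_def[abs_def] .
qed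

text \<open>The multiplier that acts on the smoothed function instead of \<open>u\<close>. The
  symbol is even, so its value at the fourth frequency may be taken at the sum of the first
  three.\<close>

definition weighted_mult :: "(real => real) => real => real => real => real => (real \<times> real) \<times> (real \<times> real) \<times> (real \<times> real) => real" where
 "weighted_mult p K c N L x = A_mult p K c N L (fst x, fs x, ss x, - fst x-fs x-ss x) /
   (I_symbol p N (fst x)*I_symbol p N (fs x)*I_symbol p N (ss x)*I_symbol p N (fst x+fs x+ss x))"

lemma measurable_weighted_mult:
 assumes p: "I_profile s p" and s: "s < 1" and N: "0 < N"
 shows "weighted_mult p K c N L \<in> \<B> (freq3 L)"
proof -
 have "(%x. (fst x, fs x, ss x, - fst x-fs x-ss x)) \<in> freq3 L ->M freq4 L" by measurable
 from measurable_compose[OF this measurable_A_mult[OF p s N]]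
 have 1: "(%x. A_mult p K c N L (fst x, fs x, ss x, - fst x-fs x-ss x)) \<in> \<B> (freq3 L)" .
 note freq3_components [measurable] measurable_I_symbol[OF p s N, measurable]
 show ?thesis unfolding weighted_mult_def[abs_def] using 1 by measurable
qed

text \<open>Replaces membership in the complement of \<open>S\<close> by the rectangle condition,
  and moves the brackets from the quotient of the multiplier onto the profiles, where they complete
  the weight of the Bourgain norm.\<close>

lemma weighted_mult_four_le:
 assumes p: "I_profile s p" and s: "s < 1" and N: "0 < N" and K: "2 <= K"
 shows "ennreal (\<bar>weighted_mult p K c N L (fst w)\<bar> * cmod (four Ph w)) * k (resonance (fst w)-phase (snd w)) <=
  mult_form p c N (%h. k (h-phase (snd w)))
   (%xi. ennreal (bracket xi * cmod (Ph (fs w, xi)))) (%xi. ennreal (bracket xi * cmod (Ph (fss w, xi))))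
   (%xi. ennreal (bracket xi * cmod (Ph (fss (snd w), xi)))) (%xi. ennreal (bracket xi * cmod (Ph (sss (snd w), xi))))
   (fst (fst w)) (- fs (fst w)) (ss (fst w)) (fst (fst w)+fs (fst w)+ss (fst w))"
proof -
 define xi1 xi2 xi3 where "xi1 = fst (fst w)" and "xi2 = fs (fst w)" and "xi3 = ss (fst w)"
 define d where "d = xi1+xi2+xi3"
 define M where "M = I_symbol p N xi1*I_symbol p N xi2*I_symbol p N xi3*I_symbol p N d"
 define B where "B = bracket xi1*bracket xi2*bracket xi3*bracket d"
 define Q where "Q = quotient_mult p N xi1 (- xi2) xi3 d"
 define R where "R = (of_bool (rect c N xi1 (- xi2) xi3 d) :: real)"
 define P1 P2 P3 P4 where "P1 = cmod (Ph (fs w, xi1))" and "P2 = cmod (Ph (fss w, - xi2))"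
  and "P3 = cmod (Ph (fss (snd w), xi3))" and "P4 = cmod (Ph (sss (snd w), d))"
 have M: "0 < M" unfolding M_def using I_symbol_bounds(1)[OF p s N] by simp
 have B: "0 < B" unfolding B_def using japanese_pos by simp
 have Q: "Q*B = \<bar>theta p N xi1-theta p N (- xi2)+theta p N xi3-theta p N d\<bar> / M" "0 <= Q"
 proof -
  have pos: "0 < I_symbol p N xi" "0 < bracket xi" for xi using I_symbol_bounds(1)[OF p s N] japanese_pos by auto
  have "Q = \<bar>theta p N xi1-theta p N (- xi2)+theta p N xi3-theta p N d\<bar> / (M*B)"
   unfolding Q_def quotient_mult_def M_def B_def using I_symbol_bounds(3)[OF p s N] by (simp add: mult_ac)
  with M B show "Q*B = \<bar>theta p N xi1-theta p N (- xi2)+theta p N xi3-theta p N d\<bar> / M" "0 <= Q" by auto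
 qed
 have e: "- xi1-xi2-xi3 = - d" by (simp add: d_def)
 have "weighted_mult p K c N L (fst w) = A_mult p K c N L (xi1, xi2, xi3, - d)/M"
  unfolding weighted_mult_def by (simp only: xi1_def[symmetric] xi2_def[symmetric] xi3_def[symmetric] e d_def[symmetric] M_def)
 hence "\<bar>weighted_mult p K c N L (fst w)\<bar> = \<bar>A_mult p K c N L (xi1, xi2, xi3, - d)\<bar> / M" using M by simp
 also have "... <= (R*\<bar>theta p N xi1-theta p N (- xi2)+theta p N xi3-theta p N d\<bar>)/M"
  using A_mult_bound[OF K, of p c N L xi1 xi2 xi3 "- d"] M by (intro divide_right_mono) (auto simp: R_def)
 also have "... = R*(Q*B)" unfolding Q by simp
 finally have w: "\<bar>weighted_mult p K c N L (fst w)\<bar> <= R*(Q*B)" .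
 have "cmod (four Ph w) = P1*P2*P3*P4"
  by (simp add: four_def norm_mult xi1_def xi2_def xi3_def d_def P1_def P2_def P3_def P4_def mult.assoc)
 hence "\<bar>weighted_mult p K c N L (fst w)\<bar> * cmod (four Ph w) <= R*(Q*B)*(P1*P2*P3*P4)"
  using w by (simp add: mult_right_mono P1_def P2_def P3_def P4_def)
 also have "... = R*(Q*((bracket xi1*P1)*(bracket (- xi2)*P2)*(bracket xi3*P3)*(bracket d*P4)))"
  by (simp add: B_def mult_ac)
 finally have "ennreal (\<bar>weighted_mult p K c N L (fst w)\<bar> * cmod (four Ph w)) <=
   ennreal (R*(Q*((bracket xi1*P1)*(bracket (- xi2)*P2)*(bracket xi3*P3)*(bracket d*P4))))" by (rule ennreal_leI)
 also have "... = ennreal R*(ennreal Q*(ennreal (bracket xi1*P1)*ennreal (bracket (- xi2)*P2)*ennreal (bracket xi3*P3)*ennreal (bracket d*P4)))"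
 proof -
  have nn: "0 <= bracket xi" for xi using japanese_pos by (simp add: less_imp_le)
  show ?thesis using Q(2) nn by (simp add: ennreal_mult R_def P1_def P2_def P3_def P4_def)
 qed
 finally have main: "ennreal (\<bar>weighted_mult p K c N L (fst w)\<bar> * cmod (four Ph w)) <=
  ennreal R*(ennreal Q*(ennreal (bracket xi1*P1)*ennreal (bracket (- xi2)*P2)*ennreal (bracket xi3*P3)*ennreal (bracket d*P4)))" .
 have res: "resonance (fst w) = (norm xi1)^2-(norm (- xi2))^2+(norm xi3)^2-(norm d)^2"
  by (simp only: resonance_def xi1_def xi2_def xi3_def d_def)
 have "ennreal (\<bar>weighted_mult p K c N L (fst w)\<bar> * cmod (four Ph w)) * k (resonance (fst w)-phase (snd w)) <=
  ennreal R*(ennreal Q*(ennreal (bracket xi1*P1)*ennreal (bracket (- xi2)*P2)*ennreal (bracket xi3*P3)*ennreal (bracket d*P4))) * k (resonance (fst w)-phase (snd w))"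
  by (rule mult_right_mono[OF main]) simp
 also have "... = of_bool (rect c N xi1 (- xi2) xi3 d)*ennreal Q * k (resonance (fst w)-phase (snd w)) *
   (ennreal (bracket xi1*P1)*ennreal (bracket (- xi2)*P2)*ennreal (bracket xi3*P3)*ennreal (bracket d*P4))"
  by (simp add: R_def mult_ac)
 also have "... = mult_form p c N (%h. k (h-phase (snd w)))
   (%xi. ennreal (bracket xi * cmod (Ph (fs w, xi)))) (%xi. ennreal (bracket xi * cmod (Ph (fss w, xi))))
   (%xi. ennreal (bracket xi * cmod (Ph (fss (snd w), xi)))) (%xi. ennreal (bracket xi * cmod (Ph (sss (snd w), xi))))
   xi1 (- xi2) xi3 d" unfolding mult_form_def Q_def P1_def P2_def P3_def P4_def res ..
 finally show ?thesis by (simp only: xi1_def xi2_def xi3_def d_def)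
qed

text \<open>In the variable \<open>\<sigma> = \<tau> + |\<xi>|\<^sup>2\<close> the weight of the Bourgain norm depends on time only, and
 the phases of the free evolutions separate from the transform. Frequencies where the time integral
 diverges form a null set and are discarded.\<close>

lemma bourgain_profile:
 assumes L: "1 <= L" and b: "1/2 < b" and w: "w \<in> L2 (spacetime L)" and X: "X_norm L 1 b w < \<infinity>"
 shows "\<exists>Ph. Ph \<in> \<B> (lborel \<otimes> freq L) \<and>
  (\<forall>xi\<in>space (freq L). integrable lborel (%sg. Ph (sg, xi))) \<and>
  (NN sg|lborel. ennreal (japanese sg powr (2*b))*(NN xi|freq L. (ennreal (bracket xi * cmod (Ph (sg, xi))))^2)) <= (X_norm L 1 b w)^2 \<and>
  (AE t in lborel. is_fourier (waveguide L) (freq L) (%z. w (t, z)) (evolution Ph t))"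
proof -
 interpret S: fourier_pair "spacetime L" "spacetime_freq L" by (rule fourier_pair_spacetime[OF L])
 interpret F: fourier_pair "waveguide L" "freq L" by (rule fourier_pair_waveguide[OF L])
 interpret sF: sigma_finite_measure "freq L" by (rule sigma_finite_freq)
 interpret B: pair_sigma_finite "lborel :: real measure" "freq L" ..
 define W where "W = st_fourier L w"
 have wW: "is_fourier (lborel \<otimes> waveguide L) (lborel \<otimes> freq L) w W"
  using S.is_fourier_fourier[OF w] by (simp add: W_def spacetime_def spacetime_freq_def)
 hence Wm [measurable]: "W \<in> \<B> (lborel \<otimes> freq L)"
  unfolding spacetime_def[symmetric] spacetime_freq_def[symmetric] by (simp add: S.is_fourier_iff square_integrable_iff)
 have snd_b [measurable]: "(%z. snd z) \<in> \<B> ((lborel :: real measure) \<otimes> freq L)" by (rule freq_into_borel) measurable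
 define wt where "wt z = ennreal ((japanese (fst z+(norm (snd z))^2) powr b*japanese (norm (snd z)) powr 1 * cmod (W z))^2)" for z
 have wtm [measurable]: "wt \<in> \<B> (lborel \<otimes> freq L)" unfolding wt_def[abs_def] by measurable
 define J where "J xi = (NN tt|lborel. wt (tt, xi))" for xi
 have X2: "(X_norm L 1 b w)^2 = (NN xi|freq L. J xi)"
 proof -
  have "(X_norm L 1 b w)^2 = (NN z|(lborel \<otimes> freq L). wt z)"
  proof -
   have "(X_norm L 1 b w)^2 = (NN z|spacetime_freq L. wt z)" unfolding X_norm_def ennreal_sqrt_power2
    by (intro nn_integral_cong) (auto simp: wt_def W_def case_prod_beta')
   thus ?thesis by (simp only: spacetime_freq_def)
  qed
  also have "... = (NN xi|freq L. J xi)" unfolding J_def by (rule B.nn_integral_snd[OF wtm, symmetric])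
  finally show ?thesis .
 qed
 have Jm: "J \<in> \<B> (freq L)"
 proof -
  have "(%(xi, tt). wt (tt, xi)) \<in> \<B> (freq L \<otimes> lborel)"
   using measurable_pair_swap[OF wtm] by (simp add: case_prod_beta')
  from lborel.borel_measurable_nn_integral[OF this] show ?thesis unfolding J_def[abs_def] by simp
 qed
 have "(NN xi|freq L. J xi) \<noteq> \<infinity>"
  unfolding X2[symmetric] using X by (simp add: power_eq_top_ennreal flip: less_top)
 hence AEJ: "AE xi in freq L. J xi \<noteq> \<infinity>" by (intro nn_integral_PInf_AE Jm)
 define I where "I xi = (NN tt|lborel. ennreal (cmod (W (tt, xi))))" for xi
 have Im [measurable]: "I \<in> \<B> (freq L)"
 proof -
  have "(%(xi, tt). ennreal (cmod (W (tt, xi)))) \<in> \<B> (freq L \<otimes> lborel)"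
   using measurable_pair_swap[of "%z. ennreal (cmod (W z))" lborel "freq L"] by (simp add: case_prod_beta')
  from lborel.borel_measurable_nn_integral[OF this] show ?thesis unfolding I_def[abs_def] by simp
 qed
 have slice [measurable]: "(%tt. W (tt, xi)) \<in> \<B> borel" if "xi \<in> space (freq L)" for xi
  using measurable_Pair1[OF Wm that] by simp
 have AEI: "AE xi in freq L. I xi < \<infinity>" using AEJ AE_space
 proof eventually_elim
  case (elim xi)
  note [measurable] = slice[OF elim(2)]
  \<comment> \<open>Here b > 1/2 enters: Cauchy-Schwarz against the integrable weight <\<tau> +
    |xi|^2>^(-2b) makes the transform integrable in time for almost every \<open>xi\<close>.\<close>
  have "(I xi)^2 <= (NN tt|lborel. wt (tt, xi))*(NN tt|lborel. ennreal (japanese (tt+(norm xi)^2) powr (- 2*b)))"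
   unfolding I_def
  proof (rule nn_integral_CS)
   show "(%tt. wt (tt, xi)) \<in> \<B> lborel" using measurable_Pair1[OF wtm elim(2)] by simp
   fix tt
   define j where "j = japanese (tt+(norm xi)^2)"
   have j: "0 < j" unfolding j_def by (rule japanese_pos)
   have jj: "(j powr b)^2*j powr (- 2*b) = 1" using j by (simp add: power2_eq_square flip: powr_add)
   have n1: "1 <= japanese (norm xi) powr 1" using japanese_ge1[of "norm xi"] by simp
   have "(cmod (W (tt, xi)))^2 <= (japanese (norm xi) powr 1 * cmod (W (tt, xi)))^2"
    using mult_right_mono[OF n1, of "cmod (W (tt, xi))"] by (intro power_mono) auto
   also have "... = (j powr b*japanese (norm xi) powr 1 * cmod (W (tt, xi)))^2*j powr (- 2*b)"
    using jj by (simp add: power_mult_distrib mult_ac)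
   finally have "ennreal ((cmod (W (tt, xi)))^2) <= ennreal ((j powr b*japanese (norm xi) powr 1 * cmod (W (tt, xi)))^2*j powr (- 2*b))"
    by (rule ennreal_leI)
   thus "(ennreal (cmod (W (tt, xi))))^2 <= wt (tt, xi)*ennreal (japanese (tt+(norm xi)^2) powr (- 2*b))"
    by (simp add: wt_def j_def ennreal_mult ennreal_power)
  qed measurable
  also have "(NN tt|lborel. ennreal (japanese (tt+(norm xi)^2) powr (- 2*b))) = (NN sg|lborel. ennreal (japanese sg powr (- 2*b)))"
   using nn_integral_real_affine[of "%sg. ennreal (japanese sg powr (- 2*b))" 1 "(norm xi)^2"] by (simp add: add.commute)
  also have "(NN tt|lborel. wt (tt, xi))*... < \<infinity>"
   using elim(1) nn_integral_japanese_finite[OF b] unfolding J_def by (simp add: ennreal_mult_less_top less_top)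
  finally show "I xi < \<infinity>" by (simp add: power_less_top_ennreal)
 qed
 define Ph where "Ph z = (if I (snd z) < \<infinity> then W (fst z-(norm (snd z))^2, snd z) else 0)" for z
 have Phm: "Ph \<in> \<B> (lborel \<otimes> freq L)"
 proof -
  have [measurable]: "(%z. I (snd z)) \<in> \<B> ((lborel :: real measure) \<otimes> freq L)" by measurable
  have "(%z. (fst z-(norm (snd z))^2, snd z)) \<in> (lborel :: real measure) \<otimes> freq L ->M lborel \<otimes> freq L"
  proof (rule measurable_Pair)
   have "(%z. fst z-(norm (snd z))^2) \<in> \<B> ((lborel :: real measure) \<otimes> freq L)" by measurable
   thus "(%z. fst z-(norm (snd z))^2) \<in> (lborel :: real measure) \<otimes> freq L ->M lborel" by simp
  qed measurable
  from measurable_compose[OF this Wm]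
  have [measurable]: "(%z. W (fst z-(norm (snd z))^2, snd z)) \<in> \<B> (lborel \<otimes> freq L)" .
  show ?thesis unfolding Ph_def[abs_def] by measurable
 qed
 have Wint: "integrable lborel (%tt. W (tt, xi))" if "xi \<in> space (freq L)" "I xi < \<infinity>" for xi
  using that slice[OF that(1)] by (simp add: integrable_iff_bounded I_def)
 have Phi: "integrable lborel (%sg. Ph (sg, xi))" if xi: "xi \<in> space (freq L)" for xi
 proof (cases "I xi < \<infinity>")
  case True
  from lborel_integrable_real_affine[OF Wint[OF xi True], of 1 "- (norm xi)\<^sup>2"]
  show ?thesis using True by (simp add: Ph_def)
 qed (simp add: Ph_def)
 have norm_le: "(NN sg|lborel. ennreal (japanese sg powr (2*b))*(NN xi|freq L. (ennreal (bracket xi * cmod (Ph (sg, xi))))^2)) <= (X_norm L 1 b w)^2"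
 proof -
  have m: "(%(sg, xi). ennreal (japanese sg powr (2*b))*(ennreal (bracket xi * cmod (Ph (sg, xi))))^2) \<in> \<B> (lborel \<otimes> freq L)"
   unfolding case_prod_beta' using Phm by measurable
  have "(NN sg|lborel. ennreal (japanese sg powr (2*b))*(NN xi|freq L. (ennreal (bracket xi * cmod (Ph (sg, xi))))^2)) =
   (NN sg|lborel. (NN xi|freq L. ennreal (japanese sg powr (2*b))*(ennreal (bracket xi * cmod (Ph (sg, xi))))^2))"
  proof (rule nn_integral_cong)
   fix sg :: real
   have "(%xi. Ph (sg, xi)) \<in> \<B> (freq L)" using measurable_Pair2[OF Phm, of sg] by simp
   hence [measurable]: "(%xi. ennreal (bracket xi * cmod (Ph (sg, xi)))) \<in> \<B> (freq L)"
    using borel_measurable_times[of "%xi. bracket xi" "freq L" "%xi. cmod (Ph (sg, xi))"] by simp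
   show "ennreal (japanese sg powr (2*b))*(NN xi|freq L. (ennreal (bracket xi * cmod (Ph (sg, xi))))^2) =
    (NN xi|freq L. ennreal (japanese sg powr (2*b))*(ennreal (bracket xi * cmod (Ph (sg, xi))))^2)"
    by (intro nn_integral_cmult[symmetric]) measurable
  qed
  also have "... = (NN xi|freq L. (NN sg|lborel. ennreal (japanese sg powr (2*b))*(ennreal (bracket xi * cmod (Ph (sg, xi))))^2))"
   by (rule B.Fubini'[OF m, symmetric])
  also have "... <= (NN xi|freq L. J xi)"
  proof (rule nn_integral_mono)
   fix xi assume xi: "xi \<in> space (freq L)"
   have "(NN sg|lborel. ennreal (japanese sg powr (2*b))*(ennreal (bracket xi * cmod (Ph (sg, xi))))^2) <=
     (NN sg|lborel. wt (- (norm xi)\<^sup>2+1 * sg, xi))"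
   proof (rule nn_integral_mono)
    fix sg :: real
    have le: "cmod (Ph (sg, xi)) <= cmod (W (sg-(norm xi)\<^sup>2, xi))" by (simp add: Ph_def)
    have p2: "japanese sg powr (2*b) = (japanese sg powr b)^2"
     using japanese_pos[of sg] by (simp add: power2_eq_square flip: powr_add)
    have "japanese sg powr (2*b)*(bracket xi * cmod (Ph (sg, xi)))^2 = (japanese sg powr b*(bracket xi * cmod (Ph (sg, xi))))^2"
     by (simp add: p2 power_mult_distrib)
    also have "... <= (japanese sg powr b*(bracket xi * cmod (W (sg-(norm xi)\<^sup>2, xi))))^2"
     using japanese_pos[of "norm xi"] le by (intro power_mono mult_left_mono) auto
    finally have wle: "ennreal (japanese sg powr (2*b)*(bracket xi * cmod (Ph (sg, xi)))^2) <=
     ennreal ((japanese sg powr b*(bracket xi * cmod (W (sg-(norm xi)\<^sup>2, xi))))^2)" by (rule ennreal_leI)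
    show "ennreal (japanese sg powr (2*b))*(ennreal (bracket xi * cmod (Ph (sg, xi))))^2 <= wt (- (norm xi)\<^sup>2+1 * sg, xi)"
    proof -
     have "(ennreal (bracket xi * cmod (Ph (sg, xi))))^2 = ennreal ((bracket xi * cmod (Ph (sg, xi)))^2)"
      using japanese_pos[of "norm xi"] by (intro ennreal_power) simp
     moreover have "wt (- (norm xi)\<^sup>2+1 * sg, xi) = ennreal ((japanese sg powr b*(bracket xi * cmod (W (sg-(norm xi)\<^sup>2, xi))))^2)"
      using japanese_pos[of "norm xi"] by (simp add: wt_def mult.assoc)
     moreover have "ennreal (japanese sg powr (2*b)*y) = ennreal (japanese sg powr (2*b))*ennreal y" if "0 <= y" for y
      using that by (simp add: ennreal_mult)
     ultimately show ?thesis using wle by (simp only: zero_le_power2)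
    qed
   qed
   also have "... = J xi"
    unfolding J_def using nn_integral_real_affine[of "%tt. wt (tt, xi)" 1 "- (norm xi)\<^sup>2"] measurable_Pair1[OF wtm xi] by simp
   finally show "(NN sg|lborel. ennreal (japanese sg powr (2*b))*(ennreal (bracket xi * cmod (Ph (sg, xi))))^2) <= J xi" .
  qed
  finally show ?thesis unfolding X2 .
 qed
 have Wi: "AE xi in freq L. integrable lborel (%tt. W (tt, xi))" using AEI AE_space by eventually_elim (rule Wint)
 have ev: "AE xi in freq L. (LINT tt|lborel. W (tt, xi) * cnj (fourier_kernel t tt)) = evolution Ph t xi" for t :: real
  using AEI
 proof eventually_elim
  case (elim xi)
  thus ?case unfolding evolution_def
   using lborel_integral_real_affine[of 1 "%tt. W (tt, xi) * cnj (fourier_kernel t tt)" "- (norm xi)\<^sup>2"]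
   by (simp add: Ph_def)
 qed
 have "AE t in lborel. is_fourier (waveguide L) (freq L) (%z. w (t, z)) (evolution Ph t)"
  using is_fourier_slices[OF fourier_pair_waveguide[OF L] wW Wi]
 proof eventually_elim
  case (elim t)
  show ?case by (rule F.is_fourier_cong[OF elim _ _ measurable_evolution[OF Phm] ev])
    (use elim in \<open>auto simp: F.is_fourier_iff square_integrable_iff\<close>)
 qed
 with Phm Phi norm_le show ?thesis by blast
qed

text \<open>The integral over the hyperplane is pulled back to the first three frequencies; there
  the chosen transforms may be replaced by evolutions divided by the symbol, since the exceptional
  sets pull back to null sets.\<close>

lemma integral_Sigma4_weighted:
 assumes L: "1 <= L" and p: "I_profile s p" and s: "s < 1" and N: "0 < N"
  and Ph: "Ph \<in> \<B> (lborel \<otimes> freq L)"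
  and U: "U \<in> \<B> (freq L)" "AE xi in freq L. U xi = evolution Ph t xi/of_real (I_symbol p N xi)"
  and V: "V \<in> \<B> (freq L)" "AE xi in freq L. V xi = cnj (evolution Ph t (- xi))/of_real (I_symbol p N xi)"
 shows "(LINT (xi1, xi2, xi3, xi4)|Sigma4_measure L. of_real (A_mult p K c N L (xi1, xi2, xi3, xi4))*U xi1*V xi2*U xi3*V xi4) =
  (LINT x|freq3 L. of_real (weighted_mult p K c N L x)*(evolution Ph t (fst x)*(cnj (evolution Ph t (- fs x)) *
   (evolution Ph t (ss x) * cnj (evolution Ph t (fst x+fs x+ss x))))))"
proof -
 define T where "T = (%(xi1, xi2, xi3, xi4). of_real (A_mult p K c N L (xi1, xi2, xi3, xi4))*U xi1*V xi2*U xi3*V xi4)"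
 note Um = U(1) and Vm = V(1)
 have Tm: "T \<in> \<B> (freq4 L)"
 proof -
  have [measurable]: "(%q. A_mult p K c N L (fst q, fs q, fss q, sss q)) \<in> \<B> (freq4 L)"
   using measurable_A_mult[OF p s N, of K c L] by simp
  have [measurable]: "(%q. U (fst q)) \<in> \<B> (freq4 L)" "(%q. V (fs q)) \<in> \<B> (freq4 L)"
   "(%q. U (fss q)) \<in> \<B> (freq4 L)" "(%q. V (sss q)) \<in> \<B> (freq4 L)"
   by (rule measurable_compose[OF _ Um] measurable_compose[OF _ Vm], measurable)+
  show ?thesis unfolding T_def case_prod_beta' by measurable
 qed
 have map: "(%(xi1, xi2, xi3). (xi1, xi2, xi3, - xi1-xi2-xi3)) \<in> freq3 L ->M freq4 L"
  unfolding case_prod_beta' by measurable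
 have Hm: "evolution Ph t \<in> \<B> (freq L)" by (rule measurable_evolution[OF Ph])
 have "(LINT q|Sigma4_measure L. T q) = (LINT x|freq3 L. T (case x of (xi1, xi2, xi3) => (xi1, xi2, xi3, - xi1-xi2-xi3)))"
  unfolding Sigma4_measure_def by (rule integral_distr[OF map Tm])
 also have "... = (LINT x|freq3 L. of_real (weighted_mult p K c N L x)*(evolution Ph t (fst x)*(cnj (evolution Ph t (- fs x)) *
   (evolution Ph t (ss x) * cnj (evolution Ph t (fst x+fs x+ss x))))))"
 proof (rule integral_cong_AE)
  show "(%x. T (case x of (xi1, xi2, xi3) => (xi1, xi2, xi3, - xi1-xi2-xi3))) \<in> \<B> (freq3 L)"
   by (rule measurable_compose[OF map Tm])
  have [measurable]: "(%x. evolution Ph t (fst x)) \<in> \<B> (freq3 L)" "(%x. evolution Ph t (- fs x)) \<in> \<B> (freq3 L)"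
   "(%x. evolution Ph t (ss x)) \<in> \<B> (freq3 L)" "(%x. evolution Ph t (fst x+fs x+ss x)) \<in> \<B> (freq3 L)"
   by (rule measurable_compose[OF _ Hm], measurable)+
  show "(%x. of_real (weighted_mult p K c N L x)*(evolution Ph t (fst x)*(cnj (evolution Ph t (- fs x)) *
   (evolution Ph t (ss x) * cnj (evolution Ph t (fst x+fs x+ss x)))))) \<in> \<B> (freq3 L)"
   using measurable_weighted_mult[OF p s N, of K c L] by measurable
  show "AE x in freq3 L. T (case x of (xi1, xi2, xi3) => (xi1, xi2, xi3, - xi1-xi2-xi3)) =
   of_real (weighted_mult p K c N L x)*(evolution Ph t (fst x)*(cnj (evolution Ph t (- fs x)) *
   (evolution Ph t (ss x) * cnj (evolution Ph t (fst x+fs x+ss x)))))"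
   using AE_freq3(1)[OF U(2)] AE_freq3(2)[OF V(2)] AE_freq3(3)[OF U(2)] AE_freq3(4)[OF V(2)]
  proof eventually_elim
   case (elim x)
   have n: "- (- fst x-fs x-ss x) = fst x+fs x+ss x" by simp
   have i: "I_symbol p N (- fst x-fs x-ss x) = I_symbol p N (fst x+fs x+ss x)"
    using I_symbol_bounds(3)[OF p s N, of "- fst x-fs x-ss x"] unfolding n by simp
   show ?case unfolding T_def weighted_mult_def case_prod_beta' fst_conv snd_conv elim n i by (simp add: mult_ac)
  qed
 qed
 finally show ?thesis unfolding T_def .
qed

section \<open>The bound for a single extension, and the conclusion\<close>

text \<open>An extension \<open>w\<close> of finite norm has a profile, whose evolutions represent
  the transforms of \<open>u\<close> on the time interval. From there on only the form with the
  oscillatory kernel matters; an extension of infinite norm makes the right side infinite.\<close>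

lemma multilinear_bound:
 assumes p: "I_profile s p" and s: "1/2 < s" "s < 1" and K: "2 <= K" and c: "0 < c" and b: "1/2 < b"
  and L: "1 <= L" and N: "1 <= N" and dl: "0 <= dl" "dl <= C0" "1 <= C0" and E: "0 < E"
  and est: "\<And>t (g1 :: real \<times> real => ennreal) g2 g3 g4. g1 \<in> \<B> (freq L) ==> g2 \<in> \<B> (freq L) ==>
   g3 \<in> \<B> (freq L) ==> g4 \<in> \<B> (freq L) ==>
   (hyp L (mult_form p c N (%h. ennreal (osc_kernel (h-t))) g1 g2 g3 g4))^2 <= ennreal (E^2) *
   (mass L g1*mass L g2*mass L g3*mass L g4)"
  and u: "\<And>t. t \<in> {0..dl} ==> u t \<in> L2 (waveguide L)"
  and w: "w \<in> L2 (spacetime L)" "AE t in lborel. t \<in> {0..dl} --> (AE z in waveguide L. w (t, z) = I_op p N L (u t) z)"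
  and B: "(NN sg|lborel. ennreal (japanese sg powr (- 2*b))) <= ennreal B" "0 < B"
 shows "ennreal (cmod (LINT t:{0..dl}|lborel. (LINT (xi1, xi2, xi3, xi4)|Sigma4_measure L.
       of_real (A_mult p K c N L (xi1, xi2, xi3, xi4)) * wg_fourier L (u t) xi1*wg_fourier L (%z. cnj (u t z)) xi2
       * wg_fourier L (u t) xi3*wg_fourier L (%z. cnj (u t z)) xi4))) <= ennreal (2*C0*E*B^2)*X_norm L 1 b w ^ 4"
proof (cases "X_norm L 1 b w < \<infinity>")
 case False
 hence "X_norm L 1 b w = top" by (simp flip: less_top)
 moreover have "0 < 2*C0*E*B^2" using dl E B by simp
 hence "ennreal (2*C0*E*B^2) \<noteq> 0" by (simp add: ennreal_eq_0_iff not_le)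
 ultimately show ?thesis by (simp add: ennreal_mult_top)
next
 case True
 interpret F: fourier_pair "waveguide L" "freq L" by (rule fourier_pair_waveguide[OF L])
 have N0: "0 < N" using N by simp
 obtain Ph where Phm: "Ph \<in> \<B> (lborel \<otimes> freq L)"
  and Phi: "\<And>xi. xi \<in> space (freq L) ==> integrable lborel (%sg. Ph (sg, xi))"
  and PhX: "(NN sg|lborel. ennreal (japanese sg powr (2*b))*(NN xi|freq L. (ennreal (bracket xi * cmod (Ph (sg, xi))))^2)) <= (X_norm L 1 b w)^2"
  and Phw: "AE t in lborel. is_fourier (waveguide L) (freq L) (%z. w (t, z)) (evolution Ph t)"
  using bourgain_profile[OF L b w(1) True] by blast
 define g where "g sg xi = ennreal (bracket xi * cmod (Ph (sg, xi)))" for sg xi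
 have gm: "(%z. g (fst z) (snd z)) \<in> \<B> (lborel \<otimes> freq L)"
 proof -
  have [measurable]: "(%z. snd z) \<in> \<B> ((lborel :: real measure) \<otimes> freq L)" by (rule freq_into_borel) measurable
  show ?thesis unfolding g_def using Phm by measurable
 qed
 let ?kap = "weighted_mult p K c N L"
 let ?Om = "freq3 L \<otimes> real4"
 \<comment> \<open>Kept general in the kernel \<open>k\<close>, in order to serve for absolute
   convergence and for the estimate itself.\<close>
 have form_le: "(NN w|?Om. ennreal (\<bar>?kap (fst w)\<bar> * cmod (four Ph w)) * k (resonance (fst w)-phase (snd w))) <= D*(ennreal B)^2*(X_norm L 1 b w) ^ 4"
  if km: "k \<in> \<B> borel" and D: "\<And>t (g1 :: real \<times> real => ennreal) g2 g3 g4. g1 \<in> \<B> (freq L) ==> g2 \<in> \<B> (freq L) ==>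
   g3 \<in> \<B> (freq L) ==> g4 \<in> \<B> (freq L) ==>
   (hyp L (mult_form p c N (%h. k (h-t)) g1 g2 g3 g4))^2 <= D^2 * (mass L g1*mass L g2*mass L g3*mass L g4)" for k D
 proof -
  have "(NN w|?Om. ennreal (\<bar>?kap (fst w)\<bar> * cmod (four Ph w)) * k (resonance (fst w)-phase (snd w))) <=
   (NN w|?Om. mult_form p c N (%h. k (h-phase (snd w))) (g (fs w)) (g (fss w)) (g (fss (snd w))) (g (sss (snd w)))
    (fst (fst w)) (- fs (fst w)) (ss (fst w)) (fst (fst w)+fs (fst w)+ss (fst w)))"
   unfolding g_def by (intro nn_integral_mono weighted_mult_four_le[OF p s(2) N0 K])
  also have "... = (NN s|real4. hyp L (mult_form p c N (%h. k (h-phase s))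
   (g (fst s)) (g (fs s)) (g (fss s)) (g (sss s))))" by (rule spacetime_form_fubini[OF p s(2) N0 km gm])
  also have "... <= D*(NN sg|lborel. ennreal (japanese sg powr (- 2*b)))^2 *
   (NN sg|lborel. ennreal (japanese sg powr (2*b))*(NN xi|freq L. (g sg xi)^2))^2"
   by (rule spacetime_form_bound[OF gm D])
  also have "... <= D*(ennreal B)^2*((X_norm L 1 b w)^2)^2"
   by (intro mult_mono power_mono B order_refl) (use PhX in \<open>simp_all add: g_def\<close>)
  finally show ?thesis by (simp flip: power_mult)
 qed
 \<comment> \<open>Only finiteness is used here, so the constant of the absolute estimate may depend
   on N.\<close>
 have fin: "(NN w|?Om. ennreal (\<bar>?kap (fst w)\<bar> * cmod (four Ph w))) < \<infinity>"
 proof -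
  obtain C where C: "\<And>(g1 :: real \<times> real => ennreal) g2 g3 g4. g1 \<in> \<B> (freq L) ==> g2 \<in> \<B> (freq L) ==>
   g3 \<in> \<B> (freq L) ==> g4 \<in> \<B> (freq L) ==>
   (hyp L (mult_form p c N (%_. 1) g1 g2 g3 g4))^2 <= ennreal C * (mass L g1*mass L g2*mass L g3*mass L g4)"
   using absolute_estimate[OF p s c N] L by blast
  have sq: "ennreal C = (ennreal (sqrt (max C 0)))^2" by (simp add: ennreal_power max_def ennreal_neg)
  have "(NN w|?Om. ennreal (\<bar>?kap (fst w)\<bar> * cmod (four Ph w))*1) <= ennreal (sqrt (max C 0))*(ennreal B)^2*(X_norm L 1 b w) ^ 4"
   by (rule form_le[where k = "%_. 1"]) (use C sq in auto)
  also have "... < \<infinity>" using True by (simp add: ennreal_mult_less_top power_less_top_ennreal)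
  finally show ?thesis by simp
 qed
 define \<Lambda> where "\<Lambda> t = (LINT x|freq3 L. of_real (?kap x)*(evolution Ph t (fst x)*(cnj (evolution Ph t (- fs x)) *
   (evolution Ph t (ss x) * cnj (evolution Ph t (fst x+fs x+ss x))))))" for t
 note osc = oscillatory_time_integral[OF Phm Phi measurable_weighted_mult[OF p s(2) N0] fin dl \<Lambda>_def]
 define T where "T t = (LINT (xi1, xi2, xi3, xi4)|Sigma4_measure L. of_real (A_mult p K c N L (xi1, xi2, xi3, xi4))
       * wg_fourier L (u t) xi1*wg_fourier L (%z. cnj (u t z)) xi2
       * wg_fourier L (u t) xi3*wg_fourier L (%z. cnj (u t z)) xi4)" for t
 have TL: "AE t in lborel. ind {0..dl} t *\<^sub>R T t = of_real (ind {0..dl} t)*\<Lambda> t" using Phw w(2)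
 proof eventually_elim
  case (elim t)
  show ?case
  proof (cases "t \<in> {0..dl}")
   case t: True
   have ut: "u t \<in> L2 (waveguide L)" by (rule u[OF t])
   have eq: "AE z in waveguide L. w (t, z) = I_op p N L (u t) z" using elim(2) t by simp
   note h = wg_fourier_of_I_op[OF L p s(2) N0 ut elim(1) eq]
   have cu: "(%z. cnj (u t z)) \<in> L2 (waveguide L)"
    using is_fourier_cnj[OF L F.is_fourier_fourier[OF ut]] by (simp add: F.is_fourier_iff)
   have "T t = \<Lambda> t" unfolding T_def \<Lambda>_def
    by (rule integral_Sigma4_weighted[OF L p s(2) N0 Phm _ h(1) _ h(2)])
     (use F.is_fourier_fourier[OF ut] F.is_fourier_fourier[OF cu] in \<open>auto simp: F.is_fourier_iff square_integrable_iff\<close>)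
   thus ?thesis using t by simp
  qed simp
 qed
 have "ennreal (cmod (LINT t:{0..dl}|lborel. T t)) <= ennreal (cmod (LINT t|lborel. of_real (ind {0..dl} t)*\<Lambda> t))"
 \<comment> \<open>The integrand of the statement agrees with a measurable function almost
   everywhere, which for Borel measurability is not enough. If it is not integrable its integral is
   0 by convention, and the inequality holds anyway.\<close>
 proof (cases "integrable lborel (%t. ind {0..dl} t *\<^sub>R T t)")
  case True
  have "(LINT t|lborel. ind {0..dl} t *\<^sub>R T t) = (LINT t|lborel. of_real (ind {0..dl} t)*\<Lambda> t)"
   by (rule integral_cong_AE[OF borel_measurable_integrable[OF True] _ TL], rule osc(1))
  thus ?thesis by (simp add: set_lebesgue_integral_def)
 qed (simp add: set_lebesgue_integral_def not_integrable_integral_eq)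
 also have "... <= ennreal (2*C0)*(NN w|?Om. ennreal (\<bar>?kap (fst w)\<bar> * cmod (four Ph w))*ennreal (osc_kernel (resonance (fst w)-phase (snd w))))"
  by (rule osc(2))
 also have "... <= ennreal (2*C0)*(ennreal E*(ennreal B)^2*(X_norm L 1 b w) ^ 4)"
 proof (intro mult_left_mono form_le)
  show "(%x. ennreal (osc_kernel x)) \<in> \<B> borel" by measurable
  have "(ennreal E)^2 = ennreal (E^2)" using E by (simp add: ennreal_power)
  thus "(hyp L (mult_form p c N (%h. ennreal (osc_kernel (h-t))) g1 g2 g3 g4))^2 <= (ennreal E)^2 *
   (mass L g1*mass L g2*mass L g3*mass L g4)"
   if "g1 \<in> \<B> (freq L)" "g2 \<in> \<B> (freq L)" "g3 \<in> \<B> (freq L)" "g4 \<in> \<B> (freq L)"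
   for t and g1 g2 g3 g4 :: "real \<times> real => ennreal" using est[OF that] by simp
 qed simp
 also have "... = ennreal (2*C0*E*B^2)*X_norm L 1 b w ^ 4"
  using dl E B(2) by (simp add: ennreal_mult ennreal_power mult.assoc)
 finally show ?thesis unfolding T_def .
qed

theorem proposition1p6:
  fixes s c0 C0 b \<epsilon> K c :: real and p :: "real \<Rightarrow> real"
  assumes "1/2 < s" "s < 1" "0 < c0" "c0 < 1" "1 < C0" "1/2 < b" "0 < \<epsilon>"
    and "I_profile s p" "2 \<le> K" "0 < c" "c < 1"
  shows "\<exists>C>0. \<forall>L\<ge>1. \<forall>N \<in> range (\<lambda>k::nat. 2 ^ k). \<forall>\<delta>\<in>{c0..C0}.
    \<forall>(u :: real \<Rightarrow> real \<times> real \<Rightarrow> complex) u0.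
      NLS_solution L \<delta> u u0 \<longrightarrow>
      continuous_in_H L 1 \<delta> (\<lambda>t. I_op p N L (u t)) \<longrightarrow>
      I_NLS_solution p N L \<delta> u u0 \<longrightarrow>
      H_norm L 1 (I_op p N L u0) \<le> ennreal C0 \<longrightarrow>
      ennreal (cmod (LINT t:{0..\<delta>}|lborel.
          (LINT (\<xi>1, \<xi>2, \<xi>3, \<xi>4)|Sigma4_measure L.
             of_real (A_mult p K c N L (\<xi>1, \<xi>2, \<xi>3, \<xi>4))
             * wg_fourier L (u t) \<xi>1 * wg_fourier L (\<lambda>z. cnj (u t z)) \<xi>2
             * wg_fourier L (u t) \<xi>3 * wg_fourier L (\<lambda>z. cnj (u t z)) \<xi>4)))
      \<le> ennreal (C * N powr (-2 + \<epsilon>)) * X_norm_on L 1 b \<delta> (\<lambda>t. I_op p N L (u t)) ^ 4"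
proof -
 obtain C where C: "0 < C" and all: "\<forall>L\<ge>1. \<forall>N\<ge>1. \<forall>t. \<forall>(g1 :: real \<times> real => ennreal) g2 g3 g4. g1 \<in> \<B> (freq L) --> g2 \<in> \<B> (freq L) -->
  g3 \<in> \<B> (freq L) --> g4 \<in> \<B> (freq L) -->
  (hyp L (mult_form p c N (%h. ennreal (osc_kernel (h-t))) g1 g2 g3 g4))^2 <= ennreal ((C*N powr (-2+\<epsilon>))^2) *
   (mass L g1*mass L g2*mass L g3*mass L g4)" using oscillatory_estimate[OF assms(8,1,2,10,7)] by (elim exE conjE)
 note est = all[rule_format]
 \<comment> \<open>The integral of <\<sigma>>^(-2b) is finite because b > 1/2; adding 1 makes the
   constant positive without further argument.\<close>
 define B where "B = enn2real (NN \<sigma>|lborel. ennreal (japanese \<sigma> powr (- 2*b)))+1"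
 have B: "(NN \<sigma>|lborel. ennreal (japanese \<sigma> powr (- 2*b))) <= ennreal B" "0 < B"
 proof -
  show "0 < B" unfolding B_def by (intro add_nonneg_pos) auto
  have "(NN \<sigma>|lborel. ennreal (japanese \<sigma> powr (- 2*b))) = ennreal (enn2real (NN \<sigma>|lborel. ennreal (japanese \<sigma> powr (- 2*b))))"
   using nn_integral_japanese_finite[OF assms(6)] by (simp add: less_top)
  also have "... <= ennreal B" unfolding B_def by (intro ennreal_leI) simp
  finally show "(NN \<sigma>|lborel. ennreal (japanese \<sigma> powr (- 2*b))) <= ennreal B" .
 qed
 show ?thesis
 \<comment> \<open>The factor 2*C0 is from the time integral over [0, \<delta>] with \<delta> \<le>
   C0, \<open>C\<close> is from the oscillatory estimate, and B^2 is from Cauchy-Schwarz in the four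
   modulations.\<close>
 proof (intro exI[of _ "2*C0*C*B^2"] conjI allI impI ballI)
  show "0 < 2*C0*C*B^2" using assms C B by simp
  fix L N \<delta> :: real and u u0
  assume L: "1 <= L" and N: "N \<in> range (%k::nat. 2 ^ k)" and \<delta>: "\<delta> \<in> {c0..C0}" and nls: "NLS_solution L \<delta> u u0"
  have N1: "1 <= N" using N by auto
  have E: "0 < C*N powr (-2+\<epsilon>)" using C N1 by simp
  have u: "u t \<in> L2 (waveguide L)" if "t \<in> {0..\<delta>}" for t
   using nls that by (simp add: NLS_solution_def schroedinger_solution_def)
  have q: "2*C0*C*B^2*N powr (-2+\<epsilon>) = 2*C0*(C*N powr (-2+\<epsilon>))*B^2" by (simp only: mult_ac)
  show "ennreal (cmod (LINT t:{0..\<delta>}|lborel. (LINT (\<xi>1, \<xi>2, \<xi>3, \<xi>4)|Sigma4_measure L.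
       of_real (A_mult p K c N L (\<xi>1, \<xi>2, \<xi>3, \<xi>4))
       * wg_fourier L (u t) \<xi>1*wg_fourier L (%z. cnj (u t z)) \<xi>2
       * wg_fourier L (u t) \<xi>3*wg_fourier L (%z. cnj (u t z)) \<xi>4)))
   <= ennreal (2*C0*C*B^2*N powr (-2+\<epsilon>))*X_norm_on L 1 b \<delta> (%t. I_op p N L (u t)) ^ 4"
   unfolding X_norm_on_def q
  proof (rule ennreal_le_mult_INF_power4)
   show "0 < 2*C0*(C*N powr (-2+\<epsilon>))*B^2" using assms E B by simp
   fix w assume w: "w \<in> {w \<in> L2 (spacetime L). AE t in lborel. t \<in> {0..\<delta>} --> (AE z in waveguide L. w (t, z) = I_op p N L (u t) z)}"
   show "ennreal (cmod (LINT t:{0..\<delta>}|lborel. (LINT (\<xi>1, \<xi>2, \<xi>3, \<xi>4)|Sigma4_measure L.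
       of_real (A_mult p K c N L (\<xi>1, \<xi>2, \<xi>3, \<xi>4))
       * wg_fourier L (u t) \<xi>1*wg_fourier L (%z. cnj (u t z)) \<xi>2
       * wg_fourier L (u t) \<xi>3*wg_fourier L (%z. cnj (u t z)) \<xi>4)))
    <= ennreal (2*C0*(C*N powr (-2+\<epsilon>))*B^2)*X_norm L 1 b w ^ 4"
   proof (rule multilinear_bound[OF assms(8,1,2,9,10,6) L N1])
    show "0 <= \<delta>" "\<delta> <= C0" "1 <= C0" using \<delta> assms(3,5) by auto
    show "w \<in> L2 (spacetime L)"
     "AE t in lborel. t \<in> {0..\<delta>} --> (AE z in waveguide L. w (t, z) = I_op p N L (u t) z)"
     using w by simp_all
   qed (fact E u B est[OF L N1])+
  qed simp
 qed
qed

end
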